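(* Suppose $W$ is a $\triangle$-regular tournamenton with $\zeta(W)\in[0,1)$, and $T_n\sim T(n,W)$ for each $n$. Let $\hat X_\triangle(T_n)=\sum_{s=2}^n\hat\lambda_s(J_s^2-1)$, where $\hat\lambda_1\ge\hat\lambda_2\ge\dots\ge\hat\lambda_n$ are the eigenvalues of the symmetric $n\times n$ matrix $\frac1n\hat\triangle_{T_n}$ and $J_1,\dots,J_n$ are i.i.d. $N(0,1)$ independent of $T_n$. Then, almost surely, as $n\to\infty$, the conditional distribution of $\hat X_\triangle(T_n)$ given $T_n$ satisfies $$\hat X_\triangle(T_n)\mid T_n\xrightarrow{D}\tau_W\cdot Z+\sum_{\lambda\in\mathrm{Spec}^-(\triangle_W)}\lambda(Z_\lambda^2-1),$$ where $Z,\{Z_\lambda\}_{\lambda\in\mathrm{Spec}^-(\triangle_W)}$ are i.i.d. $N(0,1)$ and $$\tau_W^2=\frac12\int_{[0,1]^2}W(x,y)W(y,x)\big(p_W(x,y)-p_W(y,x)\big)^2\,\mathrm dx\,\mathrm dy .$$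
   Context: A tournamenton is a measurable function $W:[0,1]^2\to[0,1]$ with $W(x,y)+W(y,x)=1$ for all $x,y$. The $W$-random tournament $T_n\sim T(n,W)$ on $[n]$ has adjacency matrix $(a_{uv})$: $\eta_1,\dots,\eta_n$ are i.i.d. $\mathrm{Unif}([0,1])$ and, conditionally, $a_{uv}\sim\mathrm{Ber}(W(\eta_u,\eta_v))$ independently for $u<v$, $a_{vu}=1-a_{uv}$, and $a_{uu}=\frac12$. The tournaments $T_n$, $n\ge1$, are defined on a common probability space, and "almost surely" refers to the randomness of $(T_n)_{n\ge1}$. The symmetrized empirical 2-point conditional homomorphism density matrix is $\hat\triangle_{T_n}=(\hat\triangle_{T_n}(u,v))_{1\le u,v\le n}$ with $$\hat\triangle_{T_n}(u,v)=\frac{a_{uv}\sum_{w=1}^na_{vw}a_{wu}+a_{vu}\sum_{w=1}^na_{uw}a_{wv}}{2n}.$$ $t(\vec C_3,W)=\int_{[0,1]^3}W(x,y)W(y,z)W(z,x)\,\mathrm dx\,\mathrm dy\,\mathrm dz$ and $\zeta(W)=1-8t(\vec C_3,W)$. $W$ is $\triangle$-regular if $t_W^\triangle(x)=\int_{[0,1]^2}W(x,y)W(y,z)W(z,x)\,\mathrm dy\,\mathrm dz$ is constant almost everywhere (the constant is then $t(\vec C_3,W)$). $p_W(x,y)=\int_0^1W(y,z)W(z,x)\,\mathrm dz$ and $\triangle_W(x,y)=\frac12(W(x,y)p_W(x,y)+W(y,x)p_W(y,x))$. $\mathrm{Spec}(\triangle_W)$ is the multiset of non-zero eigenvalues (with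 multiplicity) of the symmetric Hilbert–Schmidt operator $f\mapsto\int_0^1\triangle_W(\cdot,y)f(y)\,\mathrm dy$ on $L^2[0,1]$. When $W$ is $\triangle$-regular, $t(\vec C_3,W)$ is an eigenvalue with constant eigenfunction, and $\mathrm{Spec}^-(\triangle_W)$ is $\mathrm{Spec}(\triangle_W)$ with the multiplicity of $t(\vec C_3,W)$ decreased by $1$. The possibly infinite sum converges in $L^2$ and almost surely, with one variable $Z_\lambda$ per element counted with multiplicity. $\tau_W\ge0$. *)

theory Defs
  imports
    "HOL-Probability.Probability"
    "HOL-Library.Extended_Nat"
    "Jordan_Normal_Form.Char_Poly"
begin

abbreviation U01 :: "real measure" where
  "U01 \<equiv> restrict_space lborel {0..1}"

abbreviation U01_2 :: "(real \<times> real) measure" where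
  "U01_2 \<equiv> U01 \<Otimes>\<^sub>M U01"

abbreviation U01_3 :: "(real \<times> real \<times> real) measure" where
  "U01_3 \<equiv> U01 \<Otimes>\<^sub>M U01 \<Otimes>\<^sub>M U01"

abbreviation std_normal :: "real measure" where
  "std_normal \<equiv> density lborel std_normal_density"


subsection \<open>Tournamentons\<close>

text \<open>Values of \<open>W\<close> outside the unit square are irrelevant: every integral below is over
  \<open>U01\<close>, whose space is \<open>{0..1}\<close>. Measurable means Borel measurable.\<close>

definition tournamenton :: "(real \<Rightarrow> real \<Rightarrow> real) \<Rightarrow> bool" where
  "tournamenton W \<longleftrightarrow>
     (\<lambda>(x, y). W x y) \<in> borel_measurable U01_2 \<and>
     (\<forall>x\<in>{0..1}. \<forall>y\<in>{0..1}. 0 \<le> W x y \<and> W x y \<le> 1 \<and> W x y + W y x = 1)"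

definition t_C3 :: "(real \<Rightarrow> real \<Rightarrow> real) \<Rightarrow> real" where
  "t_C3 W = (\<integral>(x, y, z). W x y * W y z * W z x \<partial>U01_3)"

definition zeta_W :: "(real \<Rightarrow> real \<Rightarrow> real) \<Rightarrow> real" where
  "zeta_W W = 1 - 8 * t_C3 W"

definition t_tri :: "(real \<Rightarrow> real \<Rightarrow> real) \<Rightarrow> real \<Rightarrow> real" where
  "t_tri W x = (\<integral>(y, z). W x y * W y z * W z x \<partial>U01_2)"

definition tri_regular :: "(real \<Rightarrow> real \<Rightarrow> real) \<Rightarrow> bool" where
  "tri_regular W \<longleftrightarrow> (\<exists>c. AE x in U01. t_tri W x = c)"

definition p_W :: "(real \<Rightarrow> real \<Rightarrow> real) \<Rightarrow> real \<Rightarrow> real \<Rightarrow> real" where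
  "p_W W x y = (\<integral>z. W y z * W z x \<partial>U01)"

definition tri_kernel :: "(real \<Rightarrow> real \<Rightarrow> real) \<Rightarrow> real \<Rightarrow> real \<Rightarrow> real" where
  "tri_kernel W x y = (W x y * p_W W x y + W y x * p_W W y x) / 2"

definition tau_W :: "(real \<Rightarrow> real \<Rightarrow> real) \<Rightarrow> real" where
  "tau_W W = sqrt (1 / 2 * (\<integral>(x, y). W x y * W y x * (p_W W x y - p_W W y x)\<^sup>2 \<partial>U01_2))"


subsection \<open>Spectra of integral operators on \<open>L\<^sup>2[0,1]\<close>\<close>

definition eigenfunctions :: "(real \<Rightarrow> real \<Rightarrow> real) \<Rightarrow> real \<Rightarrow> (real \<Rightarrow> real) set" where
  "eigenfunctions K lam =
     {f \<in> borel_measurable U01. integrable U01 (\<lambda>x. (f x)\<^sup>2) \<and>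
        (AE x in U01. (\<integral>y. K x y * f y \<partial>U01) = lam * f x)}"

text \<open>Elements of \<open>L\<^sup>2[0,1]\<close> are represented by functions, so linear independence is understood
  modulo functions vanishing almost everywhere.\<close>

definition L2_independent :: "nat \<Rightarrow> (nat \<Rightarrow> real \<Rightarrow> real) \<Rightarrow> bool" where
  "L2_independent k f \<longleftrightarrow>
     (\<forall>c :: nat \<Rightarrow> real. (AE x in U01. (\<Sum>i<k. c i * f i x) = 0) \<longrightarrow> (\<forall>i<k. c i = 0))"

definition L2_dim :: "(real \<Rightarrow> real) set \<Rightarrow> enat" where
  "L2_dim V = Sup {enat k | k. \<exists>f. (\<forall>i<k. f i \<in> V) \<and> L2_independent k f}"

text \<open>A multiset of reals that may be infinite, given by its multiplicity function.\<close>

type_synonym real_multiplicity = "real \<Rightarrow> enat"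

definition Spec :: "(real \<Rightarrow> real \<Rightarrow> real) \<Rightarrow> real_multiplicity" where
  "Spec K lam = (if lam = 0 then 0 else L2_dim (eigenfunctions K lam))"

definition Spec_minus_tri :: "(real \<Rightarrow> real \<Rightarrow> real) \<Rightarrow> real_multiplicity" where
  "Spec_minus_tri W = (Spec (tri_kernel W))(t_C3 W := Spec (tri_kernel W) (t_C3 W) - 1)"

text \<open>One index \<open>(lam, j)\<close> per element of the multiset, counted with multiplicity.\<close>

definition elements :: "real_multiplicity \<Rightarrow> (real \<times> nat) set" where
  "elements m = {(lam, j). enat j < m lam}"


subsection \<open>The \<open>W\<close>-random tournament\<close>

text \<open>Adjacency matrix, on the vertex set \<open>{1..n}\<close>, of the tournament in which \<open>b (u, v)\<close> tells
  whether the arc between \<open>u < v\<close> points from \<open>u\<close> to \<open>v\<close>; it is set to 0 outside \<open>{1..n}\<close>.\<close>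

definition adjacency :: "nat \<Rightarrow> (nat \<times> nat \<Rightarrow> bool) \<Rightarrow> nat \<Rightarrow> nat \<Rightarrow> real" where
  "adjacency n b u v =
     (if u \<in> {1..n} \<and> v \<in> {1..n} then
        (if u = v then 1 / 2 else if u < v then of_bool (b (u, v)) else 1 - of_bool (b (v, u)))
      else 0)"

definition random_tournament :: "nat \<Rightarrow> (real \<Rightarrow> real \<Rightarrow> real) \<Rightarrow> (nat \<Rightarrow> nat \<Rightarrow> real) measure" where
  "random_tournament n W =
     PiM {1..n} (\<lambda>_. U01) \<bind> (\<lambda>\<eta>.
       measure_pmf (map_pmf (adjacency n)
         (Pi_pmf {(u, v). 1 \<le> u \<and> u < v \<and> v \<le> n} False
            (\<lambda>(u, v). bernoulli_pmf (W (\<eta> u) (\<eta> v))))))"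

definition is_random_tournament ::
    "'a measure \<Rightarrow> ('a \<Rightarrow> nat \<Rightarrow> nat \<Rightarrow> real) \<Rightarrow> nat \<Rightarrow> (real \<Rightarrow> real \<Rightarrow> real) \<Rightarrow> bool" where
  "is_random_tournament M T n W \<longleftrightarrow>
     T \<in> M \<rightarrow>\<^sub>M count_space UNIV \<and> distr M (count_space UNIV) T = random_tournament n W"


subsection \<open>The empirical matrix and its eigenvalues\<close>

definition tri_hat :: "nat \<Rightarrow> (nat \<Rightarrow> nat \<Rightarrow> real) \<Rightarrow> nat \<Rightarrow> nat \<Rightarrow> real" where
  "tri_hat n a u v =
     (a u v * (\<Sum>w=1..n. a v w * a w u) + a v u * (\<Sum>w=1..n. a u w * a w v)) / (2 * real n)"

text \<open>Matrix indices start at 0, vertices at 1.\<close>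

definition tri_hat_mat :: "nat \<Rightarrow> (nat \<Rightarrow> nat \<Rightarrow> real) \<Rightarrow> real mat" where
  "tri_hat_mat n a = mat n n (\<lambda>(i, j). tri_hat n a (Suc i) (Suc j) / real n)"

text \<open>The \<open>s\<close>-th largest eigenvalue, \<open>s = 1, \<dots>, n\<close>, of a real matrix all of whose eigenvalues are
  real (such as a symmetric one), counted with algebraic multiplicity.\<close>

definition eigenvalue_desc :: "real mat \<Rightarrow> nat \<Rightarrow> real" where
  "eigenvalue_desc A s = rev (sorted_list_of_multiset (proots (char_poly A))) ! (s - 1)"

definition X_hat :: "nat \<Rightarrow> (nat \<Rightarrow> nat \<Rightarrow> real) \<Rightarrow> (nat \<Rightarrow> real) \<Rightarrow> real" where
  "X_hat n a J = (\<Sum>s=2..n. eigenvalue_desc (tri_hat_mat n a) s * ((J s)\<^sup>2 - 1))"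


subsection \<open>Probabilistic notions\<close>

definition iid_std_normal :: "'a measure \<Rightarrow> ('i \<Rightarrow> 'a \<Rightarrow> real) \<Rightarrow> 'i set \<Rightarrow> bool" where
  "iid_std_normal M X I \<longleftrightarrow>
     prob_space.indep_vars M (\<lambda>_. borel) X I \<and> (\<forall>i\<in>I. distr M borel (X i) = std_normal)"

text \<open>Independence of two random elements of possibly different types, as independence of the
  generated \<open>\<sigma>\<close>-algebras (\<open>prob_space.indep_var\<close> needs a common type).\<close>

definition independent_of ::
    "'a measure \<Rightarrow> 'b measure \<Rightarrow> ('a \<Rightarrow> 'b) \<Rightarrow> 'c measure \<Rightarrow> ('a \<Rightarrow> 'c) \<Rightarrow> bool" where
  "independent_of M A X B Y \<longleftrightarrow>
     X \<in> M \<rightarrow>\<^sub>M A \<and> Y \<in> M \<rightarrow>\<^sub>M B \<and>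
     prob_space.indep_set M (sets (vimage_algebra (space M) X A)) (sets (vimage_algebra (space M) Y B))"

text \<open>Conditional distribution, at the outcome \<open>\<omega>\<close>, of \<open>X\<close> given a discrete random element \<open>T\<close>:
  the law of \<open>X\<close> under \<open>M\<close> conditioned on the event that \<open>T\<close> takes the value \<open>T \<omega>\<close>, which has
  positive probability for almost every \<open>\<omega>\<close>.\<close>

definition cond_distr_given :: "'a measure \<Rightarrow> ('a \<Rightarrow> real) \<Rightarrow> ('a \<Rightarrow> 'b) \<Rightarrow> 'a \<Rightarrow> real measure" where
  "cond_distr_given M X T \<omega> = distr (uniform_measure M {\<omega>' \<in> space M. T \<omega>' = T \<omega>}) borel X"

text \<open>\<open>S\<close> is the sum, in \<open>L\<^sup>2\<close>, of the possibly infinite family \<open>X\<close>; this determines \<open>S\<close> up to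
  almost sure equality. A pointwise \<open>infsum\<close> would not do, since the series need not converge
  absolutely.\<close>

definition L2_has_sum ::
    "'a measure \<Rightarrow> ('i \<Rightarrow> 'a \<Rightarrow> real) \<Rightarrow> 'i set \<Rightarrow> ('a \<Rightarrow> real) \<Rightarrow> bool" where
  "L2_has_sum M X I S \<longleftrightarrow>
     S \<in> borel_measurable M \<and> integrable M (\<lambda>\<omega>. (S \<omega>)\<^sup>2) \<and>
     (\<forall>i\<in>I. X i \<in> borel_measurable M \<and> integrable M (\<lambda>\<omega>. (X i \<omega>)\<^sup>2)) \<and>
     ((\<lambda>F. \<integral>\<omega>. (S \<omega> - (\<Sum>i\<in>F. X i \<omega>))\<^sup>2 \<partial>M) \<longlongrightarrow> 0) (finite_subsets_at_top I)"

end

theory Submission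
  imports Defs "Jordan_Normal_Form.Schur_Decomposition" "HOL-Real_Asymp.Real_Asymp"
begin

text \<open>
  The conditional law of \<open>X_hat\<close> given the tournament is determined by the eigenvalues of the
  empirical matrix, and the whole proof works with their power sums.

  If \<open>J\<close> is standard normal, the characteristic function of \<open>J\<^sup>2 - 1\<close> is
  \<open>exp (log_cf y)\<close> with an explicit function \<open>log_cf\<close> (\<open>cf_normal_square\<close>), and
  \<open>log_cf y = y\<^sup>2 * log_cf_quot y\<close> with \<open>log_cf_quot\<close> continuous and equal to \<open>-1\<close> at the
  origin. Given a tournament with empirical eigenvalues \<open>x\<^sub>1 \<ge> \<dots> \<ge> x\<^sub>n\<close>, the logarithm
  of the conditional characteristic function is therefore \<open>\<Sum>s=2..n. log_cf (t * x\<^sub>s)\<close>, a sum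
  of the form \<open>\<Sum>s. x\<^sub>s\<^sup>2 * h x\<^sub>s\<close> with \<open>h\<close> continuous. By Weierstrass approximation such
  sums converge as soon as every power sum \<open>\<Sum>s. x\<^sub>s ^ (k + 2)\<close> converges, and then Levy's
  continuity theorem gives the weak limit.

  A power sum of the eigenvalues is the trace of a power of the empirical matrix, which is the
  density in the tournament of a closed cycle of triangles (\<open>avg_tri_cycle\<close>). Densities of
  fixed patterns in \<open>T n\<close> converge almost surely (\<open>avg_converges_AE\<close>): their centred fourth
  moments are of order \<open>n\<^sup>-\<^sup>2\<close> by bounded differences, first for the arcs given the types of
  the vertices and then for the types, and the mean is, up to samples that repeat a
  vertex, the density in \<open>W\<close> whenever the pattern is affine in each arc. A cycle of at least three triangles has this property, so that for
  \<open>k \<ge> 1\<close> the power sums converge to the traces of the powers of the operator of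
  \<open>tri_kernel W\<close>. Two triangles on a common arc do not have it: since \<open>a u v\<close> is 0 or 1 for
  distinct vertices, its square is \<open>a u v\<close> and \<open>a u v * a v u\<close> vanishes, and averaging over the arc after this
  reduction yields the squared Hilbert--Schmidt norm of \<open>tri_kernel W\<close> plus
  \<open>(tau_W W)\<^sup>2 / 2\<close> (\<open>limit_density_ear\<close>). This excess is the Gaussian part of the limit:
  it belongs to eigenvalues that tend to 0 but keep a positive sum of squares, and it enters the
  limit multiplied by the value \<open>-1\<close> of \<open>log_cf_quot\<close> at the origin.

  On the side of the limit, the trace formula \<open>trace_formula_Spec\<close> identifies the traces with
  the power sums of the multiset \<open>Spec\<close>. Regularity makes the constants eigenfunctions for
  \<open>t_C3 W\<close> and, by Schur's test, makes \<open>t_C3 W\<close> the largest eigenvalue. The largest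
  empirical eigenvalue converges to it (\<open>largest_point_converges\<close>), so that removing one
  from the sum corresponds to removing one copy of the other from the spectrum. The value of
  \<open>zeta_W\<close> enters through \<open>0 < t_C3 W \<le> 1\<close>.
\<close>

section \<open>Square-integrable functions\<close>

lemma integrable_mult_square_integrable:
  fixes f g :: "'a \<Rightarrow> real"
  assumes [measurable]: "f \<in> borel_measurable M" "g \<in> borel_measurable M"
    and f2: "integrable M (\<lambda>x. (f x)\<^sup>2)" and g2: "integrable M (\<lambda>x. (g x)\<^sup>2)"
  shows "integrable M (\<lambda>x. f x * g x)"
proof (rule Bochner_Integration.integrable_bound)
  show "integrable M (\<lambda>x. (f x)\<^sup>2 + (g x)\<^sup>2)" using f2 g2 by simp
  have "\<bar>a * b\<bar> \<le> a\<^sup>2 + b\<^sup>2" for a b :: real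
  proof -
    have "2 * (\<bar>a\<bar> * \<bar>b\<bar>) \<le> \<bar>a\<bar>\<^sup>2 + \<bar>b\<bar>\<^sup>2" using sum_squares_bound[of "\<bar>a\<bar>" "\<bar>b\<bar>"] by (simp add: mult.assoc)
    then show ?thesis unfolding abs_mult power2_abs
      by (smt (verit) mult_nonneg_nonneg abs_ge_zero)
  qed
  then show "AE x in M. norm (f x * g x) \<le> norm ((f x)\<^sup>2 + (g x)\<^sup>2)" by simp
qed simp

lemma integrable_add_square_integrable:
  fixes f g :: "'a \<Rightarrow> real"
  assumes "f \<in> borel_measurable M" "g \<in> borel_measurable M"
    and "integrable M (\<lambda>x. (f x)\<^sup>2)" "integrable M (\<lambda>x. (g x)\<^sup>2)"
  shows "integrable M (\<lambda>x. (f x + g x)\<^sup>2)"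
  using assms integrable_mult_square_integrable[OF assms] by (simp add: power2_sum mult.assoc)

lemma integrable_diff_square_integrable:
  fixes f g :: "'a \<Rightarrow> real"
  assumes "f \<in> borel_measurable M" "g \<in> borel_measurable M"
    and "integrable M (\<lambda>x. (f x)\<^sup>2)" "integrable M (\<lambda>x. (g x)\<^sup>2)"
  shows "integrable M (\<lambda>x. (f x - g x)\<^sup>2)"
  using assms integrable_mult_square_integrable[OF assms] by (simp add: power2_diff mult.assoc)

lemma integral_Cauchy_Schwarz:
  fixes f g :: "'a \<Rightarrow> real"
  assumes [measurable]: "f \<in> borel_measurable M" "g \<in> borel_measurable M"
    and f2: "integrable M (\<lambda>x. (f x)\<^sup>2)" and g2: "integrable M (\<lambda>x. (g x)\<^sup>2)"
  shows "(\<integral>x. f x * g x \<partial>M)\<^sup>2 \<le> (\<integral>x. (f x)\<^sup>2 \<partial>M) * (\<integral>x. (g x)\<^sup>2 \<partial>M)"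
proof -
  let ?a = "\<integral>x. (f x)\<^sup>2 \<partial>M" and ?b = "\<integral>x. f x * g x \<partial>M" and ?c = "\<integral>x. (g x)\<^sup>2 \<partial>M"
  have fg: "integrable M (\<lambda>x. f x * g x)" by (rule integrable_mult_square_integrable) (use f2 g2 in auto)
  have q: "0 \<le> ?a * s\<^sup>2 - 2 * s * t * ?b + t\<^sup>2 * ?c" for s t :: real
  proof -
    have "0 \<le> (\<integral>x. (s * f x - t * g x)\<^sup>2 \<partial>M)" by simp
    also have "\<dots> = (\<integral>x. s\<^sup>2 * (f x)\<^sup>2 - 2 * s * t * (f x * g x) + t\<^sup>2 * (g x)\<^sup>2 \<partial>M)"
      by (rule Bochner_Integration.integral_cong) (auto simp: power2_eq_square algebra_simps)
    also have "\<dots> = s\<^sup>2 * ?a - 2 * s * t * ?b + t\<^sup>2 * ?c" using f2 g2 fg by simp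
    finally show ?thesis by (simp add: mult.commute)
  qed
  have c0: "0 \<le> ?c" by simp
  have "0 \<le> ?c * (?a * ?c - ?b\<^sup>2)"
    using q[of ?c ?b] by (simp add: power2_eq_square algebra_simps)
  then have *: "?c \<noteq> 0 \<Longrightarrow> ?thesis" using c0 by (simp add: zero_le_mult_iff)
  show ?thesis
  proof (cases "?c = 0")
    case False then show ?thesis using * by simp
  next
    case True
    have "0 \<le> ?a - 2 * t * ?b" for t using q[of 1 t] True by simp
    from this[of "(?a + 1) / (2 * ?b)"] have "?b = 0" by (cases "?b = 0") auto
    then show ?thesis by simp
  qed
qed

lemma (in prob_space) integral_abs_le_sqrt:
  fixes f :: "'a \<Rightarrow> real"
  assumes "f \<in> borel_measurable M" "integrable M (\<lambda>x. (f x)\<^sup>2)"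
  shows "(\<integral>x. \<bar>f x\<bar> \<partial>M) \<le> sqrt (\<integral>x. (f x)\<^sup>2 \<partial>M)"
proof (rule real_le_rsqrt)
  show "(\<integral>x. \<bar>f x\<bar> \<partial>M)\<^sup>2 \<le> (\<integral>x. (f x)\<^sup>2 \<partial>M)"
    using integral_Cauchy_Schwarz[of "\<lambda>x. \<bar>f x\<bar>" M "\<lambda>_. 1"] assms by (simp add: prob_space)
qed

section \<open>Bounded kernels on a probability space\<close>

context prob_space begin

text \<open>Bounded measurable functions and kernels form an algebra that is closed under
  integration in one variable; working with them everywhere, instead of with square-integrable
  functions, makes all integrals below exist and makes Fubini's theorem available without side
  conditions. The same development serves the unit interval and the uniform distribution on
  \<open>{1..n}\<close>, hence the limit operator and the empirical matrix.\<close>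

definition bfun :: "('a \<Rightarrow> real) \<Rightarrow> bool" where
  "bfun f \<longleftrightarrow> f \<in> borel_measurable M \<and> (\<exists>B. \<forall>x\<in>space M. \<bar>f x\<bar> \<le> B)"

definition bker :: "('a \<Rightarrow> 'a \<Rightarrow> real) \<Rightarrow> bool" where
  "bker K \<longleftrightarrow> (\<lambda>(x, y). K x y) \<in> borel_measurable (M \<Otimes>\<^sub>M M) \<and>
     (\<exists>B. \<forall>x\<in>space M. \<forall>y\<in>space M. \<bar>K x y\<bar> \<le> B)"

definition kop :: "('a \<Rightarrow> 'a \<Rightarrow> real) \<Rightarrow> ('a \<Rightarrow> real) \<Rightarrow> 'a \<Rightarrow> real" where
  "kop K f x = (\<integral>y. K x y * f y \<partial>M)"

definition kcomp :: "('a \<Rightarrow> 'a \<Rightarrow> real) \<Rightarrow> ('a \<Rightarrow> 'a \<Rightarrow> real) \<Rightarrow> 'a \<Rightarrow> 'a \<Rightarrow> real" where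
  "kcomp K L x y = (\<integral>z. K x z * L z y \<partial>M)"

primrec kpow :: "('a \<Rightarrow> 'a \<Rightarrow> real) \<Rightarrow> nat \<Rightarrow> 'a \<Rightarrow> 'a \<Rightarrow> real" where
  "kpow K 0 = K"
| "kpow K (Suc n) = kcomp K (kpow K n)"

definition inner2 :: "('a \<Rightarrow> real) \<Rightarrow> ('a \<Rightarrow> real) \<Rightarrow> real" where
  "inner2 f g = (\<integral>x. f x * g x \<partial>M)"

text \<open>The Hilbert--Schmidt inner product, integrated so that the inner integral pairs two
  columns.\<close>

definition kinner :: "('a \<Rightarrow> 'a \<Rightarrow> real) \<Rightarrow> ('a \<Rightarrow> 'a \<Rightarrow> real) \<Rightarrow> real" where
  "kinner K L = (\<integral>y. (\<integral>x. K x y * L x y \<partial>M) \<partial>M)"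

definition ksym :: "('a \<Rightarrow> 'a \<Rightarrow> real) \<Rightarrow> bool" where
  "ksym K \<longleftrightarrow> (\<forall>x\<in>space M. \<forall>y\<in>space M. K x y = K y x)"

lemma bfunI: "f \<in> borel_measurable M \<Longrightarrow> (\<And>x. x \<in> space M \<Longrightarrow> \<bar>f x\<bar> \<le> B) \<Longrightarrow> bfun f"
  unfolding bfun_def by blast

lemma bkerI: "(\<lambda>(x, y). K x y) \<in> borel_measurable (M \<Otimes>\<^sub>M M) \<Longrightarrow>
    (\<And>x y. x \<in> space M \<Longrightarrow> y \<in> space M \<Longrightarrow> \<bar>K x y\<bar> \<le> B) \<Longrightarrow> bker K"
  unfolding bker_def by blast

lemma bfun_measurable: "bfun f \<Longrightarrow> f \<in> borel_measurable M"
  unfolding bfun_def by blast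

lemma bker_measurable: "bker K \<Longrightarrow> (\<lambda>(x, y). K x y) \<in> borel_measurable (M \<Otimes>\<^sub>M M)"
  unfolding bker_def by blast

lemma bfun_bound: assumes "bfun f" obtains B where "B > 0" "\<And>x. x \<in> space M \<Longrightarrow> \<bar>f x\<bar> \<le> B"
proof -
  from assms obtain B where "\<forall>x\<in>space M. \<bar>f x\<bar> \<le> B" unfolding bfun_def by blast
  then show ?thesis by (intro that[of "\<bar>B\<bar> + 1"]) force+
qed

lemma bker_bound:
  assumes "bker K" obtains B where "B > 0" "\<And>x y. x \<in> space M \<Longrightarrow> y \<in> space M \<Longrightarrow> \<bar>K x y\<bar> \<le> B"
proof -
  from assms obtain B where "\<forall>x\<in>space M. \<forall>y\<in>space M. \<bar>K x y\<bar> \<le> B" unfolding bker_def by blast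
  then show ?thesis by (intro that[of "\<bar>B\<bar> + 1"]) force+
qed

lemma bfun_integrable: "bfun f \<Longrightarrow> integrable M f"
  by (metis AE_I2 bfun_bound bfun_measurable integrable_const_bound real_norm_def)

lemma bfun_const [simp]: "bfun (\<lambda>_. c)"
  by (rule bfunI[of _ "\<bar>c\<bar>"]) auto

lemma bfun_add: assumes "bfun f" "bfun g" shows "bfun (\<lambda>x. f x + g x)"
proof -
  obtain A B where "\<And>x. x \<in> space M \<Longrightarrow> \<bar>f x\<bar> \<le> A" "\<And>x. x \<in> space M \<Longrightarrow> \<bar>g x\<bar> \<le> B"
    using assms by (metis bfun_bound)
  then show ?thesis using assms[THEN bfun_measurable]
    by (intro bfunI[of _ "A + B"]) (auto intro!: order.trans[OF abs_triangle_ineq] add_mono)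
qed

lemma bfun_mult: assumes "bfun f" "bfun g" shows "bfun (\<lambda>x. f x * g x)"
proof -
  obtain A B where "A > 0" "\<And>x. x \<in> space M \<Longrightarrow> \<bar>f x\<bar> \<le> A" "\<And>x. x \<in> space M \<Longrightarrow> \<bar>g x\<bar> \<le> B"
    using assms by (metis bfun_bound)
  then show ?thesis using assms[THEN bfun_measurable]
    by (intro bfunI[of _ "A * B"]) (auto simp: abs_mult intro!: mult_mono)
qed

lemma bfun_cmult: "bfun f \<Longrightarrow> bfun (\<lambda>x. c * f x)"
  by (rule bfun_mult) auto

lemma bfun_diff: assumes "bfun f" "bfun g" shows "bfun (\<lambda>x. f x - g x)"
  using bfun_add[OF assms(1) bfun_cmult[OF assms(2), of "-1"]] by simp

lemma bfun_sum: "(\<And>i. i \<in> F \<Longrightarrow> bfun (f i)) \<Longrightarrow> bfun (\<lambda>x. \<Sum>i\<in>F. f i x)"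
  by (induction F rule: infinite_finite_induct) (auto intro: bfun_add)

lemma bfun_square: "bfun f \<Longrightarrow> bfun (\<lambda>x. (f x)\<^sup>2)"
  unfolding power2_eq_square by (rule bfun_mult)

lemma bfun_abs: "bfun f \<Longrightarrow> bfun (\<lambda>x. \<bar>f x\<bar>)"
  unfolding bfun_def by auto

lemma bfun_cong: assumes "bfun g" "\<And>x. x \<in> space M \<Longrightarrow> f x = g x" shows "bfun f"
  using assms unfolding bfun_def by (metis (no_types, lifting) measurable_cong)

lemma bker_add: assumes "bker K" "bker L" shows "bker (\<lambda>x y. K x y + L x y)"
proof -
  obtain A B where "\<And>x y. x \<in> space M \<Longrightarrow> y \<in> space M \<Longrightarrow> \<bar>K x y\<bar> \<le> A"
    "\<And>x y. x \<in> space M \<Longrightarrow> y \<in> space M \<Longrightarrow> \<bar>L x y\<bar> \<le> B" using assms by (metis bker_bound)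
  then show ?thesis using assms[THEN bker_measurable]
    by (intro bkerI[of _ "A + B"])
       (auto simp: split_beta' intro!: order.trans[OF abs_triangle_ineq] add_mono)
qed

lemma bker_mult: assumes "bker K" "bker L" shows "bker (\<lambda>x y. K x y * L x y)"
proof -
  obtain A B where "A > 0" "\<And>x y. x \<in> space M \<Longrightarrow> y \<in> space M \<Longrightarrow> \<bar>K x y\<bar> \<le> A"
    "\<And>x y. x \<in> space M \<Longrightarrow> y \<in> space M \<Longrightarrow> \<bar>L x y\<bar> \<le> B" using assms by (metis bker_bound)
  then show ?thesis using assms[THEN bker_measurable]
    by (intro bkerI[of _ "A * B"]) (auto simp: split_beta' abs_mult intro!: mult_mono)
qed

lemma bker_fst: "bfun f \<Longrightarrow> bker (\<lambda>x y. f x)"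
  unfolding bfun_def bker_def by (auto simp: split_beta')

lemma bker_snd: "bfun f \<Longrightarrow> bker (\<lambda>x y. f y)"
  unfolding bfun_def bker_def by (auto simp: split_beta')

lemma bker_tensor: "bfun f \<Longrightarrow> bfun g \<Longrightarrow> bker (\<lambda>x y. f x * g y)"
  by (intro bker_mult bker_fst bker_snd)

lemma bker_const: "bker (\<lambda>x y. c)"
  using bker_fst[OF bfun_const] .

lemma bker_cmult: "bker K \<Longrightarrow> bker (\<lambda>x y. c * K x y)"
  by (intro bker_mult bker_const)

lemma bker_diff: assumes "bker K" "bker L" shows "bker (\<lambda>x y. K x y - L x y)"
  using bker_add[OF assms(1) bker_cmult[OF assms(2), of "-1"]] by simp

lemma bker_sum: "(\<And>i. i \<in> F \<Longrightarrow> bker (f i)) \<Longrightarrow> bker (\<lambda>x y. \<Sum>i\<in>F. f i x y)"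
  by (induction F rule: infinite_finite_induct) (auto intro: bker_add bker_const)

lemma bker_swap: "bker K \<Longrightarrow> bker (\<lambda>x y. K y x)"
  unfolding bker_def by (auto intro: measurable_compose[OF measurable_pair_swap'] simp: split_beta' dest: measurable_pair_swap)

lemma bker_slice1: "bker K \<Longrightarrow> x \<in> space M \<Longrightarrow> bfun (\<lambda>y. K x y)"
  unfolding bker_def bfun_def by (auto dest!: measurable_Pair2[of _ _ _ _ x])

lemma bker_slice2: "bker K \<Longrightarrow> y \<in> space M \<Longrightarrow> bfun (\<lambda>x. K x y)"
  using bker_slice1[OF bker_swap] .

lemma bker_integral1: assumes "bker K" shows "bfun (\<lambda>x. \<integral>y. K x y \<partial>M)"
proof -
  obtain B where B: "B > 0" "\<And>x y. x \<in> space M \<Longrightarrow> y \<in> space M \<Longrightarrow> \<bar>K x y\<bar> \<le> B"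
    using assms by (metis bker_bound)
  have [measurable]: "(\<lambda>(x, y). K x y) \<in> borel_measurable (M \<Otimes>\<^sub>M M)" by (rule bker_measurable[OF assms])
  show ?thesis
  proof (rule bfunI)
    fix x assume x: "x \<in> space M"
    have "\<bar>\<integral>y. K x y \<partial>M\<bar> \<le> (\<integral>y. \<bar>K x y\<bar> \<partial>M)" by (rule integral_abs_bound)
    also have "\<dots> \<le> (\<integral>y. B \<partial>M)" using B x
      by (intro integral_mono bfun_integrable bfun_abs bker_slice1[OF assms]) auto
    finally show "\<bar>\<integral>y. K x y \<partial>M\<bar> \<le> B" by (simp add: prob_space)
  qed measurable
qed

lemma bker_integral2: "bker K \<Longrightarrow> bfun (\<lambda>y. \<integral>x. K x y \<partial>M)"
  using bker_integral1[OF bker_swap] .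

lemma bker_integrable_pair:
  assumes "bker K" shows "integrable (M \<Otimes>\<^sub>M M) (\<lambda>(x, y). K x y)"
proof -
  obtain B where B: "\<And>x y. x \<in> space M \<Longrightarrow> y \<in> space M \<Longrightarrow> \<bar>K x y\<bar> \<le> B"
    using assms by (metis bker_bound)
  note m = bker_measurable[OF assms]
  interpret pair_prob_space M M ..
  show ?thesis
    using B m by (intro P.integrable_const_bound[where B = B] AE_I2) (auto simp: space_pair_measure)
qed

lemma bker_Fubini: assumes "bker K"
  shows "(\<integral>x. (\<integral>y. K x y \<partial>M) \<partial>M) = (\<integral>y. (\<integral>x. K x y \<partial>M) \<partial>M)"
proof -
  note i = bker_integrable_pair[OF assms]
  interpret pair_prob_space M M ..
  from i show ?thesis using Fubini_integral[of K] by simp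
qed

lemma bker_integral_pair: assumes "bker K"
  shows "(\<integral>p. (case p of (x, y) \<Rightarrow> K x y) \<partial>(M \<Otimes>\<^sub>M M)) = (\<integral>x. (\<integral>y. K x y \<partial>M) \<partial>M)"
proof -
  note i = bker_integrable_pair[OF assms]
  interpret pair_prob_space M M ..
  from i show ?thesis using integral_fst'[of "\<lambda>(x, y). K x y"] by simp
qed

lemma bfun_kop: assumes "bker K" "bfun f" shows "bfun (kop K f)"
  unfolding kop_def by (intro bker_integral1 bker_mult bker_snd assms)

lemma bker_kcomp: assumes K: "bker K" and L: "bker L" shows "bker (kcomp K L)"
proof -
  obtain A where A: "A > 0" "\<And>x y. x \<in> space M \<Longrightarrow> y \<in> space M \<Longrightarrow> \<bar>K x y\<bar> \<le> A"
    using K by (metis bker_bound)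
  obtain B where B: "B > 0" "\<And>x y. x \<in> space M \<Longrightarrow> y \<in> space M \<Longrightarrow> \<bar>L x y\<bar> \<le> B"
    using L by (metis bker_bound)
  have [measurable]: "(\<lambda>(x, y). K x y) \<in> borel_measurable (M \<Otimes>\<^sub>M M)" "(\<lambda>(x, y). L x y) \<in> borel_measurable (M \<Otimes>\<^sub>M M)"
    using K L by (auto dest: bker_measurable)
  show ?thesis
  proof (rule bkerI)
    fix x y assume xy: "x \<in> space M" "y \<in> space M"
    have b: "bfun (\<lambda>z. K x z * L z y)" by (intro bfun_mult bker_slice1[OF K] bker_slice2[OF L] xy)
    have "\<bar>kcomp K L x y\<bar> \<le> (\<integral>z. \<bar>K x z * L z y\<bar> \<partial>M)" unfolding kcomp_def by (rule integral_abs_bound)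
    also have "\<dots> \<le> (\<integral>y. A * B \<partial>M)" using A B xy
      by (intro integral_mono bfun_integrable bfun_abs b) (auto simp: abs_mult intro!: mult_mono)
    finally show "\<bar>kcomp K L x y\<bar> \<le> A * B" by (simp add: prob_space)
  qed (unfold kcomp_def, measurable)
qed

lemma bker_kpow: "bker K \<Longrightarrow> bker (kpow K n)"
  by (induction n) (auto intro: bker_kcomp)

lemma kcomp_cong:
  assumes "\<And>x y. x \<in> space M \<Longrightarrow> y \<in> space M \<Longrightarrow> K x y = K' x y"
    and "\<And>x y. x \<in> space M \<Longrightarrow> y \<in> space M \<Longrightarrow> L x y = L' x y" and "x \<in> space M" "y \<in> space M"
  shows "kcomp K L x y = kcomp K' L' x y"
  unfolding kcomp_def using assms by (intro Bochner_Integration.integral_cong) auto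

lemma kcomp_assoc:
  assumes K: "bker K" and L: "bker L" and N: "bker N" and xy: "x \<in> space M" "y \<in> space M"
  shows "kcomp (kcomp K L) N x y = kcomp K (kcomp L N) x y"
proof -
  have b: "bker (\<lambda>w z. K x z * L z w * N w y)"
    by (intro bker_mult bker_snd bker_fst bker_slice1[OF K] bker_slice2[OF N] xy bker_swap[OF L])
  have "kcomp (kcomp K L) N x y = (\<integral>w. (\<integral>z. K x z * L z w * N w y \<partial>M) \<partial>M)"
    unfolding kcomp_def by (simp add: integral_mult_left_zero)
  also have "\<dots> = (\<integral>z. (\<integral>w. K x z * L z w * N w y \<partial>M) \<partial>M)" by (rule bker_Fubini[OF b])
  also have "\<dots> = kcomp K (kcomp L N) x y"
    unfolding kcomp_def by (simp add: mult.assoc integral_mult_right_zero)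
  finally show ?thesis .
qed

lemma kpow_Suc_right:
  assumes K: "bker K" and xy: "x \<in> space M" "y \<in> space M"
  shows "kpow K (Suc n) x y = kcomp (kpow K n) K x y"
  using xy
proof (induction n arbitrary: x y)
  case (Suc n)
  have "kpow K (Suc (Suc n)) x y = kcomp K (kcomp (kpow K n) K) x y"
    unfolding kpow.simps(2)[of K "Suc n"] using Suc.IH by (intro kcomp_cong Suc.prems) auto
  also have "\<dots> = kcomp (kcomp K (kpow K n)) K x y"
    by (rule kcomp_assoc[symmetric]) (use K Suc.prems bker_kpow in auto)
  finally show ?case by simp
qed simp

lemma kop_adjoint:
  assumes K: "bker K" and s: "ksym K" and f: "bfun f" and g: "bfun g"
  shows "inner2 (kop K f) g = inner2 f (kop K g)"
proof -
  have b: "bker (\<lambda>x y. K x y * f y * g x)" by (intro bker_mult bker_snd bker_fst K f g)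
  have "inner2 (kop K f) g = (\<integral>x. (\<integral>y. K x y * f y * g x \<partial>M) \<partial>M)"
    unfolding inner2_def kop_def by simp
  also have "\<dots> = (\<integral>y. (\<integral>x. K x y * f y * g x \<partial>M) \<partial>M)" by (rule bker_Fubini[OF b])
  also have "\<dots> = (\<integral>y. (\<integral>x. f y * (K y x * g x) \<partial>M) \<partial>M)"
    using s by (intro Bochner_Integration.integral_cong) (auto simp: ksym_def)
  also have "\<dots> = inner2 f (kop K g)" unfolding inner2_def kop_def by simp
  finally show ?thesis .
qed

lemma kop_slice: "kop K (\<lambda>z. L z y) x = kcomp K L x y"
  by (simp add: kop_def kcomp_def)

lemma kinner_slices: "kinner K L = (\<integral>y. inner2 (\<lambda>x. K x y) (\<lambda>x. L x y) \<partial>M)"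
  by (simp add: kinner_def inner2_def)

lemma bker_inner_slices: "bker K \<Longrightarrow> bker L \<Longrightarrow> bfun (\<lambda>y. inner2 (\<lambda>x. K x y) (\<lambda>x. L x y))"
  unfolding inner2_def by (intro bker_integral2 bker_mult)

lemma kinner_adjoint:
  assumes K: "bker K" "ksym K" and A: "bker A" and B: "bker B"
  shows "kinner (kcomp K A) B = kinner A (kcomp K B)"
  unfolding kinner_slices kop_slice[symmetric, abs_def]
  by (intro Bochner_Integration.integral_cong refl kop_adjoint K bker_slice2[OF A] bker_slice2[OF B])

lemma kinner_kpow:
  assumes K: "bker K" "ksym K"
  shows "kinner (kpow K a) (kpow K b) = kinner K (kpow K (a + b))"
proof (induction a arbitrary: b)
  case (Suc a)
  have "kinner (kpow K (Suc a)) (kpow K b) = kinner (kpow K a) (kpow K (Suc b))"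
    using kinner_adjoint[OF K bker_kpow[OF K(1)] bker_kpow[OF K(1)]] by simp
  then show ?case using Suc.IH[of "Suc b"] by simp
qed simp

text \<open>For a symmetric kernel the Hilbert--Schmidt inner product with a power is a trace;
  this is how closed walks enter.\<close>

lemma kinner_kpow_trace:
  assumes K: "bker K" "ksym K"
  shows "kinner K (kpow K m) = (\<integral>x. kpow K (Suc m) x x \<partial>M)"
  unfolding kinner_def kpow.simps(2) kcomp_def
  using K(2) by (intro Bochner_Integration.integral_cong) (auto simp: ksym_def)

lemma inner2_add_left: "bfun f \<Longrightarrow> bfun g \<Longrightarrow> bfun h \<Longrightarrow> inner2 (\<lambda>x. f x + g x) h = inner2 f h + inner2 g h"
  unfolding inner2_def distrib_right by (intro Bochner_Integration.integral_add bfun_integrable bfun_mult)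

lemma inner2_diff_left: "bfun f \<Longrightarrow> bfun g \<Longrightarrow> bfun h \<Longrightarrow> inner2 (\<lambda>x. f x - g x) h = inner2 f h - inner2 g h"
  unfolding inner2_def left_diff_distrib by (intro Bochner_Integration.integral_diff bfun_integrable bfun_mult)

lemma inner2_cmult_left: "inner2 (\<lambda>x. c * f x) h = c * inner2 f h"
  unfolding inner2_def by (simp add: mult.assoc)

lemma inner2_commute: "inner2 f g = inner2 g f"
  unfolding inner2_def by (simp add: mult.commute)

lemma inner2_sum_left:
  "(\<And>i. i \<in> F \<Longrightarrow> bfun (f i)) \<Longrightarrow> bfun h \<Longrightarrow> inner2 (\<lambda>x. \<Sum>i\<in>F. f i x) h = (\<Sum>i\<in>F. inner2 (f i) h)"
  unfolding inner2_def sum_distrib_right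
  by (intro Bochner_Integration.integral_sum bfun_integrable bfun_mult)

lemma inner2_cmult_right: "inner2 f (\<lambda>x. c * h x) = c * inner2 f h"
  unfolding inner2_commute[of f] inner2_cmult_left by (rule refl)

lemma inner2_diff_right: "bfun f \<Longrightarrow> bfun g \<Longrightarrow> bfun h \<Longrightarrow> inner2 h (\<lambda>x. f x - g x) = inner2 h f - inner2 h g"
  unfolding inner2_commute[of h] by (rule inner2_diff_left)

lemma inner2_nonneg [simp]: "0 \<le> inner2 f f"
  unfolding inner2_def by (simp flip: power2_eq_square)

lemma inner2_Cauchy_Schwarz: "bfun f \<Longrightarrow> bfun g \<Longrightarrow> (inner2 f g)\<^sup>2 \<le> inner2 f f * inner2 g g"
  using integral_Cauchy_Schwarz[of f M g] bfun_integrable[OF bfun_square]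
  by (auto simp: inner2_def power2_eq_square bfun_measurable)

lemma inner2_self_eq_0_iff:
  assumes "bfun f" shows "inner2 f f = 0 \<longleftrightarrow> (AE x in M. f x = 0)"
  unfolding inner2_def
  using integral_nonneg_eq_0_iff_AE[OF bfun_integrable[OF bfun_mult[OF assms assms]]] by simp

lemma inner2_AE_zero: "AE x in M. f x = 0 \<Longrightarrow> inner2 f g = 0"
  unfolding inner2_def by (rule integral_eq_zero_AE) auto

lemma kop_cong_AE: 
  assumes K: "bker K" and [measurable]: "f \<in> borel_measurable M" "g \<in> borel_measurable M"
    and x: "x \<in> space M" and e: "AE y in M. f y = g y"
  shows "kop K f x = kop K g x"
proof -
  have [measurable]: "(\<lambda>y. K x y) \<in> borel_measurable M" using bker_slice1[OF K x] bfun_measurable by blast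
  show ?thesis unfolding kop_def using e by (intro integral_cong_AE) auto
qed

lemma kop_add: assumes "bker K" "bfun f" "bfun g" "x \<in> space M"
  shows "kop K (\<lambda>y. f y + g y) x = kop K f x + kop K g x"
  unfolding kop_def distrib_left
  by (intro Bochner_Integration.integral_add bfun_integrable bfun_mult bker_slice1 assms)

lemma kop_cmult: "kop K (\<lambda>y. c * f y) x = c * kop K f x"
proof -
  have "kop K (\<lambda>y. c * f y) x = (\<integral>y. c * (K x y * f y) \<partial>M)" unfolding kop_def by (simp add: mult.left_commute)
  then show ?thesis by (simp add: kop_def)
qed

end

section \<open>Symmetric kernels have eigenfunctions\<close>

context prob_space begin

text \<open>The square of the operator norm, with the supremum over bounded functions
  only.\<close>

definition opsq :: "('a \<Rightarrow> 'a \<Rightarrow> real) \<Rightarrow> real" where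
  "opsq K = Sup {inner2 (kop K f) (kop K f) | f. bfun f \<and> inner2 f f \<le> 1}"

definition eigenfun :: "('a \<Rightarrow> 'a \<Rightarrow> real) \<Rightarrow> real \<Rightarrow> ('a \<Rightarrow> real) \<Rightarrow> bool" where
  "eigenfun K c f \<longleftrightarrow> bfun f \<and> (\<forall>x\<in>space M. kop K f x = c * f x)"

lemma inner2_cong: 
  assumes "\<And>x. x \<in> space M \<Longrightarrow> f x = f' x" "\<And>x. x \<in> space M \<Longrightarrow> g x = g' x"
  shows "inner2 f g = inner2 f' g'"
  unfolding inner2_def using assms by (intro Bochner_Integration.integral_cong) auto

lemma kinner_eq_swap: assumes "bker K" "bker L"
  shows "kinner K L = (\<integral>x. (\<integral>y. K x y * L x y \<partial>M) \<partial>M)"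
  unfolding kinner_def using bker_Fubini[OF bker_mult[OF assms]] by simp

lemma kinner_nonneg: "0 \<le> kinner K K"
  unfolding kinner_def by simp

lemma inner2_kop_le_kinner:
  assumes K: "bker K" and f: "bfun f"
  shows "inner2 (kop K f) (kop K f) \<le> kinner K K * inner2 f f"
proof -
  have "inner2 (kop K f) (kop K f) = (\<integral>x. (kop K f x)\<^sup>2 \<partial>M)" by (simp add: inner2_def power2_eq_square)
  also have "\<dots> \<le> (\<integral>x. (\<integral>y. K x y * K x y \<partial>M) * inner2 f f \<partial>M)"
  proof (rule integral_mono)
    show "integrable M (\<lambda>x. (kop K f x)\<^sup>2)" by (intro bfun_integrable bfun_square bfun_kop K f)
    show "integrable M (\<lambda>x. (\<integral>y. K x y * K x y \<partial>M) * inner2 f f)"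
      by (intro bfun_integrable bfun_mult bfun_const bker_integral1 bker_mult K)
    fix x assume x: "x \<in> space M"
    show "(kop K f x)\<^sup>2 \<le> (\<integral>y. K x y * K x y \<partial>M) * inner2 f f"
      using inner2_Cauchy_Schwarz[OF bker_slice1[OF K x] f] by (simp add: inner2_def kop_def)
  qed
  also have "\<dots> = kinner K K * inner2 f f" by (simp add: kinner_eq_swap[OF K K])
  finally show ?thesis .
qed

lemma opsq_bdd: assumes K: "bker K"
  shows "bdd_above {inner2 (kop K f) (kop K f) | f. bfun f \<and> inner2 f f \<le> 1}"
proof (rule bdd_aboveI[of _ "kinner K K"], safe)
  fix f assume f: "bfun f" "inner2 f f \<le> 1"
  show "inner2 (kop K f) (kop K f) \<le> kinner K K"
    using order.trans[OF inner2_kop_le_kinner[OF K f(1)] mult_left_le[OF f(2) kinner_nonneg]] .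
qed

lemma opsq_upper:
  assumes K: "bker K" and f: "bfun f" "inner2 f f \<le> 1"
  shows "inner2 (kop K f) (kop K f) \<le> opsq K"
  unfolding opsq_def by (rule cSup_upper[OF _ opsq_bdd[OF K]]) (use f in blast)

lemma opsq_least:
  assumes "\<And>f. bfun f \<Longrightarrow> inner2 f f \<le> 1 \<Longrightarrow> inner2 (kop K f) (kop K f) \<le> c"
  shows "opsq K \<le> c"
  unfolding opsq_def
proof (rule cSup_least)
  have "bfun (\<lambda>_. 0)" "inner2 (\<lambda>_. 0) (\<lambda>_. 0) \<le> 1" by (auto simp: inner2_def)
  then show "{inner2 (kop K f) (kop K f) | f. bfun f \<and> inner2 f f \<le> 1} \<noteq> {}" by blast
qed (use assms in blast)

lemma opsq_nonneg: assumes K: "bker K" shows "0 \<le> opsq K"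
  using order.trans[OF inner2_nonneg opsq_upper[OF K bfun_const[of 0]]] by (simp add: inner2_def)

lemma kop_zero_AE: assumes "bker K" "bfun f" "inner2 f f = 0" "x \<in> space M" shows "kop K f x = 0"
  using kop_cong_AE[OF assms(1) bfun_measurable[OF assms(2)] _ assms(4), of "\<lambda>_. 0"] assms
  by (auto simp: inner2_self_eq_0_iff kop_def)

lemma inner2_kop_le:
  assumes K: "bker K" and f: "bfun f"
  shows "inner2 (kop K f) (kop K f) \<le> opsq K * inner2 f f"
proof (cases "inner2 f f = 0")
  case True
  then have "inner2 (kop K f) (kop K f) = inner2 (\<lambda>_. 0) (\<lambda>_. 0)"
    by (intro inner2_cong kop_zero_AE[OF K f]) auto
  then show ?thesis using True by (simp add: inner2_def)
next
  case False
  define n where "n = inner2 f f"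
  have n: "n > 0" using False inner2_nonneg[of f] by (simp add: n_def less_eq_real_def)
  define g where "g = (\<lambda>x. (1 / sqrt n) * f x)"
  have g: "bfun g" unfolding g_def by (rule bfun_cmult[OF f])
  have g1: "inner2 g g = 1" unfolding g_def inner2_cmult_left inner2_cmult_right n_def[symmetric]
    using n by simp
  have "kop K g = (\<lambda>x. (1 / sqrt n) * kop K f x)" unfolding g_def by (rule ext) (rule kop_cmult)
  then have "inner2 (kop K g) (kop K g) = inner2 (kop K f) (kop K f) / n"
    using n by (simp only: inner2_cmult_left inner2_cmult_right) simp
  then show ?thesis using opsq_upper[OF K g] g1 n by (simp add: field_simps n_def)
qed

lemma kinner_kcomp_le:
  assumes K: "bker K" and L: "bker L"
  shows "kinner (kcomp K L) (kcomp K L) \<le> opsq K * kinner L L"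
proof -
  have "kinner (kcomp K L) (kcomp K L) \<le> (\<integral>y. opsq K * inner2 (\<lambda>x. L x y) (\<lambda>x. L x y) \<partial>M)"
    unfolding kinner_slices
  proof (rule integral_mono)
    show "integrable M (\<lambda>y. inner2 (\<lambda>x. kcomp K L x y) (\<lambda>x. kcomp K L x y))"
      by (intro bfun_integrable bker_inner_slices bker_kcomp K L)
    show "integrable M (\<lambda>y. opsq K * inner2 (\<lambda>x. L x y) (\<lambda>x. L x y))"
      by (intro bfun_integrable bfun_cmult bker_inner_slices L)
    fix y assume y: "y \<in> space M"
    show "inner2 (\<lambda>x. kcomp K L x y) (\<lambda>x. kcomp K L x y) \<le> opsq K * inner2 (\<lambda>x. L x y) (\<lambda>x. L x y)"
      using inner2_kop_le[OF K bker_slice2[OF L y]] by (simp add: kop_slice[abs_def])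
  qed
  then show ?thesis by (simp add: kinner_slices)
qed

lemma kop_kcomp:
  assumes K: "bker K" and L: "bker L" and f: "bfun f" and x: "x \<in> space M"
  shows "kop (kcomp K L) f x = kop K (kop L f) x"
proof -
  have b: "bker (\<lambda>y z. K x z * L z y * f y)"
    by (intro bker_mult bker_snd bker_fst bker_slice1[OF K x] f bker_swap[OF L])
  have "kop (kcomp K L) f x = (\<integral>y. (\<integral>z. K x z * L z y * f y \<partial>M) \<partial>M)"
    unfolding kop_def kcomp_def by simp
  also have "\<dots> = (\<integral>z. (\<integral>y. K x z * L z y * f y \<partial>M) \<partial>M)" by (rule bker_Fubini[OF b])
  also have "\<dots> = kop K (kop L f) x"
    unfolding kop_def by (simp add: mult.assoc)
  finally show ?thesis .
qed

lemma kop_cong: "(\<And>y. y \<in> space M \<Longrightarrow> f y = g y) \<Longrightarrow> kop K f x = kop K g x"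
  unfolding kop_def by (intro Bochner_Integration.integral_cong) auto

lemma bfun_kop_iter: "bker K \<Longrightarrow> bfun f \<Longrightarrow> bfun ((kop K ^^ n) f)"
  by (induction n) (auto intro: bfun_kop)

lemma kop_kpow:
  assumes K: "bker K" and f: "bfun f" and x: "x \<in> space M"
  shows "kop (kpow K n) f x = (kop K ^^ Suc n) f x"
  using x
proof (induction n arbitrary: x)
  case (Suc n)
  then show ?case using kop_kcomp[OF K bker_kpow[OF K] f Suc.prems, of n]
    by (simp add: kop_cong[of "kop (kpow K n) f" "kop K ((kop K ^^ n) f)"])
qed simp

text \<open>Symmetry makes the squared norms of the iterates \<open>(kop K ^^ n) f\<close>
  log-convex in \<open>n\<close>, so they grow at least geometrically with the first
  ratio.\<close>

lemma inner2_kop_power_le: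
  assumes K: "bker K" "ksym K" and f: "bfun f" "inner2 f f \<le> 1"
  shows "inner2 (kop K f) (kop K f) ^ n \<le> inner2 ((kop K ^^ n) f) ((kop K ^^ n) f) \<or> n = 0"
proof -
  define h where "h = (\<lambda>n. inner2 ((kop K ^^ n) f) ((kop K ^^ n) f))"
  have h0: "h n \<ge> 0" for n by (simp add: h_def)
  have lc: "(h (Suc n))\<^sup>2 \<le> h n * h (Suc (Suc n))" for n
  proof -
    have "h (Suc n) = inner2 ((kop K ^^ n) f) ((kop K ^^ Suc (Suc n)) f)"
      unfolding h_def using kop_adjoint[OF K bfun_kop_iter[OF K(1) f(1), of n] bfun_kop_iter[OF K(1) f(1), of "Suc n"]] by simp
    then show ?thesis unfolding h_def
      using inner2_Cauchy_Schwarz[OF bfun_kop_iter[OF K(1) f(1), of n] bfun_kop_iter[OF K(1) f(1), of "Suc (Suc n)"]] by simp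
  qed
  have r: "h 1 * h n \<le> h 0 * h (Suc n)" for n
  proof (induction n)
    case (Suc n)
    show ?case
    proof (cases "h n = 0")
      case True
      then have "h (Suc n) = 0" using lc[of n] by simp
      then show ?thesis using h0 by simp
    next
      case False
      have "h 1 * h (Suc n) * h n \<le> h 0 * (h (Suc n))\<^sup>2"
        using mult_right_mono[OF Suc.IH h0[of "Suc n"]] by (simp add: power2_eq_square mult_ac)
      also have "\<dots> \<le> h 0 * (h n * h (Suc (Suc n)))" using lc h0 by (intro mult_left_mono) auto
      finally have "h n * (h 1 * h (Suc n)) \<le> h n * (h 0 * h (Suc (Suc n)))" by (simp add: mult_ac)
      then show ?thesis using False h0[of n] by (simp add: mult_le_cancel_left)
    qed
  qed (simp add: mult.commute)
  have "h 1 ^ Suc n \<le> h (Suc n)" for n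
  proof (induction n)
    case (Suc n)
    have "h 1 ^ Suc (Suc n) \<le> h 1 * h (Suc n)" using Suc h0[of 1] by (simp add: mult_left_mono)
    also have "\<dots> \<le> h 0 * h (Suc (Suc n))" by (rule r)
    also have "\<dots> \<le> 1 * h (Suc (Suc n))" using f(2) h0 by (intro mult_right_mono) (auto simp: h_def)
    finally show ?case by simp
  qed simp
  then show ?thesis by (cases n) (auto simp: h_def)
qed

text \<open>Log-convexity bounds the operator norm of a power from below, and the Hilbert--Schmidt
  norm dominates the operator norm. This keeps the normalised powers away from 0 in the power
  iteration.\<close>

lemma opsq_power_le_kinner:
  assumes K: "bker K" "ksym K"
  shows "opsq K ^ Suc n \<le> kinner (kpow K n) (kpow K n)"
proof -
  let ?N = "kinner (kpow K n) (kpow K n)"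
  have "opsq K \<le> root (Suc n) ?N"
  proof (rule opsq_least)
    fix f assume f: "bfun f" "inner2 f f \<le> 1"
    have "inner2 (kop K f) (kop K f) ^ Suc n \<le> inner2 ((kop K ^^ Suc n) f) ((kop K ^^ Suc n) f)"
      using inner2_kop_power_le[OF K f, of "Suc n"] by simp
    also have "\<dots> = inner2 (kop (kpow K n) f) (kop (kpow K n) f)"
      using kop_kpow[OF K(1) f(1)] by (intro inner2_cong) auto
    also have "\<dots> \<le> ?N * inner2 f f" by (rule inner2_kop_le_kinner[OF bker_kpow[OF K(1)] f(1)])
    also have "\<dots> \<le> ?N" using f(2) kinner_nonneg by (rule mult_left_le)
    finally have "root (Suc n) (inner2 (kop K f) (kop K f) ^ Suc n) \<le> root (Suc n) ?N" by (rule real_root_le_mono[OF zero_less_Suc])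
    then show "inner2 (kop K f) (kop K f) \<le> root (Suc n) ?N"
      by (simp only: real_root_power_cancel[OF zero_less_Suc inner2_nonneg])
  qed
  then have "opsq K ^ Suc n \<le> root (Suc n) ?N ^ Suc n" by (intro power_mono opsq_nonneg K)
  then show ?thesis by (simp only: real_root_pow_pos2[OF zero_less_Suc kinner_nonneg])
qed

text \<open>An eigenfunction for a non-zero eigenvalue may be replaced by its image under the
  operator, divided by the eigenvalue: the image is bounded and is an eigenfunction at every
  point.\<close>

lemma eigenfun_of_AE:
  assumes K: "bker K" and c: "c \<noteq> 0" and f: "f \<in> borel_measurable M" "integrable M f"
    and e: "AE x in M. kop K f x = c * f x"
  obtains g where "eigenfun K c g" "AE x in M. g x = f x"
proof -
  define g where "g = (\<lambda>x. (1 / c) * kop K f x)"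
  obtain B where B: "B > 0" "\<And>x y. x \<in> space M \<Longrightarrow> y \<in> space M \<Longrightarrow> \<bar>K x y\<bar> \<le> B" using K by (metis bker_bound)
  note [measurable] = bker_measurable[OF K] f(1)
  have bk: "bfun (kop K f)"
  proof (rule bfunI)
    fix x assume x: "x \<in> space M"
    have [measurable]: "(\<lambda>y. K x y) \<in> borel_measurable M" using bker_slice1[OF K x] bfun_measurable by blast
    have b: "\<And>y. y \<in> space M \<Longrightarrow> \<bar>K x y * f y\<bar> \<le> B * \<bar>f y\<bar>"
      using B(2)[OF x] by (simp add: abs_mult mult_right_mono)
    have "integrable M (\<lambda>y. B * \<bar>f y\<bar>)" using f(2) by simp
    then have i: "integrable M (\<lambda>y. K x y * f y)"
      by (rule Bochner_Integration.integrable_bound) (use b in \<open>auto intro!: AE_I2 intro: order.trans[OF _ abs_ge_self]\<close>)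
    have "\<bar>kop K f x\<bar> \<le> (\<integral>y. \<bar>K x y * f y\<bar> \<partial>M)" unfolding kop_def by (rule integral_abs_bound)
    also have "\<dots> \<le> (\<integral>y. B * \<bar>f y\<bar> \<partial>M)" using i f(2) b by (intro integral_mono) auto
    finally show "\<bar>kop K f x\<bar> \<le> (\<integral>y. B * \<bar>f y\<bar> \<partial>M)" .
  next
    show "random_variable borel (kop K f)" unfolding kop_def by measurable
  qed
  have gb: "bfun g" unfolding g_def by (intro bfun_cmult bk)
  have ae: "AE x in M. g x = f x" using e c by (auto simp: g_def)
  have "kop K g x = c * g x" if x: "x \<in> space M" for x
    using kop_cong_AE[OF K bfun_measurable[OF gb] f(1) x ae] c by (simp add: g_def)
  then show ?thesis using that[of g] gb ae unfolding eigenfun_def by blast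
qed

text \<open>Power iteration. The numbers \<open>E m\<close> decrease and are at least 1, hence converge, and the squared
  Hilbert--Schmidt distance of two normalised odd powers is a second difference of \<open>E\<close>. So these
  powers converge, even uniformly after composition with \<open>K\<close> on both sides, to a non-zero kernel
  \<open>G\<close> whose columns \<open>f\<close> satisfy \<open>kop K (kop K f) = q\<^sup>2 * f\<close> with \<open>q\<^sup>2 = opsq K\<close>. Then
  \<open>kop K f + q * f\<close> is an eigenfunction for \<open>q\<close>, unless it vanishes almost everywhere; in that case
  \<open>f\<close> is one for \<open>- q\<close>.\<close>

lemma ex_eigenfun:
  assumes K: "bker K" "ksym K" and pos: "opsq K > 0"
  obtains f c where "eigenfun K c f" "inner2 f f \<noteq> 0" "c\<^sup>2 = opsq K"
proof -
  define r where "r = opsq K"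
  have r: "r > 0" using pos by (simp add: r_def)
  define E where "E = (\<lambda>m. kinner K (kpow K (2 * m)) / r ^ Suc m)"
  have EN: "E m = kinner (kpow K m) (kpow K m) / r ^ Suc m" for m
    unfolding E_def kinner_kpow[OF K] by (simp add: mult_2)
  have E1: "1 \<le> E m" for m
    using opsq_power_le_kinner[OF K, of m] r by (simp add: EN r_def del: power_Suc)
  have Edec: "E (Suc m) \<le> E m" for m
    using kinner_kcomp_le[OF K(1) bker_kpow[OF K(1), of m]] r
    by (simp add: EN r_def[symmetric] field_simps)
  have dE: "decseq E" using Edec by (rule decseq_SucI)
  have EL: "convergent E"
    using decseq_convergent[OF dE, of 1] E1 by (metis convergentI)
  define H where "H = (\<lambda>j x y. kpow K (2 * j + 1) x y / r ^ Suc j)"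
  have H_b: "bker (H j)" for j unfolding H_def
    using bker_cmult[OF bker_kpow[OF K(1), of "2*j+1"], of "1 / r ^ Suc j"] by simp
  have kHH: "kinner (H j) (H k) = E (j + k + 1)" for j k
  proof -
    have "kinner (H j) (H k) = kinner (kpow K (2*j+1)) (kpow K (2*k+1)) / (r ^ Suc j * r ^ Suc k)"
      unfolding kinner_def H_def by simp
    also have "\<dots> = E (j + k + 1)" unfolding E_def kinner_kpow[OF K]
      by (simp add: power_add mult_ac algebra_simps)
    finally show ?thesis .
  qed
  have kD: "kinner (\<lambda>x y. H j x y - H k x y) (\<lambda>x y. H j x y - H k x y) = E (2*j+1) - 2 * E (j+k+1) + E (2*k+1)" for j k
  proof -
    let ?p = "\<lambda>a b y. inner2 (\<lambda>x. H a x y) (\<lambda>x. H b x y)"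
    have "kinner (\<lambda>x y. H j x y - H k x y) (\<lambda>x y. H j x y - H k x y) = (\<integral>y. ?p j j y - 2 * ?p j k y + ?p k k y \<partial>M)"
      unfolding kinner_slices
    proof (rule Bochner_Integration.integral_cong[OF refl])
      fix y assume y: "y \<in> space M"
      note b = bker_slice2[OF H_b y] bfun_diff[OF bker_slice2[OF H_b y] bker_slice2[OF H_b y]]
      show "inner2 (\<lambda>x. H j x y - H k x y) (\<lambda>x. H j x y - H k x y) = ?p j j y - 2 * ?p j k y + ?p k k y"
        unfolding inner2_diff_left[OF b(1) b(1) b(2)] inner2_diff_right[OF b(1) b(1) b(1)]
        using inner2_commute[of "\<lambda>x. H k x y" "\<lambda>x. H j x y"] by linarith
    qed
    also have "\<dots> = kinner (H j) (H j) - 2 * kinner (H j) (H k) + kinner (H k) (H k)"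
    proof -
      have i: "integrable M (?p a b)" for a b by (intro bfun_integrable bker_inner_slices H_b)
      have "(\<integral>y. ?p j j y - 2 * ?p j k y + ?p k k y \<partial>M) = (\<integral>y. ?p j j y - 2 * ?p j k y \<partial>M) + (\<integral>y. ?p k k y \<partial>M)"
        by (intro Bochner_Integration.integral_add Bochner_Integration.integrable_diff integrable_mult_right i)
      also have "(\<integral>y. ?p j j y - 2 * ?p j k y \<partial>M) = (\<integral>y. ?p j j y \<partial>M) - (\<integral>y. 2 * ?p j k y \<partial>M)"
        by (intro Bochner_Integration.integral_diff integrable_mult_right i)
      finally show ?thesis unfolding kinner_slices by (simp only: integral_mult_right_zero)
    qed
    finally show ?thesis unfolding kHH by (simp only: mult_2[of j] mult_2[of k])
  qed
  obtain B where B: "B > 0" "\<And>x y. x \<in> space M \<Longrightarrow> y \<in> space M \<Longrightarrow> \<bar>K x y\<bar> \<le> B" using K(1) by (metis bker_bound)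
  \<comment> \<open>sandwiching a kernel between two copies of \<open>K\<close> turns an \<open>L\<^sup>2\<close> bound into a uniform one\<close>
  have sand: "\<bar>kcomp K (kcomp D K) x y\<bar> \<le> B\<^sup>2 * sqrt (kinner D D)" if D: "bker D" and xy: "x \<in> space M" "y \<in> space M" for D x y
  proof -
    have bs: "bfun (\<lambda>z. \<integral>w. \<bar>D z w\<bar> \<partial>M)"
      using bker_integral1[of "\<lambda>x y. \<bar>D x y\<bar>"] D unfolding bker_def by (auto simp: split_beta')
    have 1: "\<bar>kcomp D K z y\<bar> \<le> B * (\<integral>w. \<bar>D z w\<bar> \<partial>M)" if z: "z \<in> space M" for z
    proof -
      have "\<bar>kcomp D K z y\<bar> \<le> (\<integral>w. \<bar>D z w * K w y\<bar> \<partial>M)" unfolding kcomp_def by (rule integral_abs_bound)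
      also have "\<dots> \<le> (\<integral>w. B * \<bar>D z w\<bar> \<partial>M)"
        using B(2)[OF _ xy(2)] by (intro integral_mono bfun_integrable bfun_abs bfun_mult bfun_cmult bker_slice1[OF D z] bker_slice2[OF K(1) xy(2)])
          (simp add: abs_mult mult.commute[of B] mult_left_mono)
      finally show ?thesis by simp
    qed
    have "\<bar>kcomp K (kcomp D K) x y\<bar> \<le> (\<integral>z. \<bar>K x z * kcomp D K z y\<bar> \<partial>M)" 
      unfolding kcomp_def[of K] by (rule integral_abs_bound)
    also have "\<dots> \<le> (\<integral>z. B * (B * (\<integral>w. \<bar>D z w\<bar> \<partial>M)) \<partial>M)"
      using B 1 xy by (intro integral_mono bfun_integrable bfun_abs bfun_mult bfun_const bs bker_slice1[OF K(1) xy(1)] bker_slice2[OF _ xy(2)] bker_kcomp K D)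
        (auto simp: abs_mult intro!: mult_mono)
    also have "\<dots> = B\<^sup>2 * (\<integral>z. (\<integral>w. \<bar>D z w\<bar> \<partial>M) \<partial>M)" by (simp add: power2_eq_square)
    also have "(\<integral>z. (\<integral>w. \<bar>D z w\<bar> \<partial>M) \<partial>M) \<le> sqrt (kinner D D)"
    proof (rule real_le_rsqrt)
      have "(\<integral>z. (\<integral>w. \<bar>D z w\<bar> \<partial>M) \<partial>M)\<^sup>2 \<le> (\<integral>z. (\<integral>w. \<bar>D z w\<bar> \<partial>M)\<^sup>2 \<partial>M)"
        using integral_Cauchy_Schwarz[of "\<lambda>z. \<integral>w. \<bar>D z w\<bar> \<partial>M" M "\<lambda>_. 1"] bs
        by (simp add: prob_space bfun_integrable bfun_square bfun_measurable)
      also have "\<dots> \<le> (\<integral>z. (\<integral>w. D z w * D z w \<partial>M) \<partial>M)"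
      proof (rule integral_mono)
        show "integrable M (\<lambda>z. (\<integral>w. \<bar>D z w\<bar> \<partial>M)\<^sup>2)" by (intro bfun_integrable bfun_square bs)
        show "integrable M (\<lambda>z. (\<integral>w. D z w * D z w \<partial>M))" by (intro bfun_integrable bker_integral1 bker_mult D)
        fix z assume z: "z \<in> space M"
        show "(\<integral>w. \<bar>D z w\<bar> \<partial>M)\<^sup>2 \<le> (\<integral>w. D z w * D z w \<partial>M)"
          using integral_Cauchy_Schwarz[of "\<lambda>w. \<bar>D z w\<bar>" M "\<lambda>_. 1"] bfun_measurable[OF bfun_abs[OF bker_slice1[OF D z]]] bfun_integrable[OF bfun_square[OF bker_slice1[OF D z]]]
          by (simp add: prob_space) (simp add: power2_eq_square)
      qed
      finally show "(\<integral>z. (\<integral>w. \<bar>D z w\<bar> \<partial>M) \<partial>M)\<^sup>2 \<le> kinner D D" by (simp add: kinner_eq_swap[OF D D])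
    qed
    finally show ?thesis using B(1) by (simp add: mult_left_mono)
  qed
  have HS: "r * H (Suc j) x y = kcomp K (kcomp (H j) K) x y" if xy: "x \<in> space M" "y \<in> space M" for j x y
  proof -
    have "kpow K (2 * Suc j + 1) x y = kcomp K (kcomp (kpow K (2*j+1)) K) x y"
    proof -
      have "kpow K (2 * Suc j + 1) x y = kcomp K (kpow K (Suc (2*j+1))) x y" by simp
      also have "\<dots> = kcomp K (kcomp (kpow K (2*j+1)) K) x y"
        by (rule kcomp_cong[OF refl kpow_Suc_right[OF K(1)] xy])
      finally show ?thesis .
    qed
    moreover have "kcomp K (kcomp (H j) K) x y = kcomp K (kcomp (kpow K (2*j+1)) K) x y / r ^ Suc j"
      unfolding H_def kcomp_def by (simp del: kpow.simps power_Suc)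
    moreover have "r * H (Suc j) x y = kpow K (2 * Suc j + 1) x y / r ^ Suc j"
      using r unfolding H_def power_Suc[of r "Suc j"] by (simp del: kpow.simps power_Suc)
    ultimately show ?thesis by (simp only:)
  qed
  have HS2: "r * H (Suc j) x y = kcomp K (kcomp K (H j)) x y" if xy: "x \<in> space M" "y \<in> space M" for j x y
  proof -
    have "kcomp K (kcomp K (H j)) x y = kcomp K (kcomp K (kpow K (2*j+1))) x y / r ^ Suc j"
      unfolding H_def kcomp_def by (simp del: kpow.simps power_Suc)
    moreover have "kpow K (2 * Suc j + 1) x y = kcomp K (kcomp K (kpow K (2*j+1))) x y" by simp
    moreover have "r * H (Suc j) x y = kpow K (2 * Suc j + 1) x y / r ^ Suc j"
      using r unfolding H_def power_Suc[of r "Suc j"] by (simp del: kpow.simps power_Suc)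
    ultimately show ?thesis by (simp only:)
  qed
  have Hdiff: "\<bar>H (Suc j) x y - H (Suc k) x y\<bar> \<le> B\<^sup>2 / r * sqrt (E (2*j+1) - 2 * E (j+k+1) + E (2*k+1))"
    if xy: "x \<in> space M" "y \<in> space M" for j k x y
  proof -
    have "kcomp (\<lambda>x y. H j x y - H k x y) K z y = kcomp (H j) K z y - kcomp (H k) K z y" if z: "z \<in> space M" for z
      unfolding kcomp_def left_diff_distrib
      by (intro Bochner_Integration.integral_diff bfun_integrable bfun_mult bker_slice1[OF H_b z] bker_slice2[OF K(1) xy(2)])
    then have "kcomp K (kcomp (\<lambda>x y. H j x y - H k x y) K) x y = (\<integral>z. K x z * kcomp (H j) K z y - K x z * kcomp (H k) K z y \<partial>M)"
      unfolding kcomp_def[of K] by (intro Bochner_Integration.integral_cong) (auto simp: right_diff_distrib)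
    also have "\<dots> = r * H (Suc j) x y - r * H (Suc k) x y"
      unfolding HS[OF xy] kcomp_def[of K]
      by (intro Bochner_Integration.integral_diff bfun_integrable bfun_mult bker_slice1[OF K(1) xy(1)] bker_slice2[OF bker_kcomp[OF H_b K(1)] xy(2)])
    finally have "r * \<bar>H (Suc j) x y - H (Suc k) x y\<bar> = \<bar>kcomp K (kcomp (\<lambda>x y. H j x y - H k x y) K) x y\<bar>"
      using r by (simp add: abs_mult flip: right_diff_distrib)
    also have "\<dots> \<le> B\<^sup>2 * sqrt (E (2*j+1) - 2 * E (j+k+1) + E (2*k+1))"
      using sand[OF bker_diff[OF H_b[of j] H_b[of k]] xy] by (simp add: kD)
    finally show ?thesis using r by (simp add: field_simps)
  qed
  have Hbd: "\<bar>H (Suc j) x y\<bar> \<le> B\<^sup>2 / r * sqrt (E 0)" if xy: "x \<in> space M" "y \<in> space M" for j x y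
  proof -
    have "r * \<bar>H (Suc j) x y\<bar> = \<bar>kcomp K (kcomp (H j) K) x y\<bar>" using HS[OF xy] r by (metis abs_mult abs_of_pos)
    also have "\<dots> \<le> B\<^sup>2 * sqrt (kinner (H j) (H j))" by (rule sand[OF H_b xy])
    also have "\<dots> \<le> B\<^sup>2 * sqrt (E 0)" using decseqD[OF dE, of 0] by (intro mult_left_mono) (auto simp: kHH)
    finally show ?thesis using r by (simp add: field_simps)
  qed
  have conv: "convergent (\<lambda>j. H (Suc j) x y)" if xy: "x \<in> space M" "y \<in> space M" for x y
  proof -
    obtain L where L: "E \<longlonglongrightarrow> L" using EL by (auto simp: convergent_def)
    have "Cauchy (\<lambda>j. H (Suc j) x y)"
    proof (rule metric_CauchyI)
      fix e :: real assume e: "e > 0"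
      define d where "d = (e * r / B\<^sup>2)\<^sup>2 / 4"
      have d: "d > 0" using e r B(1) by (simp add: d_def)
      obtain N where N: "\<And>n. n \<ge> N \<Longrightarrow> \<bar>E n - L\<bar> < d" using LIMSEQ_D[OF L d] by auto
      have "dist (H (Suc j) x y) (H (Suc k) x y) < e" if jk: "j \<ge> N" "k \<ge> N" for j k
      proof -
        have "E (2*j+1) - 2 * E (j+k+1) + E (2*k+1) < 4 * d"
          using N[of "2*j+1"] N[of "j+k+1"] N[of "2*k+1"] jk by (auto simp: abs_less_iff)
        then have "sqrt (E (2*j+1) - 2 * E (j+k+1) + E (2*k+1)) < sqrt (4 * d)" by simp
        also have "\<dots> = e * r / B\<^sup>2" using e r by (simp add: d_def)
        finally have "B\<^sup>2 / r * sqrt (E (2*j+1) - 2 * E (j+k+1) + E (2*k+1)) < B\<^sup>2 / r * (e * r / B\<^sup>2)"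
          using B(1) r by (intro mult_strict_left_mono) auto
        also have "\<dots> = e" using B(1) r by simp
        finally show ?thesis using Hdiff[OF xy, of j k] by (simp add: dist_real_def)
      qed
      then show "\<exists>N. \<forall>m\<ge>N. \<forall>n\<ge>N. dist (H (Suc m) x y) (H (Suc n) x y) < e" by blast
    qed
    then show ?thesis by (simp add: Cauchy_convergent_iff)
  qed
  define G where "G = (\<lambda>x y. lim (\<lambda>j. H (Suc j) x y))"
  have Glim: "(\<lambda>j. H (Suc j) x y) \<longlonglongrightarrow> G x y" if "x \<in> space M" "y \<in> space M" for x y
    using conv[OF that] by (simp add: G_def convergent_LIMSEQ_iff)
  define C where "C = B\<^sup>2 / r * sqrt (E 0)"
  have HC: "\<bar>H (Suc j) x y\<bar> \<le> C" if "x \<in> space M" "y \<in> space M" for j x y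
    using Hbd[OF that] by (simp only: C_def)
  have GC: "\<bar>G x y\<bar> \<le> C" if "x \<in> space M" "y \<in> space M" for x y
    using tendsto_le[OF _ tendsto_const tendsto_rabs[OF Glim[OF that]], of C] HC[OF that] by simp
  have sqC: "h * h \<le> C\<^sup>2" if "\<bar>h\<bar> \<le> C" for h
    using that abs_le_square_iff[of h C] by (simp add: power2_eq_square)
  have G_b: "bker G"
  proof (rule bkerI[OF _ GC])
    show "(\<lambda>(x, y). G x y) \<in> borel_measurable (M \<Otimes>\<^sub>M M)"
    proof (rule borel_measurable_LIMSEQ_real)
      show "(\<lambda>(x, y). H (Suc j) x y) \<in> borel_measurable (M \<Otimes>\<^sub>M M)" for j by (rule bker_measurable[OF H_b])
    qed (auto simp: space_pair_measure intro: Glim)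
  qed
  have KG: "(\<lambda>j. kcomp K (H (Suc j)) x y) \<longlonglongrightarrow> kcomp K G x y" if xy: "x \<in> space M" "y \<in> space M" for x y
    unfolding kcomp_def
  proof (rule integral_dominated_convergence[where w = "\<lambda>_. B * C"])
    show "AE z in M. (\<lambda>j. K x z * H (Suc j) z y) \<longlonglongrightarrow> K x z * G z y"
      by (intro AE_I2 tendsto_mult tendsto_const Glim xy)
    show "AE z in M. norm (K x z * H (Suc j) z y) \<le> B * C" for j
      using B HC xy by (intro AE_I2) (auto simp: abs_mult intro!: mult_mono)
  qed (auto intro!: bfun_measurable bfun_mult bker_slice1[OF K(1) xy(1)] bker_slice2[OF H_b xy(2)] bker_slice2[OF G_b xy(2)])
  have HK: "\<bar>kcomp K (H (Suc j)) x y\<bar> \<le> B * C" if xy: "x \<in> space M" "y \<in> space M" for j x y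
  proof -
    have "\<bar>kcomp K (H (Suc j)) x y\<bar> \<le> (\<integral>z. \<bar>K x z * H (Suc j) z y\<bar> \<partial>M)" unfolding kcomp_def by (rule integral_abs_bound)
    also have "\<dots> \<le> (\<integral>z. B * C \<partial>M)" using B HC xy
      by (intro integral_mono bfun_integrable bfun_abs bfun_mult bfun_const bker_slice1[OF K(1) xy(1)] bker_slice2[OF H_b xy(2)])
         (auto simp: abs_mult intro!: mult_mono)
    finally show ?thesis by (simp add: prob_space)
  qed
  have KKG: "(\<lambda>j. kcomp K (kcomp K (H (Suc j))) x y) \<longlonglongrightarrow> kcomp K (kcomp K G) x y" if xy: "x \<in> space M" "y \<in> space M" for x y
    unfolding kcomp_def[of K "kcomp K _"]
  proof (rule integral_dominated_convergence[where w = "\<lambda>_. B * (B * C)"])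
    show "AE z in M. (\<lambda>j. K x z * kcomp K (H (Suc j)) z y) \<longlonglongrightarrow> K x z * kcomp K G z y"
      by (intro AE_I2 tendsto_mult tendsto_const KG xy)
    show "AE z in M. norm (K x z * kcomp K (H (Suc j)) z y) \<le> B * (B * C)" for j
      using B HK xy by (intro AE_I2) (auto simp: abs_mult intro!: mult_mono)
  qed (auto intro!: bfun_measurable bfun_mult bker_slice1[OF K(1) xy(1)] bker_slice2[OF bker_kcomp[OF K(1) H_b] xy(2)] bker_slice2[OF bker_kcomp[OF K(1) G_b] xy(2)])
  have G_eig: "kcomp K (kcomp K G) x y = r * G x y" if xy: "x \<in> space M" "y \<in> space M" for x y
  proof -
    have "(\<lambda>j. r * H (Suc (Suc j)) x y) \<longlonglongrightarrow> r * G x y"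
      using LIMSEQ_Suc[OF Glim[OF xy]] by (rule tendsto_mult_left)
    then show ?thesis using KKG[OF xy] by (simp add: HS2[OF xy] LIMSEQ_unique)
  qed
  have "(\<lambda>j. kinner (H (Suc j)) (H (Suc j))) \<longlonglongrightarrow> kinner G G"
    unfolding kinner_slices
  proof (rule integral_dominated_convergence[where w = "\<lambda>_. C\<^sup>2"])
    show "AE y in M. (\<lambda>j. inner2 (\<lambda>x. H (Suc j) x y) (\<lambda>x. H (Suc j) x y)) \<longlonglongrightarrow> inner2 (\<lambda>x. G x y) (\<lambda>x. G x y)"
    proof (rule AE_I2)
      fix y assume y: "y \<in> space M"
      show "(\<lambda>j. inner2 (\<lambda>x. H (Suc j) x y) (\<lambda>x. H (Suc j) x y)) \<longlonglongrightarrow> inner2 (\<lambda>x. G x y) (\<lambda>x. G x y)"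
        unfolding inner2_def
      proof (rule integral_dominated_convergence[where w = "\<lambda>_. C\<^sup>2"])
        show "AE x in M. (\<lambda>j. H (Suc j) x y * H (Suc j) x y) \<longlonglongrightarrow> G x y * G x y"
          by (intro AE_I2 tendsto_mult Glim y)
        show "AE x in M. norm (H (Suc j) x y * H (Suc j) x y) \<le> C\<^sup>2" for j
          using HC[OF _ y] by (intro AE_I2) (simp add: sqC)
      qed (auto intro!: bfun_measurable bfun_mult bker_slice2[OF H_b y] bker_slice2[OF G_b y])
    qed
    show "AE y in M. norm (inner2 (\<lambda>x. H (Suc j) x y) (\<lambda>x. H (Suc j) x y)) \<le> C\<^sup>2" for j
    proof (rule AE_I2)
      fix y assume y: "y \<in> space M"
      have "inner2 (\<lambda>x. H (Suc j) x y) (\<lambda>x. H (Suc j) x y) \<le> (\<integral>x. C\<^sup>2 \<partial>M)"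
        unfolding inner2_def using HC[OF _ y]
        by (intro integral_mono bfun_integrable bfun_mult bfun_const bker_slice2[OF H_b y])
           (simp add: sqC)
      then show "norm (inner2 (\<lambda>x. H (Suc j) x y) (\<lambda>x. H (Suc j) x y)) \<le> C\<^sup>2" by (simp add: prob_space)
    qed
  qed (auto intro!: bfun_measurable bker_inner_slices H_b G_b)
  then have G1: "1 \<le> kinner G G"
    by (rule LIMSEQ_le_const) (use E1 kHH in \<open>auto intro!: exI[of _ 0]\<close>)
  have "\<exists>y\<in>space M. inner2 (\<lambda>x. G x y) (\<lambda>x. G x y) \<noteq> 0"
  proof (rule ccontr)
    assume "\<not> ?thesis"
    then have "kinner G G = (\<integral>y. 0 \<partial>M)" unfolding kinner_slices
      by (intro Bochner_Integration.integral_cong) auto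
    then show False using G1 by simp
  qed
  then obtain y where y: "y \<in> space M" "inner2 (\<lambda>x. G x y) (\<lambda>x. G x y) \<noteq> 0" by blast
  define f where "f = (\<lambda>x. G x y)"
  have f: "bfun f" unfolding f_def by (rule bker_slice2[OF G_b y(1)])
  have f2: "kop K (kop K f) x = r * f x" if "x \<in> space M" for x
    using G_eig[OF that y(1)] by (simp add: f_def kop_def kcomp_def)
  define q where "q = sqrt r"
  have q: "q > 0" "q * q = r" using r by (auto simp: q_def)
  define g where "g = (\<lambda>x. kop K f x + q * f x)"
  have g: "bfun g" unfolding g_def by (intro bfun_add bfun_cmult bfun_kop K f)
  have ge: "eigenfun K q g"
  proof -
    have "kop K g x = q * g x" if x: "x \<in> space M" for x
      unfolding g_def kop_add[OF K(1) bfun_kop[OF K(1) f] bfun_cmult[OF f] x] f2[OF x] kop_cmult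
      using q by (simp add: algebra_simps)
    then show ?thesis using g by (simp add: eigenfun_def)
  qed
  show ?thesis
  proof (cases "inner2 g g = 0")
    case False
    have "q\<^sup>2 = opsq K" using q(2) by (simp only: power2_eq_square r_def)
    then show ?thesis by (rule that[OF ge False])
  next
    case True
    then have "AE x in M. g x = 0" by (rule iffD1[OF inner2_self_eq_0_iff[OF g]])
    then have "AE x in M. kop K f x = (- q) * f x"
      unfolding g_def by eventually_elim linarith
    moreover have "- q \<noteq> 0" using q(1) by simp
    ultimately obtain f' where f': "eigenfun K (- q) f'" "AE x in M. f' x = f x"
      using eigenfun_of_AE[OF K(1) _ bfun_measurable[OF f] bfun_integrable[OF f]] by blast
    have "inner2 f' f' \<noteq> 0"
    proof
      assume "inner2 f' f' = 0"
      then have "AE x in M. f x = 0" using f' by (auto simp: eigenfun_def inner2_self_eq_0_iff)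
      then show False using y(2) f by (simp add: f_def inner2_self_eq_0_iff)
    qed
    moreover have "(- q)\<^sup>2 = opsq K" using q(2) by (simp only: power2_minus power2_eq_square[of q] r_def)
    ultimately show ?thesis using that[OF f'(1)] by blast
  qed
qed

end

section \<open>The trace formula\<close>

text \<open>Weak convergence to 0 of a family that is bounded in \<open>L\<^sup>2\<close> can be
  tested on a generator: the tested sets form a Dynkin system (the tails of a countable union are
  controlled by Cauchy--Schwarz), and bounded functions are uniform limits of step
  functions.\<close>

lemma (in prob_space) weak_null_of_generator:
  fixes r :: "'i \<Rightarrow> 'a \<Rightarrow> real"
  assumes G: "Int_stable G" "G \<subseteq> Pow (space M)" "sets M = sigma_sets (space M) G" "space M \<in> G"
    and r [measurable]: "\<And>i. r i \<in> borel_measurable M"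
    and r2: "\<And>i. integrable M (\<lambda>x. (r i x)\<^sup>2)" and C: "\<And>i. (\<integral>x. (r i x)\<^sup>2 \<partial>M) \<le> C"
    and gen: "\<And>A. A \<in> G \<Longrightarrow> ((\<lambda>i. \<integral>x. r i x * indicator A x \<partial>M) \<longlongrightarrow> 0) Fl"
    and k [measurable]: "k \<in> borel_measurable M" and kB: "\<And>x. x \<in> space M \<Longrightarrow> \<bar>k x\<bar> \<le> B"
  shows "((\<lambda>i. \<integral>x. r i x * k x \<partial>M) \<longlongrightarrow> 0) Fl"
proof -
  have ri: "integrable M (r i)" for i using square_integrable_imp_integrable[OF r r2] .
  have i1: "integrable M (\<lambda>x. r i x * g x)" if g: "g \<in> borel_measurable M" "\<And>x. x \<in> space M \<Longrightarrow> \<bar>g x\<bar> \<le> c" for i g c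
  proof (rule Bochner_Integration.integrable_bound)
    show "integrable M (\<lambda>x. c * r i x)" using ri by simp
    show "AE x in M. norm (r i x * g x) \<le> norm (c * r i x)"
      using g(2) by (intro AE_I2) (auto simp: abs_mult mult.commute[of c] intro!: mult_left_mono intro: order.trans[OF _ abs_ge_self])
  qed (use g(1) in simp)
  have C0: "0 \<le> C" using C[of undefined] by (meson order.trans Bochner_Integration.integral_nonneg zero_le_power2)
  have sets: "((\<lambda>i. \<integral>x. r i x * indicator A x \<partial>M) \<longlongrightarrow> 0) Fl" if A: "A \<in> sets M" for A
    using G(1,2) A[unfolded G(3)]
  proof (induction rule: sigma_sets_induct_disjoint)
    case (basic A) then show ?case by (rule gen)
  next
    case empty then show ?case by simp
  next
    case (compl A)
    then have [measurable]: "A \<in> sets M" using G(3) by simp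
    have "(\<integral>x. r i x * indicator (space M - A) x \<partial>M) = (\<integral>x. r i x * indicator (space M) x \<partial>M) - (\<integral>x. r i x * indicator A x \<partial>M)" for i
    proof -
      have "(\<integral>x. r i x * indicator (space M - A) x \<partial>M) = (\<integral>x. r i x * indicator (space M) x - r i x * indicator A x \<partial>M)"
        by (intro Bochner_Integration.integral_cong) (auto simp: indicator_def)
      also have "\<dots> = (\<integral>x. r i x * indicator (space M) x \<partial>M) - (\<integral>x. r i x * indicator A x \<partial>M)"
        by (intro Bochner_Integration.integral_diff i1[of _ 1]) (auto simp: indicator_def)
      finally show ?thesis .
    qed
    then show ?case using tendsto_diff[OF gen[OF G(4)] compl.IH] by simp
  next
    case (union A)
    have Am [measurable]: "A i \<in> sets M" for i using union(2) G(3) by auto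
    have fin: "((\<lambda>i. \<integral>x. r i x * indicator (\<Union>j<n. A j) x \<partial>M) \<longlongrightarrow> 0) Fl" for n
    proof (induction n)
      case (Suc n)
      have dis: "(\<Union>j<n. A j) \<inter> A n = {}" proof -
        have "A j \<inter> A n = {}" if "j < n" for j using union(1) that by (auto simp: disjoint_family_on_def)
        then show ?thesis by blast
      qed
      have "(\<integral>x. r i x * indicator (\<Union>j<Suc n. A j) x \<partial>M) = (\<integral>x. r i x * indicator (\<Union>j<n. A j) x \<partial>M) + (\<integral>x. r i x * indicator (A n) x \<partial>M)" for i
      proof -
        have "(\<integral>x. r i x * indicator (\<Union>j<Suc n. A j) x \<partial>M) = (\<integral>x. r i x * indicator (\<Union>j<n. A j) x + r i x * indicator (A n) x \<partial>M)"
          using dis by (intro Bochner_Integration.integral_cong) (auto simp: indicator_def lessThan_Suc)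
        also have "\<dots> = (\<integral>x. r i x * indicator (\<Union>j<n. A j) x \<partial>M) + (\<integral>x. r i x * indicator (A n) x \<partial>M)"
          by (intro Bochner_Integration.integral_add i1[of _ 1]) (auto simp: indicator_def)
        finally show ?thesis .
      qed
      then show ?case using tendsto_add[OF Suc union.IH[of n]] by simp
    qed simp
    show ?case
    proof (rule tendstoI)
      fix e :: real assume e: "e > 0"
      let ?U = "\<Union>i. A i"
      have "(\<lambda>n. prob (\<Union>j<n. A j)) \<longlonglongrightarrow> prob (\<Union>n. \<Union>j<n. A j)"
        by (rule finite_Lim_measure_incseq) (auto simp: incseq_def intro: less_le_trans)
      also have "(\<Union>n. \<Union>j<n. A j) = ?U" by auto
      finally have "(\<lambda>n. prob ?U - prob (\<Union>j<n. A j)) \<longlonglongrightarrow> prob ?U - prob ?U" by (intro tendsto_diff tendsto_const)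
      then have "(\<lambda>n. prob ?U - prob (\<Union>j<n. A j)) \<longlonglongrightarrow> 0" by simp
      then have "(\<lambda>n. C * (prob ?U - prob (\<Union>j<n. A j))) \<longlonglongrightarrow> C * 0" by (rule tendsto_mult_left)
      then have "eventually (\<lambda>n. C * (prob ?U - prob (\<Union>j<n. A j)) < (e/2)\<^sup>2) sequentially"
        using e by (intro order_tendstoD) auto
      then obtain n where n: "C * (prob ?U - prob (\<Union>j<n. A j)) < (e/2)\<^sup>2" by (auto simp: eventually_sequentially)
      let ?D = "?U - (\<Union>j<n. A j)"
      have Dp: "prob ?D = prob ?U - prob (\<Union>j<n. A j)" by (rule finite_measure_Diff) auto
      have tail: "\<bar>\<integral>x. r i x * indicator ?D x \<partial>M\<bar> \<le> e / 2" for i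
      proof -
        have "(\<integral>x. r i x * indicator ?D x \<partial>M)\<^sup>2 \<le> (\<integral>x. (r i x)\<^sup>2 \<partial>M) * (\<integral>x. (indicator ?D x)\<^sup>2 \<partial>M)"
        proof (rule integral_Cauchy_Schwarz[OF _ _ r2])
          show "integrable M (\<lambda>x. (indicator ?D x :: real)\<^sup>2)"
            by (rule integrable_const_bound[where B = 1]) (auto simp: indicator_def)
        qed auto
        also have "(\<integral>x. (indicator ?D x)\<^sup>2 \<partial>M) = prob ?D"
          by (simp add: power2_eq_square indicator_inter_arith[symmetric] Int_absorb1 sets.sets_into_space)
        also have "(\<integral>x. (r i x)\<^sup>2 \<partial>M) * prob ?D \<le> C * prob ?D" by (intro mult_right_mono C) simp
        also have "\<dots> \<le> (e/2)\<^sup>2" using n Dp by simp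
        finally show ?thesis using e by (simp add: abs_le_square_iff[symmetric])
      qed
      have split: "(\<integral>x. r i x * indicator ?U x \<partial>M) = (\<integral>x. r i x * indicator (\<Union>j<n. A j) x \<partial>M) + (\<integral>x. r i x * indicator ?D x \<partial>M)" for i
      proof -
        have "(\<integral>x. r i x * indicator ?U x \<partial>M) = (\<integral>x. r i x * indicator (\<Union>j<n. A j) x + r i x * indicator ?D x \<partial>M)"
          by (intro Bochner_Integration.integral_cong) (auto simp: indicator_def)
        also have "\<dots> = (\<integral>x. r i x * indicator (\<Union>j<n. A j) x \<partial>M) + (\<integral>x. r i x * indicator ?D x \<partial>M)"
          by (intro Bochner_Integration.integral_add i1[of _ 1]) (auto simp: indicator_def)
        finally show ?thesis .
      qed
      have "eventually (\<lambda>i. dist (\<integral>x. r i x * indicator (\<Union>j<n. A j) x \<partial>M) 0 < e/2) Fl" using tendstoD[OF fin[of n] half_gt_zero[OF e]] .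
      then show "eventually (\<lambda>i. dist (\<integral>x. r i x * indicator ?U x \<partial>M) 0 < e) Fl"
      proof eventually_elim
        case (elim i) then show ?case using tail[of i] unfolding split by (simp add: dist_real_def) 
      qed
    qed
  qed
  show ?thesis
  proof (rule tendstoI)
    fix e :: real assume e: "e > 0"
    obtain N :: nat where N: "sqrt C / e * 2 < real N" "N > 0"
      by (metis reals_Archimedean2 less_trans of_nat_0_less_iff max_less_iff_conj gr_zeroI not_less_zero linorder_neqE_nat of_nat_less_iff zero_less_one less_one)
    define J where "J = {- \<lceil>N * \<bar>B\<bar>\<rceil> - 1 .. \<lceil>N * \<bar>B\<bar>\<rceil> + 1}"
    define s where "s = (\<lambda>x. \<Sum>j\<in>J. (real_of_int j / N) * indicator {x\<in>space M. \<lfloor>N * k x\<rfloor> = j} x)"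
    have s: "s x = \<lfloor>N * k x\<rfloor> / N" if x: "x \<in> space M" for x
    proof -
      have "\<bar>N * k x\<bar> \<le> N * \<bar>B\<bar>" using kB[OF x] by (auto simp: abs_mult intro!: mult_left_mono)
      then have "\<lfloor>N * k x\<rfloor> \<in> J" unfolding J_def by (auto; linarith)
      then have "s x = (\<Sum>j\<in>J. if j = \<lfloor>N * k x\<rfloor> then real_of_int j / N else 0)"
        unfolding s_def using x by (intro sum.cong) (auto simp: indicator_def)
      then show ?thesis using \<open>_ \<in> J\<close> by (simp add: J_def)
    qed
    have [measurable]: "s \<in> borel_measurable M" unfolding s_def by measurable
    have ks: "\<bar>k x - s x\<bar> \<le> 1 / N" if x: "x \<in> space M" for x
    proof -
      have "\<bar>N * k x - \<lfloor>N * k x\<rfloor>\<bar> \<le> 1" by linarith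
      then have "\<bar>N * k x - \<lfloor>N * k x\<rfloor>\<bar> / N \<le> 1 / N" by (simp add: divide_right_mono)
      moreover have "k x - s x = (N * k x - \<lfloor>N * k x\<rfloor>) / N"
        unfolding s[OF x] using N(2) by (simp add: diff_divide_distrib)
      then have "\<bar>N * k x - \<lfloor>N * k x\<rfloor>\<bar> / N = \<bar>k x - s x\<bar>"
        by (simp add: abs_divide)
      ultimately show ?thesis by simp
    qed
    have "((\<lambda>i. \<Sum>j\<in>J. (real_of_int j / N) * (\<integral>x. r i x * indicator {x\<in>space M. \<lfloor>N * k x\<rfloor> = j} x \<partial>M)) \<longlongrightarrow> (\<Sum>j\<in>J. (real_of_int j / N) * 0)) Fl"
      by (intro tendsto_sum tendsto_mult tendsto_const sets) measurable
    moreover have "(\<Sum>j\<in>J. (real_of_int j / N) * (\<integral>x. r i x * indicator {x\<in>space M. \<lfloor>N * k x\<rfloor> = j} x \<partial>M)) = (\<integral>x. r i x * s x \<partial>M)" for i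
    proof -
      have "(\<integral>x. r i x * s x \<partial>M) = (\<integral>x. (\<Sum>j\<in>J. (real_of_int j / N) * (r i x * indicator {x\<in>space M. \<lfloor>N * k x\<rfloor> = j} x)) \<partial>M)"
        unfolding s_def sum_distrib_left by (simp add: mult.left_commute)
      also have "\<dots> = (\<Sum>j\<in>J. \<integral>x. (real_of_int j / N) * (r i x * indicator {x\<in>space M. \<lfloor>N * k x\<rfloor> = j} x) \<partial>M)"
        by (intro Bochner_Integration.integral_sum integrable_mult_right i1[of _ 1]) (auto simp: indicator_def)
      finally show ?thesis by simp
    qed
    ultimately have lim: "((\<lambda>i. \<integral>x. r i x * s x \<partial>M) \<longlongrightarrow> 0) Fl" by simp
    have close: "\<bar>\<integral>x. r i x * (k x - s x) \<partial>M\<bar> \<le> e / 2" for i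
    proof -
      have "\<bar>\<integral>x. r i x * (k x - s x) \<partial>M\<bar> \<le> (\<integral>x. \<bar>r i x * (k x - s x)\<bar> \<partial>M)" by (rule integral_abs_bound)
      also have "\<dots> \<le> (\<integral>x. \<bar>r i x\<bar> * (1 / N) \<partial>M)"
        using ks ri[of i] by (intro integral_mono integrable_abs i1[of _ "1/N"] integrable_mult_left)
          (auto simp del: times_divide_eq_right simp: abs_mult intro!: mult_left_mono)
      also have "\<dots> = (\<integral>x. \<bar>r i x\<bar> \<partial>M) / N" by simp
      also have "\<dots> \<le> sqrt C / N"
        using order.trans[OF integral_abs_le_sqrt[OF r r2] real_sqrt_le_mono[OF C]] by (simp add: divide_right_mono)
      also have "\<dots> \<le> e / 2" using N e by (simp add: field_simps)
      finally show ?thesis .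
    qed
    have split: "(\<integral>x. r i x * k x \<partial>M) = (\<integral>x. r i x * s x \<partial>M) + (\<integral>x. r i x * (k x - s x) \<partial>M)" for i
    proof -
      have sB: "\<bar>s x\<bar> \<le> B + 1 / N" if "x \<in> space M" for x using ks[OF that] kB[OF that] by linarith
      have "(\<integral>x. r i x * k x \<partial>M) = (\<integral>x. r i x * s x + r i x * (k x - s x) \<partial>M)" by (simp add: algebra_simps)
      also have "\<dots> = (\<integral>x. r i x * s x \<partial>M) + (\<integral>x. r i x * (k x - s x) \<partial>M)"
        by (intro Bochner_Integration.integral_add i1[OF _ sB] i1[OF _ ks]) auto
      finally show ?thesis .
    qed
    have "eventually (\<lambda>i. dist (\<integral>x. r i x * s x \<partial>M) 0 < e/2) Fl" using tendstoD[OF lim half_gt_zero[OF e]] .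
    then show "eventually (\<lambda>i. dist (\<integral>x. r i x * k x \<partial>M) 0 < e) Fl"
    proof eventually_elim
      case (elim i) then show ?case using close[of i] unfolding split by (simp add: dist_real_def)
    qed
  qed
qed

context prob_space begin

definition orthonormal_on :: "'i set \<Rightarrow> ('i \<Rightarrow> 'a \<Rightarrow> real) \<Rightarrow> bool" where
  "orthonormal_on I \<phi> \<longleftrightarrow> (\<forall>i\<in>I. bfun (\<phi> i)) \<and> (\<forall>i\<in>I. \<forall>j\<in>I. inner2 (\<phi> i) (\<phi> j) = of_bool (i = j))"

text \<open>The kernel that remains after removing the rank-one parts of the eigenfunctions in
  \<open>F\<close>.\<close>

definition deflate :: "('a \<Rightarrow> 'a \<Rightarrow> real) \<Rightarrow> ('i \<Rightarrow> real) \<Rightarrow> ('i \<Rightarrow> 'a \<Rightarrow> real) \<Rightarrow> 'i set \<Rightarrow> 'a \<Rightarrow> 'a \<Rightarrow> real" where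
  "deflate K lam \<phi> F x y = K x y - (\<Sum>i\<in>F. lam i * (\<phi> i x * \<phi> i y))"

lemma kinner_Cauchy_Schwarz: assumes K: "bker K" and L: "bker L"
  shows "(kinner K L)\<^sup>2 \<le> kinner K K * kinner L L"
proof -
  have e: "kinner A B = (\<integral>p. A (fst p) (snd p) * B (fst p) (snd p) \<partial>(M \<Otimes>\<^sub>M M))" if "bker A" "bker B" for A B
    using bker_integral_pair[OF bker_mult[OF that]] by (simp add: kinner_eq_swap[OF that] split_beta')
  have i: "integrable (M \<Otimes>\<^sub>M M) (\<lambda>p. (A (fst p) (snd p))\<^sup>2)" if "bker A" for A
    using bker_integrable_pair[OF bker_mult[OF that that]] by (simp add: split_beta' power2_eq_square)
  show ?thesis unfolding e[OF K K] e[OF L L] e[OF K L]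
    using integral_Cauchy_Schwarz[OF _ _ i[OF K] i[OF L]] bker_measurable[OF K] bker_measurable[OF L]
    by (simp add: split_beta' power2_eq_square)
qed

lemma kinner_add_left: assumes "bker A" "bker B" "bker L"
  shows "kinner (\<lambda>x y. A x y + B x y) L = kinner A L + kinner B L"
proof -
  have "kinner (\<lambda>x y. A x y + B x y) L = (\<integral>y. inner2 (\<lambda>x. A x y) (\<lambda>x. L x y) + inner2 (\<lambda>x. B x y) (\<lambda>x. L x y) \<partial>M)"
    unfolding kinner_slices
    by (intro Bochner_Integration.integral_cong refl inner2_add_left bker_slice2[OF assms(1)] bker_slice2[OF assms(2)] bker_slice2[OF assms(3)])
  also have "\<dots> = kinner A L + kinner B L"
    unfolding kinner_slices by (intro Bochner_Integration.integral_add bfun_integrable bker_inner_slices assms)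
  finally show ?thesis .
qed

lemma kinner_commute: "kinner A B = kinner B A"
  unfolding kinner_def by (simp add: mult.commute)

lemma kinner_tensor_right:
  assumes K: "bker K" and f: "bfun f" and g: "bfun g"
  shows "kinner K (\<lambda>x y. f x * g y) = inner2 f (kop K g)"
proof -
  have "kinner K (\<lambda>x y. f x * g y) = (\<integral>x. (\<integral>y. K x y * (f x * g y) \<partial>M) \<partial>M)"
    by (rule kinner_eq_swap[OF K bker_tensor[OF f g]])
  also have "\<dots> = (\<integral>x. (\<integral>y. f x * (K x y * g y) \<partial>M) \<partial>M)" by (simp add: mult_ac)
  also have "\<dots> = inner2 f (kop K g)" by (simp add: inner2_def kop_def)
  finally show ?thesis .
qed

lemma kop_diff: assumes "bker K" "bfun f" "bfun g" "x \<in> space M"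
  shows "kop K (\<lambda>y. f y - g y) x = kop K f x - kop K g x"
  unfolding kop_def right_diff_distrib
  by (intro Bochner_Integration.integral_diff bfun_integrable bfun_mult bker_slice1 assms)

lemma kop_sum: assumes "bker K" "\<And>i. i \<in> F \<Longrightarrow> bfun (f i)" "x \<in> space M"
  shows "kop K (\<lambda>y. \<Sum>i\<in>F. f i y) x = (\<Sum>i\<in>F. kop K (f i) x)"
  unfolding kop_def sum_distrib_left
  by (intro Bochner_Integration.integral_sum bfun_integrable bfun_mult bker_slice1 assms)

lemma opsq_power_kinner_ge:
  assumes K: "bker K"
  shows "kinner (kpow K n) (kpow K n) \<le> opsq K ^ n * kinner K K"
proof (induction n)
  case (Suc n)
  have "kinner (kpow K (Suc n)) (kpow K (Suc n)) \<le> opsq K * kinner (kpow K n) (kpow K n)"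
    using kinner_kcomp_le[OF K bker_kpow[OF K]] by simp
  also have "\<dots> \<le> opsq K * (opsq K ^ n * kinner K K)" using Suc opsq_nonneg[OF K] by (rule mult_left_mono)
  finally show ?case by (simp add: mult_ac)
qed simp

context
  fixes K :: "'a \<Rightarrow> 'a \<Rightarrow> real" and I :: "'i set" and lam :: "'i \<Rightarrow> real" and \<phi> :: "'i \<Rightarrow> 'a \<Rightarrow> real"
  assumes K: "bker K" "ksym K"
    and eig: "\<And>i. i \<in> I \<Longrightarrow> eigenfun K (lam i) (\<phi> i)" and nz: "\<And>i. i \<in> I \<Longrightarrow> lam i \<noteq> 0"
    and on: "orthonormal_on I \<phi>"
begin

private abbreviation (input) "R \<equiv> deflate K lam \<phi>"

lemma deflate_eigenfun_bfun: "i \<in> I \<Longrightarrow> bfun (\<phi> i)"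
  using on by (simp add: orthonormal_on_def)

lemma bker_deflate: "F \<subseteq> I \<Longrightarrow> bker (R F)"
  unfolding deflate_def[abs_def]
  by (intro bker_diff K bker_sum bker_cmult bker_tensor deflate_eigenfun_bfun) auto

lemma ksym_deflate: "ksym (R F)"
  using K(2) unfolding ksym_def deflate_def by (simp add: mult_ac)

lemma kop_deflate:
  assumes F: "F \<subseteq> I" and f: "bfun f" and x: "x \<in> space M"
  shows "kop (R F) f x = kop K f x - (\<Sum>i\<in>F. lam i * \<phi> i x * inner2 (\<phi> i) f)"
proof -
  have b: "bfun (\<lambda>y. lam i * \<phi> i x * (\<phi> i y * f y))" if "i \<in> F" for i
    using F that by (intro bfun_cmult bfun_mult f deflate_eigenfun_bfun) auto
  have "kop (R F) f x = (\<integral>y. K x y * f y - (\<Sum>i\<in>F. lam i * \<phi> i x * (\<phi> i y * f y)) \<partial>M)"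
    unfolding kop_def deflate_def by (simp add: left_diff_distrib sum_distrib_right mult.assoc)
  also have "\<dots> = kop K f x - (\<integral>y. (\<Sum>i\<in>F. lam i * \<phi> i x * (\<phi> i y * f y)) \<partial>M)"
    unfolding kop_def
    by (intro Bochner_Integration.integral_diff bfun_integrable[OF bfun_mult[OF bker_slice1[OF K(1) x] f]] bfun_integrable[OF bfun_sum[OF b]])
  also have "(\<integral>y. (\<Sum>i\<in>F. lam i * \<phi> i x * (\<phi> i y * f y)) \<partial>M) = (\<Sum>i\<in>F. \<integral>y. lam i * \<phi> i x * (\<phi> i y * f y) \<partial>M)"
    using b by (intro Bochner_Integration.integral_sum bfun_integrable) auto
  finally show ?thesis by (simp add: inner2_def)
qed

lemma kop_deflate_eigenfun:
  assumes F: "finite F" "F \<subseteq> I" and j: "j \<in> F" and x: "x \<in> space M"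
  shows "kop (R F) (\<phi> j) x = 0"
proof -
  have "(\<Sum>i\<in>F. lam i * \<phi> i x * inner2 (\<phi> i) (\<phi> j)) = (\<Sum>i\<in>F. if i = j then lam j * \<phi> j x else 0)"
  proof (rule sum.cong[OF refl])
    fix i assume "i \<in> F"
    then have "inner2 (\<phi> i) (\<phi> j) = of_bool (i = j)" using on F j unfolding orthonormal_on_def by blast
    then show "lam i * \<phi> i x * inner2 (\<phi> i) (\<phi> j) = (if i = j then lam j * \<phi> j x else 0)" by simp
  qed
  also have "\<dots> = kop K (\<phi> j) x" using F j x eig[of j] by (auto simp: eigenfun_def)
  finally show ?thesis using kop_deflate[OF F(2) deflate_eigenfun_bfun x, of j] F j by auto
qed

lemma inner2_kpow_deflate:
  assumes F: "finite F" "F \<subseteq> I" and j: "j \<in> F" and y: "y \<in> space M"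
  shows "inner2 (\<phi> j) (\<lambda>z. kpow (R F) m z y) = 0"
proof (cases m)
  case 0
  have "inner2 (\<phi> j) (\<lambda>z. R F z y) = kop (R F) (\<phi> j) y"
    unfolding inner2_def kop_def using ksym_deflate[of F] y
    by (intro Bochner_Integration.integral_cong) (auto simp: ksym_def)
  then show ?thesis using kop_deflate_eigenfun[OF F j y] 0 by simp
next
  case (Suc n)
  note b = bker_deflate[OF F(2)]
  have bj: "bfun (\<phi> j)" using deflate_eigenfun_bfun F j by auto
  have "inner2 (\<phi> j) (\<lambda>z. kpow (R F) m z y) = inner2 (\<phi> j) (kop (R F) (\<lambda>z. kpow (R F) n z y))"
    unfolding Suc by (simp add: kop_slice[abs_def])
  also have "\<dots> = inner2 (kop (R F) (\<phi> j)) (\<lambda>z. kpow (R F) n z y)"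
    by (rule kop_adjoint[symmetric, OF b ksym_deflate bj bker_slice2[OF bker_kpow[OF b] y]])
  also have "\<dots> = inner2 (\<lambda>_. 0) (\<lambda>z. kpow (R F) n z y)"
    by (rule inner2_cong) (auto simp: kop_deflate_eigenfun[OF F j])
  finally show ?thesis by (simp add: inner2_def)
qed

lemma kpow_deflate:
  assumes F: "finite F" "F \<subseteq> I" and xy: "x \<in> space M" "y \<in> space M"
  shows "kpow (R F) m x y = kpow K m x y - (\<Sum>i\<in>F. lam i ^ Suc m * (\<phi> i x * \<phi> i y))"
  using xy(1)
proof (induction m arbitrary: x)
  case (Suc m)
  note b = bker_deflate[OF F(2)]
  have bi: "bfun (\<lambda>z. lam i ^ Suc m * \<phi> i y * \<phi> i z)" if "i \<in> F" for i
    using F that by (intro bfun_cmult deflate_eigenfun_bfun) auto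
  have "kpow (R F) (Suc m) x y = kop (R F) (\<lambda>z. kpow (R F) m z y) x" by (simp add: kop_slice)
  also have "\<dots> = kop K (\<lambda>z. kpow (R F) m z y) x"
    unfolding kop_deflate[OF F(2) bker_slice2[OF bker_kpow[OF b] xy(2)] Suc.prems]
    using inner2_kpow_deflate[OF F _ xy(2)] by simp
  also have "\<dots> = kop K (\<lambda>z. kpow K m z y - (\<Sum>i\<in>F. lam i ^ Suc m * \<phi> i y * \<phi> i z)) x"
    using Suc.IH by (intro kop_cong) (simp add: mult_ac)
  also have "\<dots> = kop K (\<lambda>z. kpow K m z y) x - kop K (\<lambda>z. \<Sum>i\<in>F. lam i ^ Suc m * \<phi> i y * \<phi> i z) x"
    by (rule kop_diff[OF K(1) bker_slice2[OF bker_kpow[OF K(1)] xy(2)] bfun_sum[OF bi] Suc.prems])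
  also have "kop K (\<lambda>z. \<Sum>i\<in>F. lam i ^ Suc m * \<phi> i y * \<phi> i z) x = (\<Sum>i\<in>F. kop K (\<lambda>z. lam i ^ Suc m * \<phi> i y * \<phi> i z) x)"
    by (rule kop_sum[OF K(1) bi Suc.prems])
  also have "\<dots> = (\<Sum>i\<in>F. lam i ^ Suc (Suc m) * (\<phi> i x * \<phi> i y))"
    using eig F Suc.prems by (intro sum.cong) (auto simp: kop_cmult eigenfun_def)
  finally show ?case by (simp add: kop_slice)
qed (simp add: deflate_def)

text \<open>The rank-one parts are orthogonal to each other and to the remainder, so traces of
  powers split.\<close>

lemma kinner_deflate:
  assumes F: "finite F" "F \<subseteq> I"
  shows "kinner (R F) (kpow (R F) m) = kinner K (kpow K m) - (\<Sum>i\<in>F. lam i ^ (m + 2))"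
proof -
  have b: "bfun (\<phi> i)" if "i \<in> F" for i using F deflate_eigenfun_bfun that by auto
  have "kinner (R F) (kpow (R F) m) = (\<integral>x. kpow (R F) (Suc m) x x \<partial>M)"
    by (rule kinner_kpow_trace[OF bker_deflate[OF F(2)] ksym_deflate])
  also have "\<dots> = (\<integral>x. kpow K (Suc m) x x - (\<Sum>i\<in>F. lam i ^ Suc (Suc m) * (\<phi> i x * \<phi> i x)) \<partial>M)"
    using kpow_deflate[OF F] by (intro Bochner_Integration.integral_cong[OF refl]) (simp only:)
  also have "\<dots> = (\<integral>x. kpow K (Suc m) x x \<partial>M) - (\<integral>x. (\<Sum>i\<in>F. lam i ^ Suc (Suc m) * (\<phi> i x * \<phi> i x)) \<partial>M)"
  proof (rule Bochner_Integration.integral_diff)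
    obtain B where "\<And>x y. x \<in> space M \<Longrightarrow> y \<in> space M \<Longrightarrow> \<bar>kpow K (Suc m) x y\<bar> \<le> B"
      using bker_bound[OF bker_kpow[OF K(1)]] by metis
    moreover have "(\<lambda>x. kpow K (Suc m) x x) \<in> borel_measurable M"
      using measurable_compose[OF _ bker_measurable[OF bker_kpow[OF K(1), of "Suc m"]], of "\<lambda>x. (x, x)" M] by simp
    ultimately show "integrable M (\<lambda>x. kpow K (Suc m) x x)" by (intro bfun_integrable bfunI[of _ B])
    show "integrable M (\<lambda>x. \<Sum>i\<in>F. lam i ^ Suc (Suc m) * (\<phi> i x * \<phi> i x))"
      using b by (intro bfun_integrable bfun_sum bfun_cmult bfun_mult) auto
  qed
  also have "(\<integral>x. (\<Sum>i\<in>F. lam i ^ Suc (Suc m) * (\<phi> i x * \<phi> i x)) \<partial>M) = (\<Sum>i\<in>F. \<integral>x. lam i ^ Suc (Suc m) * (\<phi> i x * \<phi> i x) \<partial>M)"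
    using b by (intro Bochner_Integration.integral_sum bfun_integrable bfun_cmult bfun_mult) auto
  also have "\<dots> = (\<Sum>i\<in>F. lam i ^ (m + 2))"
    using on F by (intro sum.cong) (auto simp: orthonormal_on_def inner2_def simp del: power_Suc)
  finally show ?thesis by (simp add: kinner_kpow_trace[OF K])
qed

text \<open>Bessel's inequality for the tensors \<open>\<phi> i x * \<phi> i y\<close>.\<close>

lemma eigenvalue_Bessel:
  assumes F: "finite F" "F \<subseteq> I"
  shows "(\<Sum>i\<in>F. (lam i)\<^sup>2) \<le> kinner K K"
  using kinner_deflate[OF F, of 0] kinner_nonneg[of "R F"] by (simp add: numeral_2_eq_2)

lemma kinner_deflate_le:
  assumes F: "finite F" "F \<subseteq> I" shows "kinner (R F) (R F) \<le> kinner K K"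
  using kinner_deflate[OF F, of 0] sum_nonneg[of F "\<lambda>i. (lam i)\<^sup>2"] by (simp add: numeral_2_eq_2)

lemma finite_large_eigenvalues: assumes e: "e > 0" shows "finite {i\<in>I. \<bar>lam i\<bar> \<ge> e}"
proof (rule ccontr)
  assume "infinite {i\<in>I. \<bar>lam i\<bar> \<ge> e}"
  from infinite_arbitrarily_large[OF this, of "Suc (nat \<lceil>kinner K K / e\<^sup>2\<rceil>)"]
  obtain F where F: "finite F" "F \<subseteq> {i\<in>I. \<bar>lam i\<bar> \<ge> e}" "card F = Suc (nat \<lceil>kinner K K / e\<^sup>2\<rceil>)"
    by auto
  have "real (card F) * e\<^sup>2 \<le> (\<Sum>i\<in>F. (lam i)\<^sup>2)"
    using F(2) e by (intro sum_bounded_below) (force simp: abs_le_square_iff[symmetric])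
  also have "\<dots> \<le> kinner K K" using F by (intro eigenvalue_Bessel) auto
  finally have "real (card F) \<le> kinner K K / e\<^sup>2" using e by (simp add: field_simps)
  then show False unfolding F(3) by linarith
qed

context
  assumes complete: "\<And>c f. eigenfun K c f \<Longrightarrow> c \<noteq> 0 \<Longrightarrow> (\<And>i. i \<in> I \<Longrightarrow> inner2 f (\<phi> i) = 0) \<Longrightarrow> inner2 f f = 0"
begin

text \<open>If the norm of the remainder were larger than \<open>e\<close>, the power iteration
  would give an eigenfunction of the remainder with an eigenvalue beyond \<open>e\<close>. It is
  orthogonal to the removed eigenfunctions, hence an eigenfunction of \<open>K\<close>, and
  orthogonal to the other ones as well, because their eigenvalues lie below \<open>e\<close>. This
  contradicts completeness.\<close>

lemma opsq_deflate:
  assumes F: "finite F" "F \<subseteq> I" and e: "e > 0" and large: "{i\<in>I. \<bar>lam i\<bar> \<ge> e} \<subseteq> F"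
  shows "opsq (R F) \<le> e\<^sup>2"
proof (rule ccontr)
  assume "\<not> opsq (R F) \<le> e\<^sup>2"
  then have gt: "opsq (R F) > e\<^sup>2" by simp
  note b = bker_deflate[OF F(2)]
  have "opsq (R F) > 0" using gt e by (meson less_trans zero_less_power)
  then obtain f c where f: "eigenfun (R F) c f" "inner2 f f \<noteq> 0" "c\<^sup>2 = opsq (R F)"
    using ex_eigenfun[OF b ksym_deflate] by metis
  have bf: "bfun f" using f(1) by (simp add: eigenfun_def)
  have ce: "\<bar>c\<bar> > e" using gt f(3) by (intro power_less_imp_less_base[of e 2 "\<bar>c\<bar>"]) auto
  then have c0: "c \<noteq> 0" using e by auto
  have orthF: "inner2 f (\<phi> i) = 0" if i: "i \<in> F" for i
  proof -
    have bi: "bfun (\<phi> i)" using F i deflate_eigenfun_bfun by auto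
    have "c * inner2 f (\<phi> i) = inner2 (\<lambda>x. c * f x) (\<phi> i)" by (simp add: inner2_cmult_left)
    also have "\<dots> = inner2 (kop (R F) f) (\<phi> i)" using f(1) by (intro inner2_cong) (auto simp: eigenfun_def)
    also have "\<dots> = inner2 f (kop (R F) (\<phi> i))" by (rule kop_adjoint[OF b ksym_deflate bf bi])
    also have "\<dots> = inner2 f (\<lambda>_. 0)" using kop_deflate_eigenfun[OF F i] by (intro inner2_cong) auto
    finally show ?thesis using c0 by (simp add: inner2_def)
  qed
  have ef: "eigenfun K c f"
    unfolding eigenfun_def
  proof (intro conjI ballI bf)
    fix x assume x: "x \<in> space M"
    have "kop (R F) f x = kop K f x" 
    proof -
      have "inner2 (\<phi> i) f = 0" if "i \<in> F" for i using orthF[OF that] inner2_commute[of f "\<phi> i"] by linarith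
      then show ?thesis unfolding kop_deflate[OF F(2) bf x] by simp
    qed
    then show "kop K f x = c * f x" using f(1) x by (simp add: eigenfun_def)
  qed
  have "inner2 f (\<phi> i) = 0" if i: "i \<in> I" for i
  proof (cases "i \<in> F")
    case False
    then have ne: "lam i \<noteq> c" using large i ce by auto
    have bi: "bfun (\<phi> i)" using i deflate_eigenfun_bfun by auto
    have "c * inner2 f (\<phi> i) = inner2 (\<lambda>x. c * f x) (\<phi> i)" by (simp add: inner2_cmult_left)
    also have "\<dots> = inner2 (kop K f) (\<phi> i)" using ef by (intro inner2_cong) (auto simp: eigenfun_def)
    also have "\<dots> = inner2 f (kop K (\<phi> i))" by (rule kop_adjoint[OF K bf bi])
    also have "\<dots> = inner2 f (\<lambda>x. lam i * \<phi> i x)" using eig[OF i] by (intro inner2_cong) (auto simp: eigenfun_def)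
    also have "\<dots> = lam i * inner2 f (\<phi> i)" by (rule inner2_cmult_right)
    finally show ?thesis using ne by simp
  qed (rule orthF)
  then show False using complete[OF ef c0] f(2) by blast
qed

text \<open>The operator norms of the remainders tend to 0, so their integrals over rectangles do;
  as the remainders are bounded in \<open>L\<^sup>2\<close>, they tend to 0 weakly. The remainder
  is an orthogonal projection of \<open>K\<close>, so its inner product with \<open>K\<close> is
  its own squared norm, and weak convergence becomes convergence in norm.\<close>

lemma kinner_deflate_tendsto_0:
  "((\<lambda>F. kinner (R F) (R F)) \<longlongrightarrow> 0) (finite_subsets_at_top I)"
proof -
  interpret P2: pair_prob_space M M ..
  have evF: "eventually (\<lambda>F. finite F \<and> F \<subseteq> I) (finite_subsets_at_top I)"
    by (rule eventually_finite_subsets_at_top_weakI) simp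
  have eq: "kinner (R F) K = kinner (R F) (R F)" if F: "finite F" "F \<subseteq> I" for F
  proof -
    have b: "bker (\<lambda>x y. \<Sum>i\<in>F. lam i * (\<phi> i x * \<phi> i y))"
      using F by (intro bker_sum bker_cmult bker_tensor deflate_eigenfun_bfun) auto
    have "kinner K (R F) = kinner (\<lambda>x y. R F x y + (\<Sum>i\<in>F. lam i * (\<phi> i x * \<phi> i y))) (R F)"
      by (simp add: deflate_def)
    also have "\<dots> = kinner (R F) (R F) + kinner (\<lambda>x y. \<Sum>i\<in>F. lam i * (\<phi> i x * \<phi> i y)) (R F)"
      by (rule kinner_add_left[OF bker_deflate[OF F(2)] b bker_deflate[OF F(2)]])
    also have "kinner (\<lambda>x y. \<Sum>i\<in>F. lam i * (\<phi> i x * \<phi> i y)) (R F) = (\<integral>y. 0 \<partial>M)"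
      unfolding kinner_slices
    proof (rule Bochner_Integration.integral_cong[OF refl])
      fix y assume y: "y \<in> space M"
      have "(\<lambda>x. \<Sum>i\<in>F. lam i * (\<phi> i x * \<phi> i y)) = (\<lambda>x. \<Sum>i\<in>F. (lam i * \<phi> i y) * \<phi> i x)"
        by (intro ext sum.cong) auto
      then have "inner2 (\<lambda>x. \<Sum>i\<in>F. lam i * (\<phi> i x * \<phi> i y)) (\<lambda>x. R F x y) = inner2 (\<lambda>x. \<Sum>i\<in>F. (lam i * \<phi> i y) * \<phi> i x) (\<lambda>x. R F x y)"
        by simp
      also have "\<dots> = (\<Sum>i\<in>F. inner2 (\<lambda>x. (lam i * \<phi> i y) * \<phi> i x) (\<lambda>x. R F x y))"
        using F by (intro inner2_sum_left bfun_cmult deflate_eigenfun_bfun bker_slice2[OF bker_deflate[OF F(2)] y]) auto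
      also have "\<dots> = 0" unfolding inner2_cmult_left using inner2_kpow_deflate[OF F _ y, of _ 0] by simp
      finally show "inner2 (\<lambda>x. \<Sum>i\<in>F. lam i * (\<phi> i x * \<phi> i y)) (\<lambda>x. R F x y) = 0" .
    qed
    finally show ?thesis using kinner_commute[of K "R F"] by simp
  qed
  define r where "r = (\<lambda>F p. if finite F \<and> F \<subseteq> I then R F (fst p) (snd p) else 0)"
  have rT: "r F = (\<lambda>p. R F (fst p) (snd p))" if "finite F \<and> F \<subseteq> I" for F
    using that by (simp add: r_def)
  have rF: "r F = (\<lambda>p. 0)" if "\<not> (finite F \<and> F \<subseteq> I)" for F
    unfolding r_def using that by (simp only: if_False)
  have r_int: "(\<integral>p. r F p * g p \<partial>(M \<Otimes>\<^sub>M M)) = kinner (R F) (\<lambda>x y. g (x, y))"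
    if F: "finite F" "F \<subseteq> I" and g: "bker (\<lambda>x y. g (x, y))" for F g
    using bker_integral_pair[OF bker_mult[OF bker_deflate[OF F(2)] g]] F
    by (simp add: kinner_eq_swap[OF bker_deflate[OF F(2)] g] split_beta' r_def)
  obtain B where B: "\<And>x y. x \<in> space M \<Longrightarrow> y \<in> space M \<Longrightarrow> \<bar>K x y\<bar> \<le> B" using K(1) by (metis bker_bound)
  have "((\<lambda>F. \<integral>p. r F p * K (fst p) (snd p) \<partial>(M \<Otimes>\<^sub>M M)) \<longlongrightarrow> 0) (finite_subsets_at_top I)"
  proof (rule P2.P.weak_null_of_generator[where G = "{a \<times> b | a b. a \<in> sets M \<and> b \<in> sets M}" and C = "kinner K K" and B = B])
    show "Int_stable {a \<times> b |a b. a \<in> sets M \<and> b \<in> sets M}" by (rule Int_stable_pair_measure_generator)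
    show "{a \<times> b |a b. a \<in> sets M \<and> b \<in> sets M} \<subseteq> Pow (space (M \<Otimes>\<^sub>M M))"
      by (auto simp: space_pair_measure dest: sets.sets_into_space)
    show "sets (M \<Otimes>\<^sub>M M) = sigma_sets (space (M \<Otimes>\<^sub>M M)) {a \<times> b |a b. a \<in> sets M \<and> b \<in> sets M}"
      by (simp add: sets_pair_measure space_pair_measure)
    show "space (M \<Otimes>\<^sub>M M) \<in> {a \<times> b |a b. a \<in> sets M \<and> b \<in> sets M}" by (auto simp: space_pair_measure)
    show rm: "r F \<in> borel_measurable (M \<Otimes>\<^sub>M M)" for F
    proof (cases "finite F \<and> F \<subseteq> I")
      case True
      then show ?thesis using bker_measurable[OF bker_deflate[of F]] by (simp add: rT[OF True] split_beta')
    next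
      case False
      show ?thesis unfolding rF[OF False] by simp
    qed
    show "integrable (M \<Otimes>\<^sub>M M) (\<lambda>p. (r F p)\<^sup>2)" for F
    proof (cases "finite F \<and> F \<subseteq> I")
      case True
      then show ?thesis using bker_integrable_pair[OF bker_mult[OF bker_deflate[of F] bker_deflate[of F]]]
        by (simp add: rT[OF True] split_beta' power2_eq_square)
    next
      case False
      show ?thesis unfolding rF[OF False] by simp
    qed
    show "(\<integral>p. (r F p)\<^sup>2 \<partial>(M \<Otimes>\<^sub>M M)) \<le> kinner K K" for F
    proof (cases "finite F \<and> F \<subseteq> I")
      case True
      then have "(\<integral>p. (r F p)\<^sup>2 \<partial>(M \<Otimes>\<^sub>M M)) = (\<integral>p. r F p * R F (fst p) (snd p) \<partial>(M \<Otimes>\<^sub>M M))"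
        by (simp add: rT power2_eq_square)
      also have "\<dots> = kinner (R F) (R F)" using True r_int[of F "\<lambda>p. R F (fst p) (snd p)"] bker_deflate by simp
      finally show ?thesis using kinner_deflate_le True by simp
    next
      case False
      then show ?thesis by (simp only: rF[OF False]) (simp add: kinner_nonneg)
    qed
    show "(\<lambda>p. K (fst p) (snd p)) \<in> borel_measurable (M \<Otimes>\<^sub>M M)" using bker_measurable[OF K(1)] by (simp add: split_beta')
    show "\<bar>K (fst p) (snd p)\<bar> \<le> B" if "p \<in> space (M \<Otimes>\<^sub>M M)" for p using B that by (auto simp: space_pair_measure)
    fix A assume "A \<in> {a \<times> b |a b. a \<in> sets M \<and> b \<in> sets M}"
    then obtain a b where A: "A = a \<times> b" and [measurable]: "a \<in> sets M" "b \<in> sets M" by blast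
    have ba: "bfun (indicator a)" "bfun (indicator b)" by (auto intro!: bfunI[of _ 1] simp: indicator_def)
    have n1: "inner2 (indicator s) (indicator s) \<le> 1" if [measurable]: "s \<in> sets M" for s
    proof -
      have "inner2 (indicator s) (indicator s) = (\<integral>x. indicator s x \<partial>M)" unfolding inner2_def
        by (intro Bochner_Integration.integral_cong) (auto simp: indicator_def)
      then show ?thesis by simp
    qed
    have bd: "\<bar>\<integral>p. r F p * indicator A p \<partial>(M \<Otimes>\<^sub>M M)\<bar> \<le> sqrt (opsq (R F))" if F: "finite F" "F \<subseteq> I" for F
    proof -
      note bR = bker_deflate[OF F(2)]
      have ind: "(\<lambda>x y. indicator A (x, y)) = (\<lambda>x y. indicator a x * indicator b y :: real)"
        unfolding A by (intro ext) (simp add: indicator_times)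
      have "(\<integral>p. r F p * indicator A p \<partial>(M \<Otimes>\<^sub>M M)) = inner2 (indicator a) (kop (R F) (indicator b))"
        using r_int[OF F, of "indicator A"] unfolding ind by (simp add: bker_tensor ba kinner_tensor_right[OF bR ba])
      moreover have "(inner2 (indicator a) (kop (R F) (indicator b)))\<^sup>2 \<le> inner2 (indicator a) (indicator a) * inner2 (kop (R F) (indicator b)) (kop (R F) (indicator b))"
        by (rule inner2_Cauchy_Schwarz[OF ba(1) bfun_kop[OF bR ba(2)]])
      moreover have "\<dots> \<le> 1 * opsq (R F)"
        by (intro mult_mono n1 opsq_upper[OF bR ba(2)]) auto
      ultimately show ?thesis by (intro real_le_rsqrt) simp
    qed
    show "((\<lambda>F. \<integral>p. r F p * indicator A p \<partial>(M \<Otimes>\<^sub>M M)) \<longlongrightarrow> 0) (finite_subsets_at_top I)"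
    proof (rule tendstoI)
      fix e :: real assume e: "e > 0"
      have "\<exists>X. finite X \<and> X \<subseteq> I \<and> (\<forall>Y. finite Y \<and> X \<subseteq> Y \<and> Y \<subseteq> I \<longrightarrow> dist (\<integral>p. r Y p * indicator A p \<partial>(M \<Otimes>\<^sub>M M)) 0 < e)"
      proof (intro exI[of _ "{i\<in>I. \<bar>lam i\<bar> \<ge> e/2}"] conjI allI impI)
        fix Y assume Y: "finite Y \<and> {i\<in>I. \<bar>lam i\<bar> \<ge> e/2} \<subseteq> Y \<and> Y \<subseteq> I"
        then have Y': "finite Y" "Y \<subseteq> I" "{i\<in>I. \<bar>lam i\<bar> \<ge> e/2} \<subseteq> Y" by blast+
        have "opsq (R Y) \<le> (e/2)\<^sup>2" by (rule opsq_deflate[OF Y'(1,2) half_gt_zero[OF e] Y'(3)])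
        then have "sqrt (opsq (R Y)) \<le> e/2" by (rule real_le_lsqrt[rotated]) (use e in simp)
        then have "\<bar>\<integral>p. r Y p * indicator A p \<partial>(M \<Otimes>\<^sub>M M)\<bar> < e" using bd[OF Y'(1,2)] e by linarith
        then show "dist (\<integral>p. r Y p * indicator A p \<partial>(M \<Otimes>\<^sub>M M)) 0 < e" by (simp only: dist_real_def diff_0_right)
      next
        show "finite {i\<in>I. \<bar>lam i\<bar> \<ge> e/2}" by (rule finite_large_eigenvalues[OF half_gt_zero[OF e]])
      qed blast
      then show "eventually (\<lambda>F. dist (\<integral>p. r F p * indicator A p \<partial>(M \<Otimes>\<^sub>M M)) 0 < e) (finite_subsets_at_top I)"
        unfolding eventually_finite_subsets_at_top by blast
    qed
  qed
  then show ?thesis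
  proof (rule Lim_transform_eventually)
    show "eventually (\<lambda>F. (\<integral>p. r F p * K (fst p) (snd p) \<partial>(M \<Otimes>\<^sub>M M)) = kinner (R F) (R F)) (finite_subsets_at_top I)"
      using evF
    proof eventually_elim
      case (elim F)
      then show ?case using r_int[of F "\<lambda>p. K (fst p) (snd p)"] K(1) eq by simp
    qed
  qed
qed

text \<open>For \<open>m = 0\<close> this is the convergence of the remainders in Hilbert--Schmidt
  norm; higher powers follow from it by Cauchy--Schwarz.\<close>

theorem trace_formula: "((\<lambda>i. lam i ^ (m + 2)) has_sum kinner K (kpow K m)) I"
proof -
  have evF: "eventually (\<lambda>F. finite F \<and> F \<subseteq> I) (finite_subsets_at_top I)"
    by (rule eventually_finite_subsets_at_top_weakI) simp
  have "((\<lambda>F. kinner (R F) (kpow (R F) m)) \<longlongrightarrow> 0) (finite_subsets_at_top I)"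
  proof (cases m)
    case 0
    then show ?thesis using kinner_deflate_tendsto_0 by simp
  next
    case (Suc n)
    show ?thesis
    proof (rule Lim_null_comparison)
      obtain e where e: "opsq K = e" by simp
      have bnd: "norm (kinner (R F) (kpow (R F) m)) \<le> sqrt (kinner (R F) (R F)) * sqrt (max 1 (kinner K K) ^ m * kinner K K)"
        if F: "finite F" "F \<subseteq> I" for F
      proof -
        note b = bker_deflate[OF F(2)]
        have o: "opsq (R F) \<le> max 1 (kinner K K)"
        proof (rule opsq_least)
          fix f assume f: "bfun f" "inner2 f f \<le> 1"
          have "inner2 (kop (R F) f) (kop (R F) f) \<le> kinner (R F) (R F) * inner2 f f" by (rule inner2_kop_le_kinner[OF b f(1)])
          also have "\<dots> \<le> kinner K K * 1" by (intro mult_mono f kinner_deflate_le F kinner_nonneg) auto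
          finally show "inner2 (kop (R F) f) (kop (R F) f) \<le> max 1 (kinner K K)" by simp
        qed
        have "(kinner (R F) (kpow (R F) m))\<^sup>2 \<le> kinner (R F) (R F) * kinner (kpow (R F) m) (kpow (R F) m)"
          by (rule kinner_Cauchy_Schwarz[OF b bker_kpow[OF b]])
        also have "\<dots> \<le> kinner (R F) (R F) * (opsq (R F) ^ m * kinner (R F) (R F))"
          by (intro mult_left_mono opsq_power_kinner_ge[OF b] kinner_nonneg)
        also have "\<dots> \<le> kinner (R F) (R F) * (max 1 (kinner K K) ^ m * kinner K K)"
          by (intro mult_left_mono mult_mono power_mono o opsq_nonneg b kinner_deflate_le F kinner_nonneg) auto
        finally show ?thesis by (simp add: real_le_rsqrt flip: real_sqrt_mult)
      qed
      show "eventually (\<lambda>F. norm (kinner (R F) (kpow (R F) m)) \<le> sqrt (kinner (R F) (R F)) * sqrt (max 1 (kinner K K) ^ m * kinner K K)) (finite_subsets_at_top I)"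
        using evF by eventually_elim (use bnd in auto)
      show "((\<lambda>F. sqrt (kinner (R F) (R F)) * sqrt (max 1 (kinner K K) ^ m * kinner K K)) \<longlongrightarrow> 0) (finite_subsets_at_top I)"
        by (rule tendsto_eq_intros kinner_deflate_tendsto_0 refl)+ simp
    qed
  qed
  then have "((\<lambda>F. kinner K (kpow K m) - kinner (R F) (kpow (R F) m)) \<longlongrightarrow> kinner K (kpow K m) - 0) (finite_subsets_at_top I)"
    by (intro tendsto_diff tendsto_const)
  moreover have "eventually (\<lambda>F. kinner K (kpow K m) - kinner (R F) (kpow (R F) m) = sum (\<lambda>i. lam i ^ (m + 2)) F) (finite_subsets_at_top I)"
    using evF by eventually_elim (simp add: kinner_deflate)
  ultimately have "(sum (\<lambda>i. lam i ^ (m + 2)) \<longlongrightarrow> kinner K (kpow K m) - 0) (finite_subsets_at_top I)"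
    by (rule Lim_transform_eventually)
  then show ?thesis by (simp add: has_sum_def)
qed

end
end
end

section \<open>Eigenspaces and multiplicities\<close>

context prob_space begin

lemma eigenfun_bfun: "eigenfun K c f \<Longrightarrow> bfun f"
  by (simp add: eigenfun_def)

lemma eigenfun_cmult: "eigenfun K c f \<Longrightarrow> eigenfun K c (\<lambda>x. a * f x)"
  unfolding eigenfun_def by (auto simp: kop_cmult intro: bfun_cmult)

lemma eigenfun_sum:
  assumes K: "bker K" and f: "\<And>i. i \<in> F \<Longrightarrow> eigenfun K c (f i)"
  shows "eigenfun K c (\<lambda>x. \<Sum>i\<in>F. a i * f i x)"
  unfolding eigenfun_def
proof (intro conjI ballI)
  have b: "bfun (\<lambda>x. a i * f i x)" if "i \<in> F" for i using f[OF that] by (intro bfun_cmult eigenfun_bfun)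
  then show "bfun (\<lambda>x. \<Sum>i\<in>F. a i * f i x)" by (rule bfun_sum)
  fix x assume x: "x \<in> space M"
  have "kop K (\<lambda>x. \<Sum>i\<in>F. a i * f i x) x = (\<Sum>i\<in>F. kop K (\<lambda>x. a i * f i x) x)"
    by (rule kop_sum[OF K b x])
  also have "\<dots> = (\<Sum>i\<in>F. c * (a i * f i x))"
    using f x by (intro sum.cong) (auto simp: kop_cmult eigenfun_def)
  finally show "kop K (\<lambda>x. \<Sum>i\<in>F. a i * f i x) x = c * (\<Sum>i\<in>F. a i * f i x)"
    by (simp add: sum_distrib_left)
qed

lemma orthonormal_onD:
  assumes "orthonormal_on I \<phi>" "i \<in> I"
  shows "bfun (\<phi> i)" "j \<in> I \<Longrightarrow> inner2 (\<phi> i) (\<phi> j) = of_bool (i = j)"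
  using assms by (auto simp: orthonormal_on_def)

lemma orthonormal_inner2_sum:
  assumes on: "orthonormal_on F \<phi>" and F: "finite F" and j: "j \<in> F"
  shows "inner2 (\<lambda>x. \<Sum>i\<in>F. a i * \<phi> i x) (\<phi> j) = a j"
proof -
  have "inner2 (\<lambda>x. \<Sum>i\<in>F. a i * \<phi> i x) (\<phi> j) = (\<Sum>i\<in>F. inner2 (\<lambda>x. a i * \<phi> i x) (\<phi> j))"
    using orthonormal_onD(1)[OF on] j by (intro inner2_sum_left bfun_cmult) auto
  also have "\<dots> = (\<Sum>i\<in>F. if i = j then a j else 0)"
  proof (rule sum.cong[OF refl])
    fix i assume i: "i \<in> F"
    show "inner2 (\<lambda>x. a i * \<phi> i x) (\<phi> j) = (if i = j then a j else 0)"
      unfolding inner2_cmult_left orthonormal_onD(2)[OF on i j] by simp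
  qed
  also have "\<dots> = a j" using F j by simp
  finally show ?thesis .
qed

lemma orthonormal_extend:
  assumes on: "orthonormal_on {..<k} \<phi>" and r: "bfun r" "inner2 r r \<noteq> 0"
    and orth: "\<And>i. i < k \<Longrightarrow> inner2 r (\<phi> i) = 0"
  shows "orthonormal_on {..<Suc k} (\<phi>(k := \<lambda>x. (1 / sqrt (inner2 r r)) * r x))"
proof -
  let ?u = "\<lambda>x. (1 / sqrt (inner2 r r)) * r x"
  have n: "inner2 r r > 0" using r(2) inner2_nonneg[of r] by linarith
  have u1: "inner2 ?u ?u = 1" unfolding inner2_cmult_left inner2_cmult_right using n by simp
  have u2: "inner2 ?u (\<phi> i) = 0" "inner2 (\<phi> i) ?u = 0" if "i < k" for i
    using orth[OF that] unfolding inner2_cmult_left inner2_cmult_right inner2_commute[of "\<phi> i" r] by simp_all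
  have bu: "bfun ?u" by (rule bfun_cmult[OF r(1)])
  have "inner2 ((\<phi>(k := ?u)) i) ((\<phi>(k := ?u)) j) = of_bool (i = j)" if ij: "i < Suc k" "j < Suc k" for i j
  proof -
    consider "i < k" "j < k" | "i = k" "j < k" | "i < k" "j = k" | "i = k" "j = k" using ij by linarith
    then show ?thesis
    proof cases
      case 1 then show ?thesis using orthonormal_onD(2)[OF on, of i j] by simp
    next
      case 2 then show ?thesis using u2(1)[of j] by simp
    next
      case 3 then show ?thesis using u2(2)[of i] by simp
    next
      case 4 then show ?thesis using u1 by simp
    qed
  qed
  moreover have "bfun ((\<phi>(k := ?u)) i)" if "i < Suc k" for i
    using bu orthonormal_onD(1)[OF on, of i] that by (cases "i = k") auto
  ultimately show ?thesis unfolding orthonormal_on_def lessThan_iff by blast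
qed

text \<open>Gram--Schmidt inside one eigenspace. Independence is meant modulo null sets, so that
  each new residual has a positive norm.\<close>

lemma eigenfun_Gram_Schmidt:
  fixes k :: nat
  assumes K: "bker K" and f: "\<And>i. i < k \<Longrightarrow> eigenfun K c (f i)"
    and ind: "\<And>a. AE x in M. (\<Sum>i<k. a i * f i x) = 0 \<Longrightarrow> \<forall>i<k. a i = (0::real)"
  shows "\<exists>\<phi>. (\<forall>i<k. eigenfun K c (\<phi> i) \<and> (\<exists>a. \<phi> i = (\<lambda>x. \<Sum>j<k. a j * f j x))) \<and> orthonormal_on {..<k} \<phi>"
  using f ind
proof (induction k)
  case 0
  then show ?case by (auto simp: orthonormal_on_def)
next
  case (Suc k)
  have "\<forall>i<k. a i = 0" if "AE x in M. (\<Sum>i<k. a i * f i x) = 0" for a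
  proof -
    have e: "(\<Sum>i<Suc k. (a(k := 0)) i * f i x) = (\<Sum>i<k. a i * f i x)" for x
      by (simp add: sum.lessThan_Suc) 
    have "AE x in M. (\<Sum>i<Suc k. (a(k := 0)) i * f i x) = 0" unfolding e by (rule that)
    from Suc.prems(2)[OF this] have z: "(a(k := 0)) i = 0" if "i < Suc k" for i using that by blast
    show ?thesis
    proof (intro allI impI)
      fix i assume "i < k"
      then show "a i = 0" using z[of i] by simp
    qed
  qed
  from Suc.IH[OF Suc.prems(1)[OF less_SucI] this]
  obtain \<phi> where \<phi>0: "\<forall>i<k. eigenfun K c (\<phi> i) \<and> (\<exists>a. \<phi> i = (\<lambda>x. \<Sum>j<k. a j * f j x))" "orthonormal_on {..<k} \<phi>"
    by blast
  have \<phi>: "\<And>i. i < k \<Longrightarrow> eigenfun K c (\<phi> i)" "\<And>i. i < k \<Longrightarrow> \<exists>a. \<phi> i = (\<lambda>x. \<Sum>j<k. a j * f j x)" "orthonormal_on {..<k} \<phi>"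
    using \<phi>0 by blast+
  obtain A where A: "\<And>i. i < k \<Longrightarrow> \<phi> i = (\<lambda>x. \<Sum>j<k. A i j * f j x)" using \<phi>(2) by metis
  define s where "s = (\<lambda>x. \<Sum>i<k. inner2 (f k) (\<phi> i) * \<phi> i x)"
  define r where "r = (\<lambda>x. f k x - s x)"
  have es: "eigenfun K c s" unfolding s_def by (rule eigenfun_sum[OF K]) (use \<phi>(1) in auto)
  have efk: "eigenfun K c (f k)" by (rule Suc.prems(1)) simp
  have er: "eigenfun K c r"
    using eigenfun_sum[OF K, of UNIV c "\<lambda>b. if b then f k else s" "\<lambda>b. if b then 1 else -1"] es efk
    by (simp add: UNIV_bool r_def)
  define B where "B = (\<lambda>j. if j = k then 1 else - (\<Sum>i<k. inner2 (f k) (\<phi> i) * A i j))"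
  have rB: "r = (\<lambda>x. \<Sum>j<Suc k. B j * f j x)"
  proof
    fix x
    have "s x = (\<Sum>i<k. \<Sum>j<k. inner2 (f k) (\<phi> i) * A i j * f j x)"
      unfolding s_def using A by (intro sum.cong) (auto simp: sum_distrib_left mult.assoc)
    also have "\<dots> = (\<Sum>j<k. \<Sum>i<k. inner2 (f k) (\<phi> i) * A i j * f j x)" by (rule sum.swap)
    also have "\<dots> = - (\<Sum>j<k. B j * f j x)"
      unfolding sum_negf[symmetric] B_def by (intro sum.cong) (auto simp: sum_distrib_right sum_negf)
    finally show "r x = (\<Sum>j<Suc k. B j * f j x)" by (simp add: r_def B_def)
  qed
  have r0: "inner2 r r \<noteq> 0"
  proof
    assume "inner2 r r = 0"
    then have "AE x in M. r x = 0" by (rule iffD1[OF inner2_self_eq_0_iff[OF eigenfun_bfun[OF er]]])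
    then have "AE x in M. (\<Sum>j<Suc k. B j * f j x) = 0" unfolding rB .
    from Suc.prems(2)[OF this] have "B k = 0" by blast
    then show False by (simp add: B_def)
  qed
  have orth: "inner2 r (\<phi> i) = 0" if i: "i < k" for i
  proof -
    have "inner2 r (\<phi> i) = inner2 (f k) (\<phi> i) - inner2 s (\<phi> i)"
      unfolding r_def by (intro inner2_diff_left eigenfun_bfun[OF efk] eigenfun_bfun[OF es] eigenfun_bfun[OF \<phi>(1)[OF i]])
    also have "inner2 s (\<phi> i) = inner2 (f k) (\<phi> i)"
      unfolding s_def using i by (intro orthonormal_inner2_sum[OF \<phi>(3)]) auto
    finally show ?thesis by simp
  qed
  let ?c = "1 / sqrt (inner2 r r)"
  define \<psi> where "\<psi> = \<phi>(k := \<lambda>x. ?c * r x)"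
  have "orthonormal_on {..<Suc k} \<psi>" unfolding \<psi>_def
    by (rule orthonormal_extend[OF \<phi>(3) eigenfun_bfun[OF er] r0 orth])
  moreover have "eigenfun K c (\<psi> i) \<and> (\<exists>a. \<psi> i = (\<lambda>x. \<Sum>j<Suc k. a j * f j x))" if i: "i < Suc k" for i
  proof (cases "i = k")
    case True
    have eq: "\<psi> i = (\<lambda>x. \<Sum>j<Suc k. (?c * B j) * f j x)"
      unfolding \<psi>_def True using rB by (simp add: sum_distrib_left mult.assoc fun_eq_iff del: sum.lessThan_Suc)
    have "eigenfun K c (\<psi> i)" unfolding \<psi>_def True fun_upd_same by (rule eigenfun_cmult[OF er])
    moreover have "\<exists>a. \<psi> i = (\<lambda>x. \<Sum>j<Suc k. a j * f j x)" by (rule exI, rule eq)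
    ultimately show ?thesis by (rule conjI)
  next
    case False
    then have ik: "i < k" using i by simp
    have eq: "\<psi> i = (\<lambda>x. \<Sum>j<Suc k. ((A i)(k := 0)) j * f j x)"
      unfolding \<psi>_def using A[OF ik] False by (simp add: fun_eq_iff)
    have "eigenfun K c (\<psi> i)" using \<phi>(1)[OF ik] False unfolding \<psi>_def by simp
    moreover have "\<exists>a. \<psi> i = (\<lambda>x. \<Sum>j<Suc k. a j * f j x)" by (rule exI, rule eq)
    ultimately show ?thesis by (rule conjI)
  qed
  ultimately show ?case by blast
qed

definition eigen_onfam :: "('a \<Rightarrow> 'a \<Rightarrow> real) \<Rightarrow> real \<Rightarrow> nat \<Rightarrow> (nat \<Rightarrow> 'a \<Rightarrow> real) \<Rightarrow> bool" where
  "eigen_onfam K c k \<phi> \<longleftrightarrow> (\<forall>i<k. eigenfun K c (\<phi> i)) \<and> orthonormal_on {..<k} \<phi>"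

lemma eigen_onfam_bound:
  assumes K: "bker K" "ksym K" and c: "c \<noteq> 0" and f: "eigen_onfam K c k \<phi>"
  shows "real k \<le> kinner K K / c\<^sup>2"
proof -
  have "(\<Sum>i<k. c\<^sup>2) \<le> kinner K K"
    using f c by (intro eigenvalue_Bessel[OF K, of "{..<k}" "\<lambda>_. c" \<phi>]) (auto simp: eigen_onfam_def)
  then show ?thesis using c by (simp add: field_simps)
qed

text \<open>By Bessel's inequality an eigenspace for a non-zero eigenvalue has no orthonormal
  family longer than \<open>kinner K K / c\<^sup>2\<close>, so the maximum exists.\<close>

definition eigendim :: "('a \<Rightarrow> 'a \<Rightarrow> real) \<Rightarrow> real \<Rightarrow> nat" where
  "eigendim K c = Max {k. \<exists>\<phi>. eigen_onfam K c k \<phi>}"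

lemma eigendim:
  assumes K: "bker K" "ksym K" and c: "c \<noteq> 0"
  shows "\<exists>\<phi>. eigen_onfam K c (eigendim K c) \<phi>" "eigen_onfam K c k \<phi> \<Longrightarrow> k \<le> eigendim K c"
proof -
  have "{k. \<exists>\<phi>. eigen_onfam K c k \<phi>} \<subseteq> {..nat \<lfloor>kinner K K / c\<^sup>2\<rfloor>}"
    using eigen_onfam_bound[OF K c] by (auto simp: le_nat_floor)
  then have fin: "finite {k. \<exists>\<phi>. eigen_onfam K c k \<phi>}" by (rule finite_subset) simp
  have "0 \<in> {k. \<exists>\<phi>. eigen_onfam K c k \<phi>}" by (simp add: eigen_onfam_def orthonormal_on_def)
  then have "eigendim K c \<in> {k. \<exists>\<phi>. eigen_onfam K c k \<phi>}" unfolding eigendim_def using fin by (intro Max_in) auto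
  then show "\<exists>\<phi>. eigen_onfam K c (eigendim K c) \<phi>" by simp
  show "k \<le> eigendim K c" if "eigen_onfam K c k \<phi>" unfolding eigendim_def using fin that by (intro Max_ge) auto
qed

lemma eigenfun_orthogonal:
  assumes K: "bker K" "ksym K" and f: "eigenfun K c f" and g: "eigenfun K d g" and cd: "c \<noteq> d"
  shows "inner2 f g = 0"
proof -
  have "c * inner2 f g = inner2 (\<lambda>x. c * f x) g" by (simp only: inner2_cmult_left)
  also have "\<dots> = inner2 (kop K f) g" using f by (intro inner2_cong) (auto simp: eigenfun_def)
  also have "\<dots> = inner2 f (kop K g)" by (rule kop_adjoint[OF K eigenfun_bfun[OF f] eigenfun_bfun[OF g]])
  also have "\<dots> = inner2 f (\<lambda>x. d * g x)" using g by (intro inner2_cong) (auto simp: eigenfun_def)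
  also have "\<dots> = d * inner2 f g" by (simp only: inner2_cmult_right)
  finally show ?thesis using cd by simp
qed

text \<open>Maximal orthonormal families of all eigenspaces together form a complete family: a
  further eigenfunction orthogonal to them could be adjoined to the family of its own
  eigenspace.\<close>

theorem trace_formula_eigendim:
  assumes K: "bker K" "ksym K"
  shows "((\<lambda>(c, j). c ^ (m + 2)) has_sum kinner K (kpow K m)) {(c, j). c \<noteq> 0 \<and> j < eigendim K c}"
proof -
  obtain \<phi> where \<phi>: "\<And>c. c \<noteq> 0 \<Longrightarrow> eigen_onfam K c (eigendim K c) (\<phi> c)"
    using eigendim(1)[OF K] by metis
  let ?I = "{(c, j). c \<noteq> 0 \<and> j < eigendim K c}"
  have on: "orthonormal_on ?I (\<lambda>(c, j). \<phi> c j)"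
    unfolding orthonormal_on_def
  proof (intro conjI ballI; clarify)
    fix c j assume c: "c \<noteq> 0" "j < eigendim K c"
    show "bfun (\<phi> c j)" using \<phi>[OF c(1)] c(2) by (auto simp: eigen_onfam_def eigenfun_def)
    fix c' j' assume c': "c' \<noteq> 0" "j' < eigendim K c'"
    show "inner2 (\<phi> c j) (\<phi> c' j') = of_bool ((c, j) = (c', j'))"
    proof (cases "c = c'")
      case True
      then show ?thesis using \<phi>[OF c(1)] c c' orthonormal_onD(2)[of "{..<eigendim K c}" "\<phi> c" j j'] by (simp add: eigen_onfam_def)
    next
      case False
      then show ?thesis using eigenfun_orthogonal[OF K, of c "\<phi> c j" c' "\<phi> c' j'"] \<phi>[OF c(1)] \<phi>[OF c'(1)] c c'
        by (simp add: eigen_onfam_def)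
    qed
  qed
  have "((\<lambda>i. (fst i) ^ (m + 2)) has_sum kinner K (kpow K m)) ?I"
  proof (rule trace_formula[OF K _ _ on])
    show "eigenfun K (fst i) (case i of (c, j) \<Rightarrow> \<phi> c j)" if "i \<in> ?I" for i
      using that \<phi> by (auto simp: eigen_onfam_def)
    show "fst i \<noteq> 0" if "i \<in> ?I" for i using that by auto
    fix c f assume f: "eigenfun K c f" "c \<noteq> 0" and o: "\<And>i. i \<in> ?I \<Longrightarrow> inner2 f (case i of (c, j) \<Rightarrow> \<phi> c j) = 0"
    show "inner2 f f = 0"
    proof (rule ccontr)
      assume n: "inner2 f f \<noteq> 0"
      let ?k = "eigendim K c"
      let ?u = "(\<phi> c)(?k := \<lambda>x. (1 / sqrt (inner2 f f)) * f x)"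
      have "orthonormal_on {..<Suc ?k} ?u"
        using \<phi>[OF f(2)] o[of "(c, _)"] f by (intro orthonormal_extend n) (auto simp: eigen_onfam_def eigenfun_def)
      moreover have "eigenfun K c (?u i)" if "i < Suc ?k" for i
      proof (cases "i = ?k")
        case True
        show ?thesis unfolding True fun_upd_same by (rule eigenfun_cmult[OF f(1)])
      next
        case False
        then show ?thesis using that \<phi>[OF f(2)] by (simp add: eigen_onfam_def)
      qed
      ultimately have "eigen_onfam K c (Suc ?k) ?u" unfolding eigen_onfam_def by blast
      then show False using eigendim(2)[OF K f(2)] by fastforce
    qed
  qed
  then show ?thesis by (simp add: split_beta')
qed

end

lemma prob_space_U01: "prob_space U01"
  by (rule prob_spaceI) (simp add: emeasure_restrict_space)

lemma space_U01: "space U01 = {0..1}"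
  by (simp add: space_restrict_space)

interpretation U: prob_space U01
  by (rule prob_space_U01)

text \<open>The multiplicity is defined by independent square-integrable functions that satisfy
  the eigenvalue equation almost everywhere; these may be replaced by bounded eigenfunctions, and
  orthonormal families of the latter are independent.\<close>

lemma Spec_eq_eigendim:
  assumes K: "U.bker K" "U.ksym K" and c: "c \<noteq> 0"
  shows "Spec K c = enat (U.eigendim K c)"
proof -
  let ?S = "{enat k | k. \<exists>f. (\<forall>i<k. f i \<in> eigenfunctions K c) \<and> L2_independent k f}"
  have kopE: "(\<integral>y. K x y * f y \<partial>U01) = U.kop K f x" for f x by (simp add: U.kop_def)
  have "Sup ?S = enat (U.eigendim K c)"
  proof (rule antisym)
    show "Sup ?S \<le> enat (U.eigendim K c)"
    proof (rule Sup_least, clarify)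
      fix k f assume f: "\<forall>i<k. f i \<in> eigenfunctions K c" and ind: "L2_independent k f"
      have "\<exists>g. U.eigenfun K c g \<and> (AE x in U01. g x = f i x)" if "i < k" for i
      proof -
        have "f i \<in> borel_measurable U01" "integrable U01 (\<lambda>x. (f i x)\<^sup>2)" "AE x in U01. U.kop K (f i) x = c * f i x"
          using f that by (auto simp: eigenfunctions_def kopE)
        then show ?thesis using U.eigenfun_of_AE[OF K(1) c, of "f i"] U.square_integrable_imp_integrable by blast
      qed
      then have "\<forall>i\<in>{..<k}. \<exists>g. U.eigenfun K c g \<and> (AE x in U01. g x = f i x)" by (intro ballI) (simp only: lessThan_iff)
      from bchoice[OF this] obtain g where g': "\<forall>i\<in>{..<k}. U.eigenfun K c (g i) \<and> (AE x in U01. g i x = f i x)"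
        by (elim exE) (rule that)
      have g: "U.eigenfun K c (g i)" "AE x in U01. g i x = f i x" if "i < k" for i
      proof -
        have "i \<in> {..<k}" using that by simp
        from bspec[OF g' this] show "U.eigenfun K c (g i)" "AE x in U01. g i x = f i x" by (rule conjunct1, rule conjunct2)
      qed
      have "\<forall>i<k. a i = 0" if a: "AE x in U01. (\<Sum>i<k. a i * g i x) = 0" for a :: "nat \<Rightarrow> real"
      proof -
        have "AE x in U01. \<forall>i\<in>{..<k}. g i x = f i x" using g(2) by (intro AE_finite_allI) auto
        with a have "AE x in U01. (\<Sum>i<k. a i * f i x) = 0" by eventually_elim simp
        then show ?thesis by (rule mp[OF spec[OF ind[unfolded L2_independent_def]]])
      qed
      from U.eigenfun_Gram_Schmidt[of K k c g, OF K(1) g(1) this]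
      obtain \<phi> where "U.eigen_onfam K c k \<phi>" unfolding U.eigen_onfam_def by blast
      then show "enat k \<le> enat (U.eigendim K c)" using U.eigendim(2)[OF K c] by simp
    qed
    obtain \<phi> where \<phi>: "U.eigen_onfam K c (U.eigendim K c) \<phi>" using U.eigendim(1)[OF K c] by blast
    let ?k = "U.eigendim K c"
    have on: "U.orthonormal_on {..<?k} \<phi>" and ef: "\<And>i. i < ?k \<Longrightarrow> U.eigenfun K c (\<phi> i)" using \<phi> by (auto simp: U.eigen_onfam_def)
    have mem: "\<phi> i \<in> eigenfunctions K c" if "i < ?k" for i
      unfolding eigenfunctions_def kopE
    proof (intro CollectI conjI)
      have b: "U.bfun (\<phi> i)" by (rule U.eigenfun_bfun[OF ef[OF that]])
      show "\<phi> i \<in> borel_measurable U01" "integrable U01 (\<lambda>x. (\<phi> i x)\<^sup>2)"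
        by (rule U.bfun_measurable[OF b], rule U.bfun_integrable[OF U.bfun_square[OF b]])
      show "AE x in U01. U.kop K (\<phi> i) x = c * \<phi> i x" using ef[OF that] by (intro AE_I2) (auto simp: U.eigenfun_def)
    qed
    have "L2_independent ?k \<phi>" unfolding L2_independent_def
    proof (intro allI impI)
      fix a :: "nat \<Rightarrow> real" and i assume a: "AE x in U01. (\<Sum>i<?k. a i * \<phi> i x) = 0" and i: "i < ?k"
      have "a i = U.inner2 (\<lambda>x. \<Sum>i<?k. a i * \<phi> i x) (\<phi> i)" using i by (intro U.orthonormal_inner2_sum[OF on, symmetric]) auto
      also have "\<dots> = 0" by (rule U.inner2_AE_zero[OF a])
      finally show "a i = 0" .
    qed
    then show "enat ?k \<le> Sup ?S" using mem by (intro Sup_upper) blast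
  qed
  then show ?thesis using c by (simp add: Spec_def L2_dim_def)
qed

theorem trace_formula_Spec:
  assumes K: "U.bker K" "U.ksym K"
  shows "((\<lambda>i. fst i ^ (m + 2)) has_sum U.kinner K (U.kpow K m)) (elements (Spec K))"
proof -
  have "elements (Spec K) = {(c, j). c \<noteq> 0 \<and> j < U.eigendim K c}"
  proof -
    have "enat j < Spec K c \<longleftrightarrow> c \<noteq> 0 \<and> j < U.eigendim K c" for c j
    proof (cases "c = 0")
      case True
      then show ?thesis by (simp add: Spec_def)
    next
      case False
      then show ?thesis by (simp add: Spec_eq_eigendim[OF K False])
    qed
    then show ?thesis by (simp add: elements_def)
  qed
  then show ?thesis using U.trace_formula_eigendim[OF K, of m] by (simp add: split_beta')
qed

section \<open>Eigenvalues of real symmetric matrices\<close>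

definition mtrace :: "'a :: comm_ring_1 mat \<Rightarrow> 'a" where
  "mtrace A = (\<Sum>i<dim_row A. A $$ (i, i))"

lemma mtrace_mult_commute:
  assumes "A \<in> carrier_mat n n" "B \<in> carrier_mat n n"
  shows "mtrace (A * B) = mtrace (B * A)"
proof -
  have e: "mtrace (A * B) = (\<Sum>i<n. \<Sum>j<n. A $$ (i, j) * B $$ (j, i))"
    if "A \<in> carrier_mat n n" "B \<in> carrier_mat n n" for A B
    using that by (auto simp: mtrace_def scalar_prod_def atLeast0LessThan intro!: sum.cong)
  have "(\<Sum>i<n. \<Sum>j<n. A $$ (i, j) * B $$ (j, i)) = (\<Sum>j<n. \<Sum>i<n. A $$ (i, j) * B $$ (j, i))" by (rule sum.swap)
  then show ?thesis unfolding e[OF assms] e[OF assms(2,1)] by (simp only: mult.commute)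
qed

lemma upper_triangular_mult:
  fixes A B :: "'a :: comm_ring_1 mat"
  assumes A: "A \<in> carrier_mat n n" "upper_triangular A" and B: "B \<in> carrier_mat n n" "upper_triangular B"
  shows "upper_triangular (A * B)" and "i < n \<Longrightarrow> (A * B) $$ (i, i) = A $$ (i, i) * B $$ (i, i)"
proof -
  have e: "(A * B) $$ (i, j) = (\<Sum>k<n. A $$ (i, k) * B $$ (k, j))" if "i < n" "j < n" for i j
    using that A B by (auto simp: scalar_prod_def atLeast0LessThan)
  have z: "A $$ (i, k) * B $$ (k, j) = 0" if "i < n" "k < n" "k < i \<or> j < k" for i j k
    using that A B upper_triangularD[OF A(2), of k i] upper_triangularD[OF B(2), of j k] by auto
  show "upper_triangular (A * B)"
  proof
    fix i j assume "j < i" "i < dim_row (A * B)"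
    then have ij: "i < n" "j < n" "j < i" using A by auto
    show "(A * B) $$ (i, j) = 0" unfolding e[OF ij(1,2)]
      by (intro sum.neutral ballI z) (use ij in auto)
  qed
  assume i: "i < n"
  have "(\<Sum>k<n. A $$ (i, k) * B $$ (k, i)) = (\<Sum>k<n. if k = i then A $$ (i, i) * B $$ (i, i) else 0)"
    using z[OF i, of _ i] by (intro sum.cong) (auto simp: neq_iff)
  then show "(A * B) $$ (i, i) = A $$ (i, i) * B $$ (i, i)" unfolding e[OF i i] using i by simp
qed

lemma upper_triangular_pow:
  fixes B :: "'a :: comm_ring_1 mat"
  assumes B: "B \<in> carrier_mat n n" "upper_triangular B"
  shows "upper_triangular (B ^\<^sub>m k) \<and> (\<forall>i<n. (B ^\<^sub>m k) $$ (i, i) = (B $$ (i, i)) ^ k)"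
proof (induction k)
  case (Suc k)
  have c: "B ^\<^sub>m k \<in> carrier_mat n n" using B by simp
  show ?case using upper_triangular_mult[OF c _ B] Suc by (simp add: mult.commute)
qed (use B in auto)

text \<open>Schur triangulation: the trace is invariant under similarity, and the diagonal of a
  power of a triangular matrix consists of the powers of the diagonal.\<close>

lemma mtrace_pow_of_char_poly:
  fixes A :: "real mat"
  assumes A: "A \<in> carrier_mat n n" and c: "char_poly A = (\<Prod>e\<leftarrow>es. [:- e, 1:])"
  shows "mtrace (A ^\<^sub>m k) = (\<Sum>e\<leftarrow>es. e ^ k)"
proof -
  obtain B P Q where "schur_decomposition A es = (B, P, Q)" by (metis prod_cases3)
  from schur_decomposition[OF A c this]
  have sim: "similar_mat_wit A B P Q" and ut: "upper_triangular B" and dg: "diag_mat B = es" by auto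
  note w = similar_mat_witD2[OF A sim]
  have Bk: "B ^\<^sub>m k \<in> carrier_mat n n" using w by simp
  have "mtrace (A ^\<^sub>m k) = mtrace ((P * B ^\<^sub>m k) * Q)" using similar_mat_wit_pow_id[OF sim] by simp
  also have "\<dots> = mtrace (Q * (P * B ^\<^sub>m k))" using w Bk by (intro mtrace_mult_commute[of _ n]) auto
  also have "Q * (P * B ^\<^sub>m k) = (Q * P) * B ^\<^sub>m k" by (rule assoc_mult_mat[symmetric, OF w(7) w(6) Bk])
  also have "\<dots> = B ^\<^sub>m k" using w Bk by simp
  also have "mtrace (B ^\<^sub>m k) = (\<Sum>i<n. (B $$ (i, i)) ^ k)"
    using upper_triangular_pow[OF w(5) ut, of k] Bk by (auto simp: mtrace_def)
  also have "\<dots> = (\<Sum>e\<leftarrow>es. e ^ k)"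
    unfolding dg[symmetric] diag_mat_def using w(5) by (simp add: sum_list_sum_nth atLeast0LessThan)
  finally show ?thesis .
qed

text \<open>The usual argument with the Hermitian form, which is real for a real symmetric
  matrix.\<close>

lemma symmetric_eigenvalue_real:
  fixes A :: "real mat"
  assumes A: "A \<in> carrier_mat n n" and s: "\<And>i j. i < n \<Longrightarrow> j < n \<Longrightarrow> A $$ (i, j) = A $$ (j, i)"
    and e: "eigenvalue (map_mat complex_of_real A) c"
  shows "c \<in> \<real>"
proof -
  let ?C = "map_mat complex_of_real A"
  obtain v where v: "v \<in> carrier_vec n" "v \<noteq> 0\<^sub>v n" "?C *\<^sub>v v = c \<cdot>\<^sub>v v"
    using e A unfolding eigenvalue_def eigenvector_def by auto
  define S where "S = (\<Sum>i<n. \<Sum>j<n. of_real (A $$ (i, j)) * v $ j * cnj (v $ i))"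
  define N where "N = (\<Sum>i<n. (cmod (v $ i))\<^sup>2)"
  have row: "(\<Sum>j<n. of_real (A $$ (i, j)) * v $ j) = c * v $ i" if i: "i < n" for i
  proof -
    have "(?C *\<^sub>v v) $ i = (\<Sum>j<n. of_real (A $$ (i, j)) * v $ j)"
      using i A v(1) by (auto simp: scalar_prod_def atLeast0LessThan)
    then show ?thesis using v i by simp
  qed
  have "S = (\<Sum>i<n. c * v $ i * cnj (v $ i))"
    unfolding S_def sum_distrib_right[symmetric] using row by (intro sum.cong) auto
  also have "\<dots> = c * of_real N"
    unfolding N_def by (simp add: sum_distrib_left mult.assoc flip: complex_norm_square)
  finally have S1: "S = c * of_real N" .
  have "cnj S = (\<Sum>i<n. \<Sum>j<n. of_real (A $$ (i, j)) * cnj (v $ j) * v $ i)" unfolding S_def by simp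
  also have "\<dots> = (\<Sum>j<n. \<Sum>i<n. of_real (A $$ (i, j)) * cnj (v $ j) * v $ i)" by (rule sum.swap)
  also have "\<dots> = S" unfolding S_def using s by (intro sum.cong) (auto simp: mult_ac)
  finally have S2: "cnj S = S" .
  obtain i where i: "i < n" "v $ i \<noteq> 0" using v(1,2) by (metis carrier_vecD eq_vecI index_zero_vec)
  have "0 < (cmod (v $ i))\<^sup>2" using i by simp
  also have "\<dots> \<le> N" unfolding N_def using i by (intro member_le_sum) auto
  finally have "N > 0" .
  then have "cnj c = c" using S1 S2 by simp
  then show ?thesis by (simp add: Reals_cnj_iff)
qed

lemma symmetric_char_poly_splits:
  fixes A :: "real mat"
  assumes A: "A \<in> carrier_mat n n" and s: "\<And>i j. i < n \<Longrightarrow> j < n \<Longrightarrow> A $$ (i, j) = A $$ (j, i)"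
  obtains es where "char_poly A = (\<Prod>e\<leftarrow>es. [:- e, 1:])" "length es = n"
proof -
  let ?C = "map_mat complex_of_real A"
  have C: "?C \<in> carrier_mat n n" using A by simp
  obtain cs where cs: "char_poly ?C = (\<Prod>c\<leftarrow>cs. [:- c, 1:])" "length cs = n" using char_poly_factorized[OF C] by blast
  have real: "of_real (Re c) = c" if "c \<in> set cs" for c
  proof -
    have "poly (char_poly ?C) c = 0" unfolding cs(1) poly_prod_list using that by (auto simp: prod_list_zero_iff)
    then have "eigenvalue ?C c" using eigenvalue_root_char_poly[OF C] by simp
    then show ?thesis using symmetric_eigenvalue_real[OF A s] by simp
  qed
  have hom: "map_poly complex_of_real (\<Prod>c\<leftarrow>xs. [:- Re c, 1:]) = (\<Prod>c\<leftarrow>xs. [:- c, 1:])"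
    if "\<And>c. c \<in> set xs \<Longrightarrow> of_real (Re c) = c" for xs
    using that
  proof (induction xs)
    case (Cons a xs)
    have "map_poly complex_of_real [:- Re a, 1:] = [:- a, 1:]" using Cons.prems[of a] by (simp add: map_poly_pCons)
    moreover have "map_poly complex_of_real (p * q) = map_poly complex_of_real p * map_poly complex_of_real q" for p q
      by (simp add: poly_eq_iff coeff_map_poly coeff_mult)
    ultimately show ?case using Cons by (simp del: mult_pCons_left mult_pCons_right)
  qed simp
  have "map_poly complex_of_real (char_poly A) = char_poly ?C" by (rule of_real_hom.char_poly_hom[OF A, symmetric])
  also have "\<dots> = map_poly complex_of_real (\<Prod>c\<leftarrow>cs. [:- Re c, 1:])" unfolding cs(1) by (rule hom[symmetric]) (rule real)
  finally have "char_poly A = (\<Prod>c\<leftarrow>cs. [:- Re c, 1:])"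
    by (metis (no_types, lifting) of_real_eq_iff coeff_map_poly of_real_0 poly_eqI)
  then show ?thesis using that[of "map Re cs"] cs(2) by (simp add: comp_def)
qed

lemma proots_prod_linear: "proots (\<Prod>e\<leftarrow>xs. [:- e, 1:]) = mset (xs :: real list)"
proof (induction xs)
  case (Cons a xs)
  have "(\<Prod>e\<leftarrow>xs. [:- e, 1:]) \<noteq> (0 :: real poly)" by (auto simp: prod_list_zero_iff)
  then have "proots ([:- a, 1:] * (\<Prod>e\<leftarrow>xs. [:- e, 1:])) = proots [:- a, 1:] + proots (\<Prod>e\<leftarrow>xs. [:- e, 1:])"
    by (intro proots_mult) auto
  then show ?case using Cons by (simp del: mult_pCons_left)
qed simp

lemma sum_eigenvalue_desc:
  fixes A :: "real mat" and g :: "real \<Rightarrow> 'b :: comm_monoid_add"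
  assumes c: "char_poly A = (\<Prod>e\<leftarrow>es. [:- e, 1:])"
  shows "(\<Sum>s=1..length es. g (eigenvalue_desc A s)) = (\<Sum>e\<leftarrow>es. g e)"
proof -
  define L where "L = rev (sorted_list_of_multiset (proots (char_poly A)))"
  have m: "mset L = mset es" unfolding L_def c proots_prod_linear by simp
  then have len: "length L = length es" by (metis size_mset)
  have "(\<Sum>s=1..length es. g (eigenvalue_desc A s)) = (\<Sum>i<length L. g (L ! i))"
    unfolding eigenvalue_desc_def L_def[symmetric] len
    by (rule sum.reindex_bij_witness[of _ Suc "\<lambda>s. s - 1"]) auto
  also have "\<dots> = (\<Sum>e\<leftarrow>L. g e)" by (simp add: sum_list_sum_nth atLeast0LessThan)
  also have "\<dots> = (\<Sum>e\<leftarrow>es. g e)" using m by (metis mset_map sum_mset_sum_list)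
  finally show ?thesis .
qed

lemma eigenvalue_desc_antimono:
  fixes A :: "real mat"
  assumes c: "size (proots (char_poly A)) = n" and st: "1 \<le> s" "s \<le> t" "t \<le> n"
  shows "eigenvalue_desc A t \<le> eigenvalue_desc A s"
proof -
  let ?L = "sorted_list_of_multiset (proots (char_poly A))"
  have len: "length ?L = n" using c by (metis mset_sorted_list_of_multiset size_mset)
  have "sorted (rev (rev ?L))" by simp
  then show ?thesis unfolding eigenvalue_desc_def
    using sorted_rev_nth_mono[of "rev ?L" "s - 1" "t - 1"] st len by simp
qed

lemma size_proots_char_poly:
  assumes "char_poly A = (\<Prod>e\<leftarrow>es. [:- e, 1:])"
  shows "size (proots (char_poly (A :: real mat))) = length es"
  unfolding assms proots_prod_linear by simp

section \<open>The empirical kernel\<close>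

abbreviation unif :: "nat \<Rightarrow> nat measure" where
  "unif n \<equiv> uniform_count_measure {1..n}"

lemma prob_space_unif: "n \<ge> 1 \<Longrightarrow> prob_space (unif n)"
  by (rule prob_space_uniform_count_measure) auto

lemma tri_hat_sym: "tri_hat n a u v = tri_hat n a v u"
  by (simp add: tri_hat_def add.commute)

lemma measurable_unif: "f \<in> unif n \<rightarrow>\<^sub>M borel"
  unfolding measurable_cong_sets[OF sets_uniform_count_measure_count_space refl] by simp

lemma measurable_unif_pair: "f \<in> (unif n \<Otimes>\<^sub>M unif n) \<rightarrow>\<^sub>M borel"
proof -
  have "f \<in> (count_space {1..n} \<Otimes>\<^sub>M unif n) \<rightarrow>\<^sub>M borel"
    by (rule measurable_pair_measure_countable1) (auto intro: measurable_unif)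
  moreover have "sets (unif n \<Otimes>\<^sub>M unif n) = sets (count_space {1..n} \<Otimes>\<^sub>M unif n)"
    by (intro sets_pair_measure_cong sets_uniform_count_measure_count_space refl)
  ultimately show ?thesis using measurable_cong_sets by blast
qed

lemma bker_unif:
  assumes n: "n \<ge> 1" shows "prob_space.bker (unif n) K"
proof -
  interpret P: prob_space "unif n" by (rule prob_space_unif[OF n])
  have "\<bar>K x y\<bar> \<le> (\<Sum>p\<in>{1..n}\<times>{1..n}. \<bar>K (fst p) (snd p)\<bar>)" if "x \<in> {1..n}" "y \<in> {1..n}" for x y
    using member_le_sum[of "(x, y)" "{1..n}\<times>{1..n}" "\<lambda>p. \<bar>K (fst p) (snd p)\<bar>"] that by auto
  then show ?thesis
    by (intro P.bkerI[OF measurable_unif_pair]) (auto simp: space_uniform_count_measure)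
qed

lemma integral_unif: "integral\<^sup>L (unif n) f = (\<Sum>x=1..n. f x) / real n"
  by (simp add: integral_uniform_count_measure)

lemma tri_hat_mat_pow:
  assumes n: "n \<ge> 1" and ij: "i < n" "j < n"
  shows "(tri_hat_mat n a ^\<^sub>m Suc k) $$ (i, j) = prob_space.kpow (unif n) (tri_hat n a) k (Suc i) (Suc j) / n"
  using ij
proof (induction k arbitrary: i j)
  case 0
  interpret P: prob_space "unif n" by (rule prob_space_unif[OF n])
  have A: "tri_hat_mat n a \<in> carrier_mat n n" by (simp add: tri_hat_mat_def)
  have "tri_hat_mat n a ^\<^sub>m Suc 0 = tri_hat_mat n a" using A by simp
  then show ?case using 0 by (simp add: P.kpow.simps(1) del: One_nat_def) (simp add: tri_hat_mat_def)
next
  case (Suc k)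
  interpret P: prob_space "unif n" by (rule prob_space_unif[OF n])
  let ?A = "tri_hat_mat n a" and ?K = "tri_hat n a"
  have A: "?A \<in> carrier_mat n n" by (simp add: tri_hat_mat_def)
  have "(?A ^\<^sub>m Suc (Suc k)) $$ (i, j) = (?A ^\<^sub>m Suc k * ?A) $$ (i, j)" by simp
  also have "\<dots> = (\<Sum>l<n. (?A ^\<^sub>m Suc k) $$ (i, l) * ?A $$ (l, j))"
    using Suc.prems A pow_carrier_mat[OF A, of "Suc k"]
    by (auto simp: scalar_prod_def atLeast0LessThan simp del: pow_mat.simps intro!: sum.cong)
  also have "\<dots> = (\<Sum>l<n. (P.kpow ?K k (Suc i) (Suc l) * ?K (Suc l) (Suc j)) / (real n * real n))"
    using Suc by (intro sum.cong) (auto simp: tri_hat_mat_def simp del: pow_mat.simps)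
  also have "\<dots> = (\<Sum>x=1..n. P.kpow ?K k (Suc i) x * ?K x (Suc j)) / (real n * real n)"
    unfolding sum_divide_distrib by (rule sum.reindex_bij_witness[of _ "\<lambda>x. x - 1" Suc]) auto
  also have "\<dots> = P.kcomp (P.kpow ?K k) ?K (Suc i) (Suc j) / n"
    by (simp add: P.kcomp_def integral_unif del: One_nat_def)
  also have "\<dots> = P.kpow ?K (Suc k) (Suc i) (Suc j) / n"
    using Suc.prems by (subst P.kpow_Suc_right[OF bker_unif[OF n]]) (auto simp: space_uniform_count_measure)
  finally show ?case .
qed

text \<open>The matrix is \<open>tri_hat n a\<close> as a kernel on \<open>{1..n}\<close> with the
  uniform distribution: the weight \<open>1 / n\<close> of a vertex is the factor \<open>1 /
  n\<close> of the matrix.\<close>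

theorem sum_eigenvalue_power:
  assumes n: "n \<ge> 1"
  shows "(\<Sum>s=1..n. eigenvalue_desc (tri_hat_mat n a) s ^ Suc k)
    = (\<integral>x. prob_space.kpow (unif n) (tri_hat n a) k x x \<partial>unif n)"
proof -
  let ?A = "tri_hat_mat n a"
  have A: "?A \<in> carrier_mat n n" by (simp add: tri_hat_mat_def)
  obtain es where es: "char_poly ?A = (\<Prod>e\<leftarrow>es. [:- e, 1:])" "length es = n"
    by (rule symmetric_char_poly_splits[OF A]) (auto simp: tri_hat_mat_def tri_hat_sym)
  have "(\<Sum>s=1..n. eigenvalue_desc ?A s ^ Suc k) = (\<Sum>e\<leftarrow>es. e ^ Suc k)"
    using sum_eigenvalue_desc[OF es(1), of "\<lambda>x. x ^ Suc k"] es(2) by simp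
  also have "\<dots> = mtrace (?A ^\<^sub>m Suc k)" by (rule mtrace_pow_of_char_poly[OF A es(1), symmetric])
  also have "\<dots> = (\<Sum>i<n. prob_space.kpow (unif n) (tri_hat n a) k (Suc i) (Suc i) / n)"
    using A pow_carrier_mat[OF A, of "Suc k"] tri_hat_mat_pow[OF n] by (auto simp: mtrace_def simp del: pow_mat.simps)
  also have "\<dots> = (\<Sum>x=1..n. prob_space.kpow (unif n) (tri_hat n a) k x x) / n"
    unfolding sum_divide_distrib by (rule sum.reindex_bij_witness[of _ "\<lambda>x. x - 1" Suc]) auto
  finally show ?thesis unfolding integral_unif .
qed

lemma eigenvalue_desc_tri_hat_antimono:
  assumes "1 \<le> s" "s \<le> t" "t \<le> n"
  shows "eigenvalue_desc (tri_hat_mat n a) t \<le> eigenvalue_desc (tri_hat_mat n a) s"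
proof -
  let ?A = "tri_hat_mat n a"
  have A: "?A \<in> carrier_mat n n" by (simp add: tri_hat_mat_def)
  obtain es where es: "char_poly ?A = (\<Prod>e\<leftarrow>es. [:- e, 1:])" "length es = n"
    by (rule symmetric_char_poly_splits[OF A]) (auto simp: tri_hat_mat_def tri_hat_sym)
  show ?thesis by (rule eigenvalue_desc_antimono[OF _ assms]) (simp add: size_proots_char_poly[OF es(1)] es(2))
qed

section \<open>Cyclic integrals\<close>

lemma space_PiM_D: "x \<in> space (PiM I (\<lambda>_. M)) \<Longrightarrow> i \<in> I \<Longrightarrow> x i \<in> space M"
  by (auto simp: space_PiM PiE_def Pi_def)

context prob_space begin

lemma product_prob_space_const: "product_prob_space (\<lambda>_. M)"
  by unfold_locales

lemma prob_space_PiM_const: "prob_space (PiM I (\<lambda>_. M))"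
  by (rule prob_space_PiM) unfold_locales

lemma integrable_PiM_bounded:
  fixes f :: "('i \<Rightarrow> 'a) \<Rightarrow> real"
  assumes "f \<in> borel_measurable (PiM I (\<lambda>_. M))" "\<And>x. x \<in> space (PiM I (\<lambda>_. M)) \<Longrightarrow> \<bar>f x\<bar> \<le> B"
  shows "integrable (PiM I (\<lambda>_. M)) f"
proof -
  interpret P: prob_space "PiM I (\<lambda>_. M)" by (rule prob_space_PiM_const)
  show ?thesis using assms by (intro P.integrable_const_bound[where B = B]) auto
qed

lemma integral_PiM_insert:
  fixes f :: "('i \<Rightarrow> 'a) \<Rightarrow> real"
  assumes "finite I" "i \<notin> I" and f: "f \<in> borel_measurable (PiM (insert i I) (\<lambda>_. M))"
    "\<And>x. x \<in> space (PiM (insert i I) (\<lambda>_. M)) \<Longrightarrow> \<bar>f x\<bar> \<le> B"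
  shows "(\<integral>x. f x \<partial>PiM (insert i I) (\<lambda>_. M)) = (\<integral>x. (\<integral>y. f (x(i := y)) \<partial>M) \<partial>PiM I (\<lambda>_. M))"
proof -
  note i = integrable_PiM_bounded[OF f]
  interpret product_prob_space "\<lambda>_. M" by (rule product_prob_space_const)
  show ?thesis by (rule product_integral_insert[OF assms(1,2) i])
qed

lemma space_PiM_upd: "x \<in> space (PiM I (\<lambda>_. M)) \<Longrightarrow> y \<in> space M \<Longrightarrow> x(i := y) \<in> space (PiM (insert i I) (\<lambda>_. M))"
  by (auto simp: space_PiM PiE_def extensional_def Pi_def)

context
  fixes \<phi> :: "'a \<Rightarrow> 'a \<Rightarrow> 'a \<Rightarrow> real" and B :: real
  assumes \<phi>m: "(\<lambda>p. \<phi> (fst p) (fst (snd p)) (snd (snd p))) \<in> borel_measurable (M \<Otimes>\<^sub>M M \<Otimes>\<^sub>M M)"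
    and \<phi>B: "\<And>x y z. x \<in> space M \<Longrightarrow> y \<in> space M \<Longrightarrow> z \<in> space M \<Longrightarrow> \<bar>\<phi> x y z\<bar> \<le> B"
begin

definition marginal :: "'a \<Rightarrow> 'a \<Rightarrow> real" where
  "marginal x y = (\<integral>z. \<phi> x y z \<partial>M)"

text \<open>Even coordinates are the vertices of the walk; coordinate \<open>2 * i + 1\<close> is
  the third argument of the \<open>i\<close>-th factor, the apex of a triangle over the
  \<open>i\<close>-th step.\<close>

definition walk :: "nat \<Rightarrow> (nat \<Rightarrow> 'a) \<Rightarrow> real" where
  "walk k x = (\<Prod>i<k. \<phi> (x (2*i)) (x (2*i+2)) (x (2*i+1)))"

lemma bound_nonneg: "0 \<le> B"
proof -
  obtain x where "x \<in> space M" using not_empty by blast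
  then show ?thesis using \<phi>B[of x x x] by linarith
qed

lemma measurable_phi:
  assumes [measurable]: "f \<in> N \<rightarrow>\<^sub>M M" "g \<in> N \<rightarrow>\<^sub>M M" "h \<in> N \<rightarrow>\<^sub>M M"
  shows "(\<lambda>x. \<phi> (f x) (g x) (h x)) \<in> borel_measurable N"
proof -
  have "(\<lambda>x. (f x, g x, h x)) \<in> N \<rightarrow>\<^sub>M M \<Otimes>\<^sub>M M \<Otimes>\<^sub>M M" by measurable
  from measurable_compose[OF this \<phi>m] show ?thesis by simp
qed

lemma bker_phi: "x \<in> space M \<Longrightarrow> bker (\<lambda>y z. \<phi> x y z)"
  by (rule bkerI[of _ B]) (auto simp: \<phi>B split_beta' intro!: measurable_phi)

lemma bker_marginal: "bker marginal"
proof (rule bkerI)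
  show "(\<lambda>(x, y). marginal x y) \<in> borel_measurable (M \<Otimes>\<^sub>M M)"
  proof -
    have "(\<lambda>(p, z). \<phi> (fst p) (snd p) z) \<in> borel_measurable ((M \<Otimes>\<^sub>M M) \<Otimes>\<^sub>M M)"
      unfolding split_beta' by (rule measurable_phi) measurable
    then show ?thesis unfolding marginal_def split_beta' by (rule borel_measurable_lebesgue_integral[unfolded split_beta'])
  qed
  fix x y assume xy: "x \<in> space M" "y \<in> space M"
  have "\<bar>marginal x y\<bar> \<le> (\<integral>z. \<bar>\<phi> x y z\<bar> \<partial>M)" unfolding marginal_def by (rule integral_abs_bound)
  also have "\<dots> \<le> (\<integral>z. B \<partial>M)"
    using \<phi>B xy by (intro integral_mono bfun_integrable bfun_abs bfun_const bker_slice1[OF bker_phi]) auto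
  finally show "\<bar>marginal x y\<bar> \<le> B" by (simp add: prob_space)
qed

lemma walk_measurable: "{..2*k} \<subseteq> I \<Longrightarrow> walk k \<in> borel_measurable (PiM I (\<lambda>_. M))"
  unfolding walk_def[abs_def] by (intro borel_measurable_prod measurable_phi measurable_component_singleton) auto

lemma walk_bound:
  assumes "{..2*k} \<subseteq> I" "x \<in> space (PiM I (\<lambda>_. M))" shows "\<bar>walk k x\<bar> \<le> B ^ k"
proof -
  have "\<bar>walk k x\<bar> \<le> (\<Prod>i<k. B)" unfolding walk_def abs_prod
    using assms by (intro prod_mono conjI \<phi>B space_PiM_D[OF assms(2)]) auto
  then show ?thesis by simp
qed

lemma walk_cong: "(\<And>i. i \<le> 2*k \<Longrightarrow> x i = y i) \<Longrightarrow> walk k x = walk k y"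
  unfolding walk_def by (intro prod.cong) auto

text \<open>One step of the walk, applied to the function that still has to be integrated against
  the two end points.\<close>

definition advance :: "('a \<Rightarrow> 'a \<Rightarrow> real) \<Rightarrow> 'a \<Rightarrow> 'a \<Rightarrow> real" where
  "advance g x y = (\<integral>v. marginal y v * g x v \<partial>M)"

lemma bker_advance: "bker g \<Longrightarrow> bker (advance g)"
  using bker_swap[OF bker_kcomp[OF bker_marginal bker_swap[of g]]] by (simp add: advance_def[abs_def] kcomp_def)

text \<open>The last two coordinates occur in the last factor only; integrating them out absorbs
  one step of the walk into the test function.\<close>

lemma integral_open_walk:
  assumes "bker g"
  shows "(\<integral>x. walk k x * g (x 0) (x (2*k)) \<partial>PiM {..2*k} (\<lambda>_. M)) = (\<integral>x. (advance ^^ k) g x x \<partial>M)"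
  using assms
proof (induction k arbitrary: g)
  case 0
  have w: "walk 0 x = 1" for x by (simp add: walk_def)
  have m: "(\<lambda>x. g x x) \<in> borel_measurable M"
    using measurable_compose[OF _ bker_measurable[OF 0], of "\<lambda>x. (x, x)" M] by simp
  have "(\<integral>x. g (x 0) (x 0) \<partial>PiM {0::nat} (\<lambda>_. M)) = (\<integral>x. g x x \<partial>M)"
    using product_sigma_finite.product_integral_singleton[of "\<lambda>_. M", OF _ m, of 0] sigma_finite_measure_axioms
    by (simp add: product_sigma_finite_def)
  then show ?case unfolding w by simp
next
  case (Suc k)
  let ?I = "{..2*k}" and ?J = "insert (2*k+1) {..2*k}" and ?P = "\<lambda>I. PiM I (\<lambda>_::nat. M)"
  obtain C where C: "C > 0" "\<And>x y. x \<in> space M \<Longrightarrow> y \<in> space M \<Longrightarrow> \<bar>g x y\<bar> \<le> C"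
    using bker_bound[OF Suc.prems] by metis
  note gm = bker_measurable[OF Suc.prems]
  define F where "F = (\<lambda>x. walk (Suc k) x * g (x 0) (x (2 * Suc k)))"
  have J: "{..2 * Suc k} = insert (2*k+2) ?J" by auto
  have Fm: "F \<in> borel_measurable (?P (insert (2*k+2) ?J))" unfolding F_def
    by (intro borel_measurable_times walk_measurable measurable_compose[OF measurable_Pair gm, simplified] measurable_component_singleton) auto
  have FB: "\<bar>F x\<bar> \<le> B ^ Suc k * C" if x: "x \<in> space (?P (insert (2*k+2) ?J))" for x
    unfolding F_def abs_mult
    by (intro mult_mono walk_bound[OF _ x] C(2) space_PiM_D[OF x]) (auto simp: bound_nonneg)
  have eq: "F ((x(2*k+1 := w))(2*k+2 := v)) = walk k x * (\<phi> (x (2*k)) v w * g (x 0) v)" for x w v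
  proof -
    have "walk (Suc k) ((x(2*k+1 := w))(2*k+2 := v)) = walk k ((x(2*k+1 := w))(2*k+2 := v)) * \<phi> (x (2*k)) v w"
      by (simp add: walk_def)
    also have "walk k ((x(2*k+1 := w))(2*k+2 := v)) = walk k x" by (rule walk_cong) auto
    finally have 1: "walk (Suc k) ((x(2*k+1 := w))(2*k+2 := v)) = walk k x * \<phi> (x (2*k)) v w" .
    have z: "((x(2*k+1 := w))(2*k+2 := v)) 0 = x 0" "((x(2*k+1 := w))(2*k+2 := v)) (2 * Suc k) = v" by auto
    show ?thesis unfolding F_def 1 z by (rule mult.assoc)
  qed
  define G where "G = (\<lambda>x. \<integral>v. F (x(2*k+2 := v)) \<partial>M)"
  have upd: "(\<lambda>p. (fst p)(2*k+2 := snd p)) \<in> ?P ?J \<Otimes>\<^sub>M M \<rightarrow>\<^sub>M ?P (insert (2*k+2) ?J)"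
    by (rule measurable_fun_upd[where J = ?J]) auto
  have Gm: "G \<in> borel_measurable (?P ?J)"
  proof -
    have "(\<lambda>p. F ((fst p)(2*k+2 := snd p))) \<in> borel_measurable (?P ?J \<Otimes>\<^sub>M M)" by (rule measurable_compose[OF upd Fm])
    then have "(\<lambda>(x, v). F (x(2*k+2 := v))) \<in> borel_measurable (?P ?J \<Otimes>\<^sub>M M)" by (simp add: split_beta')
    then show ?thesis unfolding G_def by (rule borel_measurable_lebesgue_integral)
  qed
  have GB: "\<bar>G x\<bar> \<le> B ^ Suc k * C" if x: "x \<in> space (?P ?J)" for x
  proof -
    have m: "(\<lambda>v. F (x(2*k+2 := v))) \<in> borel_measurable M"
      using measurable_compose[OF measurable_component_update[OF x, of "2*k+2"] Fm] by auto
    have b: "\<bar>F (x(2*k+2 := v))\<bar> \<le> B ^ Suc k * C" if "v \<in> space M" for v by (rule FB[OF space_PiM_upd[OF x that]])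
    have "\<bar>G x\<bar> \<le> (\<integral>v. \<bar>F (x(2*k+2 := v))\<bar> \<partial>M)" unfolding G_def by (rule integral_abs_bound)
    also have "\<dots> \<le> (\<integral>v. B ^ Suc k * C \<partial>M)"
      using b bfunI[OF m b] by (intro integral_mono bfun_integrable bfun_abs bfun_const) auto
    finally show ?thesis by (simp add: prob_space)
  qed
  have "(\<integral>x. F x \<partial>?P {..2 * Suc k}) = (\<integral>x. G x \<partial>?P ?J)"
    unfolding J G_def by (rule integral_PiM_insert[OF _ _ Fm FB]) auto
  also have "\<dots> = (\<integral>x. (\<integral>w. G (x(2*k+1 := w)) \<partial>M) \<partial>?P ?I)"
    by (rule integral_PiM_insert[OF _ _ Gm GB]) auto
  also have "\<dots> = (\<integral>x. walk k x * advance g (x 0) (x (2*k)) \<partial>?P ?I)"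
  proof (rule Bochner_Integration.integral_cong[OF refl])
    fix x assume x: "x \<in> space (?P ?I)"
    have x0: "x 0 \<in> space M" "x (2*k) \<in> space M" using space_PiM_D[OF x] by auto
    have b: "bker (\<lambda>w v. \<phi> (x (2*k)) v w * g (x 0) v)"
      by (intro bker_mult bker_swap[OF bker_phi[OF x0(2)]] bker_snd[OF bker_slice1[OF Suc.prems x0(1)]])
    have "(\<integral>w. G (x(2*k+1 := w)) \<partial>M) = walk k x * (\<integral>w. (\<integral>v. \<phi> (x (2*k)) v w * g (x 0) v \<partial>M) \<partial>M)"
      unfolding G_def eq by simp
    also have "(\<integral>w. (\<integral>v. \<phi> (x (2*k)) v w * g (x 0) v \<partial>M) \<partial>M) = (\<integral>v. (\<integral>w. \<phi> (x (2*k)) v w * g (x 0) v \<partial>M) \<partial>M)"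
      by (rule bker_Fubini[OF b])
    also have "\<dots> = advance g (x 0) (x (2*k))" by (simp add: advance_def marginal_def)
    finally show "(\<integral>w. G (x(2*k+1 := w)) \<partial>M) = walk k x * advance g (x 0) (x (2*k))" .
  qed
  also have "\<dots> = (\<integral>x. (advance ^^ k) (advance g) x x \<partial>M)" by (rule Suc.IH[OF bker_advance[OF Suc.prems]])
  finally show ?case by (simp add: F_def funpow_swap1)
qed

lemma advance_power: "(advance ^^ k) (\<lambda>x y. marginal y x) x y = kpow marginal k y x"
proof (induction k arbitrary: x y)
  case (Suc k)
  then have "(advance ^^ k) (\<lambda>x y. marginal y x) = (\<lambda>x y. kpow marginal k y x)" by blast
  moreover have "(advance ^^ Suc k) (\<lambda>x y. marginal y x) x y = advance ((advance ^^ k) (\<lambda>x y. marginal y x)) x y" by simp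
  ultimately have "(advance ^^ Suc k) (\<lambda>x y. marginal y x) x y = advance (\<lambda>x y. kpow marginal k y x) x y" by metis
  then show ?case unfolding advance_def by (simp add: kcomp_def)
qed simp

definition closed_walk :: "nat \<Rightarrow> (nat \<Rightarrow> 'a) \<Rightarrow> real" where
  "closed_walk k x = walk k x * \<phi> (x (2*k)) (x 0) (x (2*k+1))"

lemma closed_walk_measurable: "closed_walk k \<in> borel_measurable (PiM {..<2*k+2} (\<lambda>_. M))"
  unfolding closed_walk_def[abs_def]
  by (intro borel_measurable_times walk_measurable measurable_phi measurable_component_singleton) auto

text \<open>Integrating out the last apex turns the closing factor into the marginal, which serves
  as the test function of the open walk.\<close>

theorem integral_closed_walk:
  "(\<integral>x. closed_walk k x \<partial>PiM {..<2*k+2} (\<lambda>_. M)) = (\<integral>x. kpow marginal k x x \<partial>M)"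
proof -
  let ?I = "{..2*k}" and ?P = "\<lambda>I. PiM I (\<lambda>_::nat. M)"
  have I: "{..<2*k+2} = insert (2*k+1) ?I" by auto
  have Cm: "closed_walk k \<in> borel_measurable (?P (insert (2*k+1) ?I))" using closed_walk_measurable[of k] unfolding I .
  have CB: "\<bar>closed_walk k x\<bar> \<le> B ^ k * B" if x: "x \<in> space (?P (insert (2*k+1) ?I))" for x
    unfolding closed_walk_def abs_mult
    by (intro mult_mono walk_bound[OF _ x] \<phi>B space_PiM_D[OF x]) (auto simp: bound_nonneg)
  have "(\<integral>x. closed_walk k x \<partial>?P {..<2*k+2}) = (\<integral>x. (\<integral>w. closed_walk k (x(2*k+1 := w)) \<partial>M) \<partial>?P ?I)"
    unfolding I by (rule integral_PiM_insert[OF _ _ Cm CB]) auto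
  also have "\<dots> = (\<integral>x. walk k x * marginal (x (2*k)) (x 0) \<partial>?P ?I)"
  proof (rule Bochner_Integration.integral_cong[OF refl])
    fix x
    have "walk k (x(2*k+1 := w)) = walk k x" for w by (rule walk_cong) auto
    then show "(\<integral>w. closed_walk k (x(2*k+1 := w)) \<partial>M) = walk k x * marginal (x (2*k)) (x 0)"
      by (simp add: closed_walk_def marginal_def)
  qed
  also have "\<dots> = (\<integral>x. (advance ^^ k) (\<lambda>x y. marginal y x) x x \<partial>M)"
    by (rule integral_open_walk[OF bker_swap[OF bker_marginal]])
  finally show ?thesis unfolding advance_power .
qed

end
end

section \<open>Uniform sampling with replacement\<close>

lemma sets_PiM_unif: "finite I \<Longrightarrow> sets (PiM I (\<lambda>_. unif n)) = Pow (PiE I (\<lambda>_. {1..n}))"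
proof -
  assume I: "finite I"
  have "sets (PiM I (\<lambda>_. unif n)) = sets (PiM I (\<lambda>_. count_space {1..n}))"
    by (intro sets_PiM_cong refl sets_uniform_count_measure_count_space)
  also have "PiM I (\<lambda>_. count_space {1..n}) = count_space (PiE I (\<lambda>_. {1..n}))"
    using I by (rule count_space_PiM_finite) auto
  finally show ?thesis by simp
qed

lemma space_PiM_unif: "space (PiM I (\<lambda>_. unif n)) = PiE I (\<lambda>_. {1..n})"
  by (simp add: space_PiM space_uniform_count_measure)

lemma measurable_PiM_unif: "finite I \<Longrightarrow> f \<in> PiM I (\<lambda>_. unif n) \<rightarrow>\<^sub>M borel"
  unfolding measurable_def by (simp add: sets_PiM_unif space_PiM_unif del: One_nat_def)

lemma integral_PiM_unif:
  fixes f :: "('i \<Rightarrow> nat) \<Rightarrow> real"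
  assumes n: "n \<ge> 1" and I: "finite I"
  shows "(\<integral>x. f x \<partial>PiM I (\<lambda>_. unif n)) = (\<Sum>x\<in>PiE I (\<lambda>_. {1..n}). f x) / real n ^ card I"
  using I
proof (induction I arbitrary: f rule: finite_induct)
  case empty
  show ?case by (simp add: PiM_empty lebesgue_integral_count_space_finite)
next
  case (insert i I)
  interpret P: prob_space "unif n" by (rule prob_space_unif[OF n])
  have fin: "finite (PiE (insert i I) (\<lambda>_. {1..n}))" using insert by (intro finite_PiE) auto
  have "\<bar>f x\<bar> \<le> (\<Sum>x\<in>PiE (insert i I) (\<lambda>_. {1..n}). \<bar>f x\<bar>)" if "x \<in> space (PiM (insert i I) (\<lambda>_. unif n))" for x
    using that unfolding space_PiM_unif by (intro member_le_sum fin) auto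
  then have "(\<integral>x. f x \<partial>PiM (insert i I) (\<lambda>_. unif n)) = (\<integral>x. (\<integral>y. f (x(i := y)) \<partial>unif n) \<partial>PiM I (\<lambda>_. unif n))"
    using insert by (intro P.integral_PiM_insert measurable_PiM_unif) auto
  also have "\<dots> = (\<Sum>x\<in>PiE I (\<lambda>_. {1..n}). \<Sum>y=1..n. f (x(i := y))) / real n ^ card (insert i I)"
    unfolding insert.IH integral_unif using insert by (simp add: sum_divide_distrib)
  also have "(\<Sum>x\<in>PiE I (\<lambda>_. {1..n}). \<Sum>y=1..n. f (x(i := y))) = (\<Sum>x\<in>PiE (insert i I) (\<lambda>_. {1..n}). f x)"
  proof -
    have "(\<Sum>x\<in>PiE (insert i I) (\<lambda>_. {1..n}). f x) = (\<Sum>p\<in>{1..n} \<times> PiE I (\<lambda>_. {1..n}). f ((snd p)(i := fst p)))"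
      unfolding PiE_insert_eq
      by (subst sum.reindex[OF inj_combinator[OF insert(2)]]) (simp only: split_beta' comp_def)
    also have "\<dots> = (\<Sum>y=1..n. \<Sum>x\<in>PiE I (\<lambda>_. {1..n}). f (x(i := y)))"
      by (simp add: sum.cartesian_product split_beta')
    also have "\<dots> = (\<Sum>x\<in>PiE I (\<lambda>_. {1..n}). \<Sum>y=1..n. f (x(i := y)))" by (rule sum.swap)
    finally show ?thesis by simp
  qed
  finally show ?case .
qed

section \<open>Bounded differences\<close>

text \<open>The cubic term in \<open>D\<close> is absorbed by the geometric mean inequality; the
  term linear in \<open>D\<close> is kept, since it integrates to 0 for a martingale
  difference.\<close>

lemma quartic_bound:
  fixes A D c :: real
  assumes "\<bar>D\<bar> \<le> c"
  shows "(A + D) ^ 4 \<le> A ^ 4 + 4 * A ^ 3 * D + 8 * c\<^sup>2 * A\<^sup>2 + 3 * c ^ 4"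
proof -
  have c0: "0 \<le> c" using assms by linarith
  have D2: "D\<^sup>2 \<le> c\<^sup>2" using assms by (rule power2_le_iff_abs_le[THEN iffD2, OF c0])
  have D4: "D ^ 4 \<le> c ^ 4" using power_mono[OF D2, of 2] by simp
  have "4 * A * D ^ 3 \<le> 4 * \<bar>A\<bar> * \<bar>D\<bar> * D\<^sup>2"
  proof -
    have "A * D ^ 3 = (A * D) * D\<^sup>2" by (simp add: power2_eq_square power3_eq_cube)
    also have "\<dots> \<le> \<bar>A * D\<bar> * D\<^sup>2" by (intro mult_right_mono) auto
    finally show ?thesis by (simp add: abs_mult)
  qed
  also have "\<dots> \<le> 4 * \<bar>A\<bar> * c * c\<^sup>2" using assms D2 c0 by (intro mult_mono) auto
  also have "\<dots> \<le> 2 * c\<^sup>2 * A\<^sup>2 + 2 * c ^ 4"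
  proof -
    have "0 \<le> 2 * c\<^sup>2 * (\<bar>A\<bar> - c)\<^sup>2" by simp
    also have "\<dots> = 2 * c\<^sup>2 * A\<^sup>2 + 2 * c ^ 4 - 4 * \<bar>A\<bar> * c * c\<^sup>2"
      unfolding power2_diff power2_abs by (simp add: algebra_simps power4_eq_xxxx power2_eq_square)
    finally show ?thesis by simp
  qed
  finally have 3: "4 * A * D ^ 3 \<le> 2 * c\<^sup>2 * A\<^sup>2 + 2 * c ^ 4" .
  have 2: "6 * A\<^sup>2 * D\<^sup>2 \<le> 6 * A\<^sup>2 * c\<^sup>2" using D2 by (intro mult_left_mono) auto
  have "(A + D) ^ 4 = A ^ 4 + 4 * A ^ 3 * D + 6 * A\<^sup>2 * D\<^sup>2 + 4 * A * D ^ 3 + D ^ 4"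
    by (simp add: power4_eq_xxxx power2_eq_square power3_eq_cube algebra_simps)
  then show ?thesis using 2 3 D4 by (simp add: mult_ac)
qed

text \<open>Martingale differences: integrate out one coordinate at a time. The second moment
  grows by at most \<open>(c i)\<^sup>2\<close> per coordinate, and \<open>quartic_bound\<close>
  turns this into a bound on the fourth moment. The constant 4 is what makes the induction close,
  as \<open>3 \<le> 4\<close> and \<open>8 = 2 * 4\<close>.\<close>

lemma (in prob_space) bounded_differences_moments:
  fixes f :: "('i \<Rightarrow> 'a) \<Rightarrow> real"
  assumes I: "finite I" and f: "f \<in> borel_measurable (PiM I (\<lambda>_. M))"
    "\<And>x. x \<in> space (PiM I (\<lambda>_. M)) \<Longrightarrow> \<bar>f x\<bar> \<le> B"
    and d: "\<And>i x y. i \<in> I \<Longrightarrow> x \<in> space (PiM I (\<lambda>_. M)) \<Longrightarrow> y \<in> space M \<Longrightarrow> \<bar>f (x(i := y)) - f x\<bar> \<le> c i"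
  shows "(\<integral>x. (f x - (\<integral>x. f x \<partial>PiM I (\<lambda>_. M)))\<^sup>2 \<partial>PiM I (\<lambda>_. M)) \<le> (\<Sum>i\<in>I. (c i)\<^sup>2) \<and>
         (\<integral>x. (f x - (\<integral>x. f x \<partial>PiM I (\<lambda>_. M))) ^ 4 \<partial>PiM I (\<lambda>_. M)) \<le> 4 * (\<Sum>i\<in>I. (c i)\<^sup>2)\<^sup>2"
  using I f d
proof (induction I arbitrary: f rule: finite_induct)
  case empty
  show ?case by (simp add: PiM_empty lebesgue_integral_count_space_finite)
next
  case (insert i I)
  let ?P = "\<lambda>I. PiM I (\<lambda>_::'i. M)"
  let ?J = "insert i I"
  note fm = insert.prems(1) and fB = insert.prems(2) and fd = insert.prems(3)
  obtain x0 where x0: "x0 \<in> space (?P ?J)" using prob_space.not_empty[OF prob_space_PiM_const] by blast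
  have B0: "0 \<le> B" using fB[OF x0] by linarith
  have upd: "(\<lambda>p. (fst p)(i := snd p)) \<in> ?P I \<Otimes>\<^sub>M M \<rightarrow>\<^sub>M ?P ?J" by (rule measurable_fun_upd[where J = I]) auto
  have slice: "bfun (\<lambda>y. f (x(i := y)))" if x: "x \<in> space (?P I)" for x
  proof (rule bfunI)
    show "(\<lambda>y. f (x(i := y))) \<in> borel_measurable M"
      using measurable_compose[OF measurable_component_update[OF x insert(2)] fm] .
    show "\<bar>f (x(i := y))\<bar> \<le> B" if "y \<in> space M" for y by (rule fB[OF space_PiM_upd[OF x that]])
  qed
  define h where "h = (\<lambda>x. \<integral>y. f (x(i := y)) \<partial>M)"
  have hm: "h \<in> borel_measurable (?P I)"
  proof -
    have "(\<lambda>p. f ((fst p)(i := snd p))) \<in> borel_measurable (?P I \<Otimes>\<^sub>M M)" by (rule measurable_compose[OF upd fm])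
    then have "(\<lambda>(x, v). f (x(i := v))) \<in> borel_measurable (?P I \<Otimes>\<^sub>M M)" by (simp add: split_beta')
    then show ?thesis unfolding h_def by (rule borel_measurable_lebesgue_integral)
  qed
  have avg_le: "\<bar>(\<integral>y. g y \<partial>M)\<bar> \<le> K" if g: "bfun g" "\<And>y. y \<in> space M \<Longrightarrow> \<bar>g y\<bar> \<le> K" for g K
  proof -
    have "\<bar>\<integral>y. g y \<partial>M\<bar> \<le> (\<integral>y. \<bar>g y\<bar> \<partial>M)" by (rule integral_abs_bound)
    also have "\<dots> \<le> (\<integral>y. K \<partial>M)" using g by (intro integral_mono bfun_integrable bfun_abs bfun_const) auto
    finally show ?thesis by (simp add: prob_space)
  qed
  have hB: "\<bar>h x\<bar> \<le> B" if x: "x \<in> space (?P I)" for x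
    unfolding h_def by (intro avg_le slice x fB space_PiM_upd)
  have hd: "\<bar>h (x(j := z)) - h x\<bar> \<le> c j" if j: "j \<in> I" and x: "x \<in> space (?P I)" and z: "z \<in> space M" for j x z
  proof -
    have xz: "x(j := z) \<in> space (?P I)" using space_PiM_upd[OF x z, of j] j by (simp add: insert_absorb)
    have ij: "i \<noteq> j" using j insert(2) by blast
    have "h (x(j := z)) - h x = (\<integral>y. f ((x(j := z))(i := y)) - f (x(i := y)) \<partial>M)"
      unfolding h_def by (rule Bochner_Integration.integral_diff[symmetric]) (intro bfun_integrable slice x xz)+
    also have "\<bar>\<dots>\<bar> \<le> c j"
    proof (rule avg_le)
      show "bfun (\<lambda>y. f ((x(j := z))(i := y)) - f (x(i := y)))" by (intro bfun_diff slice x xz)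
      show "\<bar>f ((x(j := z))(i := y)) - f (x(i := y))\<bar> \<le> c j" if y: "y \<in> space M" for y
      proof -
        have "\<bar>f ((x(i := y))(j := z)) - f (x(i := y))\<bar> \<le> c j"
          by (rule fd[OF _ space_PiM_upd[OF x y] z]) (use j in auto)
        then show ?thesis unfolding fun_upd_twist[OF ij] .
      qed
    qed
    finally show ?thesis .
  qed
  have D: "\<bar>f (x(i := y)) - h x\<bar> \<le> c i" if x: "x \<in> space (?P I)" and y: "y \<in> space M" for x y
  proof -
    have "f (x(i := y)) - h x = (\<integral>z. f (x(i := y)) - f (x(i := z)) \<partial>M)"
      unfolding h_def using bfun_integrable[OF slice[OF x]] by (simp add: prob_space)
    also have "\<bar>\<dots>\<bar> \<le> c i"
    proof (rule avg_le)
      show "bfun (\<lambda>z. f (x(i := y)) - f (x(i := z)))" by (intro bfun_diff bfun_const slice x)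
      show "\<bar>f (x(i := y)) - f (x(i := z))\<bar> \<le> c i" if z: "z \<in> space M" for z
        using fd[OF insertI1 space_PiM_upd[OF x z] y] unfolding fun_upd_upd .
    qed
    finally show ?thesis .
  qed
  define m where "m = (\<integral>x. f x \<partial>?P ?J)"
  have mh: "m = (\<integral>x. h x \<partial>?P I)" unfolding m_def h_def by (rule integral_PiM_insert[OF insert(1,2) fm fB])
  have mB: "\<bar>m\<bar> \<le> B"
  proof -
    interpret P: prob_space "?P I" by (rule prob_space_PiM_const)
    have "\<bar>m\<bar> \<le> (\<integral>x. \<bar>h x\<bar> \<partial>?P I)" unfolding mh by (rule integral_abs_bound)
    also have "\<dots> \<le> (\<integral>x. B \<partial>?P I)" using hB integrable_PiM_bounded[OF hm hB] by (intro integral_mono) auto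
    finally show ?thesis by (simp add: P.prob_space)
  qed
  have fmB: "\<bar>f x - m\<bar> \<le> 2 * B" if "x \<in> space (?P ?J)" for x using fB[OF that] mB by linarith
  have hmB: "\<bar>h x - m\<bar> \<le> 2 * B" if "x \<in> space (?P I)" for x using hB[OF that] mB by linarith
  have pw: "\<bar>t ^ k\<bar> \<le> (2 * B) ^ k" if "\<bar>t\<bar> \<le> 2 * B" for t k using power_mono[OF that, of k] by (simp add: power_abs)
  have ih: "integrable (?P I) (\<lambda>x. (h x - m) ^ k)" for k
    using hm hmB pw by (intro integrable_PiM_bounded[where B = "(2*B)^k"]) auto
  have unf: "(\<integral>x. (f x - m) ^ k \<partial>?P ?J) = (\<integral>x. (\<integral>y. (f (x(i := y)) - m) ^ k \<partial>M) \<partial>?P I)" for k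
    using fm fmB pw by (intro integral_PiM_insert[OF insert(1,2), where B = "(2*B)^k"]) auto
  have ii: "integrable (?P I) (\<lambda>x. \<integral>y. (f (x(i := y)) - m) ^ k \<partial>M)" for k
  proof (rule integrable_PiM_bounded)
    have "(\<lambda>p. (f ((fst p)(i := snd p)) - m) ^ k) \<in> borel_measurable (?P I \<Otimes>\<^sub>M M)"
      by (intro borel_measurable_power borel_measurable_diff measurable_compose[OF upd fm]) auto
    then have "(\<lambda>(x, v). (f (x(i := v)) - m) ^ k) \<in> borel_measurable (?P I \<Otimes>\<^sub>M M)" by (simp add: split_beta')
    then show "(\<lambda>x. \<integral>y. (f (x(i := y)) - m) ^ k \<partial>M) \<in> borel_measurable (?P I)" by (rule borel_measurable_lebesgue_integral)
    fix x assume x: "x \<in> space (?P I)"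
    have b: "\<bar>(f (x(i := y)) - m) ^ k\<bar> \<le> (2*B)^k" if "y \<in> space M" for y using pw fmB[OF space_PiM_upd[OF x that]] by blast
    have "bfun (\<lambda>y. (f (x(i := y)) - m) ^ k)"
      using bfun_measurable[OF slice[OF x]] b by (intro bfunI[of _ "(2*B)^k"]) auto
    then show "\<bar>\<integral>y. (f (x(i := y)) - m) ^ k \<partial>M\<bar> \<le> (2*B)^k" using b by (rule avg_le)
  qed
  have D0: "(\<integral>y. f (x(i := y)) - h x \<partial>M) = 0" if x: "x \<in> space (?P I)" for x
    using bfun_integrable[OF slice[OF x]] by (simp add: prob_space h_def)
  let ?V = "\<Sum>i\<in>I. (c i)\<^sup>2"
  have IH: "(\<integral>x. (h x - m)\<^sup>2 \<partial>?P I) \<le> ?V" "(\<integral>x. (h x - m) ^ 4 \<partial>?P I) \<le> 4 * ?V\<^sup>2"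
    using insert.IH[OF hm hB hd] unfolding mh[symmetric] by blast+
  interpret P: prob_space "?P I" by (rule prob_space_PiM_const)
  have "(\<integral>x. (f x - m)\<^sup>2 \<partial>?P ?J) \<le> (\<integral>x. (h x - m)\<^sup>2 + (c i)\<^sup>2 \<partial>?P I)"
    unfolding unf
  proof (rule integral_mono[OF ii])
    show "integrable (?P I) (\<lambda>x. (h x - m)\<^sup>2 + (c i)\<^sup>2)" using ih[of 2] by simp
    fix x assume x: "x \<in> space (?P I)"
    have bD: "bfun (\<lambda>y. f (x(i := y)) - h x)" by (intro bfun_diff slice x bfun_const)
    have "(\<integral>y. (f (x(i := y)) - m)\<^sup>2 \<partial>M) \<le> (\<integral>y. ((h x - m)\<^sup>2 + (c i)\<^sup>2) + 2 * (h x - m) * (f (x(i := y)) - h x) \<partial>M)"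
    proof (rule integral_mono)
      show "integrable M (\<lambda>y. (f (x(i := y)) - m)\<^sup>2)" by (intro bfun_integrable bfun_square bfun_diff slice x bfun_const)
      show "integrable M (\<lambda>y. ((h x - m)\<^sup>2 + (c i)\<^sup>2) + 2 * (h x - m) * (f (x(i := y)) - h x))"
        by (intro bfun_integrable bfun_add bfun_const bfun_cmult bD)
      fix y assume y: "y \<in> space M"
      have "(f (x(i := y)) - h x)\<^sup>2 \<le> (c i)\<^sup>2" using D[OF x y] by (metis abs_ge_zero order_trans power2_le_iff_abs_le)
      moreover have "(f (x(i := y)) - m)\<^sup>2 = (h x - m)\<^sup>2 + 2 * (h x - m) * (f (x(i := y)) - h x) + (f (x(i := y)) - h x)\<^sup>2"
        by (simp add: power2_eq_square algebra_simps)
      ultimately show "(f (x(i := y)) - m)\<^sup>2 \<le> ((h x - m)\<^sup>2 + (c i)\<^sup>2) + 2 * (h x - m) * (f (x(i := y)) - h x)" by linarith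
    qed
    also have "\<dots> = (\<integral>y. (h x - m)\<^sup>2 + (c i)\<^sup>2 \<partial>M) + (\<integral>y. 2 * (h x - m) * (f (x(i := y)) - h x) \<partial>M)"
      by (intro Bochner_Integration.integral_add bfun_integrable bfun_const bfun_cmult bD)
    also have "\<dots> = (h x - m)\<^sup>2 + (c i)\<^sup>2" using D0[OF x] by (simp only: integral_mult_right_zero) (simp add: prob_space)
    finally show "(\<integral>y. (f (x(i := y)) - m)\<^sup>2 \<partial>M) \<le> (h x - m)\<^sup>2 + (c i)\<^sup>2" .
  qed
  also have "\<dots> = (\<integral>x. (h x - m)\<^sup>2 \<partial>?P I) + (c i)\<^sup>2" using ih[of 2] by (simp add: P.prob_space)
  also have "\<dots> \<le> ?V + (c i)\<^sup>2" using IH(1) by simp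
  finally have 1: "(\<integral>x. (f x - m)\<^sup>2 \<partial>?P ?J) \<le> (\<Sum>i\<in>?J. (c i)\<^sup>2)" using insert by simp
  have "(\<integral>x. (f x - m) ^ 4 \<partial>?P ?J) \<le> (\<integral>x. (h x - m) ^ 4 + 8 * (c i)\<^sup>2 * (h x - m)\<^sup>2 + 3 * (c i) ^ 4 \<partial>?P I)"
    unfolding unf
  proof (rule integral_mono[OF ii])
    show "integrable (?P I) (\<lambda>x. (h x - m) ^ 4 + 8 * (c i)\<^sup>2 * (h x - m)\<^sup>2 + 3 * (c i) ^ 4)" using ih[of 2] ih[of 4] by simp
    fix x assume x: "x \<in> space (?P I)"
    let ?c = "(h x - m) ^ 4 + 8 * (c i)\<^sup>2 * (h x - m)\<^sup>2 + 3 * (c i) ^ 4"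
    have bD: "bfun (\<lambda>y. f (x(i := y)) - h x)" by (intro bfun_diff slice x bfun_const)
    have "(\<integral>y. (f (x(i := y)) - m) ^ 4 \<partial>M) \<le> (\<integral>y. ?c + 4 * (h x - m) ^ 3 * (f (x(i := y)) - h x) \<partial>M)"
    proof (rule integral_mono)
      have "bfun (\<lambda>y. ((f (x(i := y)) - m)\<^sup>2)\<^sup>2)" by (intro bfun_square bfun_diff slice x bfun_const)
      then show "integrable M (\<lambda>y. (f (x(i := y)) - m) ^ 4)" by (intro bfun_integrable) simp
      show "integrable M (\<lambda>y. ?c + 4 * (h x - m) ^ 3 * (f (x(i := y)) - h x))"
        by (intro bfun_integrable bfun_add bfun_const bfun_cmult bD)
      fix y assume y: "y \<in> space M"
      show "(f (x(i := y)) - m) ^ 4 \<le> ?c + 4 * (h x - m) ^ 3 * (f (x(i := y)) - h x)"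
        using quartic_bound[OF D[OF x y], of "h x - m"] by simp
    qed
    also have "\<dots> = (\<integral>y. ?c \<partial>M) + (\<integral>y. 4 * (h x - m) ^ 3 * (f (x(i := y)) - h x) \<partial>M)"
      by (intro Bochner_Integration.integral_add bfun_integrable bfun_const bfun_cmult bD)
    also have "\<dots> = ?c" using D0[OF x] by (simp only: integral_mult_right_zero) (simp add: prob_space)
    finally show "(\<integral>y. (f (x(i := y)) - m) ^ 4 \<partial>M) \<le> ?c" .
  qed
  also have "\<dots> = (\<integral>x. (h x - m) ^ 4 \<partial>?P I) + 8 * (c i)\<^sup>2 * (\<integral>x. (h x - m)\<^sup>2 \<partial>?P I) + 3 * (c i) ^ 4"
    using ih[of 2] ih[of 4] by (simp add: P.prob_space)
  also have "\<dots> \<le> 4 * ?V\<^sup>2 + 8 * (c i)\<^sup>2 * ?V + 3 * (c i) ^ 4"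
    by (intro add_mono IH mult_left_mono) auto
  also have "\<dots> \<le> 4 * ((c i)\<^sup>2 + ?V)\<^sup>2"
  proof -
    have "((c i)\<^sup>2)\<^sup>2 = c i ^ 4" by simp
    then have "4 * ((c i)\<^sup>2 + ?V)\<^sup>2 = 4 * ?V\<^sup>2 + 8 * (c i)\<^sup>2 * ?V + 4 * c i ^ 4" unfolding power2_sum by (simp add: algebra_simps)
    moreover have "0 \<le> c i ^ 4" by simp
    ultimately show ?thesis by linarith
  qed
  finally have "(\<integral>x. (f x - m) ^ 4 \<partial>?P ?J) \<le> 4 * (\<Sum>i\<in>?J. (c i)\<^sup>2)\<^sup>2" using insert by simp
  then show ?case using 1 unfolding m_def by blast
qed

section \<open>Products of Bernoulli variables\<close>

text \<open>Expectation over independent bits \<open>b e\<close> with success probabilities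
  \<open>p e\<close>, for \<open>e\<close> in \<open>A\<close>.\<close>

definition bern_exp :: "'e set \<Rightarrow> ('e \<Rightarrow> real) \<Rightarrow> (('e \<Rightarrow> bool) \<Rightarrow> real) \<Rightarrow> real" where
  "bern_exp A p F = measure_pmf.expectation (Pi_pmf A False (\<lambda>e. bernoulli_pmf (p e))) F"

lemma finite_set_Pi_pmf_bool:
  "finite A \<Longrightarrow> finite (set_pmf (Pi_pmf A False (p :: 'e \<Rightarrow> bool pmf)))"
  by (simp add: set_Pi_pmf finite_PiE_dflt)

lemma bern_exp_integrable: "finite A \<Longrightarrow> integrable (measure_pmf (Pi_pmf A False (p :: 'e \<Rightarrow> bool pmf))) (F :: _ \<Rightarrow> real)"
  by (intro integrable_measure_pmf_finite finite_set_Pi_pmf_bool)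

lemma bern_exp_empty: "bern_exp {} p F = F (\<lambda>_. False)"
  by (simp add: bern_exp_def)

lemma bern_exp_insert:
  assumes A: "finite A" "e \<notin> A" and p: "0 \<le> p e" "p e \<le> 1"
  shows "bern_exp (insert e A) p F =
    p e * bern_exp A p (\<lambda>b. F (b(e := True))) + (1 - p e) * bern_exp A p (\<lambda>b. F (b(e := False)))"
proof -
  let ?Q = "Pi_pmf A False (\<lambda>e. bernoulli_pmf (p e))"
  have "Pi_pmf (insert e A) False (\<lambda>e. bernoulli_pmf (p e)) = bernoulli_pmf (p e) \<bind> (\<lambda>y. map_pmf (\<lambda>f. f(e := y)) ?Q)"
    unfolding Pi_pmf_insert'[OF A] map_pmf_def ..
  then have "bern_exp (insert e A) p F = measure_pmf.expectation (bernoulli_pmf (p e) \<bind> (\<lambda>y. map_pmf (\<lambda>f. f(e := y)) ?Q)) F"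
    by (simp add: bern_exp_def)
  also have "\<dots> = (\<Sum>y\<in>UNIV. pmf (bernoulli_pmf (p e)) y *\<^sub>R measure_pmf.expectation (map_pmf (\<lambda>f. f(e := y)) ?Q) F)"
    using finite_set_Pi_pmf_bool[OF A(1)] by (intro pmf_expectation_bind) auto
  also have "\<dots> = p e * bern_exp A p (\<lambda>b. F (b(e := True))) + (1 - p e) * bern_exp A p (\<lambda>b. F (b(e := False)))"
    using p by (simp add: UNIV_bool bern_exp_def integral_map_pmf)
  finally show ?thesis .
qed

lemma bern_exp_add: "finite A \<Longrightarrow> bern_exp A p (\<lambda>b. F b + G b) = bern_exp A p F + bern_exp A p G"
  unfolding bern_exp_def by (intro Bochner_Integration.integral_add bern_exp_integrable)

lemma bern_exp_cmult: "bern_exp A p (\<lambda>b. c * F b) = c * bern_exp A p F"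
  unfolding bern_exp_def by simp

lemma bern_exp_const: "bern_exp A p (\<lambda>b. c) = c"
  unfolding bern_exp_def by simp

lemma bern_exp_mono: "finite A \<Longrightarrow> (\<And>b. F b \<le> G b) \<Longrightarrow> bern_exp A p F \<le> bern_exp A p G"
  unfolding bern_exp_def by (intro integral_mono bern_exp_integrable)

lemma bern_exp_sum: "finite A \<Longrightarrow> bern_exp A p (\<lambda>b. \<Sum>i\<in>S. F i b) = (\<Sum>i\<in>S. bern_exp A p (F i))"
  unfolding bern_exp_def by (intro Bochner_Integration.integral_sum bern_exp_integrable)

lemma bern_exp_abs_diff:
  assumes "finite A" "\<And>b. \<bar>F b - G b\<bar> \<le> c" shows "\<bar>bern_exp A p F - bern_exp A p G\<bar> \<le> c"
proof -
  have *: "bern_exp A p F \<le> bern_exp A p G + c" if "\<And>b. F b \<le> G b + c" for F G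
    using bern_exp_mono[OF assms(1) that, of p] by (simp add: bern_exp_add[OF assms(1)] bern_exp_const)
  have "F b \<le> G b + c" "G b \<le> F b + c" for b using assms(2)[of b] by auto
  from *[of F G, OF this(1)] *[of G F, OF this(2)] show ?thesis by auto
qed

text \<open>A function that is affine in each bit commutes with taking the expectation of each
  bit.\<close>

lemma bern_exp_affine:
  assumes "finite A" and p: "\<And>e. e \<in> A \<Longrightarrow> 0 \<le> p e \<and> p e \<le> 1"
    and G: "\<And>e y t. e \<in> A \<Longrightarrow> 0 \<le> t \<Longrightarrow> t \<le> 1 \<Longrightarrow> G (y(e := t)) = t * G (y(e := 1)) + (1 - t) * G (y(e := 0 :: real))"
  shows "bern_exp A p (\<lambda>b. G (\<lambda>e. of_bool (b e))) = G (\<lambda>e. if e \<in> A then p e else 0)"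
  using assms
proof (induction A arbitrary: G rule: finite_induct)
  case empty
  show ?case by (simp add: bern_exp_empty)
next
  case (insert e A)
  let ?P = "\<lambda>e. if e \<in> A then p e else 0"
  have upd: "(\<lambda>e'. of_bool ((b(e := s)) e')) = (\<lambda>e'. of_bool (b e'))(e := of_bool s)" for b s by auto
  have IH: "bern_exp A p (\<lambda>b. G ((\<lambda>e. of_bool (b e))(e := s))) = G (?P(e := s))" for s
  proof (rule insert.IH)
    show "0 \<le> p e \<and> p e \<le> 1" if "e \<in> A" for e using insert.prems(1) that by blast
    fix e' y and t :: real assume e': "e' \<in> A" and t: "0 \<le> t" "t \<le> 1"
    have ne: "e' \<noteq> e" using e' insert(2) by blast
    show "G ((y(e' := t))(e := s)) = t * G ((y(e' := 1))(e := s)) + (1 - t) * G ((y(e' := 0))(e := s))"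
      unfolding fun_upd_twist[OF ne] by (rule insert.prems(2)) (use e' t in auto)
  qed
  have pe: "0 \<le> p e" "p e \<le> 1" using insert.prems(1) by auto
  have "bern_exp (insert e A) p (\<lambda>b. G (\<lambda>e. of_bool (b e))) = p e * G (?P(e := 1)) + (1 - p e) * G (?P(e := 0))"
    unfolding bern_exp_insert[of A e p, OF insert(1,2) pe] upd IH by simp
  also have "\<dots> = G (?P(e := p e))" by (rule insert.prems(2)[symmetric]) (use pe in auto)
  also have "?P(e := p e) = (\<lambda>e'. if e' \<in> insert e A then p e' else 0)" by auto
  finally show ?case .
qed

text \<open>Induction on the set of bits: averaging one bit out lowers the second moment by its
  conditional variance, which is at most \<open>(c e)\<^sup>2\<close>.\<close>

lemma bern_exp_variance:
  assumes "finite A" and p: "\<And>e. e \<in> A \<Longrightarrow> 0 \<le> p e \<and> p e \<le> 1"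
    and d: "\<And>e b s. e \<in> A \<Longrightarrow> \<bar>F (b(e := s)) - F b\<bar> \<le> c e"
  shows "bern_exp A p (\<lambda>b. (F b - bern_exp A p F)\<^sup>2) \<le> (\<Sum>e\<in>A. (c e)\<^sup>2)"
  using assms
proof (induction A arbitrary: F rule: finite_induct)
  case empty
  show ?case by (simp add: bern_exp_empty)
next
  case (insert e A)
  have pe: "0 \<le> p e" "p e \<le> 1" using insert.prems(1) by auto
  define h where "h = (\<lambda>b. p e * F (b(e := True)) + (1 - p e) * F (b(e := False)))"
  define m where "m = bern_exp (insert e A) p F"
  have mh: "m = bern_exp A p h" unfolding m_def h_def bern_exp_insert[of A e p, OF insert(1,2) pe]
    by (simp add: bern_exp_add[OF insert(1)] bern_exp_cmult)
  have IH: "bern_exp A p (\<lambda>b. (h b - bern_exp A p h)\<^sup>2) \<le> (\<Sum>e\<in>A. (c e)\<^sup>2)"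
  proof (rule insert.IH)
    show "0 \<le> p e \<and> p e \<le> 1" if "e \<in> A" for e using insert.prems(1) that by blast
    fix e' b s assume e': "e' \<in> A"
    have ne: "e' \<noteq> e" using e' insert(2) by blast
    have d: "\<bar>F ((b(e' := s))(e := t)) - F (b(e := t))\<bar> \<le> c e'" for t
      unfolding fun_upd_twist[OF ne] using insert.prems(2) e' by blast
    have "h (b(e' := s)) - h b = p e * (F ((b(e' := s))(e := True)) - F (b(e := True))) + (1 - p e) * (F ((b(e' := s))(e := False)) - F (b(e := False)))"
      by (simp add: h_def algebra_simps)
    also have "\<bar>\<dots>\<bar> \<le> p e * c e' + (1 - p e) * c e'"
      using pe by (intro order.trans[OF abs_triangle_ineq] add_mono) (auto simp: abs_mult intro!: mult_left_mono d)
    finally show "\<bar>h (b(e' := s)) - h b\<bar> \<le> c e'" by (simp add: algebra_simps)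
  qed
  have pt: "p e * (F (b(e := True)) - m)\<^sup>2 + (1 - p e) * (F (b(e := False)) - m)\<^sup>2 \<le> (h b - m)\<^sup>2 + (c e)\<^sup>2" for b
  proof -
    let ?x = "F (b(e := True))" and ?y = "F (b(e := False))"
    have "\<bar>?x - ?y\<bar> \<le> c e" using insert.prems(2)[OF insertI1, of "b(e := False)" True] unfolding fun_upd_upd .
    then have xy: "(?x - ?y)\<^sup>2 \<le> (c e)\<^sup>2" by (metis abs_ge_zero order_trans power2_le_iff_abs_le)
    have "p e * (1 - p e) \<le> 1 * 1" using pe by (intro mult_mono) auto
    then have "p e * (1 - p e) * (?x - ?y)\<^sup>2 \<le> 1 * (?x - ?y)\<^sup>2" by (intro mult_right_mono) auto
    moreover have "p e * (?x - m)\<^sup>2 + (1 - p e) * (?y - m)\<^sup>2 = (h b - m)\<^sup>2 + p e * (1 - p e) * (?x - ?y)\<^sup>2"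
    proof -
      have "q * (x - m)\<^sup>2 + (1 - q) * (y - m)\<^sup>2 = (q * x + (1 - q) * y - m)\<^sup>2 + q * (1 - q) * (x - y)\<^sup>2" for q x y :: real
        by (simp add: power2_eq_square algebra_simps)
      then show ?thesis unfolding h_def by blast
    qed
    ultimately show ?thesis using xy by linarith
  qed
  have "bern_exp (insert e A) p (\<lambda>b. (F b - m)\<^sup>2) = bern_exp A p (\<lambda>b. p e * (F (b(e := True)) - m)\<^sup>2 + (1 - p e) * (F (b(e := False)) - m)\<^sup>2)"
    unfolding bern_exp_insert[of A e p, OF insert(1,2) pe] by (simp add: bern_exp_add[OF insert(1)] bern_exp_cmult)
  also have "\<dots> \<le> bern_exp A p (\<lambda>b. (h b - m)\<^sup>2 + (c e)\<^sup>2)" by (rule bern_exp_mono[OF insert(1) pt])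
  also have "\<dots> = bern_exp A p (\<lambda>b. (h b - m)\<^sup>2) + (c e)\<^sup>2" by (simp add: bern_exp_add[OF insert(1)] bern_exp_const)
  also have "\<dots> \<le> (\<Sum>e\<in>A. (c e)\<^sup>2) + (c e)\<^sup>2" using IH unfolding mh by simp
  finally show ?case using insert by (simp add: m_def)
qed

text \<open>Both expectations are compared with the one in which the bits of \<open>B\<close> are
  reset to \<open>False\<close>: it depends on the parameters outside \<open>B\<close>
  only.\<close>

lemma bern_exp_change_params:
  assumes A: "finite A" and p: "\<And>e. e \<in> A - B \<Longrightarrow> p e = p' e"
    and d: "\<And>b b'. (\<And>e. e \<in> A - B \<Longrightarrow> b e = b' e) \<Longrightarrow> \<bar>F b - F b'\<bar> \<le> c"
  shows "\<bar>bern_exp A p F - bern_exp A p' F\<bar> \<le> 2 * c"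
proof -
  let ?R = "\<lambda>b x. if x \<in> A - B then b x else False"
  have r: "bern_exp A q (\<lambda>b. F (?R b)) = bern_exp (A - B) q F" for q
    unfolding bern_exp_def using Pi_pmf_subset[OF A, of "A - B" False "\<lambda>e. bernoulli_pmf (q e)"] by (simp add: integral_map_pmf)
  have "bern_exp (A - B) p F = bern_exp (A - B) p' F"
    unfolding bern_exp_def using p A by (intro arg_cong[where f = "\<lambda>M. measure_pmf.expectation M F"] Pi_pmf_cong) auto
  moreover have "\<bar>bern_exp A q F - bern_exp A q (\<lambda>b. F (?R b))\<bar> \<le> c" for q
    by (rule bern_exp_abs_diff[OF A d]) simp
  from this[of p] this[of p'] calculation show ?thesis unfolding r by linarith
qed

lemma bern_exp_measurable:
  assumes "finite A" and m: "\<And>e. e \<in> A \<Longrightarrow> (\<lambda>\<eta>. p \<eta> e) \<in> borel_measurable N"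
    and p: "\<And>\<eta> e. \<eta> \<in> space N \<Longrightarrow> e \<in> A \<Longrightarrow> 0 \<le> p \<eta> e \<and> p \<eta> e \<le> 1"
  shows "(\<lambda>\<eta>. bern_exp A (p \<eta>) F) \<in> borel_measurable N"
  using assms
proof (induction A arbitrary: F rule: finite_induct)
  case empty
  show ?case by (simp add: bern_exp_empty)
next
  case (insert e A)
  have IH: "(\<lambda>\<eta>. bern_exp A (p \<eta>) F) \<in> borel_measurable N" for F by (rule insert.IH) (use insert.prems in auto)
  have "(\<lambda>\<eta>. p \<eta> e * bern_exp A (p \<eta>) (\<lambda>b. F (b(e := True))) + (1 - p \<eta> e) * bern_exp A (p \<eta>) (\<lambda>b. F (b(e := False)))) \<in> borel_measurable N"
    using IH insert.prems(1)[of e] by (intro borel_measurable_add borel_measurable_times borel_measurable_diff) auto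
  then show ?case
    by (rule measurable_cong[THEN iffD2, rotated]) (intro bern_exp_insert[OF insert(1,2)]; use insert.prems(2)[of _ e] in auto)
qed

section \<open>The characteristic function of a centred squared normal variable\<close>

lemma DERIV_integral_dominated:
  fixes f f' :: "real \<Rightarrow> 'a \<Rightarrow> real"
  assumes d: "\<And>y x. x \<in> space M \<Longrightarrow> ((\<lambda>y. f y x) has_real_derivative f' y x) (at y)"
    and w: "\<And>y x. x \<in> space M \<Longrightarrow> \<bar>f' y x\<bar> \<le> w x" "integrable M w"
    and i: "\<And>y. integrable M (f y)" and m: "f' y0 \<in> borel_measurable M"
  shows "((\<lambda>y. \<integral>x. f y x \<partial>M) has_real_derivative (\<integral>x. f' y0 x \<partial>M)) (at y0)"
  unfolding DERIV_def tendsto_at_iff_sequentially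
proof (intro allI impI)
  fix h :: "nat \<Rightarrow> real" assume h: "\<forall>i. h i \<in> UNIV - {0}" "h \<longlonglongrightarrow> 0"
  have h0: "h n \<noteq> 0" for n using h(1) by auto
  have "(\<lambda>n. \<integral>x. (f (y0 + h n) x - f y0 x) / h n \<partial>M) \<longlonglongrightarrow> (\<integral>x. f' y0 x \<partial>M)"
  proof (rule integral_dominated_convergence[where w = w])
    show "AE x in M. (\<lambda>n. (f (y0 + h n) x - f y0 x) / h n) \<longlonglongrightarrow> f' y0 x"
    proof (rule AE_I2)
      fix x assume "x \<in> space M"
      from d[OF this, of y0] show "(\<lambda>n. (f (y0 + h n) x - f y0 x) / h n) \<longlonglongrightarrow> f' y0 x"
        unfolding DERIV_def tendsto_at_iff_sequentially using h by (auto simp: comp_def)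
    qed
    show "AE x in M. norm ((f (y0 + h n) x - f y0 x) / h n) \<le> w x" for n
    proof (rule AE_I2)
      fix x assume x: "x \<in> space M"
      have "norm (f (y0 + h n) x - f y0 x) \<le> w x * norm (y0 + h n - y0)"
        by (rule field_differentiable_bound[of UNIV "\<lambda>y. f y x" "\<lambda>y. f' y x"]) (use d[OF x] w(1)[OF x] in auto)
      then show "norm ((f (y0 + h n) x - f y0 x) / h n) \<le> w x" using h0[of n] by (simp add: field_simps)
    qed
    show "(\<lambda>x. (f (y0 + h n) x - f y0 x) / h n) \<in> borel_measurable M" for n
      using i[THEN borel_measurable_integrable] by measurable
  qed (use w m in auto)
  moreover have "(\<integral>x. (f (y0 + h n) x - f y0 x) / h n \<partial>M) = ((\<integral>x. f (y0 + h n) x \<partial>M) - (\<integral>x. f y0 x \<partial>M)) / h n" for n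
    using i by simp
  ultimately show "((\<lambda>h. ((\<integral>x. f (y0 + h) x \<partial>M) - (\<integral>x. f y0 x \<partial>M)) / h) \<circ> h) \<longlonglongrightarrow> (\<integral>x. f' y0 x \<partial>M)"
    by (simp only: comp_def)
qed

interpretation normal: prob_space std_normal
  by (rule prob_space_normal_density) simp

lemma integral_std_normal: "f \<in> borel_measurable borel \<Longrightarrow>
    (\<integral>x. f x \<partial>std_normal) = (\<integral>x. std_normal_density x * f x \<partial>lborel)" for f :: "real \<Rightarrow> real"
  by (subst integral_density) auto

lemma integrable_std_normal_iff: "f \<in> borel_measurable borel \<Longrightarrow>
    integrable std_normal f \<longleftrightarrow> integrable lborel (\<lambda>x. std_normal_density x * f x)" for f :: "real \<Rightarrow> real"
  by (subst integrable_density) auto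

lemma integrable_std_normal_power: "integrable std_normal (\<lambda>x. x ^ k)"
  using integrable_std_normal_moment[of k] by (subst integrable_std_normal_iff) auto

text \<open>The integrand times the density is the derivative of \<open>x * g x *
  std_normal_density x\<close>, which vanishes at both ends.\<close>

lemma std_normal_FTC_zero:
  fixes g :: "real \<Rightarrow> real"
  assumes d: "\<And>x. (g has_real_derivative g' x) (at x)" and c: "\<And>x. isCont g' x"
    and b: "\<And>x. \<bar>g x\<bar> \<le> 1" "\<And>x. \<bar>g' x\<bar> \<le> C * (1 + x\<^sup>2)"
  shows "(\<integral>x. g x + x * g' x - x\<^sup>2 * g x \<partial>std_normal) = 0"
proof -
  let ?F = "\<lambda>x. x * g x * std_normal_density x"
  let ?f = "\<lambda>x. std_normal_density x * (g x + x * g' x - x\<^sup>2 * g x)"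
  have gc: "isCont g x" for x using d by (rule DERIV_isCont)
  have gm[measurable]: "g \<in> borel_measurable borel" "g' \<in> borel_measurable borel"
    using gc c by (auto intro!: borel_measurable_continuous_onI continuous_at_imp_continuous_on)
  have D: "(?F has_vector_derivative ?f x) (at x)" for x
  proof -
    have dphi: "(std_normal_density has_real_derivative (- x * std_normal_density x)) (at x)"
    proof -
      define c :: real where "c = 1 / sqrt (2 * pi)"
      have "((\<lambda>x. c * exp (- x\<^sup>2 / 2)) has_real_derivative (- x * (c * exp (- x\<^sup>2 / 2)))) (at x)"
        by (auto intro!: derivative_eq_intros)
      then show ?thesis unfolding std_normal_density_def c_def .
    qed
    show ?thesis
      unfolding has_real_derivative_iff_has_vector_derivative[symmetric]
      by (auto intro!: derivative_eq_intros d dphi simp: algebra_simps power2_eq_square)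
  qed
  have C0: "0 \<le> C" using b(2)[of 0] by (auto intro: order.trans[OF abs_ge_zero])
  have int: "integrable lborel ?f"
  proof -
    have i: "integrable std_normal (\<lambda>x. 1 + C * (\<bar>x\<bar> + \<bar>x ^ 3\<bar>) + x\<^sup>2)"
      using integrable_std_normal_power[of 1] integrable_std_normal_power[of 2] integrable_std_normal_power[of 3] by simp
    have "integrable std_normal (\<lambda>x. g x + x * g' x - x\<^sup>2 * g x)"
    proof (rule Bochner_Integration.integrable_bound[OF i])
      show "AE x in std_normal. norm (g x + x * g' x - x\<^sup>2 * g x) \<le> norm (1 + C * (\<bar>x\<bar> + \<bar>x ^ 3\<bar>) + x\<^sup>2)"
      proof (intro AE_I2)
        fix x :: real
        have "\<bar>x * g' x\<bar> \<le> \<bar>x\<bar> * (C * (1 + x\<^sup>2))" unfolding abs_mult by (intro mult_left_mono b) auto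
        also have "\<dots> = C * (\<bar>x\<bar> + \<bar>x ^ 3\<bar>)" proof -
          have "\<bar>x ^ 3\<bar> = \<bar>x\<bar> * x\<^sup>2" by (simp add: power3_eq_cube power2_eq_square abs_mult)
          then show ?thesis by (simp only: algebra_simps mult_1_right)
        qed
        finally have 1: "\<bar>x * g' x\<bar> \<le> C * (\<bar>x\<bar> + \<bar>x ^ 3\<bar>)" .
        have 2: "\<bar>x\<^sup>2 * g x\<bar> \<le> x\<^sup>2" using mult_left_mono[OF b(1)[of x], of "x\<^sup>2"] by (simp add: abs_mult)
        have "\<bar>g x + x * g' x - x\<^sup>2 * g x\<bar> \<le> \<bar>g x\<bar> + \<bar>x * g' x\<bar> + \<bar>x\<^sup>2 * g x\<bar>" by linarith
        also have "\<dots> \<le> 1 + C * (\<bar>x\<bar> + \<bar>x ^ 3\<bar>) + x\<^sup>2" using 1 2 b(1)[of x] by linarith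
        finally show "norm (g x + x * g' x - x\<^sup>2 * g x) \<le> norm (1 + C * (\<bar>x\<bar> + \<bar>x ^ 3\<bar>) + x\<^sup>2)"
          unfolding real_norm_def by linarith
      qed
    qed measurable
    then show ?thesis by (subst (asm) integrable_std_normal_iff) auto
  qed
  have lim: "((\<lambda>x::real. x * std_normal_density x) \<longlongrightarrow> 0) at_top" "((\<lambda>x::real. x * std_normal_density x) \<longlongrightarrow> 0) at_bot"
    unfolding std_normal_density_def by real_asymp+
  have Fl: "(?F \<longlongrightarrow> 0) l" if "((\<lambda>x. x * std_normal_density x) \<longlongrightarrow> 0) l" for l
  proof (rule Lim_null_comparison[OF _ tendsto_rabs_zero[OF that]])
    have "\<bar>x * g x * std_normal_density x\<bar> \<le> \<bar>x * std_normal_density x\<bar>" for x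
      using mult_right_mono[OF b(1)[of x], of "\<bar>x * std_normal_density x\<bar>"] by (simp add: abs_mult mult_ac)
    then show "eventually (\<lambda>x. norm (?F x) \<le> \<bar>x * std_normal_density x\<bar>) l" by simp
  qed
  have "(LBINT x=-\<infinity>..\<infinity>. ?f x) = 0 - 0"
  proof (rule interval_integral_FTC_integrable[where F = ?F])
    show "isCont ?f x" for x unfolding std_normal_density_def by (intro continuous_intros gc c) auto
    show "set_integrable lborel (einterval (-\<infinity>) \<infinity>) ?f" using int by (simp add: set_integrable_def)
    show "((?F \<circ> real_of_ereal) \<longlongrightarrow> 0) (at_right (- \<infinity>))" using Fl[OF lim(2)] by (simp add: ereal_tendsto_simps)
    show "((?F \<circ> real_of_ereal) \<longlongrightarrow> 0) (at_left \<infinity>)" using Fl[OF lim(1)] by (simp add: ereal_tendsto_simps)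
  qed (auto intro: D)
  then have "(\<integral>x. ?f x \<partial>lborel) = 0" by (simp add: interval_lebesgue_integral_def set_lebesgue_integral_def)
  then show ?thesis by (subst integral_std_normal) auto
qed

text \<open>A logarithm of \<open>(1 - 2 * \<i> * y) powr (-1/2) * exp (- \<i> * y)\<close>,
  written in real and imaginary part.\<close>

definition log_cf :: "real \<Rightarrow> complex" where
  "log_cf y = Complex (- ln (1 + 4 * y\<^sup>2) / 4) (arctan (2 * y) / 2 - y)"

text \<open>Let \<open>F\<close> be the characteristic function of the square. Integration by
  parts expresses its derivative by \<open>F\<close> itself, \<open>F' = q * F\<close> with
  \<open>q y = \<i> / (1 - 2 * \<i> * y)\<close>; the differential equation has only one solution
  with value 1 at 0.\<close>

theorem cf_normal_square:
  "(CLINT x|std_normal. iexp (y * (x\<^sup>2 - 1))) = exp (log_cf y)"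
proof -
  define C where "C = (\<lambda>y. \<integral>x. cos (y * x\<^sup>2) \<partial>std_normal)"
  define S where "S = (\<lambda>y. \<integral>x. sin (y * x\<^sup>2) \<partial>std_normal)"
  define C2 where "C2 = (\<lambda>y. \<integral>x. x\<^sup>2 * cos (y * x\<^sup>2) \<partial>std_normal)"
  define S2 where "S2 = (\<lambda>y. \<integral>x. x\<^sup>2 * sin (y * x\<^sup>2) \<partial>std_normal)"
  have i0: "integrable std_normal (\<lambda>x. cos (y * x\<^sup>2))" "integrable std_normal (\<lambda>x. sin (y * x\<^sup>2))" for y
    by (auto intro!: normal.integrable_const_bound[where B = 1])
  have i2: "integrable std_normal (\<lambda>x. x\<^sup>2 * cos (y * x\<^sup>2))" "integrable std_normal (\<lambda>x. x\<^sup>2 * sin (y * x\<^sup>2))" for y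
    by (rule Bochner_Integration.integrable_bound[OF integrable_std_normal_power[of 2]]; auto simp: abs_mult mult_left_le)+
  have dC: "(C has_real_derivative - S2 y) (at y)" for y
  proof -
    have "((\<lambda>y. \<integral>x. cos (y * x\<^sup>2) \<partial>std_normal) has_real_derivative (\<integral>x. - (x\<^sup>2 * sin (y * x\<^sup>2)) \<partial>std_normal)) (at y)"
      by (rule DERIV_integral_dominated[where w = "\<lambda>x. x\<^sup>2"])
        (auto intro!: derivative_eq_intros i0 integrable_std_normal_power simp: abs_mult mult_left_le)
    then show ?thesis by (simp add: C_def S2_def)
  qed
  have dS: "(S has_real_derivative C2 y) (at y)" for y
  proof -
    have "((\<lambda>y. \<integral>x. sin (y * x\<^sup>2) \<partial>std_normal) has_real_derivative (\<integral>x. x\<^sup>2 * cos (y * x\<^sup>2) \<partial>std_normal)) (at y)"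
      by (rule DERIV_integral_dominated[where w = "\<lambda>x. x\<^sup>2"])
        (auto intro!: derivative_eq_intros i0 integrable_std_normal_power simp: abs_mult mult_left_le)
    then show ?thesis by (simp add: S_def C2_def)
  qed
  have bnd: "\<bar>2 * y * x * t\<bar> \<le> \<bar>2 * y\<bar> * (1 + x\<^sup>2)" if "\<bar>t\<bar> \<le> 1" for y x t :: real
  proof -
    have "\<bar>x\<bar> \<le> 1 + x\<^sup>2" using sum_squares_bound[of 1 "\<bar>x\<bar>"] by (simp; linarith)
    then have "\<bar>x\<bar> * \<bar>t\<bar> \<le> (1 + x\<^sup>2) * 1" using that by (intro mult_mono) auto
    from mult_left_mono[OF this, of "\<bar>2 * y\<bar>"] show ?thesis by (simp add: abs_mult mult_ac)
  qed
  have e1: "C y - 2 * y * S2 y - C2 y = 0" for y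
  proof -
    have "(\<integral>x. cos (y * x\<^sup>2) + x * (- (2 * y * x * sin (y * x\<^sup>2))) - x\<^sup>2 * cos (y * x\<^sup>2) \<partial>std_normal) = 0"
      by (rule std_normal_FTC_zero[where C = "\<bar>2 * y\<bar>"]) (auto intro!: derivative_eq_intros continuous_intros simp del: abs_mult simp: bnd)
    also have "(\<lambda>x. cos (y * x\<^sup>2) + x * (- (2 * y * x * sin (y * x\<^sup>2))) - x\<^sup>2 * cos (y * x\<^sup>2)) =
        (\<lambda>x. cos (y * x\<^sup>2) - 2 * y * (x\<^sup>2 * sin (y * x\<^sup>2)) - x\<^sup>2 * cos (y * x\<^sup>2))" by (auto simp: power2_eq_square fun_eq_iff)
    finally show ?thesis using i0 i2 by (simp add: C_def S2_def C2_def)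
  qed
  have e2: "S y + 2 * y * C2 y - S2 y = 0" for y
  proof -
    have "(\<integral>x. sin (y * x\<^sup>2) + x * (2 * y * x * cos (y * x\<^sup>2)) - x\<^sup>2 * sin (y * x\<^sup>2) \<partial>std_normal) = 0"
      by (rule std_normal_FTC_zero[where C = "\<bar>2 * y\<bar>"]) (auto intro!: derivative_eq_intros continuous_intros simp del: abs_mult simp: bnd)
    also have "(\<lambda>x. sin (y * x\<^sup>2) + x * (2 * y * x * cos (y * x\<^sup>2)) - x\<^sup>2 * sin (y * x\<^sup>2)) =
        (\<lambda>x. sin (y * x\<^sup>2) + 2 * y * (x\<^sup>2 * cos (y * x\<^sup>2)) - x\<^sup>2 * sin (y * x\<^sup>2))" by (auto simp: power2_eq_square fun_eq_iff)
    finally show ?thesis using i0 i2 by (simp add: S_def S2_def C2_def)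
  qed
  define F where "F = (\<lambda>y. Complex (C y) (S y))"
  define L where "L = (\<lambda>y. Complex (- ln (1 + 4 * y\<^sup>2) / 4) (arctan (2 * y) / 2))"
  define q where "q = (\<lambda>y. Complex (- 2 * y / (1 + 4 * y\<^sup>2)) (1 / (1 + 4 * y\<^sup>2)))"
  have pos: "1 + 4 * y\<^sup>2 > 0" for y :: real by (simp add: add_pos_nonneg)
  have dF: "(F has_vector_derivative (q y * F y)) (at y)" for y
  proof -
    have C2e: "C2 y = (C y - 2 * y * S y) / (1 + 4 * y\<^sup>2)" and S2e: "S2 y = (S y + 2 * y * C y) / (1 + 4 * y\<^sup>2)"
    proof -
      have s: "S2 y = S y + 2 * y * C2 y" "C2 y = C y - 2 * y * S2 y" using e1[of y] e2[of y] by auto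
      have "C2 y = C y - 2 * y * (S y + 2 * y * C2 y)" by (subst s(1)[symmetric]) (rule s(2))
      then have "C2 y - (C y - 2 * y * (S y + 2 * y * C2 y)) = 0" by simp
      moreover have "C2 y * (1 + 4 * y\<^sup>2) - (C y - 2 * y * S y) = C2 y - (C y - 2 * y * (S y + 2 * y * C2 y))"
        by (simp add: algebra_simps power2_eq_square)
      ultimately have "C2 y * (1 + 4 * y\<^sup>2) = C y - 2 * y * S y" by linarith
      then show "C2 y = (C y - 2 * y * S y) / (1 + 4 * y\<^sup>2)" using pos[of y] by (simp add: field_simps)
      have "S2 y = S y + 2 * y * (C y - 2 * y * S2 y)" by (subst s(2)[symmetric]) (rule s(1))
      then have "S2 y - (S y + 2 * y * (C y - 2 * y * S2 y)) = 0" by simp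
      moreover have "S2 y * (1 + 4 * y\<^sup>2) - (S y + 2 * y * C y) = S2 y - (S y + 2 * y * (C y - 2 * y * S2 y))"
        by (simp add: algebra_simps power2_eq_square)
      ultimately have "S2 y * (1 + 4 * y\<^sup>2) = S y + 2 * y * C y" by linarith
      then show "S2 y = (S y + 2 * y * C y) / (1 + 4 * y\<^sup>2)" using pos[of y] by (simp add: field_simps)
    qed
    have "q y * F y = Complex (- S2 y) (C2 y)"
      unfolding q_def F_def C2e S2e by (simp add: complex_eq_iff add_divide_distrib diff_divide_distrib)
    moreover have "(F has_vector_derivative Complex (- S2 y) (C2 y)) (at y)"
      unfolding has_vector_derivative_complex_iff F_def using dC[of y] dS[of y] by simp
    ultimately show ?thesis by simp
  qed
  have dL: "(L has_vector_derivative q y) (at y)" for y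
    unfolding has_vector_derivative_complex_iff L_def q_def
    using pos[of y] by (auto intro!: derivative_eq_intros simp: power2_eq_square field_simps)
  have "((\<lambda>y. F y * exp (- L y)) has_vector_derivative 0) (at y)" for y
  proof -
    have "((\<lambda>y. exp (- L y)) has_vector_derivative (- q y * exp (- L y))) (at y)"
      using field_vector_diff_chain_at[OF has_vector_derivative_minus[OF dL] DERIV_exp] by (simp add: comp_def)
    from has_vector_derivative_mult[OF dF this] show ?thesis by (simp add: mult_ac)
  qed
  then obtain c where c: "\<And>y. F y * exp (- L y) = c"
    using has_vector_derivative_zero_constant[of UNIV "\<lambda>y. F y * exp (- L y)"] by auto
  have "F 0 = 1" "L 0 = 0" using normal.prob_space by (auto simp: F_def C_def S_def L_def complex_eq_iff)
  then have "c = 1" using c[of 0] by simp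
  then have FL: "F y = exp (L y)" using c[of y] by (simp add: exp_minus field_simps)
  have fi: "(CLINT x|std_normal. iexp (y * x\<^sup>2)) = F y"
  proof -
    have "(CLINT x|std_normal. iexp (y * x\<^sup>2)) = (CLINT x|std_normal. of_real (cos (y * x\<^sup>2)) + \<i> * of_real (sin (y * x\<^sup>2)))"
      by (intro Bochner_Integration.integral_cong) (auto simp: exp_eq_polar cis.ctr complex_eq_iff simp flip: of_real_mult)
    also have "\<dots> = of_real (C y) + \<i> * of_real (S y)"
      using i0[of y] by (simp add: C_def S_def)
    finally show ?thesis by (simp add: F_def complex_eq_iff)
  qed
  have "(CLINT x|std_normal. iexp (y * (x\<^sup>2 - 1))) = (CLINT x|std_normal. iexp (- y) * iexp (y * x\<^sup>2))"
    by (intro Bochner_Integration.integral_cong) (auto simp: algebra_simps exp_add[symmetric])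
  also have "\<dots> = iexp (- y) * F y" by (simp only: integral_mult_right_zero fi)
  also have "\<dots> = exp (log_cf y)"
    unfolding FL exp_add[symmetric] by (rule arg_cong[of _ _ exp]) (simp add: L_def log_cf_def complex_eq_iff)
  finally show ?thesis .
qed

text \<open>The value at 0 is the limit, as \<open>log_cf y\<close> is \<open>- y\<^sup>2\<close>
  up to higher order.\<close>

definition log_cf_quot :: "real \<Rightarrow> complex" where
  "log_cf_quot y = (if y = 0 then -1 else log_cf y / of_real (y\<^sup>2))"

lemma log_cf_eq_quot: "log_cf y = of_real (y\<^sup>2) * log_cf_quot y"
  by (auto simp: log_cf_quot_def log_cf_def complex_eq_iff)

lemma isCont_log_cf_quot: "isCont log_cf_quot y"
proof (cases "y = 0")
  case True
  have "((\<lambda>y::real. (- ln (1 + 4 * y\<^sup>2) / 4) / y\<^sup>2) \<longlongrightarrow> -1) (at 0)" by real_asymp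
  moreover have "((\<lambda>y::real. (arctan (2 * y) / 2 - y) / y\<^sup>2) \<longlongrightarrow> 0) (at 0)" by real_asymp
  ultimately have "((\<lambda>y. Complex ((- ln (1 + 4 * y\<^sup>2) / 4) / y\<^sup>2) ((arctan (2 * y) / 2 - y) / y\<^sup>2)) \<longlongrightarrow> Complex (-1) 0) (at 0)"
    by (rule tendsto_Complex)
  moreover have "eventually (\<lambda>y. Complex ((- ln (1 + 4 * y\<^sup>2) / 4) / y\<^sup>2) ((arctan (2 * y) / 2 - y) / y\<^sup>2) = log_cf_quot y) (at 0)"
    unfolding eventually_at_filter by (auto simp: log_cf_quot_def log_cf_def complex_eq_iff simp flip: of_real_power)
  ultimately have "(log_cf_quot \<longlongrightarrow> Complex (-1) 0) (at 0)" by (rule Lim_transform_eventually)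
  then show ?thesis by (simp add: isCont_def True log_cf_quot_def complex_eq_iff Complex_eq)
next
  case False
  have "isCont (\<lambda>y. log_cf y / of_real (y\<^sup>2)) y"
    unfolding log_cf_def Complex_eq using False by (intro continuous_intros) (auto simp: add_nonneg_eq_0_iff)
  moreover have ev: "eventually (\<lambda>x. log_cf x / of_real (x\<^sup>2) = log_cf_quot x) (nhds y)"
    using t1_space_nhds[OF False] by eventually_elim (simp add: log_cf_quot_def)
  ultimately show ?thesis using isCont_cong[OF ev] by simp
qed

section \<open>From power sums to continuous test functions\<close>

text \<open>Power sums of order at least 2 determine the sums of \<open>x\<^sup>2 * h x\<close>
  for polynomials \<open>h\<close>; these are uniformly dense on \<open>{-1..1}\<close>, and the
  sums of squares are bounded. The excess \<open>v\<close> in the sum of squares acts as a point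
  mass at the origin.\<close>

lemma test_function_convergence_real:
  fixes x :: "nat \<Rightarrow> nat \<Rightarrow> real" and lam :: "'i \<Rightarrow> real" and h :: "real \<Rightarrow> real"
  assumes x1: "\<And>n s. s \<in> A n \<Longrightarrow> \<bar>x n s\<bar> \<le> 1" and l1: "\<And>i. i \<in> I \<Longrightarrow> \<bar>lam i\<bar> \<le> 1" and v: "0 \<le> v"
    and M: "\<And>k. ((\<lambda>i. lam i ^ (k + 2)) has_sum M k) I"
    and conv: "\<And>k. (\<lambda>n. \<Sum>s\<in>A n. x n s ^ (k + 2)) \<longlonglongrightarrow> M k + (if k = 0 then v else 0)"
    and h: "continuous_on {-1..1} h"
  shows "(\<lambda>i. (lam i)\<^sup>2 * h (lam i)) summable_on I"
    and "(\<lambda>n. \<Sum>s\<in>A n. (x n s)\<^sup>2 * h (x n s)) \<longlonglongrightarrow> infsum (\<lambda>i. (lam i)\<^sup>2 * h (lam i)) I + v * h 0"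
proof -
  have M2: "((\<lambda>i. (lam i)\<^sup>2) has_sum M 0) I" using M[of 0] by (simp add: numeral_2_eq_2)
  have l2: "(\<lambda>i. (lam i)\<^sup>2) summable_on I" using M2 by (auto simp: summable_on_def)
  have M0: "0 \<le> M 0" using has_sum_nonneg[OF M2] by simp
  have summ: "(\<lambda>i. (lam i)\<^sup>2 * g (lam i)) summable_on I"
    if B: "\<And>y. y \<in> {-1..1} \<Longrightarrow> \<bar>g y\<bar> \<le> B" for g :: "real \<Rightarrow> real" and B
  proof -
    have "(\<lambda>i. norm ((lam i)\<^sup>2 * g (lam i))) summable_on I"
    proof (rule summable_on_comparison_test[OF summable_on_cmult_right[OF l2, of B]])
      show "norm ((lam i)\<^sup>2 * g (lam i)) \<le> B * (lam i)\<^sup>2" if "i \<in> I" for i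
        using B[of "lam i"] l1[OF that] by (auto simp: mult.commute[of B] abs_mult abs_le_iff intro!: mult_left_mono)
    qed auto
    then show ?thesis by (rule abs_summable_summable)
  qed
  have bnd: "\<exists>B. \<forall>y\<in>{-1..1}. \<bar>g y\<bar> \<le> B" if "continuous_on {-1..1} g" for g :: "real \<Rightarrow> real"
    using compact_imp_bounded[OF compact_continuous_image[OF that compact_Icc]] by (auto simp: bounded_iff)
  show sh: "(\<lambda>i. (lam i)\<^sup>2 * h (lam i)) summable_on I" using bnd[OF h] summ by blast
  define T where "T = (\<lambda>n g. \<Sum>s\<in>A n. (x n s)\<^sup>2 * g (x n s))"
  define L where "L = (\<lambda>g. infsum (\<lambda>i. (lam i)\<^sup>2 * g (lam i)) I + v * g 0)"
  have poly: "(\<lambda>n. T n (\<lambda>y. \<Sum>k\<le>m. a k * y ^ k)) \<longlonglongrightarrow> L (\<lambda>y. \<Sum>k\<le>m. a k * y ^ k)" for m :: nat and a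
  proof -
    have "(\<lambda>n. \<Sum>k\<le>m. a k * (\<Sum>s\<in>A n. x n s ^ (k + 2))) \<longlonglongrightarrow> (\<Sum>k\<le>m. a k * (M k + (if k = 0 then v else 0)))"
      by (intro tendsto_sum tendsto_mult conv tendsto_const)
    moreover have "(\<Sum>k\<le>m. a k * (\<Sum>s\<in>A n. x n s ^ (k + 2))) = T n (\<lambda>y. \<Sum>k\<le>m. a k * y ^ k)" for n
      unfolding T_def sum_distrib_left by (subst sum.swap) (simp add: power_add mult_ac power2_eq_square)
    moreover have "(\<Sum>k\<le>m. a k * (M k + (if k = 0 then v else 0))) = L (\<lambda>y. \<Sum>k\<le>m. a k * y ^ k)"
    proof -
      have "((\<lambda>i. \<Sum>k\<le>m. a k * lam i ^ (k + 2)) has_sum (\<Sum>k\<le>m. a k * M k)) I"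
      proof (induction m)
        case 0
        show ?case using has_sum_cmult_right[OF M[of 0], of "a 0"] by simp
      next
        case (Suc m)
        show ?case unfolding sum.atMost_Suc by (intro has_sum_add Suc has_sum_cmult_right M)
      qed
      then have "infsum (\<lambda>i. (lam i)\<^sup>2 * (\<Sum>k\<le>m. a k * lam i ^ k)) I = (\<Sum>k\<le>m. a k * M k)"
        by (intro infsumI) (simp add: power_add mult_ac sum_distrib_left power2_eq_square)
      moreover have "(\<Sum>k\<le>m. a k * (if k = 0 then v else 0)) = v * a 0"
        by (simp add: if_distrib[of "\<lambda>z. a _ * z"] mult.commute cong: if_cong)
      moreover have "(\<Sum>k\<le>m. a k * 0 ^ k) = a 0" by (simp add: power_0_left if_distrib[of "\<lambda>z. a _ * z"] cong: if_cong)
      ultimately show ?thesis by (simp add: L_def distrib_left sum.distrib)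
    qed
    ultimately show ?thesis by simp
  qed
  have "(\<lambda>n. \<Sum>s\<in>A n. (x n s)\<^sup>2) \<longlonglongrightarrow> M 0 + v" using conv[of 0] by (simp add: numeral_2_eq_2)
  then have "Bseq (\<lambda>n. \<Sum>s\<in>A n. (x n s)\<^sup>2)" by (intro convergent_imp_Bseq convergentI)
  then obtain C where C: "C > 0" "\<And>n. (\<Sum>s\<in>A n. (x n s)\<^sup>2) \<le> C" by (auto simp: Bseq_def abs_le_iff)
  have "(\<lambda>n. T n h) \<longlonglongrightarrow> L h"
  proof (rule LIMSEQ_I)
    fix e :: real assume e: "e > 0"
    define X where "X = C + M 0 + v + 1"
    define d where "d = e / (3 * X)"
    have den: "X > 0" using C M0 v unfolding X_def by linarith
    have d: "d > 0" using e den by (simp add: d_def)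
    obtain p where p: "real_polynomial_function p" "\<And>y. y \<in> {-1..1} \<Longrightarrow> \<bar>h y - p y\<bar> < d"
      using Stone_Weierstrass_real_polynomial_function[OF compact_Icc h d] by blast
    obtain a m where pe: "p = (\<lambda>y. \<Sum>k\<le>m. a k * y ^ k)" using p(1) unfolding real_polynomial_function_iff_sum by blast
    have dC: "d * C < e / 3" "d * (M 0 + v) < e / 3"
    proof -
      have "d * X = e / 3" using den by (simp add: d_def)
      moreover have "d * C < d * X" "d * (M 0 + v) < d * X" using d C M0 v unfolding X_def by auto
      ultimately show "d * C < e / 3" "d * (M 0 + v) < e / 3" by linarith+
    qed
    have 1: "\<bar>T n h - T n p\<bar> \<le> d * C" for n
    proof -
      have "\<bar>T n h - T n p\<bar> = \<bar>\<Sum>s\<in>A n. (x n s)\<^sup>2 * (h (x n s) - p (x n s))\<bar>"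
        by (simp add: T_def right_diff_distrib sum_subtractf)
      also have "\<dots> \<le> (\<Sum>s\<in>A n. \<bar>(x n s)\<^sup>2 * (h (x n s) - p (x n s))\<bar>)" by (rule sum_abs)
      also have "\<dots> \<le> (\<Sum>s\<in>A n. d * (x n s)\<^sup>2)"
      proof (rule sum_mono)
        fix s assume "s \<in> A n"
        then have "\<bar>h (x n s) - p (x n s)\<bar> \<le> d" using p(2)[of "x n s"] x1[of s n] by (simp add: abs_le_iff less_imp_le)
        then show "\<bar>(x n s)\<^sup>2 * (h (x n s) - p (x n s))\<bar> \<le> d * (x n s)\<^sup>2"
          by (simp add: abs_mult mult.commute[of d] mult_left_mono)
      qed
      also have "\<dots> \<le> d * C" using C(2)[of n] d by (simp add: sum_distrib_left[symmetric])
      finally show ?thesis .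
    qed
    have 2: "\<bar>L h - L p\<bar> \<le> d * (M 0 + v)"
    proof -
      obtain B where B: "\<And>y. y \<in> {-1..1} \<Longrightarrow> \<bar>h y\<bar> \<le> B" using bnd[OF h] by blast
      have pB: "\<bar>p y\<bar> \<le> B + d" if "y \<in> {-1..1}" for y using B[OF that] p(2)[OF that] by linarith
      have sp: "(\<lambda>i. - ((lam i)\<^sup>2 * p (lam i))) summable_on I"
        using summ[of p "B + d", OF pB] by (simp add: summable_on_uminus)
      have diff: "L h - L p = infsum (\<lambda>i. (lam i)\<^sup>2 * (h (lam i) - p (lam i))) I + v * (h 0 - p 0)"
        using infsum_add[OF summ[of h B, OF B] sp] by (simp add: L_def right_diff_distrib infsum_uminus)
      have sd: "(\<lambda>i. (lam i)\<^sup>2 * (h (lam i) - p (lam i))) summable_on I"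
        using summable_on_add[OF summ[of h B, OF B] sp] by (simp add: right_diff_distrib)
      have pt: "\<bar>(lam i)\<^sup>2 * (h (lam i) - p (lam i))\<bar> \<le> d * (lam i)\<^sup>2" if "i \<in> I" for i
      proof -
        have "\<bar>h (lam i) - p (lam i)\<bar> \<le> d" using p(2)[of "lam i"] l1[OF that] by (simp add: abs_le_iff less_imp_le)
        then show ?thesis by (simp add: abs_mult mult.commute[of d] mult_left_mono)
      qed
      have dM: "((\<lambda>i. d * (lam i)\<^sup>2) has_sum (d * M 0)) I" by (rule has_sum_cmult_right[OF M2])
      have "infsum (\<lambda>i. (lam i)\<^sup>2 * (h (lam i) - p (lam i))) I \<le> d * M 0"
        by (rule has_sum_mono[OF has_sum_infsum[OF sd] dM]) (use pt in \<open>auto simp: abs_le_iff\<close>)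
      moreover have "infsum (\<lambda>i. - ((lam i)\<^sup>2 * (h (lam i) - p (lam i)))) I \<le> d * M 0"
        by (rule has_sum_mono[OF has_sum_infsum[OF summable_on_uminus[THEN iffD2, OF sd]] dM]) (use pt in \<open>auto simp: abs_le_iff\<close>)
      ultimately have "\<bar>infsum (\<lambda>i. (lam i)\<^sup>2 * (h (lam i) - p (lam i))) I\<bar> \<le> d * M 0"
        by (simp add: infsum_uminus)
      moreover have "\<bar>v * (h 0 - p 0)\<bar> \<le> d * v" using p(2)[of 0] v by (simp add: abs_mult mult.commute[of d] mult_left_mono)
      ultimately show ?thesis unfolding diff by (simp add: distrib_left)
    qed
    obtain N where N: "\<And>n. n \<ge> N \<Longrightarrow> \<bar>T n p - L p\<bar> < e / 3"
      using LIMSEQ_D[OF poly[of a m], of "e/3"] e unfolding pe by auto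
    have "norm (T n h - L h) < e" if "n \<ge> N" for n
    proof -
      have "\<bar>T n h - L h\<bar> \<le> \<bar>T n h - T n p\<bar> + \<bar>T n p - L p\<bar> + \<bar>L h - L p\<bar>" by linarith
      then show ?thesis unfolding real_norm_def using 1[of n] 2 N[OF that] dC by linarith
    qed
    then show "\<exists>N. \<forall>n\<ge>N. norm (T n h - L h) < e" by blast
  qed
  then show "(\<lambda>n. \<Sum>s\<in>A n. (x n s)\<^sup>2 * h (x n s)) \<longlonglongrightarrow> infsum (\<lambda>i. (lam i)\<^sup>2 * h (lam i)) I + v * h 0"
    by (simp add: T_def L_def)
qed

section \<open>Subtournament averages\<close>

text \<open>The density of \<open>\<Phi>\<close> in \<open>a\<close>: vertices are drawn with
  replacement, so that densities are exactly traces of powers.\<close>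

definition avg :: "nat \<Rightarrow> nat \<Rightarrow> ((nat \<Rightarrow> nat \<Rightarrow> real) \<Rightarrow> real) \<Rightarrow> (nat \<Rightarrow> nat \<Rightarrow> real) \<Rightarrow> real" where
  "avg n m \<Phi> a = (\<integral>x. \<Phi> (\<lambda>i j. a (x i) (x j)) \<partial>PiM {..<m} (\<lambda>_. unif n))"

lemma integral_unif_of_bool: "n \<ge> 1 \<Longrightarrow> u \<in> {1..n} \<Longrightarrow> (\<integral>y. of_bool (y = u) \<partial>unif n) = 1 / real n"
  by (simp add: integral_unif of_bool_def del: One_nat_def)

lemma of_bool_mult_of_bool_eq:
  "of_bool (p = u) * of_bool (q = u) = (if p = u then of_bool (p = q) else 0 :: real)"
  by auto

context
  fixes n m :: nat
  assumes n: "n \<ge> 1"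
begin

interpretation P: prob_space "unif n" by (rule prob_space_unif[OF n])
interpretation PP: product_prob_space "\<lambda>_::nat. unif n" by (rule P.product_prob_space_const)
interpretation PM: prob_space "PiM {..<m} (\<lambda>_::nat. unif n)" by (rule P.prob_space_PiM_const)

lemma integrable_unif: "integrable (unif n) (f :: nat \<Rightarrow> real)"
  using P.bfun_integrable[OF P.bker_slice1[OF bker_unif[OF n, of "\<lambda>_. f"]]] P.not_empty by blast

lemma integrable_PiM_unif: "integrable (PiM {..<m} (\<lambda>_::nat. unif n)) (f :: (nat \<Rightarrow> nat) \<Rightarrow> real)"
proof (rule P.integrable_PiM_bounded)
  show "f \<in> borel_measurable (PiM {..<m} (\<lambda>_. unif n))" by (rule measurable_PiM_unif) simp
  fix x assume "x \<in> space (PiM {..<m} (\<lambda>_. unif n))"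
  then show "\<bar>f x\<bar> \<le> (\<Sum>x\<in>PiE {..<m} (\<lambda>_. {1..n}). \<bar>f x\<bar>)"
    unfolding space_PiM_unif by (intro member_le_sum finite_PiE) auto
qed

lemma integral_hit1:
  assumes "i < m" "u \<in> {1..n}"
  shows "(\<integral>x. of_bool (x i = u) \<partial>PiM {..<m} (\<lambda>_. unif n)) = 1 / real n"
proof -
  let ?f = "\<lambda>k y. if k = i then of_bool (y = u) else 1 :: real"
  have "(\<integral>x. (\<Prod>k<m. ?f k (x k)) \<partial>PiM {..<m} (\<lambda>_. unif n)) = (\<Prod>k<m. \<integral>y. ?f k y \<partial>unif n)"
    by (intro PP.product_integral_prod integrable_unif) simp
  also have "(\<Prod>k<m. \<integral>y. ?f k y \<partial>unif n) = (\<Prod>k<m. if k = i then 1 / real n else 1)"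
    using integral_unif_of_bool[OF n assms(2)] P.prob_space by (intro prod.cong) auto
  finally show ?thesis using assms(1) by simp
qed

lemma integral_hit2:
  assumes "i < m" "j < m" "i \<noteq> j" "u \<in> {1..n}" "v \<in> {1..n}"
  shows "(\<integral>x. of_bool (x i = u) * of_bool (x j = v) \<partial>PiM {..<m} (\<lambda>_. unif n)) = 1 / (real n)\<^sup>2"
proof -
  let ?f = "\<lambda>k y. if k = i then of_bool (y = u) else if k = j then of_bool (y = v) else 1 :: real"
  have "(\<integral>x. (\<Prod>k<m. ?f k (x k)) \<partial>PiM {..<m} (\<lambda>_. unif n)) = (\<Prod>k<m. \<integral>y. ?f k y \<partial>unif n)"
    by (intro PP.product_integral_prod integrable_unif) simp
  also have "(\<Prod>k<m. \<integral>y. ?f k y \<partial>unif n) = (\<Prod>k<m. (if k = i then 1 / real n else 1) * (if k = j then 1 / real n else 1))"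
    using integral_unif_of_bool[OF n assms(4)] integral_unif_of_bool[OF n assms(5)] P.prob_space assms(3)
    by (intro prod.cong) auto
  also have "\<dots> = 1 / (real n)\<^sup>2" using assms unfolding prod.distrib by (simp add: power2_eq_square)
  also have "(\<lambda>x. \<Prod>k<m. ?f k (x k)) = (\<lambda>x. of_bool (x i = u) * of_bool (x j = v))"
  proof
    fix x :: "nat \<Rightarrow> nat"
    have "(\<Prod>k<m. ?f k (x k)) = (\<Prod>k<m. (if k = i then of_bool (x i = u) else 1) * (if k = j then of_bool (x j = v) else 1))"
      using assms(3) by (intro prod.cong) auto
    also have "\<dots> = of_bool (x i = u) * of_bool (x j = v)" using assms unfolding prod.distrib by simp
    finally show "(\<Prod>k<m. ?f k (x k)) = of_bool (x i = u) * of_bool (x j = v)" .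
  qed
  finally show ?thesis .
qed

lemma integral_collision:
  assumes "i < m" "j < m" "i \<noteq> j"
  shows "(\<integral>x. of_bool (x i = x j) \<partial>PiM {..<m} (\<lambda>_. unif n)) = 1 / real n"
proof -
  have "(\<integral>x. (of_bool (x i = x j) :: real) \<partial>PiM {..<m} (\<lambda>_. unif n))
      = (\<integral>x. (\<Sum>u=1..n. of_bool (x i = u) * of_bool (x j = u) :: real) \<partial>PiM {..<m} (\<lambda>_. unif n))"
  proof (rule Bochner_Integration.integral_cong[OF refl])
    fix x assume "x \<in> space (PiM {..<m} (\<lambda>_. unif n))"
    then have "x i \<in> {1..n}" unfolding space_PiM_unif by (rule PiE_mem) (simp add: assms(1))
    then show "of_bool (x i = x j) = (\<Sum>u=1..n. of_bool (x i = u) * of_bool (x j = u) :: real)"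
      unfolding of_bool_mult_of_bool_eq by (subst sum.delta') (rule finite_atLeastAtMost, rule if_P[symmetric])
  qed
  also have "\<dots> = (\<Sum>u=1..n. \<integral>x. of_bool (x i = u) * of_bool (x j = u) \<partial>PiM {..<m} (\<lambda>_. unif n))"
    by (intro Bochner_Integration.integral_sum integrable_PiM_unif)
  also have "\<dots> = (\<Sum>u=1..n. 1 / (real n)\<^sup>2)" by (intro sum.cong refl integral_hit2 assms)
  also have "\<dots> = 1 / real n" using n by (simp add: power2_eq_square)
  finally show ?thesis .
qed

lemma integral_diff_le:
  fixes F G H :: "(nat \<Rightarrow> nat) \<Rightarrow> real"
  assumes "\<And>x. x \<in> PiE {..<m} (\<lambda>_. {1..n}) \<Longrightarrow> \<bar>F x - G x\<bar> \<le> H x"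
  shows "\<bar>(\<integral>x. F x \<partial>PiM {..<m} (\<lambda>_. unif n)) - (\<integral>x. G x \<partial>PiM {..<m} (\<lambda>_. unif n))\<bar> \<le> (\<integral>x. H x \<partial>PiM {..<m} (\<lambda>_. unif n))"
proof -
  have "(\<integral>x. F x \<partial>PiM {..<m} (\<lambda>_. unif n)) - (\<integral>x. G x \<partial>PiM {..<m} (\<lambda>_. unif n)) = (\<integral>x. F x - G x \<partial>PiM {..<m} (\<lambda>_. unif n))"
    by (intro Bochner_Integration.integral_diff[symmetric] integrable_PiM_unif)
  also have "\<bar>\<dots>\<bar> \<le> (\<integral>x. \<bar>F x - G x\<bar> \<partial>PiM {..<m} (\<lambda>_. unif n))" by (rule integral_abs_bound)
  also have "\<dots> \<le> (\<integral>x. H x \<partial>PiM {..<m} (\<lambda>_. unif n))"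
    by (intro integral_mono integrable_PiM_unif assms) (simp only: space_PiM_unif)
  finally show ?thesis .
qed

lemma sum_of_bool_ge_1: "finite S \<Longrightarrow> i \<in> S \<Longrightarrow> Q i \<Longrightarrow> 1 \<le> (\<Sum>i\<in>S. of_bool (Q i) :: real)"
  using member_le_sum[of i S "\<lambda>i. of_bool (Q i) :: real"] by simp

text \<open>Changing the entries at one vertex affects a sample only if the vertex is hit, with
  probability at most \<open>m / n\<close>; changing one arc requires both ends to be hit, with
  probability at most \<open>m\<^sup>2 / n\<^sup>2\<close>.\<close>

lemma avg_change:
  assumes loc: "\<And>c c'. (\<And>i j. i < m \<Longrightarrow> j < m \<Longrightarrow> c i j = c' i j) \<Longrightarrow> \<Phi> c = \<Phi> c'"
    and bd: "\<And>c. (\<And>i j. 0 \<le> c i j \<and> c i j \<le> 1) \<Longrightarrow> \<bar>\<Phi> c\<bar> \<le> C"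
    and a: "\<And>p q. 0 \<le> a p q \<and> a p q \<le> 1" "\<And>p q. 0 \<le> a' p q \<and> a' p q \<le> (1::real)"
  shows "u \<in> {1..n} \<Longrightarrow> (\<And>p q. p \<noteq> u \<Longrightarrow> q \<noteq> u \<Longrightarrow> a p q = a' p q) \<Longrightarrow>
           \<bar>avg n m \<Phi> a - avg n m \<Phi> a'\<bar> \<le> 2 * C * m / n"
    and "u \<in> {1..n} \<Longrightarrow> v \<in> {1..n} \<Longrightarrow> u \<noteq> v \<Longrightarrow> (\<And>p q. \<not> (p = u \<and> q = v) \<Longrightarrow> \<not> (p = v \<and> q = u) \<Longrightarrow> a p q = a' p q) \<Longrightarrow>
           \<bar>avg n m \<Phi> a - avg n m \<Phi> a'\<bar> \<le> 2 * C * m\<^sup>2 / n\<^sup>2"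
proof -
  have bda: "\<bar>\<Phi> (\<lambda>i j. a (x i) (x j))\<bar> \<le> C" "\<bar>\<Phi> (\<lambda>i j. a' (x i) (x j))\<bar> \<le> C" for x :: "nat \<Rightarrow> nat"
    by (intro bd a)+
  have bd2: "\<bar>\<Phi> (\<lambda>i j. a (x i) (x j)) - \<Phi> (\<lambda>i j. a' (x i) (x j))\<bar> \<le> 2 * C" for x :: "nat \<Rightarrow> nat"
    using bda[of x] by linarith
  have C: "0 \<le> C" using bda(1)[of id] by linarith
  show "\<bar>avg n m \<Phi> a - avg n m \<Phi> a'\<bar> \<le> 2 * C * m / n"
    if u: "u \<in> {1..n}" and e: "\<And>p q. p \<noteq> u \<Longrightarrow> q \<noteq> u \<Longrightarrow> a p q = a' p q"
  proof -
    have "\<bar>avg n m \<Phi> a - avg n m \<Phi> a'\<bar> \<le> (\<integral>x. 2 * C * (\<Sum>i<m. of_bool (x i = u)) \<partial>PiM {..<m} (\<lambda>_. unif n))"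
      unfolding avg_def
    proof (rule integral_diff_le)
      fix x :: "nat \<Rightarrow> nat"
      show "\<bar>\<Phi> (\<lambda>i j. a (x i) (x j)) - \<Phi> (\<lambda>i j. a' (x i) (x j))\<bar> \<le> 2 * C * (\<Sum>i<m. of_bool (x i = u))"
      proof (cases "\<exists>i<m. x i = u")
        case True
        then obtain i where "i < m" "x i = u" by blast
        then have "1 \<le> (\<Sum>i<m. of_bool (x i = u) :: real)" by (intro sum_of_bool_ge_1[of _ i]) auto
        then have "2 * C * 1 \<le> 2 * C * (\<Sum>i<m. of_bool (x i = u))" using C by (intro mult_left_mono) auto
        then show ?thesis using bd2[of x] by linarith
      next
        case False
        then have "\<Phi> (\<lambda>i j. a (x i) (x j)) = \<Phi> (\<lambda>i j. a' (x i) (x j))" by (intro loc e) auto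
        then show ?thesis using C by (simp add: sum_nonneg)
      qed
    qed
    also have "\<dots> = 2 * C * (\<Sum>i<m. \<integral>x. of_bool (x i = u) \<partial>PiM {..<m} (\<lambda>_. unif n))"
      by (simp only: integral_mult_right_zero) (subst Bochner_Integration.integral_sum, rule integrable_PiM_unif, rule refl)
    also have "\<dots> = 2 * C * (\<Sum>i<m. 1 / real n)" by (subst sum.cong[OF refl integral_hit1]) (use u in auto)
    finally show ?thesis by simp
  qed
  show "\<bar>avg n m \<Phi> a - avg n m \<Phi> a'\<bar> \<le> 2 * C * m\<^sup>2 / n\<^sup>2"
    if u: "u \<in> {1..n}" "v \<in> {1..n}" "u \<noteq> v" and e: "\<And>p q. \<not> (p = u \<and> q = v) \<Longrightarrow> \<not> (p = v \<and> q = u) \<Longrightarrow> a p q = a' p q"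
  proof -
    let ?S = "{(i, j). i < m \<and> j < m \<and> i \<noteq> j}"
    have fS: "finite ?S" by (rule finite_subset[of _ "{..<m} \<times> {..<m}"]) auto
    have cS: "card ?S \<le> m\<^sup>2" proof -
      have "?S \<subseteq> {..<m} \<times> {..<m}" by auto
      from card_mono[OF _ this] show ?thesis by (simp add: power2_eq_square)
    qed
    let ?h = "\<lambda>x p. of_bool (x (fst p) = u) * of_bool (x (snd p) = v) :: real"
    have "\<bar>avg n m \<Phi> a - avg n m \<Phi> a'\<bar> \<le> (\<integral>x. 2 * C * (\<Sum>p\<in>?S. ?h x p) \<partial>PiM {..<m} (\<lambda>_. unif n))"
      unfolding avg_def
    proof (rule integral_diff_le)
      fix x :: "nat \<Rightarrow> nat"
      show "\<bar>\<Phi> (\<lambda>i j. a (x i) (x j)) - \<Phi> (\<lambda>i j. a' (x i) (x j))\<bar> \<le> 2 * C * (\<Sum>p\<in>?S. ?h x p)"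
      proof (cases "\<exists>i<m. \<exists>j<m. x i = u \<and> x j = v")
        case True
        then obtain i j where ij: "i < m" "j < m" "x i = u" "x j = v" by blast
        then have "(i, j) \<in> ?S" using u(3) by auto
        have "?h x (i, j) \<le> (\<Sum>p\<in>?S. ?h x p)" by (rule member_le_sum[OF \<open>(i, j) \<in> ?S\<close> _ fS]) simp
        then have "1 \<le> (\<Sum>p\<in>?S. ?h x p)" using ij by simp
        then have "2 * C * 1 \<le> 2 * C * (\<Sum>p\<in>?S. ?h x p)" using C by (intro mult_left_mono) auto
        then show ?thesis using bd2[of x] by linarith
      next
        case False
        then have "\<Phi> (\<lambda>i j. a (x i) (x j)) = \<Phi> (\<lambda>i j. a' (x i) (x j))" by (intro loc e) auto
        then show ?thesis using C by (simp add: sum_nonneg)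
      qed
    qed
    also have "\<dots> = 2 * C * (\<integral>x. (\<Sum>p\<in>?S. ?h x p) \<partial>PiM {..<m} (\<lambda>_. unif n))"
      by (simp only: integral_mult_right_zero)
    also have "(\<integral>x. (\<Sum>p\<in>?S. ?h x p) \<partial>PiM {..<m} (\<lambda>_. unif n)) = (\<Sum>p\<in>?S. \<integral>x. ?h x p \<partial>PiM {..<m} (\<lambda>_. unif n))"
      by (intro Bochner_Integration.integral_sum integrable_PiM_unif)
    also have "\<dots> = (\<Sum>p\<in>?S. 1 / (real n)\<^sup>2)" using u by (intro sum.cong refl integral_hit2) auto
    also have "2 * C * \<dots> \<le> 2 * C * (real (m\<^sup>2) * (1 / (real n)\<^sup>2))"
    proof -
      have "real (card ?S) \<le> real (m\<^sup>2)" using cS by (simp only: of_nat_le_iff)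
      then have "real (card ?S) * (1 / (real n)\<^sup>2) \<le> real (m\<^sup>2) * (1 / (real n)\<^sup>2)" by (rule mult_right_mono) simp
      then show ?thesis unfolding sum_constant using C by (intro mult_left_mono) simp_all
    qed
    finally show ?thesis by simp
  qed
qed

end

section \<open>The random tournament\<close>

abbreviation arcs :: "nat \<Rightarrow> (nat \<times> nat) set" where
  "arcs n \<equiv> {(u, v). 1 \<le> u \<and> u < v \<and> v \<le> n}"

lemma finite_arcs: "finite (arcs n)"
  by (rule finite_subset[of _ "{1..n} \<times> {1..n}"]) auto

lemma card_arcs_le: "card (arcs n) \<le> n\<^sup>2"
proof -
  have "arcs n \<subseteq> {1..n} \<times> {1..n}" by auto
  from card_mono[OF _ this] show ?thesis by (simp add: power2_eq_square)
qed

text \<open>The adjacency matrix with real weights in place of bits, so that expectations of bits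
  can be inserted.\<close>

definition real_adjacency :: "nat \<Rightarrow> (nat \<times> nat \<Rightarrow> real) \<Rightarrow> nat \<Rightarrow> nat \<Rightarrow> real" where
  "real_adjacency n y u v = (if u \<in> {1..n} \<and> v \<in> {1..n} then
     (if u = v then 1 / 2 else if u < v then y (u, v) else 1 - y (v, u)) else 0)"

lemma adjacency_eq_real: "adjacency n b = real_adjacency n (\<lambda>e. of_bool (b e))"
  by (intro ext) (simp add: adjacency_def real_adjacency_def)

lemma adjacency_bounds: "0 \<le> adjacency n b u v \<and> adjacency n b u v \<le> 1"
  by (auto simp: adjacency_def)

definition flip_entry :: "(nat \<Rightarrow> nat \<Rightarrow> real) \<Rightarrow> nat \<Rightarrow> nat \<Rightarrow> real \<Rightarrow> nat \<Rightarrow> nat \<Rightarrow> real" where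
  "flip_entry c i j t = (\<lambda>k l. if k = i \<and> l = j then t else if k = j \<and> l = i then 1 - t else c k l)"

text \<open>The two entries of a pair describe one arc, so they move together. Over independent
  arcs, such a pattern has the expectation that is obtained by inserting the probabilities of the
  arcs.\<close>

definition pair_affine :: "nat \<Rightarrow> ((nat \<Rightarrow> nat \<Rightarrow> real) \<Rightarrow> real) \<Rightarrow> bool" where
  "pair_affine m \<Phi> \<longleftrightarrow> (\<forall>c i j t. i < m \<longrightarrow> j < m \<longrightarrow> i \<noteq> j \<longrightarrow> 0 \<le> t \<longrightarrow> t \<le> 1 \<longrightarrow>
     \<Phi> (flip_entry c i j t) = t * \<Phi> (flip_entry c i j 1) + (1 - t) * \<Phi> (flip_entry c i j 0))"

lemma tournamenton_bounds:
  "tournamenton W \<Longrightarrow> x \<in> {0..1} \<Longrightarrow> y \<in> {0..1} \<Longrightarrow> 0 \<le> W x y \<and> W x y \<le> 1 \<and> W y x = 1 - W x y"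
proof -
  assume "tournamenton W" "x \<in> {0..1}" "y \<in> {0..1}"
  then have "0 \<le> W x y \<and> W x y \<le> 1 \<and> W x y + W y x = 1" unfolding tournamenton_def by blast
  then show ?thesis by linarith
qed

lemma tournamenton_measurable:
  assumes "tournamenton W" "f \<in> N \<rightarrow>\<^sub>M U01" "g \<in> N \<rightarrow>\<^sub>M U01"
  shows "(\<lambda>x. W (f x) (g x)) \<in> borel_measurable N"
  using measurable_compose[OF measurable_Pair[OF assms(2,3)], of "\<lambda>(x, y). W x y" borel] assms(1)
  by (simp add: tournamenton_def)

text \<open>The expectation over the arcs when the types \<open>\<eta>\<close> of the vertices are
  given.\<close>

definition tournament_exp :: "nat \<Rightarrow> (real \<Rightarrow> real \<Rightarrow> real) \<Rightarrow> (nat \<Rightarrow> real) \<Rightarrow> ((nat \<times> nat \<Rightarrow> bool) \<Rightarrow> real) \<Rightarrow> real" where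
  "tournament_exp n W \<eta> F = bern_exp (arcs n) (\<lambda>(u, v). W (\<eta> u) (\<eta> v)) F"

context
  fixes W :: "real \<Rightarrow> real \<Rightarrow> real"
  assumes W: "tournamenton W"
begin

lemma arc_prob: "\<eta> \<in> space (PiM {1..n} (\<lambda>_. U01)) \<Longrightarrow> e \<in> arcs n \<Longrightarrow>
    0 \<le> (case e of (u, v) \<Rightarrow> W (\<eta> u) (\<eta> v)) \<and> (case e of (u, v) \<Rightarrow> W (\<eta> u) (\<eta> v)) \<le> 1"
proof -
  assume \<eta>: "\<eta> \<in> space (PiM {1..n} (\<lambda>_. U01))" and e: "e \<in> arcs n"
  obtain u v where uv: "e = (u, v)" "u \<in> {1..n}" "v \<in> {1..n}" using e by auto
  have "\<eta> u \<in> {0..1}" "\<eta> v \<in> {0..1}" using space_PiM_D[OF \<eta> uv(2)] space_PiM_D[OF \<eta> uv(3)] by (simp_all add: space_U01)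
  from tournamenton_bounds[OF W this] show ?thesis unfolding uv(1) by simp
qed

lemma tournament_exp_measurable: "(\<lambda>\<eta>. tournament_exp n W \<eta> F) \<in> borel_measurable (PiM {1..n} (\<lambda>_. U01))"
  unfolding tournament_exp_def
proof (rule bern_exp_measurable[OF finite_arcs])
  fix e assume "e \<in> arcs n"
  then show "(\<lambda>\<eta>. case e of (u, v) \<Rightarrow> W (\<eta> u) (\<eta> v)) \<in> borel_measurable (PiM {1..n} (\<lambda>_. U01))"
    by (auto intro!: tournamenton_measurable[OF W] measurable_component_singleton)
qed (rule arc_prob)

lemma nn_integral_random_tournament:
  assumes F: "\<And>a. 0 \<le> (F a :: real)"
  shows "(\<integral>\<^sup>+a. ennreal (F a) \<partial>random_tournament n W) =
    (\<integral>\<^sup>+\<eta>. ennreal (tournament_exp n W \<eta> (\<lambda>b. F (adjacency n b))) \<partial>PiM {1..n} (\<lambda>_. U01))"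
proof -
  let ?p = "\<lambda>\<eta>. Pi_pmf (arcs n) False (\<lambda>(u, v). bernoulli_pmf (W (\<eta> u) (\<eta> v)))"
  let ?K = "\<lambda>\<eta>. measure_pmf (map_pmf (adjacency n) (?p \<eta>))"
  have pe: "measure_pmf.expectation (?p \<eta>) G = tournament_exp n W \<eta> G" for \<eta> G
    by (simp add: tournament_exp_def bern_exp_def case_prod_unfold)
  have nn: "(\<integral>\<^sup>+a. ennreal (G a) \<partial>?K \<eta>) = ennreal (tournament_exp n W \<eta> (\<lambda>b. G (adjacency n b)))"
    if "\<And>a. 0 \<le> G a" for \<eta> and G :: "_ \<Rightarrow> real"
  proof -
    have "(\<integral>\<^sup>+a. ennreal (G a) \<partial>?K \<eta>) = (\<integral>\<^sup>+b. ennreal (G (adjacency n b)) \<partial>measure_pmf (?p \<eta>))" by simp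
    also have "\<dots> = ennreal (measure_pmf.expectation (?p \<eta>) (\<lambda>b. G (adjacency n b)))"
      by (intro nn_integral_eq_integral bern_exp_integrable finite_arcs) (simp add: that)
    finally show ?thesis unfolding pe .
  qed
  have K: "?K \<in> PiM {1..n} (\<lambda>_. U01) \<rightarrow>\<^sub>M subprob_algebra (count_space UNIV)"
  proof (rule measurable_subprob_algebra)
    fix A :: "(nat \<Rightarrow> nat \<Rightarrow> real) set"
    have "emeasure (?K \<eta>) A = ennreal (tournament_exp n W \<eta> (\<lambda>b. indicator A (adjacency n b)))" for \<eta>
    proof -
      have "emeasure (?K \<eta>) A = (\<integral>\<^sup>+a. indicator A a \<partial>?K \<eta>)" by (rule nn_integral_indicator[symmetric]) simp
      also have "\<dots> = (\<integral>\<^sup>+a. ennreal (indicator A a) \<partial>?K \<eta>)" by (simp only: ennreal_indicator)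
      finally show ?thesis by (simp only: nn indicator_pos_le)
    qed
    then show "(\<lambda>\<eta>. emeasure (?K \<eta>) A) \<in> borel_measurable (PiM {1..n} (\<lambda>_. U01))"
      using tournament_exp_measurable by simp
  qed (auto intro: measure_pmf.subprob_space_axioms)
  have "(\<integral>\<^sup>+a. ennreal (F a) \<partial>random_tournament n W) = (\<integral>\<^sup>+\<eta>. (\<integral>\<^sup>+a. ennreal (F a) \<partial>?K \<eta>) \<partial>PiM {1..n} (\<lambda>_. U01))"
    unfolding random_tournament_def by (rule nn_integral_bind[OF _ K]) simp
  then show ?thesis by (simp only: nn[OF F])
qed

text \<open>For distinct vertices the arcs may be replaced by their probabilities. Diagonal
  entries agree because \<open>W x x = 1 / 2\<close>.\<close>

lemma tournament_exp_affine:
  assumes x: "inj_on x {..<m}" "x ` {..<m} \<subseteq> {1..n}" and \<eta>: "\<eta> \<in> space (PiM {1..n} (\<lambda>_. U01))"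
    and loc: "\<And>c c'. (\<And>i j. i < m \<Longrightarrow> j < m \<Longrightarrow> c i j = c' i j) \<Longrightarrow> \<Phi> c = \<Phi> c'"
    and aff: "pair_affine m \<Phi>"
  shows "tournament_exp n W \<eta> (\<lambda>b. \<Phi> (\<lambda>i j. adjacency n b (x i) (x j))) = \<Phi> (\<lambda>i j. W (\<eta> (x i)) (\<eta> (x j)))"
proof -
  define G where "G = (\<lambda>y. \<Phi> (\<lambda>i j. real_adjacency n y (x i) (x j)))"
  let ?p = "\<lambda>(u, v). W (\<eta> u) (\<eta> v)"
  have xm: "x i \<in> {1..n}" if "i < m" for i using x(2) that by auto
  have "tournament_exp n W \<eta> (\<lambda>b. \<Phi> (\<lambda>i j. adjacency n b (x i) (x j))) = bern_exp (arcs n) ?p (\<lambda>b. G (\<lambda>e. of_bool (b e)))"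
    unfolding tournament_exp_def G_def adjacency_eq_real ..
  also have "\<dots> = G (\<lambda>e. if e \<in> arcs n then ?p e else 0)"
  proof (rule bern_exp_affine[OF finite_arcs arc_prob[OF \<eta>]])
    fix e y and t :: real assume e: "e \<in> arcs n" and t: "0 \<le> t" "t \<le> 1"
    obtain u v where uv: "e = (u, v)" "u < v" "1 \<le> u" "v \<le> n" using e by auto
    show "G (y(e := t)) = t * G (y(e := 1)) + (1 - t) * G (y(e := 0))"
    proof (cases "\<exists>i<m. \<exists>j<m. x i = u \<and> x j = v")
      case True
      then obtain i j where ij: "i < m" "j < m" "x i = u" "x j = v" by blast
      have ne: "i \<noteq> j" using ij uv by auto
      have "G (y(e := s)) = \<Phi> (flip_entry (\<lambda>i j. real_adjacency n y (x i) (x j)) i j s)" for s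
        unfolding G_def
      proof (rule loc)
        fix k l assume kl: "k < m" "l < m"
        have eq: "k = i \<longleftrightarrow> x k = u" "l = j \<longleftrightarrow> x l = v" "k = j \<longleftrightarrow> x k = v" "l = i \<longleftrightarrow> x l = u"
          using inj_on_eq_iff[OF x(1), of k i] inj_on_eq_iff[OF x(1), of l j] inj_on_eq_iff[OF x(1), of k j]
            inj_on_eq_iff[OF x(1), of l i] kl ij by simp_all
        show "real_adjacency n (y(e := s)) (x k) (x l) = flip_entry (\<lambda>i j. real_adjacency n y (x i) (x j)) i j s k l"
          unfolding flip_entry_def eq using uv xm[OF kl(1)] xm[OF kl(2)] by (auto simp: real_adjacency_def)
      qed
      moreover have "\<Phi> (flip_entry c i j t) = t * \<Phi> (flip_entry c i j 1) + (1 - t) * \<Phi> (flip_entry c i j 0)" for c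
        using aff ij(1,2) ne t unfolding pair_affine_def by blast
      ultimately show ?thesis by (simp only:)
    next
      case False
      have "G (y(e := s)) = G y" for s
        unfolding G_def
      proof (rule loc)
        fix k l assume "k < m" "l < m"
        then show "real_adjacency n (y(e := s)) (x k) (x l) = real_adjacency n y (x k) (x l)"
          using False uv by (auto simp: real_adjacency_def)
      qed
      then show ?thesis by (simp add: algebra_simps)
    qed
  qed
  also have "\<dots> = \<Phi> (\<lambda>i j. W (\<eta> (x i)) (\<eta> (x j)))"
    unfolding G_def
  proof (rule loc)
    fix i j assume ij: "i < m" "j < m"
    have e: "\<eta> (x i) \<in> {0..1}" "\<eta> (x j) \<in> {0..1}"
      using space_PiM_D[OF \<eta> xm[OF ij(1)]] space_PiM_D[OF \<eta> xm[OF ij(2)]] by (auto simp: space_U01)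
    have "W (\<eta> (x i)) (\<eta> (x i)) = 1 / 2" using tournamenton_bounds[OF W e(1) e(1)] by simp
    then show "real_adjacency n (\<lambda>e. if e \<in> arcs n then ?p e else 0) (x i) (x j) = W (\<eta> (x i)) (\<eta> (x j))"
      using xm[OF ij(1)] xm[OF ij(2)] tournamenton_bounds[OF W e] by (auto simp: real_adjacency_def)
  qed
  finally show ?thesis .
qed

end

section \<open>Almost sure convergence of subtournament averages\<close>

lemma power4_sum3: "(a + b + c :: real) ^ 4 \<le> 27 * (a ^ 4 + b ^ 4 + c ^ 4)"
proof -
  have 1: "(x + y + z)\<^sup>2 \<le> 3 * (x\<^sup>2 + y\<^sup>2 + z\<^sup>2)" for x y z :: real
  proof -
    have "0 \<le> (x - y)\<^sup>2 + (y - z)\<^sup>2 + (x - z)\<^sup>2" by simp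
    then show ?thesis by (simp add: power2_eq_square algebra_simps)
  qed
  have "(a + b + c) ^ 4 = ((a + b + c)\<^sup>2)\<^sup>2" by simp
  also have "\<dots> \<le> (3 * (a\<^sup>2 + b\<^sup>2 + c\<^sup>2))\<^sup>2" by (intro power_mono 1) simp
  also have "\<dots> = 9 * (a\<^sup>2 + b\<^sup>2 + c\<^sup>2)\<^sup>2" by (simp only: power_mult_distrib) simp
  also have "\<dots> \<le> 9 * (3 * ((a\<^sup>2)\<^sup>2 + (b\<^sup>2)\<^sup>2 + (c\<^sup>2)\<^sup>2))" by (intro mult_left_mono 1) simp
  finally show ?thesis by simp
qed

definition limit_density :: "nat \<Rightarrow> (real \<Rightarrow> real \<Rightarrow> real) \<Rightarrow> ((nat \<Rightarrow> nat \<Rightarrow> real) \<Rightarrow> real) \<Rightarrow> real" where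
  "limit_density m W \<Phi> = (\<integral>\<eta>. \<Phi> (\<lambda>i j. W (\<eta> i) (\<eta> j)) \<partial>PiM {..<m} (\<lambda>_. U01))"

context
  fixes W :: "real \<Rightarrow> real \<Rightarrow> real" and m :: nat and \<Phi> :: "(nat \<Rightarrow> nat \<Rightarrow> real) \<Rightarrow> real" and C :: real
  assumes W: "tournamenton W"
    and loc: "\<And>c c'. (\<And>i j. i < m \<Longrightarrow> j < m \<Longrightarrow> c i j = c' i j) \<Longrightarrow> \<Phi> c = \<Phi> c'"
    and bd: "\<And>c. (\<And>i j. i < m \<Longrightarrow> j < m \<Longrightarrow> 0 \<le> c i j \<and> c i j \<le> 1) \<Longrightarrow> \<bar>\<Phi> c\<bar> \<le> C"
    and aff: "pair_affine m \<Phi>"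
    and meas: "(\<lambda>\<eta>. \<Phi> (\<lambda>i j. W (\<eta> i) (\<eta> j))) \<in> borel_measurable (PiM {..<m} (\<lambda>_. U01))"
begin

lemma density_bound_nonneg: "0 \<le> C"
  using bd[of "\<lambda>_ _. 0"] by linarith

lemma abs_adjacency_le: "\<bar>\<Phi> (\<lambda>i j. adjacency n b (x i) (x j))\<bar> \<le> C"
  by (rule bd) (rule adjacency_bounds)

lemma abs_avg_le: assumes n: "n \<ge> 1" and a: "\<And>p q. 0 \<le> a p q \<and> a p q \<le> 1" shows "\<bar>avg n m \<Phi> a\<bar> \<le> C"
proof -
  interpret PM: prob_space "PiM {..<m} (\<lambda>_::nat. unif n)" by (rule prob_space.prob_space_PiM_const[OF prob_space_unif[OF n]])
  have "\<bar>avg n m \<Phi> a - (\<integral>x. 0 \<partial>PiM {..<m} (\<lambda>_. unif n))\<bar> \<le> (\<integral>x. C \<partial>PiM {..<m} (\<lambda>_. unif n))"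
    unfolding avg_def by (rule integral_diff_le[OF n]) (use bd a in simp)
  then show ?thesis by (simp add: PM.prob_space del: One_nat_def)
qed

lemma integral_injective_sample:
  assumes x: "inj_on x {..<m}" "x ` {..<m} \<subseteq> {1..n}"
  shows "(\<integral>\<eta>. \<Phi> (\<lambda>i j. W (\<eta> (x i)) (\<eta> (x j))) \<partial>PiM {1..n} (\<lambda>_. U01)) = limit_density m W \<Phi>"
proof -
  let ?t = "\<lambda>\<omega>. \<lambda>i\<in>{..<m}. \<omega> (x i)"
  have d: "distr (PiM {1..n} (\<lambda>_. U01)) (PiM {..<m} (\<lambda>_. U01)) ?t = PiM {..<m} (\<lambda>_. U01)"
    using distr_PiM_reindex[of "{1..n}" "\<lambda>_. U01" x "{..<m}"] x prob_space_U01 by auto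
  have t: "?t \<in> PiM {1..n} (\<lambda>_. U01) \<rightarrow>\<^sub>M PiM {..<m} (\<lambda>_. U01)"
    using x(2) by (intro measurable_restrict measurable_component_singleton) auto
  have "limit_density m W \<Phi> = (\<integral>\<eta>. \<Phi> (\<lambda>i j. W (?t \<eta> i) (?t \<eta> j)) \<partial>PiM {1..n} (\<lambda>_. U01))"
    unfolding limit_density_def by (subst d[symmetric]) (rule integral_distr[OF t meas])
  also have "\<dots> = (\<integral>\<eta>. \<Phi> (\<lambda>i j. W (\<eta> (x i)) (\<eta> (x j))) \<partial>PiM {1..n} (\<lambda>_. U01))"
    by (intro Bochner_Integration.integral_cong refl loc) simp
  finally show ?thesis by simp
qed

lemma abs_limit_density_le: "\<bar>limit_density m W \<Phi>\<bar> \<le> C"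
proof -
  interpret Q: prob_space "PiM {..<m} (\<lambda>_::nat. U01)" by (rule U.prob_space_PiM_const)
  have b: "\<bar>\<Phi> (\<lambda>i j. W (\<eta> i) (\<eta> j))\<bar> \<le> C" if \<eta>: "\<eta> \<in> space (PiM {..<m} (\<lambda>_. U01))" for \<eta>
  proof (rule bd)
    fix i j assume "i < m" "j < m"
    then have "\<eta> i \<in> {0..1}" "\<eta> j \<in> {0..1}" using space_PiM_D[OF \<eta>] by (auto simp: space_U01)
    from tournamenton_bounds[OF W this] show "0 \<le> W (\<eta> i) (\<eta> j) \<and> W (\<eta> i) (\<eta> j) \<le> 1" by blast
  qed
  have "\<bar>limit_density m W \<Phi>\<bar> \<le> (\<integral>\<eta>. \<bar>\<Phi> (\<lambda>i j. W (\<eta> i) (\<eta> j))\<bar> \<partial>PiM {..<m} (\<lambda>_. U01))"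
    unfolding limit_density_def by (rule integral_abs_bound)
  also have "\<dots> \<le> (\<integral>\<eta>. C \<partial>PiM {..<m} (\<lambda>_. U01))"
    using b U.integrable_PiM_bounded[OF meas b] by (intro integral_mono) auto
  finally show ?thesis by (simp add: Q.prob_space del: One_nat_def)
qed

context
  fixes n :: nat
  assumes n: "n \<ge> 1"
begin

private abbreviation (input) "f b \<equiv> avg n m \<Phi> (adjacency n b)"
private abbreviation (input) "g \<eta> \<equiv> tournament_exp n W \<eta> (\<lambda>b. avg n m \<Phi> (adjacency n b))"
private abbreviation (input) "Q \<equiv> PiM {1..n} (\<lambda>_::nat. U01)"

lemma conditional_mean_measurable: "(\<lambda>\<eta>. g \<eta>) \<in> borel_measurable Q"
  by (rule tournament_exp_measurable[OF W])

lemma conditional_mean_bound: "\<bar>g \<eta>\<bar> \<le> C"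
  using bern_exp_abs_diff[OF finite_arcs, of "\<lambda>b. f b" "\<lambda>_. 0" C n] abs_avg_le[OF n adjacency_bounds]
  by (simp add: tournament_exp_def bern_exp_const)

text \<open>The type of \<open>u\<close> changes only the parameters of the arcs at
  \<open>u\<close>, and these arcs together have little influence.\<close>

lemma conditional_mean_bounded_differences:
  assumes u: "u \<in> {1..n}" and \<eta>: "\<eta> \<in> space Q" and y: "y \<in> space U01"
  shows "\<bar>g (\<eta>(u := y)) - g \<eta>\<bar> \<le> 4 * C * m / n"
proof -
  let ?B = "{(p, q). p = u \<or> q = u}"
  have "\<bar>g (\<eta>(u := y)) - g \<eta>\<bar> \<le> 2 * (2 * C * m / n)"
    unfolding tournament_exp_def
  proof (rule bern_exp_change_params[OF finite_arcs, where B = ?B])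
    show "(case e of (p, q) \<Rightarrow> W ((\<eta>(u := y)) p) ((\<eta>(u := y)) q)) = (case e of (p, q) \<Rightarrow> W (\<eta> p) (\<eta> q))"
      if "e \<in> arcs n - ?B" for e using that by (auto split: if_splits)
    fix b b' :: "nat \<times> nat \<Rightarrow> bool"
    assume eq: "\<And>e. e \<in> arcs n - ?B \<Longrightarrow> b e = b' e"
    show "\<bar>f b - f b'\<bar> \<le> 2 * C * m / n"
    proof (rule avg_change(1)[OF n loc _ adjacency_bounds adjacency_bounds u])
      show "\<bar>\<Phi> c\<bar> \<le> C" if "\<And>i j. 0 \<le> c i j \<and> c i j \<le> 1" for c by (rule bd) (rule that)
      fix p q assume pq: "p \<noteq> u" "q \<noteq> u"
      have "b (p, q) = b' (p, q)" if "1 \<le> p" "p < q" "q \<le> n" by (rule eq) (use that pq in auto)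
      moreover have "b (q, p) = b' (q, p)" if "1 \<le> q" "q < p" "p \<le> n" by (rule eq) (use that pq in auto)
      ultimately show "adjacency n b p q = adjacency n b' p q" by (auto simp: adjacency_def)
    qed
  qed
  then show ?thesis by simp
qed

lemma conditional_mean_fourth_moment:
  "(\<integral>\<eta>. (g \<eta> - (\<integral>\<eta>. g \<eta> \<partial>Q)) ^ 4 \<partial>Q) \<le> 1024 * C ^ 4 * m ^ 4 / (real n)\<^sup>2"
proof -
  have "(\<integral>\<eta>. (g \<eta> - (\<integral>\<eta>. g \<eta> \<partial>Q)) ^ 4 \<partial>Q) \<le> 4 * (\<Sum>i\<in>{1..n}. (4 * C * m / n)\<^sup>2)\<^sup>2"
    using U.bounded_differences_moments[of "{1..n}" "\<lambda>\<eta>. g \<eta>" C "\<lambda>_. 4 * C * m / n"] conditional_mean_measurable conditional_mean_bound conditional_mean_bounded_differences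
    by blast
  also have "(\<Sum>i\<in>{1..n}. (4 * C * m / n)\<^sup>2) = 16 * C\<^sup>2 * m\<^sup>2 / n"
    using n by (simp add: power2_eq_square)
  also have "4 * (16 * C\<^sup>2 * m\<^sup>2 / n)\<^sup>2 = 1024 * C ^ 4 * m ^ 4 / (real n)\<^sup>2"
    by (simp add: power_divide power_mult_distrib)
  finally show ?thesis .
qed

text \<open>Given the types there are about \<open>n\<^sup>2\<close> arcs of influence
  \<open>n\<^sup>-\<^sup>2\<close>, so that the variance is already of order
  \<open>n\<^sup>-\<^sup>2\<close>; boundedness turns it into a bound on the fourth
  moment.\<close>

lemma conditional_fourth_moment:
  assumes \<eta>: "\<eta> \<in> space Q"
  shows "tournament_exp n W \<eta> (\<lambda>b. (f b - g \<eta>) ^ 4) \<le> 16 * C ^ 4 * m ^ 4 / (real n)\<^sup>2"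
proof -
  have C: "0 \<le> C" by (rule density_bound_nonneg)
  have pt: "(f b - g \<eta>) ^ 4 \<le> (4 * C\<^sup>2) * (f b - g \<eta>)\<^sup>2" for b
  proof -
    have "\<bar>f b - g \<eta>\<bar> \<le> 2 * C"
    proof -
      have "\<bar>f b\<bar> \<le> C" by (rule abs_avg_le[OF n adjacency_bounds])
      then show ?thesis using conditional_mean_bound[of \<eta>] by linarith
    qed
    then have "(f b - g \<eta>)\<^sup>2 \<le> (2 * C)\<^sup>2" using C by (intro power2_le_iff_abs_le[THEN iffD2]) auto
    then have "(f b - g \<eta>)\<^sup>2 * (f b - g \<eta>)\<^sup>2 \<le> (2 * C)\<^sup>2 * (f b - g \<eta>)\<^sup>2" by (rule mult_right_mono) simp
    then show ?thesis by (simp add: power_mult_distrib flip: power_add)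
  qed
  have d: "\<bar>f (b(e := s)) - f b\<bar> \<le> 2 * C * m\<^sup>2 / n\<^sup>2" if e: "e \<in> arcs n" for e b s
  proof -
    obtain u v where uv: "e = (u, v)" "1 \<le> u" "u < v" "v \<le> n" using e by auto
    show ?thesis
    proof (rule avg_change(2)[where C = C and u = u and v = v, OF n loc _ adjacency_bounds adjacency_bounds])
      show "\<bar>\<Phi> c\<bar> \<le> C" if "\<And>i j. 0 \<le> c i j \<and> c i j \<le> 1" for c by (rule bd) (rule that)
      fix p q assume "\<not> (p = u \<and> q = v)" "\<not> (p = v \<and> q = u)"
      then show "adjacency n (b(e := s)) p q = adjacency n b p q" using uv by (auto simp: adjacency_def)
    qed (use uv in auto)
  qed
  have "tournament_exp n W \<eta> (\<lambda>b. (f b - g \<eta>) ^ 4) \<le> (4 * C\<^sup>2) * tournament_exp n W \<eta> (\<lambda>b. (f b - g \<eta>)\<^sup>2)"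
    unfolding tournament_exp_def[of n W \<eta> "\<lambda>b. (f b - g \<eta>) ^ 4"] tournament_exp_def[of n W \<eta> "\<lambda>b. (f b - g \<eta>)\<^sup>2"] bern_exp_cmult[symmetric]
    by (rule bern_exp_mono[OF finite_arcs pt])
  also have "tournament_exp n W \<eta> (\<lambda>b. (f b - g \<eta>)\<^sup>2) \<le> (\<Sum>e\<in>arcs n. (2 * C * m\<^sup>2 / n\<^sup>2)\<^sup>2)"
    unfolding tournament_exp_def by (rule bern_exp_variance[OF finite_arcs arc_prob[OF W \<eta>] d])
  also have "\<dots> \<le> real (n\<^sup>2) * (2 * C * m\<^sup>2 / n\<^sup>2)\<^sup>2"
  proof -
    have "real (card (arcs n)) \<le> real (n\<^sup>2)" using card_arcs_le[of n] by (simp only: of_nat_le_iff)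
    then show ?thesis unfolding sum_constant by (rule mult_right_mono) simp
  qed
  also have "\<dots> = 4 * C\<^sup>2 * m ^ 4 / (real n)\<^sup>2"
  proof -
    have "N * (2 * C * y / N)\<^sup>2 = 4 * C\<^sup>2 * y\<^sup>2 / N" if "N \<noteq> 0" for N y :: real
      using that by (simp add: field_simps power2_eq_square)
    from this[of "real (n\<^sup>2)" "real (m\<^sup>2)"] show ?thesis using n by simp
  qed
  finally have "tournament_exp n W \<eta> (\<lambda>b. (f b - g \<eta>) ^ 4) \<le> (4 * C\<^sup>2) * (4 * C\<^sup>2 * m ^ 4 / (real n)\<^sup>2)"
    using C by (simp add: mult_left_mono)
  also have "\<dots> = 16 * C ^ 4 * m ^ 4 / (real n)\<^sup>2" by (simp add: power2_eq_square power4_eq_xxxx)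
  finally show ?thesis .
qed

text \<open>On injective samples the mean is exactly the density in \<open>W\<close>; a sample has
  a repeated vertex with probability at most \<open>m\<^sup>2 / n\<close>.\<close>

lemma mean_bias: "\<bar>(\<integral>\<eta>. g \<eta> \<partial>Q) - limit_density m W \<Phi>\<bar> \<le> 2 * C * m\<^sup>2 / n"
proof -
  have C: "0 \<le> C" by (rule density_bound_nonneg)
  let ?X = "PiE {..<m} (\<lambda>_. {1..n})"
  let ?N = "real n ^ card {..<m}"
  define E where "E = (\<lambda>x. \<integral>\<eta>. tournament_exp n W \<eta> (\<lambda>b. \<Phi> (\<lambda>i j. adjacency n b (x i) (x j))) \<partial>Q)"
  have fin: "finite ?X" by (intro finite_PiE) auto
  interpret Q: prob_space Q by (rule U.prob_space_PiM_const)
  have te: "\<bar>tournament_exp n W \<eta> (\<lambda>b. \<Phi> (\<lambda>i j. adjacency n b (x i) (x j)))\<bar> \<le> C" for \<eta> x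
    using bern_exp_abs_diff[OF finite_arcs, of "\<lambda>b. \<Phi> (\<lambda>i j. adjacency n b (x i) (x j))" "\<lambda>_. 0" C n] abs_adjacency_le
    by (simp add: tournament_exp_def bern_exp_const)
  have ti: "integrable Q (\<lambda>\<eta>. tournament_exp n W \<eta> (\<lambda>b. \<Phi> (\<lambda>i j. adjacency n b (x i) (x j))))" for x
    by (rule U.integrable_PiM_bounded[OF tournament_exp_measurable[OF W] te])
  have gs: "g \<eta> = (\<Sum>x\<in>?X. (1 / ?N) * tournament_exp n W \<eta> (\<lambda>b. \<Phi> (\<lambda>i j. adjacency n b (x i) (x j))))" for \<eta>
  proof -
    have "(\<lambda>b. f b) = (\<lambda>b. \<Sum>x\<in>?X. (1 / ?N) * \<Phi> (\<lambda>i j. adjacency n b (x i) (x j)))"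
      unfolding avg_def integral_PiM_unif[OF n finite_lessThan] by (simp add: sum_divide_distrib)
    then show ?thesis unfolding tournament_exp_def by (simp only: bern_exp_sum[OF finite_arcs] bern_exp_cmult)
  qed
  have "(\<integral>\<eta>. g \<eta> \<partial>Q) = (\<Sum>x\<in>?X. (1 / ?N) * E x)"
    unfolding gs E_def by (subst Bochner_Integration.integral_sum) (intro integrable_mult_right ti, simp only: integral_mult_right_zero)
  also have "\<dots> = (\<integral>x. E x \<partial>PiM {..<m} (\<lambda>_. unif n))"
    unfolding integral_PiM_unif[OF n finite_lessThan] by (simp add: sum_divide_distrib)
  finally have gE: "(\<integral>\<eta>. g \<eta> \<partial>Q) = (\<integral>x. E x \<partial>PiM {..<m} (\<lambda>_. unif n))" .
  let ?S = "{(i, j). i < m \<and> j < m \<and> i \<noteq> j}"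
  have fS: "finite ?S" by (rule finite_subset[of _ "{..<m} \<times> {..<m}"]) auto
  have cS: "real (card ?S) \<le> real (m\<^sup>2)"
  proof -
    have "?S \<subseteq> {..<m} \<times> {..<m}" by auto
    from card_mono[OF _ this] have "card ?S \<le> m\<^sup>2" by (simp add: power2_eq_square)
    then show ?thesis by (simp only: of_nat_le_iff)
  qed
  interpret PM: prob_space "PiM {..<m} (\<lambda>_::nat. unif n)" by (rule prob_space.prob_space_PiM_const[OF prob_space_unif[OF n]])
  have EB: "\<bar>E x\<bar> \<le> C" for x
  proof -
    have "\<bar>E x\<bar> \<le> (\<integral>\<eta>. \<bar>tournament_exp n W \<eta> (\<lambda>b. \<Phi> (\<lambda>i j. adjacency n b (x i) (x j)))\<bar> \<partial>Q)" unfolding E_def by (rule integral_abs_bound)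
    also have "\<dots> \<le> (\<integral>\<eta>. C \<partial>Q)" using te ti by (intro integral_mono) (auto simp del: One_nat_def)
    finally show ?thesis by (simp add: Q.prob_space del: One_nat_def)
  qed
  have "\<bar>(\<integral>x. E x \<partial>PiM {..<m} (\<lambda>_. unif n)) - (\<integral>x. limit_density m W \<Phi> \<partial>PiM {..<m} (\<lambda>_. unif n))\<bar>
      \<le> (\<integral>x. 2 * C * (\<Sum>p\<in>?S. of_bool (x (fst p) = x (snd p))) \<partial>PiM {..<m} (\<lambda>_. unif n))"
  proof (rule integral_diff_le[OF n])
    fix x assume x: "x \<in> ?X"
    then have xi: "x ` {..<m} \<subseteq> {1..n}" by auto
    show "\<bar>E x - limit_density m W \<Phi>\<bar> \<le> 2 * C * (\<Sum>p\<in>?S. of_bool (x (fst p) = x (snd p)))"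
    proof (cases "inj_on x {..<m}")
      case True
      have "E x = (\<integral>\<eta>. \<Phi> (\<lambda>i j. W (\<eta> (x i)) (\<eta> (x j))) \<partial>Q)"
        unfolding E_def by (intro Bochner_Integration.integral_cong refl tournament_exp_affine[OF W True xi _ loc aff])
      then have "E x = limit_density m W \<Phi>" using integral_injective_sample[OF True xi] by simp
      then show ?thesis using C by (simp add: sum_nonneg)
    next
      case False
      then obtain i j where ij: "i < m" "j < m" "i \<noteq> j" "x i = x j" by (auto simp: inj_on_def)
      then have "(i, j) \<in> ?S" by simp
      then have "of_bool (x (fst (i, j)) = x (snd (i, j))) \<le> (\<Sum>p\<in>?S. of_bool (x (fst p) = x (snd p)) :: real)"
        by (rule member_le_sum[OF _ _ fS]) simp
      then have "1 \<le> (\<Sum>p\<in>?S. of_bool (x (fst p) = x (snd p)) :: real)" using ij by simp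
      then have "2 * C * 1 \<le> 2 * C * (\<Sum>p\<in>?S. of_bool (x (fst p) = x (snd p)))" using C by (intro mult_left_mono) auto
      then show ?thesis using EB[of x] abs_limit_density_le by linarith
    qed
  qed
  also have "(\<integral>x. 2 * C * (\<Sum>p\<in>?S. of_bool (x (fst p) = x (snd p))) \<partial>PiM {..<m} (\<lambda>_. unif n))
      = 2 * C * (\<Sum>p\<in>?S. \<integral>x. of_bool (x (fst p) = x (snd p)) \<partial>PiM {..<m} (\<lambda>_. unif n))"
    by (simp only: integral_mult_right_zero) (subst Bochner_Integration.integral_sum, rule integrable_PiM_unif[OF n], rule refl)
  also have "(\<Sum>p\<in>?S. \<integral>x. of_bool (x (fst p) = x (snd p)) \<partial>PiM {..<m} (\<lambda>_. unif n)) = (\<Sum>p\<in>?S. 1 / real n)"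
    by (intro sum.cong refl integral_collision[OF n]) auto
  also have "2 * C * (\<Sum>p\<in>?S. 1 / real n) \<le> 2 * C * (real (m\<^sup>2) * (1 / real n))"
    unfolding sum_constant using C by (intro mult_left_mono mult_right_mono cS) auto
  finally show ?thesis unfolding gE by (simp add: PM.prob_space del: One_nat_def)
qed

text \<open>The deviation splits into fluctuation of the arcs, fluctuation of the types, and
  bias.\<close>

lemma avg_fourth_moment:
  "(\<integral>\<^sup>+a. ennreal ((avg n m \<Phi> a - limit_density m W \<Phi>) ^ 4) \<partial>random_tournament n W)
    \<le> ennreal (27 * (1040 * C ^ 4 * m ^ 4 + 16 * C ^ 4 * m ^ 8) / (real n)\<^sup>2)"
proof -
  have C: "0 \<le> C" by (rule density_bound_nonneg)
  let ?y = "limit_density m W \<Phi>"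
  define mu where "mu = (\<integral>\<eta>. g \<eta> \<partial>Q)"
  interpret Q: prob_space Q by (rule U.prob_space_PiM_const)
  have b4: "\<bar>(z - ?y) ^ 4\<bar> \<le> (2 * C) ^ 4" if "\<bar>z\<bar> \<le> C" for z
  proof -
    have "\<bar>z - ?y\<bar> \<le> 2 * C" using that abs_limit_density_le by linarith
    from power_mono[OF this, of 4] show ?thesis by simp
  qed
    have te: "\<bar>tournament_exp n W \<eta> (\<lambda>b. (f b - ?y) ^ 4)\<bar> \<le> (2 * C) ^ 4" for \<eta>
      using bern_exp_abs_diff[OF finite_arcs, of "\<lambda>b. (f b - ?y) ^ 4" "\<lambda>_. 0" "(2 * C) ^ 4" n] b4[OF abs_avg_le[OF n adjacency_bounds]]
      by (simp add: tournament_exp_def bern_exp_const)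
    have tei: "integrable Q (\<lambda>\<eta>. tournament_exp n W \<eta> (\<lambda>b. (f b - ?y) ^ 4))"
      by (rule U.integrable_PiM_bounded[OF tournament_exp_measurable[OF W] te])
    have mB: "\<bar>mu\<bar> \<le> C"
    proof -
      have "\<bar>mu\<bar> \<le> (\<integral>\<eta>. \<bar>g \<eta>\<bar> \<partial>Q)" unfolding mu_def by (rule integral_abs_bound)
      also have "\<dots> \<le> (\<integral>\<eta>. C \<partial>Q)" using conditional_mean_bound U.integrable_PiM_bounded[OF conditional_mean_measurable conditional_mean_bound] by (intro integral_mono) (auto simp del: One_nat_def)
      finally show ?thesis by (simp add: Q.prob_space del: One_nat_def)
    qed
    have "\<bar>(g \<eta> - mu) ^ 4\<bar> \<le> (2 * C) ^ 4" for \<eta>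
    proof -
      have "\<bar>g \<eta> - mu\<bar> \<le> 2 * C" using conditional_mean_bound[of \<eta>] mB by linarith
      from power_mono[OF this, of 4] show ?thesis by simp
    qed
    then have gi: "integrable Q (\<lambda>\<eta>. (g \<eta> - mu) ^ 4)"
      using conditional_mean_measurable by (intro U.integrable_PiM_bounded[where B = "(2 * C) ^ 4"]) auto
  have te0: "0 \<le> tournament_exp n W \<eta> (\<lambda>b. (f b - ?y) ^ 4)" for \<eta>
    using bern_exp_mono[OF finite_arcs, of "\<lambda>_. 0" "\<lambda>b. (f b - ?y) ^ 4" n] by (simp add: tournament_exp_def bern_exp_const)
  have "(\<integral>\<eta>. tournament_exp n W \<eta> (\<lambda>b. (f b - ?y) ^ 4) \<partial>Q) \<le> (\<integral>\<eta>. 27 * (16 * C ^ 4 * m ^ 4 / (real n)\<^sup>2 + (g \<eta> - mu) ^ 4 + (mu - ?y) ^ 4) \<partial>Q)"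
  proof (rule integral_mono)
    show "integrable Q (\<lambda>\<eta>. tournament_exp n W \<eta> (\<lambda>b. (f b - ?y) ^ 4))" by (rule tei)
    show "integrable Q (\<lambda>\<eta>. 27 * (16 * C ^ 4 * m ^ 4 / (real n)\<^sup>2 + (g \<eta> - mu) ^ 4 + (mu - ?y) ^ 4))" using gi by (simp del: One_nat_def)
    fix \<eta> assume \<eta>: "\<eta> \<in> space Q"
    have "tournament_exp n W \<eta> (\<lambda>b. (f b - ?y) ^ 4) \<le> tournament_exp n W \<eta> (\<lambda>b. 27 * ((f b - g \<eta>) ^ 4 + ((g \<eta> - mu) ^ 4 + (mu - ?y) ^ 4)))"
      unfolding tournament_exp_def[of n W \<eta> "\<lambda>b. (f b - ?y) ^ 4"] tournament_exp_def[of n W \<eta> "\<lambda>b. 27 * ((f b - g \<eta>) ^ 4 + ((g \<eta> - mu) ^ 4 + (mu - ?y) ^ 4))"]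
    proof (rule bern_exp_mono[OF finite_arcs])
      fix b
      have "f b - ?y = (f b - g \<eta>) + (g \<eta> - mu) + (mu - ?y)" by simp
      then show "(f b - ?y) ^ 4 \<le> 27 * ((f b - g \<eta>) ^ 4 + ((g \<eta> - mu) ^ 4 + (mu - ?y) ^ 4))"
        using power4_sum3[of "f b - g \<eta>" "g \<eta> - mu" "mu - ?y"] by (simp only: add.assoc)
    qed
    also have "\<dots> = 27 * (tournament_exp n W \<eta> (\<lambda>b. (f b - g \<eta>) ^ 4) + ((g \<eta> - mu) ^ 4 + (mu - ?y) ^ 4))"
      unfolding tournament_exp_def[of n W \<eta> "\<lambda>b. 27 * ((f b - g \<eta>) ^ 4 + ((g \<eta> - mu) ^ 4 + (mu - ?y) ^ 4))"] tournament_exp_def[of n W \<eta> "\<lambda>b. (f b - g \<eta>) ^ 4"]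
      by (simp only: bern_exp_cmult bern_exp_add[OF finite_arcs] bern_exp_const)
    also have "\<dots> \<le> 27 * (16 * C ^ 4 * m ^ 4 / (real n)\<^sup>2 + (g \<eta> - mu) ^ 4 + (mu - ?y) ^ 4)"
      using conditional_fourth_moment[OF \<eta>] by simp
    finally show "tournament_exp n W \<eta> (\<lambda>b. (f b - ?y) ^ 4) \<le> 27 * (16 * C ^ 4 * m ^ 4 / (real n)\<^sup>2 + (g \<eta> - mu) ^ 4 + (mu - ?y) ^ 4)" .
  qed
  also have "\<dots> = 27 * (16 * C ^ 4 * m ^ 4 / (real n)\<^sup>2 + (\<integral>\<eta>. (g \<eta> - mu) ^ 4 \<partial>Q) + (mu - ?y) ^ 4)"
    using gi by (simp add: Q.prob_space del: One_nat_def)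
  also have "\<dots> \<le> 27 * (16 * C ^ 4 * m ^ 4 / (real n)\<^sup>2 + 1024 * C ^ 4 * m ^ 4 / (real n)\<^sup>2 + 16 * C ^ 4 * m ^ 8 / (real n)\<^sup>2)"
  proof -
    have "(mu - ?y) ^ 4 \<le> (2 * C * m\<^sup>2 / n) ^ 4"
      using power_mono[OF mean_bias, of 4] by (simp add: mu_def)
    also have "\<dots> = 16 * C ^ 4 * m ^ 8 / (real n) ^ 4" by (simp add: power_divide power_mult_distrib flip: power_mult)
    also have "\<dots> \<le> 16 * C ^ 4 * m ^ 8 / (real n)\<^sup>2"
      using n by (intro divide_left_mono power_increasing mult_nonneg_nonneg) auto
    finally have "(mu - ?y) ^ 4 \<le> 16 * C ^ 4 * m ^ 8 / (real n)\<^sup>2" .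
    then show ?thesis using conditional_mean_fourth_moment[folded mu_def] by (intro mult_left_mono add_mono order_refl) auto
  qed
  also have "\<dots> = 27 * (1040 * C ^ 4 * m ^ 4 + 16 * C ^ 4 * m ^ 8) / (real n)\<^sup>2"
  proof -
    have "27 * (16 * x / N + 1024 * x / N + 16 * y / N) = 27 * (1040 * x + 16 * y) / N" for x y N :: real
      by (cases "N = 0") (simp_all add: field_simps)
    from this[of "C ^ 4 * m ^ 4" _ "C ^ 4 * m ^ 8"] show ?thesis by (simp only: mult.assoc)
  qed
  finally have fin: "(\<integral>\<eta>. tournament_exp n W \<eta> (\<lambda>b. (f b - ?y) ^ 4) \<partial>Q) \<le> 27 * (1040 * C ^ 4 * m ^ 4 + 16 * C ^ 4 * m ^ 8) / (real n)\<^sup>2" .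
  have "(\<integral>\<^sup>+a. ennreal ((avg n m \<Phi> a - ?y) ^ 4) \<partial>random_tournament n W) = (\<integral>\<^sup>+\<eta>. ennreal (tournament_exp n W \<eta> (\<lambda>b. (f b - ?y) ^ 4)) \<partial>Q)"
    by (rule nn_integral_random_tournament[OF W]) simp
  also have "\<dots> = ennreal (\<integral>\<eta>. tournament_exp n W \<eta> (\<lambda>b. (f b - ?y) ^ 4) \<partial>Q)"
    by (rule nn_integral_eq_integral[OF tei]) (simp add: te0)
  finally show ?thesis using fin by (simp add: ennreal_leI)
qed

end

text \<open>The fourth moments are summable, so that the sum of the fourth powers of the
  deviations is finite almost surely.\<close>

theorem avg_converges_AE:
  assumes M: "prob_space M" and T: "\<And>n. n \<ge> 1 \<Longrightarrow> is_random_tournament M (T n) n W"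
  shows "AE \<omega> in M. (\<lambda>n. avg n m \<Phi> (T n \<omega>)) \<longlonglongrightarrow> limit_density m W \<Phi>"
proof -
  let ?y = "limit_density m W \<Phi>"
  define K where "K = 27 * (1040 * C ^ 4 * m ^ 4 + 16 * C ^ 4 * m ^ 8)"
  have K0: "0 \<le> K" unfolding K_def using density_bound_nonneg by simp
  define X where "X = (\<lambda>n \<omega>. (avg (Suc n) m \<Phi> (T (Suc n) \<omega>) - ?y) ^ 4)"
  have Tm: "T (Suc n) \<in> M \<rightarrow>\<^sub>M count_space UNIV" for n using T[of "Suc n"] by (simp add: is_random_tournament_def)
  have Xm: "(\<lambda>\<omega>. ennreal (X n \<omega>)) \<in> borel_measurable M" for n
    unfolding X_def by (rule measurable_compose[OF Tm]) simp
  have "(\<integral>\<^sup>+\<omega>. ennreal (X n \<omega>) \<partial>M) \<le> ennreal (K * (1 / (real (Suc n))\<^sup>2))" for n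
  proof -
    have "(\<integral>\<^sup>+\<omega>. ennreal (X n \<omega>) \<partial>M) = (\<integral>\<^sup>+a. ennreal ((avg (Suc n) m \<Phi> a - ?y) ^ 4) \<partial>distr M (count_space UNIV) (T (Suc n)))"
      unfolding X_def by (subst nn_integral_distr[OF Tm]) simp_all
    also have "distr M (count_space UNIV) (T (Suc n)) = random_tournament (Suc n) W"
      using T[of "Suc n"] by (simp add: is_random_tournament_def)
    also have "(\<integral>\<^sup>+a. ennreal ((avg (Suc n) m \<Phi> a - ?y) ^ 4) \<partial>random_tournament (Suc n) W) \<le> ennreal (K / (real (Suc n))\<^sup>2)"
      unfolding K_def by (rule avg_fourth_moment) simp
    finally show ?thesis by simp
  qed
  then have "(\<Sum>n. \<integral>\<^sup>+\<omega>. ennreal (X n \<omega>) \<partial>M) \<le> (\<Sum>n. ennreal (K * (1 / (real (Suc n))\<^sup>2)))"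
    by (intro suminf_le) auto
  also have "\<dots> < \<infinity>"
  proof -
    have "summable (\<lambda>n. K * (1 / (real (Suc n))\<^sup>2))"
      using inverse_power_summable[of 2] by (intro summable_mult) (subst summable_Suc_iff, simp add: inverse_eq_divide)
    then have "(\<Sum>n. ennreal (K * (1 / (real (Suc n))\<^sup>2))) \<noteq> \<infinity>" using K0 unfolding infinity_ennreal_def by (intro ennreal_suminf_neq_top) auto
    then show ?thesis by (simp add: less_top[symmetric])
  qed
  finally have "(\<integral>\<^sup>+\<omega>. (\<Sum>n. ennreal (X n \<omega>)) \<partial>M) < \<infinity>" by (subst nn_integral_suminf[OF Xm])
  then have "AE \<omega> in M. (\<Sum>n. ennreal (X n \<omega>)) \<noteq> \<infinity>"
    using Xm by (intro nn_integral_PInf_AE) auto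
  then show ?thesis
  proof eventually_elim
    case (elim \<omega>)
    have "summable (\<lambda>n. X n \<omega>)" using elim by (intro summable_suminf_not_top) (auto simp: X_def)
    then have "(\<lambda>n. X n \<omega>) \<longlonglongrightarrow> 0" by (rule summable_LIMSEQ_zero)
    then have "(\<lambda>n. root 4 (X n \<omega>)) \<longlonglongrightarrow> root 4 0" by (rule tendsto_real_root)
    moreover have "root 4 (X n \<omega>) = \<bar>avg (Suc n) m \<Phi> (T (Suc n) \<omega>) - ?y\<bar>" for n
      using real_root_power_cancel[of 4 "\<bar>avg (Suc n) m \<Phi> (T (Suc n) \<omega>) - ?y\<bar>"] by (simp add: X_def)
    ultimately have "(\<lambda>n. avg (Suc n) m \<Phi> (T (Suc n) \<omega>) - ?y) \<longlonglongrightarrow> 0"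
      by (simp add: tendsto_rabs_zero_iff)
    then have "(\<lambda>n. avg (Suc n) m \<Phi> (T (Suc n) \<omega>)) \<longlonglongrightarrow> ?y" by (simp add: LIM_zero_iff)
    then show ?case by (rule LIMSEQ_imp_Suc)
  qed
qed

end

section \<open>Quadratic chaos\<close>

text \<open>Completeness of \<open>L\<^sup>2\<close>: the limit of an almost surely convergent
  subsequence is a limit in norm by Fatou's lemma.\<close>

lemma (in prob_space) L2_complete:
  fixes X :: "nat \<Rightarrow> 'a \<Rightarrow> real"
  assumes m [measurable]: "\<And>n. X n \<in> borel_measurable M" and i: "\<And>n. integrable M (\<lambda>x. (X n x)\<^sup>2)"
    and c: "\<And>e. e > 0 \<Longrightarrow> \<exists>N. \<forall>i\<ge>N. \<forall>j\<ge>N. (\<integral>x. (X i x - X j x)\<^sup>2 \<partial>M) < e"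
  obtains S where "S \<in> borel_measurable M" "integrable M (\<lambda>x. (S x)\<^sup>2)" "(\<lambda>n. \<integral>x. (S x - X n x)\<^sup>2 \<partial>M) \<longlonglongrightarrow> 0"
proof -
  have id: "integrable M (\<lambda>x. (X i x - X j x)\<^sup>2)" for i j by (intro integrable_diff_square_integrable m i)
  have "\<exists>N. \<forall>i\<ge>N. \<forall>j\<ge>N. (\<integral>x. norm (X i x - X j x) \<partial>M) < e" if e: "e > 0" for e
  proof -
    obtain N where N: "\<forall>i\<ge>N. \<forall>j\<ge>N. (\<integral>x. (X i x - X j x)\<^sup>2 \<partial>M) < e\<^sup>2" using c[of "e\<^sup>2"] e by auto
    have "(\<integral>x. norm (X i x - X j x) \<partial>M) < e" if ij: "i \<ge> N" "j \<ge> N" for i j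
    proof -
      have "(\<integral>x. \<bar>X i x - X j x\<bar> \<partial>M) \<le> sqrt (\<integral>x. (X i x - X j x)\<^sup>2 \<partial>M)"
        by (rule integral_abs_le_sqrt[OF _ id]) measurable
      also have "\<dots> < e"
      proof -
        have "sqrt (\<integral>x. (X i x - X j x)\<^sup>2 \<partial>M) < sqrt (e\<^sup>2)" using N ij by (intro real_sqrt_less_mono) auto
        then show ?thesis using e by simp
      qed
      finally show ?thesis by simp
    qed
    then show ?thesis by blast
  qed
  then obtain r where r: "strict_mono r" "AE x in M. Cauchy (\<lambda>i. X (r i) x)"
    using cauchy_L1_AE_cauchy_subseq[of M X] square_integrable_imp_integrable[OF m i] by blast
  define S where "S = (\<lambda>x. lim (\<lambda>i. X (r i) x))"
  have S [measurable]: "S \<in> borel_measurable M" unfolding S_def by measurable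
  have lim: "AE x in M. (\<lambda>i. X (r i) x) \<longlonglongrightarrow> S x"
    using r(2) by eventually_elim (simp add: S_def Cauchy_convergent_iff convergent_LIMSEQ_iff)
  have nn: "(\<integral>\<^sup>+x. ennreal ((S x - X n x)\<^sup>2) \<partial>M) \<le> ennreal e"
    if N: "\<forall>i\<ge>N. \<forall>j\<ge>N. (\<integral>x. (X i x - X j x)\<^sup>2 \<partial>M) < e" and n: "n \<ge> N" for e N n
  proof -
    have "(\<integral>\<^sup>+x. ennreal ((S x - X n x)\<^sup>2) \<partial>M) = (\<integral>\<^sup>+x. liminf (\<lambda>i. ennreal ((X (r i) x - X n x)\<^sup>2)) \<partial>M)"
    proof (rule nn_integral_cong_AE)
      show "AE x in M. ennreal ((S x - X n x)\<^sup>2) = liminf (\<lambda>i. ennreal ((X (r i) x - X n x)\<^sup>2))"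
        using lim
      proof eventually_elim
        case (elim x)
        have "(\<lambda>i. ennreal ((X (r i) x - X n x)\<^sup>2)) \<longlonglongrightarrow> ennreal ((S x - X n x)\<^sup>2)"
          by (intro tendsto_ennrealI tendsto_power tendsto_diff elim tendsto_const)
        then show ?case by (rule lim_imp_Liminf[OF trivial_limit_sequentially, symmetric])
      qed
    qed
    also have "\<dots> \<le> liminf (\<lambda>i. \<integral>\<^sup>+x. ennreal ((X (r i) x - X n x)\<^sup>2) \<partial>M)" by (rule nn_integral_liminf) measurable
    also have "\<dots> \<le> limsup (\<lambda>i. \<integral>\<^sup>+x. ennreal ((X (r i) x - X n x)\<^sup>2) \<partial>M)" by (rule Liminf_le_Limsup) simp
    also have "\<dots> \<le> ennreal e"
    proof (rule Limsup_bounded)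
      show "\<forall>\<^sub>F i in sequentially. (\<integral>\<^sup>+x. ennreal ((X (r i) x - X n x)\<^sup>2) \<partial>M) \<le> ennreal e"
        using eventually_ge_at_top[of N]
      proof eventually_elim
        case (elim i)
        then have "r i \<ge> N" using seq_suble[OF r(1), of i] by linarith
        then have "(\<integral>x. (X (r i) x - X n x)\<^sup>2 \<partial>M) < e" using N n by blast
        then show ?case using nn_integral_eq_integral[OF id[of "r i" n]] by (simp add: ennreal_leI)
      qed
    qed
    finally show ?thesis .
  qed
  have int: "integrable M (\<lambda>x. (S x - X n x)\<^sup>2) \<and> (\<integral>x. (S x - X n x)\<^sup>2 \<partial>M) \<le> e"
    if N: "\<forall>i\<ge>N. \<forall>j\<ge>N. (\<integral>x. (X i x - X j x)\<^sup>2 \<partial>M) < e" and n: "n \<ge> N" and e: "e > 0" for e N n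
  proof -
    have "(\<integral>\<^sup>+x. ennreal ((S x - X n x)\<^sup>2) \<partial>M) < \<infinity>" using nn[OF N n] by (rule le_less_trans) simp
    then have I: "integrable M (\<lambda>x. (S x - X n x)\<^sup>2)" by (intro integrableI_nonneg) auto
    then have "ennreal (\<integral>x. (S x - X n x)\<^sup>2 \<partial>M) \<le> ennreal e" using nn[OF N n] nn_integral_eq_integral[OF I] by simp
    then show ?thesis using I e by simp
  qed
  obtain N1 where N1: "\<forall>i\<ge>N1. \<forall>j\<ge>N1. (\<integral>x. (X i x - X j x)\<^sup>2 \<partial>M) < 1" using c[of 1] by auto
  have "integrable M (\<lambda>x. ((S x - X N1 x) + X N1 x)\<^sup>2)"
    using int[OF N1 order_refl] by (intro integrable_add_square_integrable i) auto
  then have S2: "integrable M (\<lambda>x. (S x)\<^sup>2)" by simp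
  have "(\<lambda>n. \<integral>x. (S x - X n x)\<^sup>2 \<partial>M) \<longlonglongrightarrow> 0"
  proof (rule LIMSEQ_I)
    fix e :: real assume e: "e > 0"
    obtain N where N: "\<forall>i\<ge>N. \<forall>j\<ge>N. (\<integral>x. (X i x - X j x)\<^sup>2 \<partial>M) < e/2" using c[of "e/2"] e by auto
    have "norm ((\<integral>x. (S x - X n x)\<^sup>2 \<partial>M) - 0) < e" if "n \<ge> N" for n
      using int[OF N that] e by simp
    then show "\<exists>N. \<forall>n\<ge>N. norm ((\<integral>x. (S x - X n x)\<^sup>2 \<partial>M) - 0) < e" by blast
  qed
  with S S2 that show ?thesis by blast
qed

lemma std_normal_square_moments:
  "integrable std_normal (\<lambda>x. x\<^sup>2 - 1)" "(\<integral>x. x\<^sup>2 - 1 \<partial>std_normal) = 0"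
  "integrable std_normal (\<lambda>x. (x\<^sup>2 - 1)\<^sup>2)" "(\<integral>x. (x\<^sup>2 - 1)\<^sup>2 \<partial>std_normal) = 2"
proof -
  have i: "integrable std_normal (\<lambda>x. x\<^sup>2)" "integrable std_normal (\<lambda>x. x ^ 4)" by (rule integrable_std_normal_power)+
  have e2: "(\<integral>x. x\<^sup>2 \<partial>std_normal) = 1"
    using integral_std_normal_moment_even[of 1] by (subst integral_std_normal) (auto simp: numeral_2_eq_2)
  have e4: "(\<integral>x. x ^ 4 \<partial>std_normal) = 3"
    using integral_std_normal_moment_even[of 2] by (subst integral_std_normal) (auto simp: fact_numeral)
  have s: "(\<lambda>x. (x\<^sup>2 - 1)\<^sup>2) = (\<lambda>x::real. x ^ 4 - 2 * x\<^sup>2 + 1)"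
    by (auto simp: power2_eq_square power4_eq_xxxx algebra_simps)
  show "integrable std_normal (\<lambda>x. x\<^sup>2 - 1)" using i by simp
  show "(\<integral>x. x\<^sup>2 - 1 \<partial>std_normal) = 0" using i e2 normal.prob_space by simp
  show "integrable std_normal (\<lambda>x. (x\<^sup>2 - 1)\<^sup>2)" unfolding s using i by simp
  show "(\<integral>x. (x\<^sup>2 - 1)\<^sup>2 \<partial>std_normal) = 2" unfolding s using i e2 e4 normal.prob_space by simp
qed

context prob_space begin

lemma iid_std_normal_measurable: "iid_std_normal M Z I \<Longrightarrow> i \<in> I \<Longrightarrow> Z i \<in> borel_measurable M"
  unfolding iid_std_normal_def indep_vars_def by auto

lemma iid_std_normal_integral:
  fixes g :: "real \<Rightarrow> 'c :: {banach, second_countable_topology}"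
  assumes Z: "iid_std_normal M Z I" "i \<in> I" and g [measurable]: "g \<in> borel_measurable borel"
  shows "(\<integral>\<omega>. g (Z i \<omega>) \<partial>M) = (\<integral>x. g x \<partial>std_normal)" and "integrable M (\<lambda>\<omega>. g (Z i \<omega>)) \<longleftrightarrow> integrable std_normal g"
proof -
  have m: "Z i \<in> M \<rightarrow>\<^sub>M borel" by (rule iid_std_normal_measurable[OF Z])
  have d: "distr M borel (Z i) = std_normal" using Z by (simp add: iid_std_normal_def)
  show "(\<integral>\<omega>. g (Z i \<omega>) \<partial>M) = (\<integral>x. g x \<partial>std_normal)" unfolding d[symmetric] by (rule integral_distr[OF m g, symmetric])
  show "integrable M (\<lambda>\<omega>. g (Z i \<omega>)) \<longleftrightarrow> integrable std_normal g" unfolding d[symmetric] by (rule integrable_distr_eq[OF m g, symmetric])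
qed

lemma iid_std_normal_subset: "iid_std_normal M Z I \<Longrightarrow> J \<subseteq> I \<Longrightarrow> iid_std_normal M Z J"
  unfolding iid_std_normal_def using indep_vars_subset by blast

lemma chaos_orthogonality:
  assumes Z: "iid_std_normal M Z I" and F: "finite F" "F \<subseteq> I"
  shows "(\<integral>\<omega>. (\<Sum>i\<in>F. c i * ((Z i \<omega>)\<^sup>2 - 1))\<^sup>2 \<partial>M) = 2 * (\<Sum>i\<in>F. (c i)\<^sup>2)"
    and "integrable M (\<lambda>\<omega>. (\<Sum>i\<in>F. c i * ((Z i \<omega>)\<^sup>2 - 1))\<^sup>2)"
proof -
  let ?Y = "\<lambda>i \<omega>. (Z i \<omega>)\<^sup>2 - 1"
  have iY: "integrable M (?Y i)" and EY: "(\<integral>\<omega>. ?Y i \<omega> \<partial>M) = 0" and iY2: "integrable M (\<lambda>\<omega>. (?Y i \<omega>)\<^sup>2)" and EY2: "(\<integral>\<omega>. (?Y i \<omega>)\<^sup>2 \<partial>M) = 2" if "i \<in> F" for i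
    using iid_std_normal_integral[OF Z, of i "\<lambda>x. x\<^sup>2 - 1"] iid_std_normal_integral[OF Z, of i "\<lambda>x. (x\<^sup>2 - 1)\<^sup>2"] std_normal_square_moments that F by auto
  have mY: "?Y i \<in> borel_measurable M" if "i \<in> F" for i using iY[OF that] by (rule borel_measurable_integrable)
  have iYY: "integrable M (\<lambda>\<omega>. ?Y i \<omega> * ?Y j \<omega>)" if "i \<in> F" "j \<in> F" for i j
    by (rule integrable_mult_square_integrable[OF mY[OF that(1)] mY[OF that(2)] iY2[OF that(1)] iY2[OF that(2)]])
  have EYY: "(\<integral>\<omega>. ?Y i \<omega> * ?Y j \<omega> \<partial>M) = (if i = j then 2 else 0)" if ij: "i \<in> F" "j \<in> F" for i j
  proof (cases "i = j")
    case True
    then show ?thesis using EY2[OF ij(1)] by (simp add: power2_eq_square)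
  next
    case False
    have "indep_vars (\<lambda>_. borel) (\<lambda>k \<omega>. (Z k \<omega>)\<^sup>2 - 1) {i, j}"
      using indep_vars_compose2[of "\<lambda>_. borel" Z "{i, j}" "\<lambda>_ x. x\<^sup>2 - 1" "\<lambda>_. borel"] iid_std_normal_subset[OF Z, of "{i, j}"] ij F
      by (auto simp: iid_std_normal_def)
    from indep_vars_lebesgue_integral[OF _ this] have "(\<integral>\<omega>. (\<Prod>k\<in>{i, j}. ?Y k \<omega>) \<partial>M) = (\<Prod>k\<in>{i, j}. \<integral>\<omega>. ?Y k \<omega> \<partial>M)"
      using iY ij by auto
    then show ?thesis using False EY ij by simp
  qed
  have sq: "(\<Sum>i\<in>F. c i * ?Y i \<omega>)\<^sup>2 = (\<Sum>i\<in>F. \<Sum>j\<in>F. (c i * c j) * (?Y i \<omega> * ?Y j \<omega>))" for \<omega>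
    by (simp add: power2_eq_square sum_product mult_ac)
  show "integrable M (\<lambda>\<omega>. (\<Sum>i\<in>F. c i * ?Y i \<omega>)\<^sup>2)" unfolding sq by (intro Bochner_Integration.integrable_sum integrable_mult_right iYY)
  have "(\<integral>\<omega>. (\<Sum>i\<in>F. c i * ?Y i \<omega>)\<^sup>2 \<partial>M) = (\<Sum>i\<in>F. \<Sum>j\<in>F. (c i * c j) * (\<integral>\<omega>. ?Y i \<omega> * ?Y j \<omega> \<partial>M))"
    unfolding sq
    by (simp only: Bochner_Integration.integral_sum integrable_mult_right iYY Bochner_Integration.integrable_sum integral_mult_right_zero cong: sum.cong)
  also have "\<dots> = (\<Sum>i\<in>F. \<Sum>j\<in>F. if j = i then 2 * (c i)\<^sup>2 else 0)"
    by (intro sum.cong refl) (auto simp: EYY[unfolded power2_eq_square] power2_eq_square)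
  also have "\<dots> = 2 * (\<Sum>i\<in>F. (c i)\<^sup>2)" using F(1) by (simp add: sum_distrib_left)
  finally show "(\<integral>\<omega>. (\<Sum>i\<in>F. c i * ?Y i \<omega>)\<^sup>2 \<partial>M) = 2 * (\<Sum>i\<in>F. (c i)\<^sup>2)" .
qed

text \<open>By orthogonality the partial sums form a Cauchy net in \<open>L\<^sup>2\<close>
  because the squares of the coefficients are summable; a sequence of finite sets with vanishing
  tails reduces this to completeness.\<close>

lemma ex_chaos_sum:
  assumes Z: "iid_std_normal M Z I" and c: "(\<lambda>i. (c i)\<^sup>2) summable_on I"
  shows "\<exists>S. L2_has_sum M (\<lambda>i \<omega>. c i * ((Z i \<omega>)\<^sup>2 - 1)) I S"
proof -
  let ?X = "\<lambda>i \<omega>. c i * ((Z i \<omega>)\<^sup>2 - 1)"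
  let ?S = "\<lambda>F \<omega>. \<Sum>i\<in>F. ?X i \<omega>"
  obtain a where a: "((\<lambda>i. (c i)\<^sup>2) has_sum a) I" using c by (auto simp: summable_on_def)
  have mS: "?S F \<in> borel_measurable M" if "F \<subseteq> I" for F
    using iid_std_normal_measurable[OF Z] that by (intro borel_measurable_sum borel_measurable_times borel_measurable_diff borel_measurable_power borel_measurable_const) auto
  have iS: "integrable M (\<lambda>\<omega>. (?S F \<omega>)\<^sup>2)" if "finite F" "F \<subseteq> I" for F by (rule chaos_orthogonality(2)[OF Z that])
  have tail: "\<exists>F. finite F \<and> F \<subseteq> I \<and> (\<forall>G. finite G \<and> F \<subseteq> G \<and> G \<subseteq> I \<longrightarrow> (\<integral>\<omega>. (?S G \<omega> - ?S F \<omega>)\<^sup>2 \<partial>M) < e)" if e: "e > 0" for e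
  proof -
    have "eventually (\<lambda>F. dist (\<Sum>i\<in>F. (c i)\<^sup>2) a < e / 4) (finite_subsets_at_top I)"
      using a e unfolding has_sum_def by (intro tendstoD) auto
    then obtain F where F12: "finite F" "F \<subseteq> I" and F3: "\<forall>G. finite G \<and> F \<subseteq> G \<and> G \<subseteq> I \<longrightarrow> dist (\<Sum>i\<in>G. (c i)\<^sup>2) a < e / 4"
      unfolding eventually_finite_subsets_at_top by (elim exE conjE) (rule that)
    have F: "finite F" "F \<subseteq> I" "\<And>G. finite G \<Longrightarrow> F \<subseteq> G \<Longrightarrow> G \<subseteq> I \<Longrightarrow> dist (\<Sum>i\<in>G. (c i)\<^sup>2) a < e / 4"
      using F12 F3 by simp_all
    have "(\<integral>\<omega>. (?S G \<omega> - ?S F \<omega>)\<^sup>2 \<partial>M) < e" if G: "finite G" "F \<subseteq> G" "G \<subseteq> I" for G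
    proof -
      have d: "?S G \<omega> - ?S F \<omega> = ?S (G - F) \<omega>" for \<omega> using sum_diff[OF G(1,2), of "\<lambda>i. ?X i \<omega>"] by simp
      have "(\<integral>\<omega>. (?S G \<omega> - ?S F \<omega>)\<^sup>2 \<partial>M) = 2 * (\<Sum>i\<in>G - F. (c i)\<^sup>2)"
        unfolding d by (rule chaos_orthogonality(1)[OF Z]) (use G in auto)
      also have "(\<Sum>i\<in>G - F. (c i)\<^sup>2) = (\<Sum>i\<in>G. (c i)\<^sup>2) - (\<Sum>i\<in>F. (c i)\<^sup>2)" by (rule sum_diff[OF G(1,2)])
      also have "\<dots> < e / 2" using F(3)[OF G] F(3)[OF F(1) order_refl F(2)] unfolding dist_real_def by linarith
      finally show ?thesis by simp
    qed
    then show ?thesis using F(1,2) by blast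
  qed
  have sq: "(\<integral>\<omega>. (f \<omega> - h \<omega>)\<^sup>2 \<partial>M) \<le> 2 * (\<integral>\<omega>. (f \<omega> - g \<omega>)\<^sup>2 \<partial>M) + 2 * (\<integral>\<omega>. (g \<omega> - h \<omega>)\<^sup>2 \<partial>M)"
    if "f \<in> borel_measurable M" "g \<in> borel_measurable M" "h \<in> borel_measurable M"
      "integrable M (\<lambda>\<omega>. (f \<omega>)\<^sup>2)" "integrable M (\<lambda>\<omega>. (g \<omega>)\<^sup>2)" "integrable M (\<lambda>\<omega>. (h \<omega>)\<^sup>2)" for f g h :: "'a \<Rightarrow> real"
  proof -
    have i: "integrable M (\<lambda>\<omega>. (f \<omega> - h \<omega>)\<^sup>2)" "integrable M (\<lambda>\<omega>. (f \<omega> - g \<omega>)\<^sup>2)" "integrable M (\<lambda>\<omega>. (g \<omega> - h \<omega>)\<^sup>2)"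
      by (intro integrable_diff_square_integrable that)+
    have "(\<integral>\<omega>. (f \<omega> - h \<omega>)\<^sup>2 \<partial>M) \<le> (\<integral>\<omega>. 2 * (f \<omega> - g \<omega>)\<^sup>2 + 2 * (g \<omega> - h \<omega>)\<^sup>2 \<partial>M)"
    proof (rule integral_mono)
      fix \<omega>
      have "0 \<le> ((f \<omega> - g \<omega>) - (g \<omega> - h \<omega>))\<^sup>2" by simp
      then show "(f \<omega> - h \<omega>)\<^sup>2 \<le> 2 * (f \<omega> - g \<omega>)\<^sup>2 + 2 * (g \<omega> - h \<omega>)\<^sup>2" by (simp add: power2_eq_square algebra_simps)
    qed (use i in auto)
    then show ?thesis using i by simp
  qed
  obtain F where F: "\<And>n. finite (F n)" "\<And>n. F n \<subseteq> I"
    "\<And>n G. finite G \<Longrightarrow> F n \<subseteq> G \<Longrightarrow> G \<subseteq> I \<Longrightarrow> (\<integral>\<omega>. (?S G \<omega> - ?S (F n) \<omega>)\<^sup>2 \<partial>M) < 1 / Suc n"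
  proof -
    have "\<forall>n. \<exists>F. finite F \<and> F \<subseteq> I \<and> (\<forall>G. finite G \<and> F \<subseteq> G \<and> G \<subseteq> I \<longrightarrow> (\<integral>\<omega>. (?S G \<omega> - ?S F \<omega>)\<^sup>2 \<partial>M) < 1 / Suc n)"
      using tail by simp
    from choice[OF this] obtain F where F: "\<forall>n. finite (F n) \<and> F n \<subseteq> I \<and> (\<forall>G. finite G \<and> F n \<subseteq> G \<and> G \<subseteq> I \<longrightarrow> (\<integral>\<omega>. (?S G \<omega> - ?S (F n) \<omega>)\<^sup>2 \<partial>M) < 1 / Suc n)"
      by (elim exE) (rule that)
    show ?thesis by (rule that[of F]) (simp_all only: F simp_thms)
  qed
  have cau: "(\<integral>\<omega>. (?S (F i) \<omega> - ?S (F j) \<omega>)\<^sup>2 \<partial>M) < 4 / Suc N" if ij: "i \<ge> N" "j \<ge> N" for i j N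
  proof -
    let ?G = "F i \<union> F j"
    have G: "finite ?G" "?G \<subseteq> I" using F(1,2) by auto
    have k: "(\<integral>\<omega>. (?S ?G \<omega> - ?S (F k) \<omega>)\<^sup>2 \<partial>M) < 1 / Suc N" if k: "k = i \<or> k = j" for k
    proof -
      have "(\<integral>\<omega>. (?S ?G \<omega> - ?S (F k) \<omega>)\<^sup>2 \<partial>M) < 1 / Suc k" using k by (intro F(3) G) auto
      also have "\<dots> \<le> 1 / Suc N" using k ij by (intro divide_left_mono) auto
      finally show ?thesis .
    qed
    have "(\<integral>\<omega>. (?S (F i) \<omega> - ?S (F j) \<omega>)\<^sup>2 \<partial>M) \<le> 2 * (\<integral>\<omega>. (?S (F i) \<omega> - ?S ?G \<omega>)\<^sup>2 \<partial>M) + 2 * (\<integral>\<omega>. (?S ?G \<omega> - ?S (F j) \<omega>)\<^sup>2 \<partial>M)"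
      by (intro sq mS iS F G)
    also have "(\<integral>\<omega>. (?S (F i) \<omega> - ?S ?G \<omega>)\<^sup>2 \<partial>M) = (\<integral>\<omega>. (?S ?G \<omega> - ?S (F i) \<omega>)\<^sup>2 \<partial>M)"
      by (simp only: power2_commute)
    finally show ?thesis using k[of i] k[of j] by simp
  qed
  obtain S where S: "S \<in> borel_measurable M" "integrable M (\<lambda>x. (S x)\<^sup>2)" "(\<lambda>n. \<integral>\<omega>. (S \<omega> - ?S (F n) \<omega>)\<^sup>2 \<partial>M) \<longlonglongrightarrow> 0"
  proof (rule L2_complete[of "\<lambda>n. ?S (F n)"])
    show "?S (F n) \<in> borel_measurable M" "integrable M (\<lambda>\<omega>. (?S (F n) \<omega>)\<^sup>2)" for n by (intro mS iS F)+
    fix e :: real assume e: "e > 0"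
    obtain N where N: "4 / e < real (Suc N)" by (metis reals_Archimedean2 less_trans of_nat_less_iff lessI)
    then have "4 / Suc N < e" using e by (simp add: field_simps)
    then show "\<exists>N. \<forall>i\<ge>N. \<forall>j\<ge>N. (\<integral>\<omega>. (?S (F i) \<omega> - ?S (F j) \<omega>)\<^sup>2 \<partial>M) < e" using cau by (meson less_trans)
  qed
  have "((\<lambda>F. \<integral>\<omega>. (S \<omega> - ?S F \<omega>)\<^sup>2 \<partial>M) \<longlongrightarrow> 0) (finite_subsets_at_top I)"
  proof (rule tendstoI)
    fix e :: real assume e: "e > 0"
    have "eventually (\<lambda>n. (\<integral>\<omega>. (S \<omega> - ?S (F n) \<omega>)\<^sup>2 \<partial>M) < e / 4) sequentially"
      using S(3) e by (intro order_tendstoD) auto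
    moreover have "eventually (\<lambda>n. 1 / real (Suc n) < e / 4) sequentially"
      using e by (intro order_tendstoD[OF LIMSEQ_Suc[OF lim_1_over_n]]) auto
    ultimately have "eventually (\<lambda>n. (\<integral>\<omega>. (S \<omega> - ?S (F n) \<omega>)\<^sup>2 \<partial>M) < e / 4 \<and> 1 / real (Suc n) < e / 4) sequentially"
      by (rule eventually_conj)
    then obtain n where n: "(\<integral>\<omega>. (S \<omega> - ?S (F n) \<omega>)\<^sup>2 \<partial>M) < e / 4" "1 / real (Suc n) < e / 4"
      by (auto simp: eventually_sequentially)
    have "dist (\<integral>\<omega>. (S \<omega> - ?S G \<omega>)\<^sup>2 \<partial>M) 0 < e" if G: "finite G" "F n \<subseteq> G" "G \<subseteq> I" for G
    proof -
      have "(\<integral>\<omega>. (S \<omega> - ?S G \<omega>)\<^sup>2 \<partial>M) \<le> 2 * (\<integral>\<omega>. (S \<omega> - ?S (F n) \<omega>)\<^sup>2 \<partial>M) + 2 * (\<integral>\<omega>. (?S (F n) \<omega> - ?S G \<omega>)\<^sup>2 \<partial>M)"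
        by (intro sq mS iS S(1,2) F G)
      also have "(\<integral>\<omega>. (?S (F n) \<omega> - ?S G \<omega>)\<^sup>2 \<partial>M) = (\<integral>\<omega>. (?S G \<omega> - ?S (F n) \<omega>)\<^sup>2 \<partial>M)"
        by (simp only: power2_commute)
      finally have "(\<integral>\<omega>. (S \<omega> - ?S G \<omega>)\<^sup>2 \<partial>M) < e" using n F(3)[OF G] by linarith
      moreover have "0 \<le> (\<integral>\<omega>. (S \<omega> - ?S G \<omega>)\<^sup>2 \<partial>M)" by simp
      ultimately show ?thesis by (simp only: dist_real_def diff_0_right abs_of_nonneg)
    qed
    then show "eventually (\<lambda>F. dist (\<integral>\<omega>. (S \<omega> - ?S F \<omega>)\<^sup>2 \<partial>M) 0 < e) (finite_subsets_at_top I)"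
      unfolding eventually_finite_subsets_at_top by (intro exI[of _ "F n"] conjI allI impI F(1,2)) (elim conjE)
  qed
  moreover have "?X i \<in> borel_measurable M \<and> integrable M (\<lambda>\<omega>. (?X i \<omega>)\<^sup>2)" if "i \<in> I" for i
    using mS[of "{i}"] iS[of "{i}"] that by simp
  ultimately have "L2_has_sum M ?X I S" unfolding L2_has_sum_def using S(1,2) by blast
  then show ?thesis by blast
qed

end

lemma char_finite_chaos:
  assumes "prob_space M" and Z: "iid_std_normal M Z I" and F: "finite F" "F \<subseteq> I"
  shows "char (distr M borel (\<lambda>\<omega>. \<Sum>i\<in>F. c i * ((Z i \<omega>)\<^sup>2 - 1))) t = exp (\<Sum>i\<in>F. log_cf (t * c i))"
proof -
  interpret prob_space M by fact
  have "indep_vars (\<lambda>_. borel) (\<lambda>i \<omega>. c i * ((Z i \<omega>)\<^sup>2 - 1)) F"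
    using indep_vars_compose2[of "\<lambda>_. borel" Z F "\<lambda>i x. c i * (x\<^sup>2 - 1)" "\<lambda>_. borel"] iid_std_normal_subset[OF Z F(2)]
    by (simp add: iid_std_normal_def)
  from char_distr_sum[OF this] have "char (distr M borel (\<lambda>\<omega>. \<Sum>i\<in>F. c i * ((Z i \<omega>)\<^sup>2 - 1))) t
      = (\<Prod>i\<in>F. char (distr M borel (\<lambda>\<omega>. c i * ((Z i \<omega>)\<^sup>2 - 1))) t)" .
  also have "\<dots> = (\<Prod>i\<in>F. exp (log_cf (t * c i)))"
  proof (rule prod.cong[OF refl])
    fix i assume "i \<in> F"
    then have i: "i \<in> I" using F by blast
    note m[measurable] = iid_std_normal_measurable[OF Z i]
    have "char (distr M borel (\<lambda>\<omega>. c i * ((Z i \<omega>)\<^sup>2 - 1))) t = (CLINT \<omega>|M. iexp (t * (c i * ((Z i \<omega>)\<^sup>2 - 1))))"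
      unfolding char_def by (subst integral_distr) auto
    also have "\<dots> = (CLINT x|std_normal. iexp (t * (c i * (x\<^sup>2 - 1))))"
      by (rule iid_std_normal_integral(1)[OF Z i]) measurable
    also have "\<dots> = exp (log_cf (t * c i))" using cf_normal_square[of "t * c i"] by (simp only: mult.assoc)
    finally show "char (distr M borel (\<lambda>\<omega>. c i * ((Z i \<omega>)\<^sup>2 - 1))) t = exp (log_cf (t * c i))" .
  qed
  finally show ?thesis by (simp add: exp_sum F(1))
qed

text \<open>Characteristic functions are Lipschitz in \<open>L\<^sup>1\<close>, hence continuous for \<open>L\<^sup>2\<close> convergence.\<close>

lemma char_L2_limit:
  assumes "prob_space M" and m: "V \<in> borel_measurable M" "\<And>F. F \<in> A \<Longrightarrow> U F \<in> borel_measurable M"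
    and i: "integrable M (\<lambda>\<omega>. (V \<omega>)\<^sup>2)" "\<And>F. F \<in> A \<Longrightarrow> integrable M (\<lambda>\<omega>. (U F \<omega>)\<^sup>2)"
    and A: "eventually (\<lambda>F. F \<in> A) Fl"
    and l: "((\<lambda>F. \<integral>\<omega>. (V \<omega> - U F \<omega>)\<^sup>2 \<partial>M) \<longlongrightarrow> 0) Fl"
  shows "((\<lambda>F. char (distr M borel (U F)) t) \<longlongrightarrow> char (distr M borel V) t) Fl"
proof -
  interpret prob_space M by fact
  have b: "norm (char (distr M borel (U F)) t - char (distr M borel V) t) \<le> \<bar>t\<bar> * sqrt (\<integral>\<omega>. (V \<omega> - U F \<omega>)\<^sup>2 \<partial>M)" if F: "F \<in> A" for F
  proof -
    note mm[measurable] = m(1) m(2)[OF F]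
    have iV: "integrable M (\<lambda>\<omega>. iexp (t * V \<omega>))" "integrable M (\<lambda>\<omega>. iexp (t * U F \<omega>))"
      by (auto intro!: integrable_const_bound[where B = 1])
    have d2: "integrable M (\<lambda>\<omega>. (V \<omega> - U F \<omega>)\<^sup>2)" by (rule integrable_diff_square_integrable[OF m(1) m(2)[OF F] i(1) i(2)[OF F]])
    have d1: "integrable M (\<lambda>\<omega>. V \<omega> - U F \<omega>)" by (rule square_integrable_imp_integrable[OF _ d2]) measurable
    have "char (distr M borel (U F)) t - char (distr M borel V) t = (CLINT \<omega>|M. iexp (t * U F \<omega>) - iexp (t * V \<omega>))"
      unfolding char_def using iV by (subst integral_distr, simp, simp)+ simp
    also have "norm \<dots> \<le> (\<integral>\<omega>. norm (iexp (t * U F \<omega>) - iexp (t * V \<omega>)) \<partial>M)" by (rule integral_norm_bound)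
    also have "\<dots> \<le> (\<integral>\<omega>. \<bar>t\<bar> * \<bar>V \<omega> - U F \<omega>\<bar> \<partial>M)"
    proof (rule integral_mono)
      show "integrable M (\<lambda>\<omega>. norm (iexp (t * U F \<omega>) - iexp (t * V \<omega>)))" using iV by simp
      show "integrable M (\<lambda>\<omega>. \<bar>t\<bar> * \<bar>V \<omega> - U F \<omega>\<bar>)" using d1 by simp
      fix \<omega>
      have "iexp (t * U F \<omega>) - iexp (t * V \<omega>) = iexp (t * V \<omega>) * (iexp (t * (U F \<omega> - V \<omega>)) - 1)"
        by (simp add: right_diff_distrib exp_add[symmetric] algebra_simps)
      also have "norm \<dots> = norm (iexp (t * (U F \<omega> - V \<omega>)) - 1)" by (simp add: norm_mult)
      also have "\<dots> \<le> \<bar>t * (U F \<omega> - V \<omega>)\<bar>" using iexp_approx1[of "t * (U F \<omega> - V \<omega>)" 0] by simp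
      finally show "norm (iexp (t * U F \<omega>) - iexp (t * V \<omega>)) \<le> \<bar>t\<bar> * \<bar>V \<omega> - U F \<omega>\<bar>" by (simp add: abs_mult abs_minus_commute)
    qed
    also have "\<dots> = \<bar>t\<bar> * (\<integral>\<omega>. \<bar>V \<omega> - U F \<omega>\<bar> \<partial>M)" by simp
    also have "\<dots> \<le> \<bar>t\<bar> * sqrt (\<integral>\<omega>. (V \<omega> - U F \<omega>)\<^sup>2 \<partial>M)"
      by (intro mult_left_mono integral_abs_le_sqrt d2) auto
    finally show ?thesis .
  qed
  have "((\<lambda>F. \<bar>t\<bar> * sqrt (\<integral>\<omega>. (V \<omega> - U F \<omega>)\<^sup>2 \<partial>M)) \<longlongrightarrow> \<bar>t\<bar> * sqrt 0) Fl"
    by (intro tendsto_mult tendsto_const tendsto_real_sqrt l)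
  then have z: "((\<lambda>F. \<bar>t\<bar> * sqrt (\<integral>\<omega>. (V \<omega> - U F \<omega>)\<^sup>2 \<partial>M)) \<longlongrightarrow> 0) Fl" by simp
  have "((\<lambda>F. char (distr M borel (U F)) t - char (distr M borel V) t) \<longlongrightarrow> 0) Fl"
    by (rule Lim_null_comparison[OF _ z]) (use A b in \<open>auto elim: eventually_mono\<close>)
  then show ?thesis by (simp add: LIM_zero_iff)
qed

section \<open>Power sums of the empirical eigenvalues\<close>

text \<open>The symmetrised triangle over the pair \<open>u, v\<close> with apex \<open>w\<close>;
  averaging over the apex gives \<open>tri_hat\<close> and \<open>tri_kernel\<close>.\<close>

definition tri_hom :: "('i \<Rightarrow> 'i \<Rightarrow> real) \<Rightarrow> 'i \<Rightarrow> 'i \<Rightarrow> 'i \<Rightarrow> real" where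
  "tri_hom c u v w = (c u v * c v w * c w u + c v u * c u w * c w v) / 2"

text \<open>A closed cycle of \<open>k + 1\<close> triangles: vertices \<open>0, 2, \<dots>, 2 *
  k\<close> of the cycle and apexes at the odd numbers.\<close>

definition tri_cycle :: "nat \<Rightarrow> (nat \<Rightarrow> nat \<Rightarrow> real) \<Rightarrow> real" where
  "tri_cycle k c = (\<Prod>l\<le>k. tri_hom c (2*l) (if l < k then 2*l+2 else 0) (2*l+1))"

lemma tri_hom_bounds:
  assumes "\<And>p q. p \<in> {u, v, w} \<Longrightarrow> q \<in> {u, v, w} \<Longrightarrow> 0 \<le> c p q \<and> c p q \<le> 1"
  shows "0 \<le> tri_hom c u v w \<and> tri_hom c u v w \<le> 1"
proof -
  have 1: "0 \<le> x * y * z \<and> x * y * z \<le> 1" if "0 \<le> x \<and> x \<le> 1" "0 \<le> y \<and> y \<le> 1" "0 \<le> z \<and> z \<le> 1" for x y z :: real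
    using that mult_le_one[of x y] mult_le_one[of "x * y" z] by simp
  have "0 \<le> c u v * c v w * c w u \<and> c u v * c v w * c w u \<le> 1" "0 \<le> c v u * c u w * c w v \<and> c v u * c u w * c w v \<le> 1"
    by (intro 1 assms; simp)+
  then show ?thesis by (simp add: tri_hom_def)
qed

lemma tri_cycle_cong: "(\<And>i j. i < 2*k+2 \<Longrightarrow> j < 2*k+2 \<Longrightarrow> c i j = c' i j) \<Longrightarrow> tri_cycle k c = tri_cycle k c'"
  unfolding tri_cycle_def tri_hom_def by (intro prod.cong) auto

lemma tri_cycle_bound:
  assumes "\<And>i j. i < 2*k+2 \<Longrightarrow> j < 2*k+2 \<Longrightarrow> 0 \<le> c i j \<and> c i j \<le> 1" shows "\<bar>tri_cycle k c\<bar> \<le> 1"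
proof -
  have "\<bar>tri_cycle k c\<bar> \<le> (\<Prod>l\<le>k. 1)" unfolding tri_cycle_def abs_prod
  proof (rule prod_mono)
    fix l assume l: "l \<in> {..k}"
    have "0 \<le> tri_hom c (2*l) (if l < k then 2*l+2 else 0) (2*l+1) \<and> tri_hom c (2*l) (if l < k then 2*l+2 else 0) (2*l+1) \<le> 1"
      using l by (intro tri_hom_bounds assms) auto
    then show "0 \<le> \<bar>tri_hom c (2*l) (if l < k then 2*l+2 else 0) (2*l+1)\<bar> \<and> \<bar>tri_hom c (2*l) (if l < k then 2*l+2 else 0) (2*l+1)\<bar> \<le> 1"
      by simp
  qed
  then show ?thesis by simp
qed

lemma tri_hom_flip_outside:
  "\<not> {i, j} \<subseteq> {u, v, w} \<Longrightarrow> tri_hom (flip_entry c i j t) u v w = tri_hom c u v w"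
proof -
  assume a: "\<not> {i, j} \<subseteq> {u, v, w}"
  have "flip_entry c i j t p q = c p q" if "p \<in> {u, v, w}" "q \<in> {u, v, w}" for p q
  proof -
    have "\<not> (p = i \<and> q = j)" "\<not> (p = j \<and> q = i)" using a that by blast+
    then show ?thesis unfolding flip_entry_def by (simp only: if_False)
  qed
  then show ?thesis unfolding tri_hom_def by simp
qed

lemma tri_hom_flip_affine:
  assumes "u \<noteq> v" "v \<noteq> w" "u \<noteq> w" "i \<noteq> j"
  shows "tri_hom (flip_entry c i j t) u v w = t * tri_hom (flip_entry c i j 1) u v w + (1 - t) * tri_hom (flip_entry c i j 0) u v w"
proof (cases "{i, j} \<subseteq> {u, v, w}")
  case False
  then show ?thesis by (simp add: tri_hom_flip_outside algebra_simps)
next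
  case True
  then consider "i = u" "j = v" | "i = u" "j = w" | "i = v" "j = u" | "i = v" "j = w" | "i = w" "j = u" | "i = w" "j = v"
    using assms(4) by blast
  then obtain A B where AB: "\<And>s. tri_hom (flip_entry c i j s) u v w = (s * A + (1 - s) * B) / 2"
  proof cases
    case 1
    then show ?thesis using assms by (intro that[of "c v w * c w u" "c u w * c w v"]) (simp add: tri_hom_def flip_entry_def)
  next
    case 2
    then show ?thesis using assms by (intro that[of "c v u * c w v" "c u v * c v w"]) (simp add: tri_hom_def flip_entry_def)
  next
    case 3
    then show ?thesis using assms by (intro that[of "c u w * c w v" "c v w * c w u"]) (simp add: tri_hom_def flip_entry_def)
  next
    case 4
    then show ?thesis using assms by (intro that[of "c u v * c w u" "c v u * c u w"]) (simp add: tri_hom_def flip_entry_def)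
  next
    case 5
    then show ?thesis using assms by (intro that[of "c u v * c v w" "c v u * c w v"]) (simp add: tri_hom_def flip_entry_def)
  next
    case 6
    then show ?thesis using assms by (intro that[of "c v u * c u w" "c u v * c w u"]) (simp add: tri_hom_def flip_entry_def)
  qed
  show ?thesis unfolding AB by (simp add: field_simps)
qed

text \<open>An apex belongs to one triangle only, so a pair in two triangles would be an edge of the underlying
  cycle for both; a cycle of length at least 3 has no double edges.\<close>

lemma tri_cycle_pair_unique:
  fixes k l l' i j :: nat
  assumes k: "2 \<le> k" and l: "l \<le> k" "l' \<le> k" and ij: "i \<noteq> j"
    and s: "{i, j} \<subseteq> {2*l, if l < k then 2*l+2 else 0, 2*l+1}" "{i, j} \<subseteq> {2*l', if l' < k then 2*l'+2 else 0, 2*l'+1}"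
  shows "l = l'"
proof -
  define nx where "nx = (\<lambda>l. if l < k then 2*l+2 else 0)"
  have s': "i \<in> {2*l, nx l, 2*l+1}" "j \<in> {2*l, nx l, 2*l+1}" "i \<in> {2*l', nx l', 2*l'+1}" "j \<in> {2*l', nx l', 2*l'+1}"
    using s by (simp_all add: nx_def)
  have even_nx: "even (nx x)" for x by (simp add: nx_def)
  have odd: "x = 2*m+1" if "odd x" "x \<in> {2*m, nx m, 2*m+1}" for x m using that even_nx[of m] by auto
  have even: "x = 2*m \<or> x = nx m" if "even x" "x \<in> {2*m, nx m, 2*m+1}" for x m using that by auto
  consider "odd i" | "odd j" | "even i" "even j" by blast
  then show ?thesis
  proof cases
    case 1
    then have "2*l+1 = 2*l'+1" using odd[OF 1 s'(1)] odd[OF 1 s'(3)] by simp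
    then show ?thesis by simp
  next
    case 2
    then have "2*l+1 = 2*l'+1" using odd[OF 2 s'(2)] odd[OF 2 s'(4)] by simp
    then show ?thesis by simp
  next
    case 3
    have "2*l = 2*l' \<or> 2*l = nx l' \<and> nx l = 2*l'"
      using even[OF 3(1) s'(1)] even[OF 3(2) s'(2)] even[OF 3(1) s'(3)] even[OF 3(2) s'(4)] ij by metis
    then show ?thesis
    proof
      assume "2*l = nx l' \<and> nx l = 2*l'"
      then show ?thesis using k l unfolding nx_def by (auto split: if_splits)
    qed simp
  qed
qed

text \<open>Each pair lies in at most one triangle of the cycle, and a triangle is affine in each
  of its three pairs.\<close>

lemma pair_affine_tri_cycle:
  assumes k: "2 \<le> k" shows "pair_affine (2*k+2) (tri_cycle k)"
  unfolding pair_affine_def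
proof (intro allI impI)
  fix c :: "nat \<Rightarrow> nat \<Rightarrow> real" and i j :: nat and t :: real assume ij: "i \<noteq> j"
  let ?T = "\<lambda>t l. tri_hom (flip_entry c i j t) (2*l) (if l < k then 2*l+2 else 0) (2*l+1)"
  let ?V = "\<lambda>l. {2*l, if l < k then 2*l+2 else 0, 2*l+1}"
  have "(\<Prod>l\<le>k. ?T t l) = t * (\<Prod>l\<le>k. ?T 1 l) + (1 - t) * (\<Prod>l\<le>k. ?T 0 l)"
  proof (cases "\<exists>l\<le>k. {i, j} \<subseteq> ?V l")
    case True
    then obtain l where l: "l \<le> k" "{i, j} \<subseteq> ?V l" by blast
    have r: "(\<Prod>l\<le>k. ?T s l) = ?T s l * (\<Prod>l\<in>{..k} - {l}. ?T 0 l)" for s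
    proof -
      have "(\<Prod>l\<le>k. ?T s l) = ?T s l * (\<Prod>l\<in>{..k} - {l}. ?T s l)" using l(1) by (intro prod.remove) auto
      also have "(\<Prod>l\<in>{..k} - {l}. ?T s l) = (\<Prod>l\<in>{..k} - {l}. ?T 0 l)"
      proof (rule prod.cong[OF refl])
        fix l' assume l': "l' \<in> {..k} - {l}"
        then have "\<not> {i, j} \<subseteq> ?V l'" using tri_cycle_pair_unique[OF k l(1) _ ij l(2), of l'] by blast
        from tri_hom_flip_outside[OF this, of c s] tri_hom_flip_outside[OF this, of c 0]
        show "?T s l' = ?T 0 l'" by (rule trans[OF _ sym])
      qed
      finally show ?thesis .
    qed
    have "?T t l = t * ?T 1 l + (1 - t) * ?T 0 l" by (rule tri_hom_flip_affine[OF _ _ _ ij]) (use k in auto)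
    then have "?T t l * P = t * (?T 1 l * P) + (1 - t) * (?T 0 l * P)" for P by (simp only: distrib_right mult.assoc)
    then show ?thesis unfolding r[of t] r[of 1] r[of 0] .
  next
    case False
    have "(\<Prod>l\<le>k. ?T s l) = (\<Prod>l\<le>k. ?T 0 l)" for s
    proof (rule prod.cong[OF refl])
      fix l assume "l \<in> {..k}"
      then have "\<not> {i, j} \<subseteq> ?V l" using False by blast
      from tri_hom_flip_outside[OF this, of c s] tri_hom_flip_outside[OF this, of c 0]
      show "?T s l = ?T 0 l" by (rule trans[OF _ sym])
    qed
    then have "(\<Prod>l\<le>k. ?T t l) = (\<Prod>l\<le>k. ?T 0 l)" "(\<Prod>l\<le>k. ?T 1 l) = (\<Prod>l\<le>k. ?T 0 l)" by blast+
    moreover have "P = t * P + (1 - t) * P" for P by (simp add: algebra_simps)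
    ultimately show ?thesis by metis
  qed
  then show "tri_cycle k (flip_entry c i j t) = t * tri_cycle k (flip_entry c i j 1) + (1 - t) * tri_cycle k (flip_entry c i j 0)"
    unfolding tri_cycle_def .
qed

context prob_space begin

lemma kpow_cong:
  assumes "\<And>x y. x \<in> space M \<Longrightarrow> y \<in> space M \<Longrightarrow> K x y = K' x y" "x \<in> space M" "y \<in> space M"
  shows "kpow K n x y = kpow K' n x y"
  using assms(2,3)
proof (induction n arbitrary: x y)
  case 0
  then show ?case using assms(1) by simp
next
  case (Suc n)
  have "kcomp K (kpow K n) x y = kcomp K' (kpow K' n) x y" by (rule kcomp_cong[OF assms(1) Suc.IH Suc.prems])
  then show ?case by simp
qed

lemma integral_tri_cycle:
  assumes m: "(\<lambda>p. tri_hom a (fst p) (fst (snd p)) (snd (snd p))) \<in> borel_measurable (M \<Otimes>\<^sub>M M \<Otimes>\<^sub>M M)"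
    and b: "\<And>x y. x \<in> space M \<Longrightarrow> y \<in> space M \<Longrightarrow> 0 \<le> a x y \<and> a x y \<le> 1"
  shows "(\<integral>x. tri_cycle k (\<lambda>i j. a (x i) (x j)) \<partial>PiM {..<2*k+2} (\<lambda>_. M)) = (\<integral>x. kpow (\<lambda>x y. \<integral>z. tri_hom a x y z \<partial>M) k x x \<partial>M)"
    and "(\<lambda>x. tri_cycle k (\<lambda>i j. a (x i) (x j))) \<in> borel_measurable (PiM {..<2*k+2} (\<lambda>_. M))"
proof -
  have B: "\<bar>tri_hom a x y z\<bar> \<le> 1" if "x \<in> space M" "y \<in> space M" "z \<in> space M" for x y z
  proof -
    have "0 \<le> tri_hom a x y z \<and> tri_hom a x y z \<le> 1" by (rule tri_hom_bounds, rule b) (use that in auto)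
    then show ?thesis by simp
  qed
  have h: "tri_hom (\<lambda>i j. a (x i) (x j)) u v w = tri_hom a (x u) (x v) (x w)" for u v w :: nat and x :: "nat \<Rightarrow> 'a" by (simp add: tri_hom_def)
  have c: "(\<lambda>x. tri_cycle k (\<lambda>i j. a (x i) (x j))) = closed_walk (tri_hom a) k"
    unfolding tri_cycle_def h lessThan_Suc_atMost[symmetric] prod.lessThan_Suc
    by (rule ext) (simp add: closed_walk_def[OF m B] walk_def[OF m B])
  have mg: "marginal (tri_hom a) = (\<lambda>x y. \<integral>z. tri_hom a x y z \<partial>M)" by (intro ext) (rule marginal_def[OF m B])
  show "(\<lambda>x. tri_cycle k (\<lambda>i j. a (x i) (x j))) \<in> borel_measurable (PiM {..<2*k+2} (\<lambda>_. M))"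
    unfolding c by (rule closed_walk_measurable[OF m B])
  show "(\<integral>x. tri_cycle k (\<lambda>i j. a (x i) (x j)) \<partial>PiM {..<2*k+2} (\<lambda>_. M)) = (\<integral>x. kpow (\<lambda>x y. \<integral>z. tri_hom a x y z \<partial>M) k x x \<partial>M)"
    unfolding c mg[symmetric] by (rule integral_closed_walk[OF m B])
qed

end

lemma measurable_unif_triple: "(f :: _ \<Rightarrow> real) \<in> (unif n \<Otimes>\<^sub>M unif n \<Otimes>\<^sub>M unif n) \<rightarrow>\<^sub>M borel"
proof -
  have "sets (unif n \<Otimes>\<^sub>M unif n \<Otimes>\<^sub>M unif n) = sets (count_space {1..n} \<Otimes>\<^sub>M count_space {1..n} \<Otimes>\<^sub>M count_space {1..n})"
    by (intro sets_pair_measure_cong sets_uniform_count_measure_count_space)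
  also have "count_space {1..n} \<Otimes>\<^sub>M count_space {1..n} \<Otimes>\<^sub>M count_space {1..n} = count_space ({1..n} \<times> {1..n} \<times> {1..n})"
    by (simp add: pair_measure_count_space)
  finally have "measurable (unif n \<Otimes>\<^sub>M unif n \<Otimes>\<^sub>M unif n) (borel :: real measure) = measurable (count_space ({1..n} \<times> {1..n} \<times> {1..n})) borel"
    by (rule measurable_cong_sets) simp
  then show ?thesis by (simp del: One_nat_def)
qed

text \<open>A trace of a power of the empirical matrix is the integral of a closed walk of
  triangles.\<close>

lemma avg_tri_cycle:
  assumes n: "n \<ge> 1" and a: "\<And>p q. 0 \<le> a p q \<and> a p q \<le> 1"
  shows "avg n (2*k+2) (tri_cycle k) a = (\<Sum>s=1..n. eigenvalue_desc (tri_hat_mat n a) s ^ Suc k)"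
proof -
  interpret P: prob_space "unif n" by (rule prob_space_unif[OF n])
  have "(\<lambda>x y. \<integral>z. tri_hom a x y z \<partial>unif n) = tri_hat n a"
  proof (intro ext)
    fix x y
    have "(\<Sum>z=1..n. tri_hom a x y z) = (a x y * (\<Sum>w=1..n. a y w * a w x) + a y x * (\<Sum>w=1..n. a x w * a w y)) / 2"
      unfolding tri_hom_def sum_divide_distrib[symmetric] sum.distrib sum_distrib_left mult.assoc ..
    then show "(\<integral>z. tri_hom a x y z \<partial>unif n) = tri_hat n a x y"
      unfolding integral_unif tri_hat_def by (simp only: divide_divide_eq_left)
  qed
  then show ?thesis unfolding avg_def sum_eigenvalue_power[OF n]
    using P.integral_tri_cycle(1)[of a k, OF measurable_unif_triple a] by simp
qed

section \<open>Limits of the power sums\<close>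

context
  fixes W :: "real \<Rightarrow> real \<Rightarrow> real"
  assumes W: "tournamenton W"
begin

lemma W_bounds: "x \<in> space U01 \<Longrightarrow> y \<in> space U01 \<Longrightarrow> 0 \<le> W x y \<and> W x y \<le> 1"
  using tournamenton_bounds[OF W, of x y] by (simp add: space_U01)

lemma bker_W: "U.bker W"
  using W W_bounds by (intro U.bkerI[of _ 1]) (auto simp: tournamenton_def)

lemma p_W_eq_kcomp: "p_W W = (\<lambda>x y. U.kcomp W W y x)"
  by (intro ext) (simp add: p_W_def U.kcomp_def)

lemma bker_p_W: "U.bker (p_W W)"
  unfolding p_W_eq_kcomp by (rule U.bker_swap[OF U.bker_kcomp[OF bker_W bker_W]])

lemma tri_kernel_eq: "tri_kernel W = (\<lambda>x y. (1/2) * (W x y * p_W W x y + W y x * p_W W y x))"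
  by (intro ext) (simp add: tri_kernel_def)

lemma bker_tri_kernel: "U.bker (tri_kernel W)"
  unfolding tri_kernel_eq
  by (intro U.bker_cmult U.bker_add U.bker_mult bker_W bker_p_W U.bker_swap[OF bker_W] U.bker_swap[OF bker_p_W])

lemma ksym_tri_kernel: "U.ksym (tri_kernel W)"
  by (simp add: U.ksym_def tri_kernel_def)

lemma integral_tri_hom_W:
  assumes "x \<in> space U01" "y \<in> space U01"
  shows "(\<integral>z. tri_hom W x y z \<partial>U01) = tri_kernel W x y"
proof -
  have b: "integrable U01 (\<lambda>z. W y z * W z x)" if "x \<in> space U01" "y \<in> space U01" for x y
    by (intro U.bfun_integrable U.bfun_mult U.bker_slice1[OF bker_W] U.bker_slice2[OF bker_W] that)
  have "(\<integral>z. tri_hom W x y z \<partial>U01) = (\<integral>z. (1/2) * (W x y * (W y z * W z x)) + (1/2) * (W y x * (W x z * W z y)) \<partial>U01)"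
    by (intro Bochner_Integration.integral_cong refl) (simp add: tri_hom_def)
  also have "\<dots> = (1/2) * (W x y * p_W W x y) + (1/2) * (W y x * p_W W y x)"
    using b[OF assms] b[OF assms(2,1)] unfolding p_W_def by (subst Bochner_Integration.integral_add) simp_all
  finally show ?thesis by (simp add: tri_kernel_def)
qed

lemma tri_hom_W_measurable: "(\<lambda>p. tri_hom W (fst p) (fst (snd p)) (snd (snd p))) \<in> borel_measurable (U01 \<Otimes>\<^sub>M U01 \<Otimes>\<^sub>M U01)"
  unfolding tri_hom_def
  by (intro borel_measurable_divide borel_measurable_add borel_measurable_times borel_measurable_const tournamenton_measurable[OF W]
      measurable_fst measurable_compose[OF measurable_snd measurable_fst] measurable_compose[OF measurable_snd measurable_snd])

lemma limit_density_tri_cycle: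
  "limit_density (2*k+2) W (tri_cycle k) = (\<integral>x. U.kpow (tri_kernel W) k x x \<partial>U01)"
proof -
  have "limit_density (2*k+2) W (tri_cycle k) = (\<integral>x. U.kpow (\<lambda>x y. \<integral>z. tri_hom W x y z \<partial>U01) k x x \<partial>U01)"
    unfolding limit_density_def by (rule U.integral_tri_cycle(1)[OF tri_hom_W_measurable W_bounds])
  also have "\<dots> = (\<integral>x. U.kpow (tri_kernel W) k x x \<partial>U01)"
    by (intro Bochner_Integration.integral_cong refl U.kpow_cong integral_tri_hom_W)
  finally show ?thesis .
qed

lemma tri_cycle_W_measurable: "(\<lambda>\<eta>. tri_cycle k (\<lambda>i j. W (\<eta> i) (\<eta> j))) \<in> borel_measurable (PiM {..<2*k+2} (\<lambda>_. U01))"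
  by (rule U.integral_tri_cycle(2)[OF tri_hom_W_measurable W_bounds])

end

text \<open>Two triangles over the pair \<open>0, 2\<close> with apexes 1 and 3, multiplied out
  for an entry \<open>c 0 2\<close> that is 0 or 1: the pair then occurs to the first
  power.\<close>

definition ear_density :: "(nat \<Rightarrow> nat \<Rightarrow> real) \<Rightarrow> real" where
  "ear_density c = (c 0 2 * (c 2 1 * c 1 0) * (c 2 3 * c 3 0) + c 2 0 * (c 0 1 * c 1 2) * (c 0 3 * c 3 2)) / 4"

lemma tri_cycle_1_eq_ear_density:
  assumes "c 0 2 = 0 \<and> c 2 0 = 1 \<or> c 0 2 = 1 \<and> c 2 0 = 0"
  shows "tri_cycle 1 c = ear_density c"
proof -
  have "{..1::nat} = {0, 1}" by auto
  then have "tri_cycle 1 c = tri_hom c 0 2 1 * tri_hom c 2 0 3" by (simp add: tri_cycle_def numeral_2_eq_2 numeral_3_eq_3)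
  then show ?thesis using assms by (auto simp: tri_hom_def ear_density_def)
qed

lemma ear_density_bound:
  assumes b: "\<And>i j. i < 4 \<Longrightarrow> j < 4 \<Longrightarrow> 0 \<le> c i j \<and> c i j \<le> 1" shows "0 \<le> ear_density c" "ear_density c \<le> 1"
proof -
  have 1: "0 \<le> x * y \<and> x * y \<le> 1" if "0 \<le> x \<and> x \<le> 1" "0 \<le> y \<and> y \<le> 1" for x y :: real
    using that mult_le_one[of x y] by simp
  have "0 \<le> c 0 2 * (c 2 1 * c 1 0) * (c 2 3 * c 3 0) \<and> c 0 2 * (c 2 1 * c 1 0) * (c 2 3 * c 3 0) \<le> 1"
    "0 \<le> c 2 0 * (c 0 1 * c 1 2) * (c 0 3 * c 3 2) \<and> c 2 0 * (c 0 1 * c 1 2) * (c 0 3 * c 3 2) \<le> 1"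
    by (intro 1 b; simp)+
  then show "0 \<le> ear_density c" "ear_density c \<le> 1" by (simp_all add: ear_density_def)
qed

lemma ear_density_cong: "(\<And>i j. i < 4 \<Longrightarrow> j < 4 \<Longrightarrow> c i j = c' i j) \<Longrightarrow> ear_density c = ear_density c'"
  unfolding ear_density_def by simp

lemma pair_affine_ear_density: "pair_affine 4 ear_density"
  unfolding pair_affine_def
proof (intro allI impI)
  fix c :: "nat \<Rightarrow> nat \<Rightarrow> real" and i j :: nat and t :: real assume ij: "i < 4" "j < 4" "i \<noteq> j"
  have 4: "{..<4::nat} = {0, 1, 2, 3}" by auto
  have "i \<in> {..<4}" "j \<in> {..<4}" using ij by simp_all
  then show "ear_density (flip_entry c i j t) = t * ear_density (flip_entry c i j 1) + (1 - t) * ear_density (flip_entry c i j 0)"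
    using ij(3) unfolding 4 insert_iff empty_iff
    by (elim disjE) (simp_all add: ear_density_def flip_entry_def algebra_simps add_divide_distrib diff_divide_distrib)
qed

text \<open>Both apexes are integrated out with the base fixed, which gives the square of the same
  average.\<close>

lemma (in prob_space) integral_ears:
  fixes u :: "'a \<Rightarrow> 'a \<Rightarrow> 'a \<Rightarrow> real"
  assumes g: "bker g" and um: "\<And>N f h k. f \<in> N \<rightarrow>\<^sub>M M \<Longrightarrow> h \<in> N \<rightarrow>\<^sub>M M \<Longrightarrow> k \<in> N \<rightarrow>\<^sub>M M \<Longrightarrow> (\<lambda>x. u (f x) (h x) (k x)) \<in> borel_measurable (N :: (nat \<Rightarrow> 'a) measure)"
    and ub: "\<And>x y z. x \<in> space M \<Longrightarrow> y \<in> space M \<Longrightarrow> z \<in> space M \<Longrightarrow> \<bar>u x y z\<bar> \<le> 1"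
    and p: "bker p" "\<And>x y. x \<in> space M \<Longrightarrow> y \<in> space M \<Longrightarrow> p x y = (\<integral>z. u x y z \<partial>M)"
  shows "(\<integral>x. g (x 0) (x 2) * u (x 0) (x 2) (x 1) * u (x 0) (x 2) (x 3) \<partial>PiM {..<4::nat} (\<lambda>_. M)) = (\<integral>x. (\<integral>y. g x y * (p x y)\<^sup>2 \<partial>M) \<partial>M)"
    and "integrable (PiM {..<4::nat} (\<lambda>_. M)) (\<lambda>x. g (x 0) (x 2) * u (x 0) (x 2) (x 1) * u (x 0) (x 2) (x 3))"
proof -
  let ?P = "\<lambda>I. PiM I (\<lambda>_::nat. M)"
  obtain B where B: "B > 0" "\<And>x y. x \<in> space M \<Longrightarrow> y \<in> space M \<Longrightarrow> \<bar>g x y\<bar> \<le> B" using bker_bound[OF g] by metis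
  obtain D where D: "D > 0" "\<And>x y. x \<in> space M \<Longrightarrow> y \<in> space M \<Longrightarrow> \<bar>p x y\<bar> \<le> D" using bker_bound[OF p(1)] by metis
  have km: "(\<lambda>x. k (x 0) (x 2)) \<in> borel_measurable (?P I)" if "bker k" "0 \<in> I" "2 \<in> I" for k and I :: "nat set"
    using measurable_compose[OF measurable_Pair bker_measurable[OF that(1)], of "\<lambda>x. x 0" "?P I" "\<lambda>x. x 2"] that by simp
  have S: "{..<4::nat} = insert 3 (insert 1 (insert 2 {0}))" by auto
  let ?I2 = "insert 2 {0::nat}" and ?I1 = "insert 1 (insert 2 {0::nat})"
  let ?F = "\<lambda>x. g (x 0) (x 2) * u (x 0) (x 2) (x 1) * u (x 0) (x 2) (x 3)"
  let ?G = "\<lambda>x. g (x 0) (x 2) * p (x 0) (x 2) * u (x 0) (x 2) (x 1)"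
  have Fm: "?F \<in> borel_measurable (?P (insert 3 ?I1))" by (intro borel_measurable_times km g um measurable_component_singleton) auto
  have Fb: "\<bar>?F x\<bar> \<le> B * 1 * 1" if x: "x \<in> space (?P (insert 3 ?I1))" for x
    unfolding abs_mult using B by (intro mult_mono B ub space_PiM_D[OF x]) auto
  show "integrable (?P {..<4::nat}) ?F" unfolding S by (rule integrable_PiM_bounded[OF Fm Fb])
  have Gm: "?G \<in> borel_measurable (?P ?I1)" by (intro borel_measurable_times km g p um measurable_component_singleton) auto
  have Gb: "\<bar>?G x\<bar> \<le> B * D * 1" if x: "x \<in> space (?P ?I1)" for x
    unfolding abs_mult using B D by (intro mult_mono B D ub space_PiM_D[OF x]) auto
  have h: "bker (\<lambda>x y. g x y * (p x y)\<^sup>2)" unfolding power2_eq_square by (intro bker_mult g p)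
  obtain E where E: "E > 0" "\<And>x y. x \<in> space M \<Longrightarrow> y \<in> space M \<Longrightarrow> \<bar>g x y * (p x y)\<^sup>2\<bar> \<le> E" using bker_bound[OF h] by metis
  have "(\<integral>x. ?F x \<partial>?P {..<4::nat}) = (\<integral>x. (\<integral>y. ?F (x(3 := y)) \<partial>M) \<partial>?P ?I1)"
    unfolding S by (rule integral_PiM_insert[OF _ _ Fm Fb]) auto
  also have "\<dots> = (\<integral>x. ?G x \<partial>?P ?I1)"
  proof (rule Bochner_Integration.integral_cong[OF refl])
    fix x assume x: "x \<in> space (?P ?I1)"
    have "(\<integral>y. u (x 0) (x 2) y \<partial>M) = p (x 0) (x 2)" by (rule p(2)[symmetric]; rule space_PiM_D[OF x]; simp)
    then show "(\<integral>y. ?F (x(3 := y)) \<partial>M) = ?G x" by simp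
  qed
  also have "\<dots> = (\<integral>x. (\<integral>y. ?G (x(1 := y)) \<partial>M) \<partial>?P ?I2)"
    by (rule integral_PiM_insert[OF _ _ Gm Gb]) auto
  also have "\<dots> = (\<integral>x. g (x 0) (x 2) * (p (x 0) (x 2))\<^sup>2 \<partial>?P ?I2)"
  proof (rule Bochner_Integration.integral_cong[OF refl])
    fix x assume x: "x \<in> space (?P ?I2)"
    have "(\<integral>y. u (x 0) (x 2) y \<partial>M) = p (x 0) (x 2)" by (rule p(2)[symmetric]; rule space_PiM_D[OF x]; simp)
    then show "(\<integral>y. ?G (x(1 := y)) \<partial>M) = g (x 0) (x 2) * (p (x 0) (x 2))\<^sup>2" by (simp add: power2_eq_square)
  qed
  also have "\<dots> = (\<integral>x. (\<integral>y. g ((x(2 := y)) 0) ((x(2 := y)) 2) * (p ((x(2 := y)) 0) ((x(2 := y)) 2))\<^sup>2 \<partial>M) \<partial>?P {0})"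
  proof (rule integral_PiM_insert)
    show "(\<lambda>x. g (x 0) (x 2) * (p (x 0) (x 2))\<^sup>2) \<in> borel_measurable (?P ?I2)" by (rule km[OF h]) auto
    show "\<bar>g (x 0) (x 2) * (p (x 0) (x 2))\<^sup>2\<bar> \<le> E" if x: "x \<in> space (?P ?I2)" for x
      by (intro E space_PiM_D[OF x]) auto
  qed auto
  also have "\<dots> = (\<integral>x. (\<integral>y. g (x 0) y * (p (x 0) y)\<^sup>2 \<partial>M) \<partial>?P {0})" by simp
  also have "\<dots> = (\<integral>x. (\<integral>y. g x y * (p x y)\<^sup>2 \<partial>M) \<partial>M)"
    using product_sigma_finite.product_integral_singleton[of "\<lambda>_. M", OF _ bfun_measurable[OF bker_integral1[OF h]], of 0] sigma_finite_measure_axioms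
    by (simp add: product_sigma_finite_def)
  finally show "(\<integral>x. ?F x \<partial>?P {..<4::nat}) = (\<integral>x. (\<integral>y. g x y * (p x y)\<^sup>2 \<partial>M) \<partial>M)" .
qed

context
  fixes W :: "real \<Rightarrow> real \<Rightarrow> real"
  assumes W: "tournamenton W"
begin

lemma tau_W_nonneg_integrand: "x \<in> space U01 \<Longrightarrow> y \<in> space U01 \<Longrightarrow> 0 \<le> W x y * W y x * (p_W W x y - p_W W y x)\<^sup>2"
  using W_bounds[OF W] by (intro mult_nonneg_nonneg) auto

lemma bker_tau: "U.bker (\<lambda>x y. W x y * W y x * (p_W W x y - p_W W y x)\<^sup>2)"
  unfolding power2_eq_square
  by (intro U.bker_mult U.bker_diff bker_W[OF W] bker_p_W[OF W] U.bker_swap[OF bker_W[OF W]] U.bker_swap[OF bker_p_W[OF W]])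

lemma tau_W_square: "(tau_W W)\<^sup>2 = (1/2) * (\<integral>x. (\<integral>y. W x y * W y x * (p_W W x y - p_W W y x)\<^sup>2 \<partial>U01) \<partial>U01)"
proof -
  have "0 \<le> (\<integral>p. (case p of (x, y) \<Rightarrow> W x y * W y x * (p_W W x y - p_W W y x)\<^sup>2) \<partial>U01_2)"
    using tau_W_nonneg_integrand by (intro Bochner_Integration.integral_nonneg) (auto simp: space_pair_measure)
  then show ?thesis unfolding tau_W_def using U.bker_integral_pair[OF bker_tau] by simp
qed

text \<open>Pointwise, \<open>w * p\<^sup>2 + (1 - w) * q\<^sup>2 = (w * p + (1 - w) * q)\<^sup>2
  + w * (1 - w) * (p - q)\<^sup>2\<close>: the second term is the variance of the bit that the
  reduction has averaged only once.\<close>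

lemma limit_density_ear:
  "limit_density 4 W ear_density = U.kinner (tri_kernel W) (tri_kernel W) + (tau_W W)\<^sup>2 / 2"
proof -
  let ?p = "p_W W"
  have um: "(\<lambda>x. W (h x) (k x) * W (k x) (f x)) \<in> borel_measurable N"
    if "f \<in> N \<rightarrow>\<^sub>M U01" "h \<in> N \<rightarrow>\<^sub>M U01" "k \<in> N \<rightarrow>\<^sub>M U01" for f h k and N :: "(nat \<Rightarrow> real) measure"
    by (intro borel_measurable_times tournamenton_measurable[OF W] that)
  have ub: "\<bar>W y z * W z x\<bar> \<le> 1" if "x \<in> space U01" "y \<in> space U01" "z \<in> space U01" for x y z
    using W_bounds[OF W that(2,3)] W_bounds[OF W that(3,1)] by (simp add: abs_mult mult_le_one)
  note e1' = U.integral_ears[of W "\<lambda>x y z. W y z * W z x" ?p, OF bker_W[OF W] um ub bker_p_W[OF W] p_W_def]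
  note e2' = U.integral_ears[of "\<lambda>x y. W y x" "\<lambda>x y z. W x z * W z y" "\<lambda>x y. ?p y x", OF U.bker_swap[OF bker_W[OF W]] um ub U.bker_swap[OF bker_p_W[OF W]] p_W_def]
  let ?f = "\<lambda>\<eta>::nat \<Rightarrow> real. W (\<eta> 0) (\<eta> 2) * (W (\<eta> 2) (\<eta> 1) * W (\<eta> 1) (\<eta> 0)) * (W (\<eta> 2) (\<eta> 3) * W (\<eta> 3) (\<eta> 0))"
    and ?f' = "\<lambda>\<eta>::nat \<Rightarrow> real. W (\<eta> 2) (\<eta> 0) * (W (\<eta> 0) (\<eta> 1) * W (\<eta> 1) (\<eta> 2)) * (W (\<eta> 0) (\<eta> 3) * W (\<eta> 3) (\<eta> 2))"
  have e1: "(\<integral>\<eta>. ?f \<eta> \<partial>PiM {..<4::nat} (\<lambda>_. U01)) = (\<integral>x. (\<integral>y. W x y * (?p x y)\<^sup>2 \<partial>U01) \<partial>U01)"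
    "integrable (PiM {..<4::nat} (\<lambda>_. U01)) ?f"
    by (rule e1'; assumption)+
  have e2: "(\<integral>\<eta>. ?f' \<eta> \<partial>PiM {..<4::nat} (\<lambda>_. U01)) = (\<integral>x. (\<integral>y. W y x * (?p y x)\<^sup>2 \<partial>U01) \<partial>U01)"
    "integrable (PiM {..<4::nat} (\<lambda>_. U01)) ?f'"
    by (rule e2'; assumption)+
  let ?b = "\<lambda>x y. W x y * (?p x y)\<^sup>2" and ?b' = "\<lambda>x y. W y x * (?p y x)\<^sup>2"
  have b: "U.bker ?b" "U.bker ?b'" unfolding power2_eq_square
    by (intro U.bker_mult bker_W[OF W] bker_p_W[OF W] U.bker_swap[OF bker_W[OF W]] U.bker_swap[OF bker_p_W[OF W]])+
  let ?T = "\<lambda>x y. W x y * W y x * (?p x y - ?p y x)\<^sup>2" and ?K = "\<lambda>x y. tri_kernel W x y * tri_kernel W x y"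
  have K: "U.bker ?K" by (intro U.bker_mult bker_tri_kernel[OF W])
  have "limit_density 4 W ear_density
      = (\<integral>\<eta>. (1/4) * (W (\<eta> 0) (\<eta> 2) * (W (\<eta> 2) (\<eta> 1) * W (\<eta> 1) (\<eta> 0)) * (W (\<eta> 2) (\<eta> 3) * W (\<eta> 3) (\<eta> 0)))
          + (1/4) * (W (\<eta> 2) (\<eta> 0) * (W (\<eta> 0) (\<eta> 1) * W (\<eta> 1) (\<eta> 2)) * (W (\<eta> 0) (\<eta> 3) * W (\<eta> 3) (\<eta> 2))) \<partial>PiM {..<4::nat} (\<lambda>_. U01))"
    unfolding limit_density_def ear_density_def by (simp add: add_divide_distrib)
  also have "\<dots> = (1/4) * (\<integral>x. (\<integral>y. ?b x y \<partial>U01) \<partial>U01) + (1/4) * (\<integral>x. (\<integral>y. ?b' x y \<partial>U01) \<partial>U01)"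
  proof -
    have 1: "integrable Q (\<lambda>\<eta>. (1/4) * f \<eta> + (1/4) * h \<eta>) \<and> (\<integral>\<eta>. (1/4) * f \<eta> + (1/4) * h \<eta> \<partial>Q) = (1/4) * (\<integral>\<eta>. f \<eta> \<partial>Q) + (1/4) * (\<integral>\<eta>. h \<eta> \<partial>Q)"
      if "integrable Q f" "integrable Q h" for Q :: "(nat \<Rightarrow> real) measure" and f h :: "_ \<Rightarrow> real" using that by simp
    show ?thesis using 1[OF e1(2) e2(2)] unfolding e1(1) e2(1) by (rule conjunct2)
  qed
  also have "\<dots> = (\<integral>x. (\<integral>y. (1/4) * ?b x y + (1/4) * ?b' x y \<partial>U01) \<partial>U01)"
  proof -
    have "(\<integral>x. (\<integral>y. (1/4) * ?b x y + (1/4) * ?b' x y \<partial>U01) \<partial>U01) = (\<integral>x. (1/4) * (\<integral>y. ?b x y \<partial>U01) + (1/4) * (\<integral>y. ?b' x y \<partial>U01) \<partial>U01)"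
      by (intro Bochner_Integration.integral_cong refl)
        (simp add: U.bfun_integrable[OF U.bker_slice1[OF b(1)]] U.bfun_integrable[OF U.bker_slice1[OF b(2)]])
    also have "\<dots> = (1/4) * (\<integral>x. (\<integral>y. ?b x y \<partial>U01) \<partial>U01) + (1/4) * (\<integral>x. (\<integral>y. ?b' x y \<partial>U01) \<partial>U01)"
      using U.bfun_integrable[OF U.bker_integral1[OF b(1)]] U.bfun_integrable[OF U.bker_integral1[OF b(2)]] by simp
    finally show ?thesis by simp
  qed
  also have "\<dots> = (\<integral>x. (\<integral>y. ?K x y + (1/4) * ?T x y \<partial>U01) \<partial>U01)"
  proof (intro Bochner_Integration.integral_cong refl)
    fix x y assume "x \<in> space U01" "y \<in> space U01"
    then have s: "W y x = 1 - W x y" using tournamenton_bounds[OF W, of x y] by (simp add: space_U01)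
    show "(1/4) * ?b x y + (1/4) * ?b' x y = ?K x y + (1/4) * ?T x y"
      unfolding tri_kernel_def s by (simp add: power2_eq_square field_simps)
  qed
  also have "\<dots> = (\<integral>x. (\<integral>y. ?K x y \<partial>U01) + (1/4) * (\<integral>y. ?T x y \<partial>U01) \<partial>U01)"
    by (intro Bochner_Integration.integral_cong refl)
      (simp add: U.bfun_integrable[OF U.bker_slice1[OF K]] U.bfun_integrable[OF U.bker_slice1[OF bker_tau]])
  also have "\<dots> = (\<integral>x. (\<integral>y. ?K x y \<partial>U01) \<partial>U01) + (1/4) * (\<integral>x. (\<integral>y. ?T x y \<partial>U01) \<partial>U01)"
    using U.bfun_integrable[OF U.bker_integral1[OF K]] U.bfun_integrable[OF U.bker_integral1[OF bker_tau]] by simp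
  also have "(\<integral>x. (\<integral>y. ?K x y \<partial>U01) \<partial>U01) = U.kinner (tri_kernel W) (tri_kernel W)"
    unfolding U.kinner_def by (rule U.bker_Fubini[OF K])
  finally show ?thesis unfolding tau_W_square by simp
qed

lemma AE_tournament_range:
  assumes T: "is_random_tournament M T n W"
  shows "AE \<omega> in M. T \<omega> \<in> range (adjacency n)"
proof -
  have Tm: "T \<in> M \<rightarrow>\<^sub>M count_space UNIV" and d: "distr M (count_space UNIV) T = random_tournament n W"
    using T by (auto simp: is_random_tournament_def)
  let ?F = "indicator (- range (adjacency n)) :: _ \<Rightarrow> real"
  have z: "tournament_exp n W \<eta> (\<lambda>b. ?F (adjacency n b)) = 0" for \<eta>
    by (simp add: tournament_exp_def bern_exp_const)
  have "(\<integral>\<^sup>+\<omega>. ennreal (?F (T \<omega>)) \<partial>M) = (\<integral>\<^sup>+a. ennreal (?F a) \<partial>random_tournament n W)"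
    unfolding d[symmetric] by (subst nn_integral_distr[OF Tm]) simp_all
  also have "\<dots> = 0" by (subst nn_integral_random_tournament[OF W]) (simp_all only: z indicator_pos_le ennreal_0 nn_integral_const mult_zero_left)
  finally have "AE \<omega> in M. ennreal (?F (T \<omega>)) = 0"
    by (subst (asm) nn_integral_0_iff_AE) (auto intro: measurable_compose[OF Tm])
  then show ?thesis by eventually_elim (auto simp: indicator_def split: if_splits)
qed

text \<open>The two patterns differ only on samples that use one vertex for both ends of the base,
  where the diagonal entry \<open>1 / 2\<close> spoils the reduction.\<close>

lemma avg_ear_density:
  assumes n: "n \<ge> 1"
  shows "\<bar>avg n 4 (tri_cycle 1) (adjacency n b) - avg n 4 ear_density (adjacency n b)\<bar> \<le> 2 / real n"
proof -
  let ?a = "adjacency n b"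
  have "\<bar>avg n 4 (tri_cycle 1) ?a - avg n 4 ear_density ?a\<bar> \<le> (\<integral>x. 2 * of_bool (x 0 = x 2) \<partial>PiM {..<4::nat} (\<lambda>_. unif n))"
    unfolding avg_def
  proof (rule integral_diff_le[OF n])
    fix x :: "nat \<Rightarrow> nat" assume x: "x \<in> PiE {..<4::nat} (\<lambda>_. {1..n})"
    show "\<bar>tri_cycle 1 (\<lambda>i j. ?a (x i) (x j)) - ear_density (\<lambda>i j. ?a (x i) (x j))\<bar> \<le> 2 * of_bool (x 0 = x 2)"
    proof (cases "x 0 = x 2")
      case True
      have "\<bar>tri_cycle 1 (\<lambda>i j. ?a (x i) (x j))\<bar> \<le> 1" by (rule tri_cycle_bound[OF adjacency_bounds])
      moreover have "0 \<le> ear_density (\<lambda>i j. ?a (x i) (x j))" "ear_density (\<lambda>i j. ?a (x i) (x j)) \<le> 1"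
        by (rule ear_density_bound[OF adjacency_bounds])+
      ultimately show ?thesis using True by simp
    next
      case False
      have "x 0 \<in> {1..n}" "x 2 \<in> {1..n}" by (rule PiE_mem[OF x], simp)+
      then have "?a (x 0) (x 2) = 0 \<and> ?a (x 2) (x 0) = 1 \<or> ?a (x 0) (x 2) = 1 \<and> ?a (x 2) (x 0) = 0"
        using False by (auto simp: adjacency_def)
      then show ?thesis using tri_cycle_1_eq_ear_density[of "\<lambda>i j. ?a (x i) (x j)"] by simp
    qed
  qed
  also have "\<dots> = 2 * (1 / real n)"
    using integral_collision[OF n, of 0 4 2] by simp
  finally show ?thesis by simp
qed

theorem power_sums_converge:
  assumes M: "prob_space M" and T: "\<And>n. n \<ge> 1 \<Longrightarrow> is_random_tournament M (T n) n W"
  shows "AE \<omega> in M. \<forall>k. (\<lambda>n. \<Sum>s=1..n. eigenvalue_desc (tri_hat_mat n (T n \<omega>)) s ^ (k + 2)) \<longlonglongrightarrow>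
    U.kinner (tri_kernel W) (U.kpow (tri_kernel W) k) + (if k = 0 then (tau_W W)\<^sup>2 / 2 else 0)"
proof -
  let ?K = "tri_kernel W"
  let ?e = "\<lambda>k n \<omega>. \<Sum>s=1..n. eigenvalue_desc (tri_hat_mat n (T n \<omega>)) s ^ (k + 2)"
  let ?R = "\<lambda>\<omega>. \<forall>n. n \<ge> 1 \<longrightarrow> T n \<omega> \<in> range (adjacency n)"
  have "AE \<omega> in M. n \<ge> 1 \<longrightarrow> T n \<omega> \<in> range (adjacency n)" for n
    using AE_tournament_range[OF T, of n] by (cases "n \<ge> 1") auto
  then have R: "AE \<omega> in M. ?R \<omega>" by (intro AE_all_countable[THEN iffD2] allI)
  have e: "avg n (2 * Suc k + 2) (tri_cycle (Suc k)) (T n \<omega>) = ?e k n \<omega>" if r: "?R \<omega>" and n: "n \<ge> 1" for n k \<omega>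
  proof -
    obtain b where "T n \<omega> = adjacency n b" using r n by blast
    then show ?thesis using avg_tri_cycle[OF n, of "T n \<omega>" "Suc k"] adjacency_bounds by (simp only: add_2_eq_Suc' simp_thms)
  qed
  have lim: "limit_density (2 * Suc k + 2) W (tri_cycle (Suc k)) = U.kinner ?K (U.kpow ?K k)" for k
    unfolding limit_density_tri_cycle[OF W] U.kinner_kpow_trace[OF bker_tri_kernel[OF W] ksym_tri_kernel[OF W]] ..
  have "AE \<omega> in M. (\<lambda>n. ?e k n \<omega>) \<longlonglongrightarrow> U.kinner ?K (U.kpow ?K k) + (if k = 0 then (tau_W W)\<^sup>2 / 2 else 0)" for k
  proof (cases "k = 0")
    case False
    then have k: "2 \<le> Suc k" by simp
    have "AE \<omega> in M. (\<lambda>n. avg n (2 * Suc k + 2) (tri_cycle (Suc k)) (T n \<omega>)) \<longlonglongrightarrow> limit_density (2 * Suc k + 2) W (tri_cycle (Suc k))"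
      by (rule avg_converges_AE[OF W tri_cycle_cong tri_cycle_bound pair_affine_tri_cycle[OF k] tri_cycle_W_measurable[OF W] M T])
    with R show ?thesis
    proof eventually_elim
      case (elim \<omega>)
      have "eventually (\<lambda>n. avg n (2 * Suc k + 2) (tri_cycle (Suc k)) (T n \<omega>) = ?e k n \<omega>) sequentially"
        using eventually_ge_at_top[of 1] by eventually_elim (rule e[OF elim(1)])
      then have "(\<lambda>n. ?e k n \<omega>) \<longlonglongrightarrow> limit_density (2 * Suc k + 2) W (tri_cycle (Suc k))"
        using elim(2) by (rule Lim_transform_eventually[rotated])
      then show ?case using False unfolding lim by simp
    qed
  next
    case True
    have "(\<lambda>\<eta>. ear_density (\<lambda>i j. W (\<eta> i) (\<eta> j))) \<in> borel_measurable (PiM {..<4::nat} (\<lambda>_. U01))"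
      unfolding ear_density_def
      by (intro borel_measurable_divide borel_measurable_add borel_measurable_times borel_measurable_const
          tournamenton_measurable[OF W] measurable_component_singleton) auto
    note meas = this
    have bd: "\<bar>ear_density c\<bar> \<le> 1" if "\<And>i j. i < 4 \<Longrightarrow> j < 4 \<Longrightarrow> 0 \<le> c i j \<and> c i j \<le> 1" for c
      using ear_density_bound[OF that] by simp
    have "AE \<omega> in M. (\<lambda>n. avg n 4 ear_density (T n \<omega>)) \<longlonglongrightarrow> limit_density 4 W ear_density"
      by (rule avg_converges_AE[where C = 1, OF W ear_density_cong bd pair_affine_ear_density meas M T])
    with R show ?thesis
    proof eventually_elim
      case (elim \<omega>)
      have "(\<lambda>n. ?e 0 n \<omega> - avg n 4 ear_density (T n \<omega>)) \<longlonglongrightarrow> 0"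
      proof (rule Lim_null_comparison)
        show "(\<lambda>n. 2 / real n) \<longlonglongrightarrow> 0" by (rule lim_const_over_n)
        show "eventually (\<lambda>n. norm (?e 0 n \<omega> - avg n 4 ear_density (T n \<omega>)) \<le> 2 / real n) sequentially"
          using eventually_ge_at_top[of 1]
        proof eventually_elim
          fix n :: nat assume n: "n \<ge> 1"
          obtain b where b: "T n \<omega> = adjacency n b" using elim(1) n by blast
          have "?e 0 n \<omega> = avg n 4 (tri_cycle 1) (adjacency n b)"
            using e[OF elim(1) n, of 0] by (simp add: b)
          then show "norm (?e 0 n \<omega> - avg n 4 ear_density (T n \<omega>)) \<le> 2 / real n"
            using avg_ear_density[OF n, of b] by (simp only: b real_norm_def)
        qed
      qed
      from tendsto_add[OF this elim(2)] show ?case using True by (simp add: limit_density_ear)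
    qed
  qed
  then show ?thesis by (intro AE_all_countable[THEN iffD2] allI)
qed

end

section \<open>The conditional distribution given the tournament\<close>

text \<open>The variables have different types and are independent through the
  \<open>\<sigma>\<close>-algebras they generate; complex functions of them have a common type, so
  that \<open>indep_var\<close> applies.\<close>

lemma (in prob_space) independent_of_integral_mult:
  fixes f :: "'b \<Rightarrow> complex" and g :: "'c \<Rightarrow> complex"
  assumes ind: "independent_of M A X B Y" and f: "f \<in> borel_measurable A" and g: "g \<in> borel_measurable B"
    and fi: "integrable M (\<lambda>\<omega>. f (X \<omega>))" and gi: "integrable M (\<lambda>\<omega>. g (Y \<omega>))"
  shows "(CLINT \<omega>|M. f (X \<omega>) * g (Y \<omega>)) = (CLINT \<omega>|M. f (X \<omega>)) * (CLINT \<omega>|M. g (Y \<omega>))"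
proof (rule indep_var_lebesgue_integral[OF _ fi gi])
  have X: "X \<in> M \<rightarrow>\<^sub>M A" and Y: "Y \<in> M \<rightarrow>\<^sub>M B"
    and i: "indep_set (sets (vimage_algebra (space M) X A)) (sets (vimage_algebra (space M) Y B))"
    using ind by (auto simp: independent_of_def)
  have gen: "sigma_sets (space M) {(\<lambda>\<omega>. h (V \<omega>)) -` S \<inter> space M |S. S \<in> sets borel} \<subseteq> sets (vimage_algebra (space M) V C)"
    if V: "V \<in> M \<rightarrow>\<^sub>M C" and h: "h \<in> borel_measurable C" for V :: "'a \<Rightarrow> 'd" and C and h :: "'d \<Rightarrow> complex"
  proof -
    have "V \<in> vimage_algebra (space M) V C \<rightarrow>\<^sub>M C" using measurable_space[OF V] by (intro measurable_vimage_algebra1) auto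
    from measurable_compose[OF this h] have m: "(\<lambda>\<omega>. h (V \<omega>)) \<in> borel_measurable (vimage_algebra (space M) V C)" .
    have "{(\<lambda>\<omega>. h (V \<omega>)) -` S \<inter> space M |S. S \<in> sets borel} \<subseteq> sets (vimage_algebra (space M) V C)"
      using measurable_sets[OF m] by auto
    from sets.sigma_sets_subset[OF this] show ?thesis by simp
  qed
  show "indep_var borel (\<lambda>\<omega>. f (X \<omega>)) borel (\<lambda>\<omega>. g (Y \<omega>))"
    unfolding indep_var_eq
  proof (intro conjI)
    show "random_variable borel (\<lambda>\<omega>. f (X \<omega>))" by (rule measurable_compose[OF X f])
    show "random_variable borel (\<lambda>\<omega>. g (Y \<omega>))" by (rule measurable_compose[OF Y g])
    show "indep_set (sigma_sets (space M) {(\<lambda>\<omega>. f (X \<omega>)) -` S \<inter> space M |S. S \<in> sets borel})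
       (sigma_sets (space M) {(\<lambda>\<omega>. g (Y \<omega>)) -` S \<inter> space M |S. S \<in> sets borel})"
      using i unfolding indep_set_def
      by (rule indep_sets_mono_sets) (use gen[OF X f] gen[OF Y g] in \<open>auto split: bool.split\<close>)
  qed
qed

lemma (in prob_space) integral_uniform_measure:
  fixes f :: "'a \<Rightarrow> complex"
  assumes A: "A \<in> events" "prob A \<noteq> 0" and f: "f \<in> borel_measurable M"
  shows "integral\<^sup>L (uniform_measure M A) f = (CLINT \<omega>|M. indicator A \<omega> * f \<omega>) / prob A"
proof -
  have "uniform_measure M A = density M (\<lambda>x. ennreal (indicator A x / prob A))"
    unfolding uniform_measure_def
  proof (rule arg_cong[of _ _ "density M"], rule ext)
    fix x show "indicator A x / emeasure M A = ennreal (indicator A x / prob A)"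
      using A(2) by (cases "x \<in> A") (simp_all add: emeasure_eq_measure divide_ennreal zero_less_measure_iff flip: ennreal_1)
  qed
  then have "integral\<^sup>L (uniform_measure M A) f = (\<integral>x. (indicator A x / prob A) *\<^sub>R f x \<partial>M)"
    using A(1) by (simp add: integral_density f)
  also have "\<dots> = (CLINT \<omega>|M. (indicator A \<omega> * f \<omega>) / prob A)"
    by (intro Bochner_Integration.integral_cong refl) (simp add: scaleR_conv_of_real split: split_indicator)
  finally show ?thesis by simp
qed

lemma finite_range_adjacency: "finite (range (adjacency n))"
proof (rule finite_subset)
  show "range (adjacency n) \<subseteq> (\<lambda>S. adjacency n (\<lambda>e. e \<in> S)) ` Pow (arcs n)"
  proof clarify
    fix b
    have "adjacency n b = adjacency n (\<lambda>e. e \<in> {e \<in> arcs n. b e})" by (intro ext) (auto simp: adjacency_def)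
    then show "adjacency n b \<in> (\<lambda>S. adjacency n (\<lambda>e. e \<in> S)) ` Pow (arcs n)"
      by (rule image_eqI) auto
  qed
  show "finite ((\<lambda>S. adjacency n (\<lambda>e. e \<in> S)) ` Pow (arcs n))" by (intro finite_imageI finite_Pow_iff[THEN iffD2] finite_arcs)
qed

text \<open>The null atoms are finitely many, so together they form a null set.\<close>

lemma (in prob_space) AE_atom_positive:
  assumes T: "T \<in> M \<rightarrow>\<^sub>M count_space UNIV" and R: "finite R" "AE \<omega> in M. T \<omega> \<in> R"
  shows "AE \<omega> in M. prob {\<omega>' \<in> space M. T \<omega>' = T \<omega>} \<noteq> 0"
proof -
  let ?N = "{a \<in> R. prob {\<omega>' \<in> space M. T \<omega>' = a} = 0}"
  have ev: "{\<omega>' \<in> space M. T \<omega>' = a} \<in> events" for a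
    using measurable_sets[OF T, of "{a}"] by (simp add: vimage_def Int_def conj_commute)
  have "AE \<omega> in M. T \<omega> \<noteq> a" if "prob {\<omega>' \<in> space M. T \<omega>' = a} = 0" for a
    using that ev[of a] by (intro AE_I[of _ _ "{\<omega>' \<in> space M. T \<omega>' = a}"]) (auto simp: emeasure_eq_measure)
  then have "AE \<omega> in M. \<forall>a\<in>?N. T \<omega> \<noteq> a" using R(1) by (intro AE_finite_allI) auto
  with R(2) show ?thesis by eventually_elim auto
qed

context
  fixes M :: "'a measure" and n :: nat and T :: "'a \<Rightarrow> nat \<Rightarrow> nat \<Rightarrow> real" and J :: "nat \<Rightarrow> 'a \<Rightarrow> real" and \<omega>0 :: 'a
  assumes M: "prob_space M" and J: "iid_std_normal M J {1..n}"
    and ind: "independent_of M (count_space UNIV) T (PiM {1..n} (\<lambda>_. borel)) (\<lambda>\<omega>. \<lambda>s\<in>{1..n}. J s \<omega>)"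
    and pos: "measure M {\<omega> \<in> space M. T \<omega> = T \<omega>0} \<noteq> 0"
begin

interpretation M: prob_space M by (rule M)

private abbreviation (input) "A0 \<equiv> {\<omega> \<in> space M. T \<omega> = T \<omega>0}"
private abbreviation (input) "X \<equiv> \<lambda>\<omega>. X_hat n (T \<omega>) (\<lambda>s. J s \<omega>)"

lemma measurable_T: "T \<in> M \<rightarrow>\<^sub>M count_space UNIV"
  using ind by (simp add: independent_of_def)

lemma A0_event: "A0 \<in> sets M"
  using measurable_sets[OF measurable_T, of "{T \<omega>0}"] by (simp add: vimage_def Int_def conj_commute)

lemma X_hat_measurable: "X \<in> borel_measurable M"
  unfolding X_hat_def
proof (intro borel_measurable_sum borel_measurable_times borel_measurable_diff borel_measurable_power borel_measurable_const)
  fix s assume s: "s \<in> {2..n}"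
  show "(\<lambda>\<omega>. eigenvalue_desc (tri_hat_mat n (T \<omega>)) s) \<in> borel_measurable M"
    by (rule measurable_compose[OF measurable_T]) simp
  show "J s \<in> borel_measurable M" by (rule M.iid_std_normal_measurable[OF J]) (use s in auto)
qed

lemma real_distribution_cond: "real_distribution (cond_distr_given M X T \<omega>0)"
proof -
  interpret C: prob_space "uniform_measure M A0"
    using A0_event pos by (intro prob_space_uniform_measure) (simp_all add: M.emeasure_eq_measure)
  have "X \<in> uniform_measure M A0 \<rightarrow>\<^sub>M borel" using X_hat_measurable by simp
  then show ?thesis unfolding cond_distr_given_def by (rule C.real_distribution_distr)
qed

text \<open>On the event that the tournament has the given value, its eigenvalues may be replaced
  by constants; then independence removes the conditioning and leaves a finite sum of independent
  centred squares.\<close>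

lemma char_cond:
  "char (cond_distr_given M X T \<omega>0) t = exp (\<Sum>s=2..n. log_cf (t * eigenvalue_desc (tri_hat_mat n (T \<omega>0)) s))"
proof -
  let ?c = "\<lambda>s. eigenvalue_desc (tri_hat_mat n (T \<omega>0)) s"
  let ?g = "\<lambda>y. iexp (t * (\<Sum>s=2..n. ?c s * ((y s)\<^sup>2 - 1)))"
  let ?Y = "\<lambda>\<omega>. \<lambda>s\<in>{1..n}. J s \<omega>" and ?f = "\<lambda>a. indicator {T \<omega>0} a :: complex"
  have gm: "?g \<in> borel_measurable (PiM {1..n} (\<lambda>_. borel))"
  proof -
    have "(\<lambda>y. \<Sum>s=2..n. ?c s * ((y s)\<^sup>2 - 1)) \<in> borel_measurable (PiM {1..n} (\<lambda>_. borel :: real measure))"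
      by (intro borel_measurable_sum borel_measurable_times borel_measurable_diff borel_measurable_power borel_measurable_const
          measurable_component_singleton) auto
    then show ?thesis by measurable
  qed
  have Ym: "?Y \<in> M \<rightarrow>\<^sub>M PiM {1..n} (\<lambda>_. borel)" using ind by (simp add: independent_of_def)
  have gY: "?g (?Y \<omega>) = iexp (t * (\<Sum>s=2..n. ?c s * ((J s \<omega>)\<^sup>2 - 1)))" for \<omega>
    by (intro arg_cong[where f = "\<lambda>x. iexp (t * x)"] sum.cong) auto
  have f: "?f (T \<omega>) = indicator A0 \<omega>" if "\<omega> \<in> space M" for \<omega> using that by (simp add: indicator_def)
  have gi: "integrable M (\<lambda>\<omega>. ?g (?Y \<omega>))"
    using measurable_compose[OF Ym gm] by (intro M.integrable_const_bound[where B = 1]) auto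
  have fm: "(\<lambda>\<omega>. ?f (T \<omega>)) \<in> borel_measurable M" by (rule measurable_compose[OF measurable_T]) simp
  have fi: "integrable M (\<lambda>\<omega>. ?f (T \<omega>))"
    using fm by (intro M.integrable_const_bound[where B = 1]) (auto simp: indicator_def)
  have X0m: "(\<lambda>\<omega>. \<Sum>s=2..n. ?c s * ((J s \<omega>)\<^sup>2 - 1)) \<in> borel_measurable M"
    by (intro borel_measurable_sum borel_measurable_times borel_measurable_diff borel_measurable_power borel_measurable_const
        M.iid_std_normal_measurable[OF J]) auto
  have em: "(\<lambda>\<omega>. iexp (t * X \<omega>)) \<in> borel_measurable M" using X_hat_measurable by measurable
  have "char (cond_distr_given M X T \<omega>0) t = (CLINT \<omega>|uniform_measure M A0. iexp (t * X \<omega>))"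
    unfolding char_def cond_distr_given_def using X_hat_measurable by (subst integral_distr) simp_all
  also have "\<dots> = (CLINT \<omega>|M. indicator A0 \<omega> * iexp (t * X \<omega>)) / measure M A0"
    by (rule M.integral_uniform_measure[OF A0_event pos em])
  also have "(CLINT \<omega>|M. indicator A0 \<omega> * iexp (t * X \<omega>)) = (CLINT \<omega>|M. ?f (T \<omega>) * ?g (?Y \<omega>))"
    unfolding gY by (intro Bochner_Integration.integral_cong refl) (auto simp: X_hat_def split: split_indicator)
  also have "\<dots> = (CLINT \<omega>|M. ?f (T \<omega>)) * (CLINT \<omega>|M. ?g (?Y \<omega>))"
    by (rule M.independent_of_integral_mult[where f = ?f and g = ?g, OF ind _ gm fi gi]) simp
  also have "(CLINT \<omega>|M. ?f (T \<omega>)) = measure M A0"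
  proof -
    have "(CLINT \<omega>|M. ?f (T \<omega>)) = (CLINT \<omega>|M. complex_of_real (indicator A0 \<omega>))"
      by (intro Bochner_Integration.integral_cong refl) (simp add: indicator_def)
    also have "\<dots> = complex_of_real (\<integral>\<omega>. indicator A0 \<omega> \<partial>M)" by (rule integral_complex_of_real)
    also have "(\<integral>\<omega>. indicator A0 \<omega> \<partial>M) = measure M A0" using A0_event by (simp add: Int_absorb2 sets.sets_into_space)
    finally show ?thesis .
  qed
  also have "(CLINT \<omega>|M. ?g (?Y \<omega>)) = char (distr M borel (\<lambda>\<omega>. \<Sum>s=2..n. ?c s * ((J s \<omega>)\<^sup>2 - 1))) t"
    unfolding gY char_def using X0m by (subst integral_distr) simp_all
  also have "\<dots> = exp (\<Sum>s=2..n. log_cf (t * ?c s))" by (rule char_finite_chaos[OF M J]) auto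
  finally show ?thesis using pos by simp
qed

end

section \<open>The law of the limit\<close>

lemma (in prob_space) indep_vars_reindex_inj:
  assumes i: "indep_vars (\<lambda>_. N) X (f ` I)" and f: "inj_on f I"
  shows "indep_vars (\<lambda>_. N) (\<lambda>k. X (f k)) I"
  unfolding indep_vars_def2
proof (intro conjI ballI indep_setsI)
  have rv: "\<And>i. i \<in> f ` I \<Longrightarrow> random_variable N (X i)"
    and ist: "indep_sets (\<lambda>i. {X i -` A \<inter> space M | A. A \<in> sets N}) (f ` I)"
    using i unfolding indep_vars_def2 by blast+
  show "random_variable N (X (f k))" if "k \<in> I" for k using rv that by blast
  show "{X (f k) -` A \<inter> space M |A. A \<in> sets N} \<subseteq> events" if "k \<in> I" for k
    using rv[of "f k"] that by (auto intro: measurable_sets)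
  fix A J assume J: "J \<noteq> {}" "J \<subseteq> I" "finite J" and A: "\<forall>j\<in>J. A j \<in> {X (f j) -` A \<inter> space M |A. A \<in> sets N}"
  have fJ: "inj_on f J" using f J(2) by (rule inj_on_subset)
  let ?B = "\<lambda>i. A (the_inv_into J f i)"
  have B: "?B (f j) = A j" if "j \<in> J" for j using the_inv_into_f_f[OF fJ that] by simp
  have "prob (\<Inter>i\<in>f ` J. ?B i) = (\<Prod>i\<in>f ` J. prob (?B i))"
    by (rule indep_setsD[OF ist]) (use J A B in auto)
  moreover have "(\<Inter>i\<in>f ` J. ?B i) = (\<Inter>j\<in>J. A j)" using B by auto
  moreover have "(\<Prod>i\<in>f ` J. prob (?B i)) = (\<Prod>j\<in>J. prob (A j))" using B by (simp add: prod.reindex[OF fJ])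
  ultimately show "prob (\<Inter>j\<in>J. A j) = (\<Prod>j\<in>J. prob (A j))" by simp
qed

lemma iid_std_normal_case_option:
  assumes "prob_space N" "iid_std_normal N (case_option Z Z') (insert None (Some ` I))"
  shows "iid_std_normal N Z' I"
proof -
  interpret prob_space N by fact
  have "iid_std_normal N (case_option Z Z') (Some ` I)" by (rule iid_std_normal_subset[OF assms(2)]) auto
  then show ?thesis using indep_vars_reindex_inj[of borel "case_option Z Z'" Some I] by (auto simp: iid_std_normal_def)
qed

text \<open>The characteristic function of the Gaussian part plus a finite partial sum is
  explicit, and both sides pass to the limit along finite subsets.\<close>

lemma char_gaussian_chaos:
  assumes N: "prob_space N" and Z: "iid_std_normal N (case_option Z Z') (insert None (Some ` I))"
    and S: "L2_has_sum N (\<lambda>i \<omega>. c i * ((Z' i \<omega>)\<^sup>2 - 1)) I S"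
    and L: "((\<lambda>i. log_cf (t * c i)) has_sum L) I"
  shows "char (distr N borel (\<lambda>\<omega>. \<tau> * Z \<omega> + S \<omega>)) t = exp (L - of_real (\<tau>\<^sup>2 * t\<^sup>2 / 2))"
proof -
  interpret prob_space N by fact
  let ?Y = "case_option Z Z'" and ?I = "insert None (Some ` I)"
  have Z': "iid_std_normal N Z' I" by (rule iid_std_normal_case_option[OF N Z])
  have Zm: "Z \<in> borel_measurable N" using iid_std_normal_measurable[OF Z, of None] by simp
  have Z'm: "Z' i \<in> borel_measurable N" if "i \<in> I" for i using iid_std_normal_measurable[OF Z' that] .
  have Z2: "integrable N (\<lambda>\<omega>. (\<tau> * Z \<omega>)\<^sup>2)"
    using iid_std_normal_integral(2)[OF Z, of None "\<lambda>x. x\<^sup>2"] integrable_std_normal_power[of 2] by (simp add: power_mult_distrib)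
  have Sm: "S \<in> borel_measurable N" "integrable N (\<lambda>\<omega>. (S \<omega>)\<^sup>2)"
    and Sl: "((\<lambda>F. \<integral>\<omega>. (S \<omega> - (\<Sum>i\<in>F. c i * ((Z' i \<omega>)\<^sup>2 - 1)))\<^sup>2 \<partial>N) \<longlongrightarrow> 0) (finite_subsets_at_top I)"
    using S by (auto simp: L2_has_sum_def)
  let ?S = "\<lambda>F \<omega>. \<Sum>i\<in>F. c i * ((Z' i \<omega>)\<^sup>2 - 1)"
  have SFm: "?S F \<in> borel_measurable N" if "F \<subseteq> I" for F
    using that by (intro borel_measurable_sum borel_measurable_times borel_measurable_diff borel_measurable_power borel_measurable_const Z'm) auto
  have char_F: "char (distr N borel (\<lambda>\<omega>. \<tau> * Z \<omega> + ?S F \<omega>)) t = of_real (exp (- (\<tau>\<^sup>2 * t\<^sup>2 / 2))) * exp (\<Sum>i\<in>F. log_cf (t * c i))"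
    if F: "finite F" "F \<subseteq> I" for F
  proof -
    let ?h = "\<lambda>k x. case k of None \<Rightarrow> \<tau> * x | Some i \<Rightarrow> c i * (x\<^sup>2 - 1)"
    have sub: "insert None (Some ` F) \<subseteq> ?I" using F by auto
    have "indep_vars (\<lambda>_. borel) (\<lambda>k \<omega>. ?h k (?Y k \<omega>)) (insert None (Some ` F))"
    proof (rule indep_vars_compose2[of "\<lambda>_. borel" ?Y _ ?h "\<lambda>_. borel"])
      show "indep_vars (\<lambda>_. borel) ?Y (insert None (Some ` F))" using iid_std_normal_subset[OF Z sub] by (simp add: iid_std_normal_def)
      show "?h k \<in> borel \<rightarrow>\<^sub>M borel" for k by (cases k) simp_all
    qed
    from char_distr_sum[OF this, of t]
    have "char (distr N borel (\<lambda>\<omega>. \<tau> * Z \<omega> + ?S F \<omega>)) t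
        = char (distr N borel (\<lambda>\<omega>. \<tau> * Z \<omega>)) t * (\<Prod>i\<in>F. char (distr N borel (\<lambda>\<omega>. c i * ((Z' i \<omega>)\<^sup>2 - 1))) t)"
      using F(1) by (subst (asm) sum.insert, simp, force, subst (asm) prod.insert, simp, force) (simp add: sum.reindex prod.reindex)
    also have "char (distr N borel (\<lambda>\<omega>. \<tau> * Z \<omega>)) t = of_real (exp (- (\<tau>\<^sup>2 * t\<^sup>2 / 2)))"
    proof -
      have "char (distr N borel (\<lambda>\<omega>. \<tau> * Z \<omega>)) t = (CLINT \<omega>|N. iexp ((t * \<tau>) * Z \<omega>))"
        unfolding char_def using Zm by (subst integral_distr) (simp_all add: mult_ac)
      also have "\<dots> = (CLINT x|std_normal. iexp ((t * \<tau>) * x))"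
        using iid_std_normal_integral(1)[OF Z, of None "\<lambda>x. iexp ((t * \<tau>) * x)"] by simp
      also have "\<dots> = char std_normal_distribution (t * \<tau>)" by (simp add: char_def)
      finally show ?thesis by (simp add: char_std_normal_distribution power_mult_distrib mult_ac)
    qed
    also have "(\<Prod>i\<in>F. char (distr N borel (\<lambda>\<omega>. c i * ((Z' i \<omega>)\<^sup>2 - 1))) t) = (\<Prod>i\<in>F. exp (log_cf (t * c i)))"
    proof (rule prod.cong[OF refl])
      fix i assume "i \<in> F"
      then show "char (distr N borel (\<lambda>\<omega>. c i * ((Z' i \<omega>)\<^sup>2 - 1))) t = exp (log_cf (t * c i))"
        using char_finite_chaos[OF N Z', of "{i}" c t] F by auto
    qed
    finally show ?thesis by (simp add: exp_sum F(1))
  qed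
  have l1: "((\<lambda>F. char (distr N borel (\<lambda>\<omega>. \<tau> * Z \<omega> + ?S F \<omega>)) t) \<longlongrightarrow> char (distr N borel (\<lambda>\<omega>. \<tau> * Z \<omega> + S \<omega>)) t) (finite_subsets_at_top I)"
  proof (rule char_L2_limit[OF N, where A = "{F. finite F \<and> F \<subseteq> I}"])
    show "(\<lambda>\<omega>. \<tau> * Z \<omega> + S \<omega>) \<in> borel_measurable N" using Zm Sm by simp
    show "integrable N (\<lambda>\<omega>. (\<tau> * Z \<omega> + S \<omega>)\<^sup>2)" using Zm Sm Z2 by (intro integrable_add_square_integrable) auto
    show "(\<lambda>\<omega>. \<tau> * Z \<omega> + ?S F \<omega>) \<in> borel_measurable N" if "F \<in> {F. finite F \<and> F \<subseteq> I}" for F using Zm SFm that by simp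
    show "integrable N (\<lambda>\<omega>. (\<tau> * Z \<omega> + ?S F \<omega>)\<^sup>2)" if "F \<in> {F. finite F \<and> F \<subseteq> I}" for F
      using Zm SFm[of F] Z2 chaos_orthogonality(2)[OF Z', of F c] that by (intro integrable_add_square_integrable) auto
    show "eventually (\<lambda>F. F \<in> {F. finite F \<and> F \<subseteq> I}) (finite_subsets_at_top I)"
      by (auto intro: eventually_finite_subsets_at_top_weakI)
    show "((\<lambda>F. \<integral>\<omega>. (\<tau> * Z \<omega> + S \<omega> - (\<tau> * Z \<omega> + ?S F \<omega>))\<^sup>2 \<partial>N) \<longlongrightarrow> 0) (finite_subsets_at_top I)"
      using Sl by simp
  qed
  have "((\<lambda>F. of_real (exp (- (\<tau>\<^sup>2 * t\<^sup>2 / 2))) * exp (\<Sum>i\<in>F. log_cf (t * c i))) \<longlongrightarrow> of_real (exp (- (\<tau>\<^sup>2 * t\<^sup>2 / 2))) * exp L) (finite_subsets_at_top I)"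
    using L unfolding has_sum_def by (intro tendsto_mult tendsto_const tendsto_exp)
  then have l2: "((\<lambda>F. char (distr N borel (\<lambda>\<omega>. \<tau> * Z \<omega> + ?S F \<omega>)) t) \<longlongrightarrow> of_real (exp (- (\<tau>\<^sup>2 * t\<^sup>2 / 2))) * exp L) (finite_subsets_at_top I)"
    by (rule tendsto_cong[THEN iffD1, rotated]) (auto intro!: eventually_finite_subsets_at_top_weakI simp: char_F)
  have "char (distr N borel (\<lambda>\<omega>. \<tau> * Z \<omega> + S \<omega>)) t = of_real (exp (- (\<tau>\<^sup>2 * t\<^sup>2 / 2))) * exp L"
    using tendsto_unique[OF finite_subsets_at_top_neq_bot l1 l2] .
  also have "\<dots> = exp (L - of_real (\<tau>\<^sup>2 * t\<^sup>2 / 2))"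
    by (simp add: exp_of_real[symmetric] exp_add[symmetric])
  finally show ?thesis .
qed

section \<open>Regularity and the largest eigenvalue\<close>

context
  fixes W :: "real \<Rightarrow> real \<Rightarrow> real"
  assumes W: "tournamenton W"
begin

lemma tri_kernel_nonneg: "x \<in> space U01 \<Longrightarrow> y \<in> space U01 \<Longrightarrow> 0 \<le> tri_kernel W x y"
proof -
  assume xy: "x \<in> space U01" "y \<in> space U01"
  have "0 \<le> p_W W x y" if "x \<in> space U01" "y \<in> space U01" for x y
    unfolding p_W_def using W_bounds[OF W] that by (intro Bochner_Integration.integral_nonneg mult_nonneg_nonneg) auto
  then show ?thesis unfolding tri_kernel_def using W_bounds[OF W] xy by (intro divide_nonneg_nonneg add_nonneg_nonneg mult_nonneg_nonneg) auto
qed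

lemma bker_tri_slice: "x \<in> space U01 \<Longrightarrow> U.bker (\<lambda>y z. W x y * W y z * W z x)"
  by (intro U.bker_mult U.bker_fst U.bker_snd bker_W[OF W] U.bker_slice1[OF bker_W[OF W]] U.bker_slice2[OF bker_W[OF W]])

text \<open>The first form integrates out \<open>z\<close>, the second integrates out
  \<open>y\<close>; they correspond to the two summands of \<open>tri_kernel\<close>.\<close>

lemma t_tri_eq: "x \<in> space U01 \<Longrightarrow> t_tri W x = (\<integral>y. W x y * p_W W x y \<partial>U01)"
  "x \<in> space U01 \<Longrightarrow> t_tri W x = (\<integral>y. W y x * p_W W y x \<partial>U01)"
proof -
  assume x: "x \<in> space U01"
  have e: "t_tri W x = (\<integral>y. (\<integral>z. W x y * W y z * W z x \<partial>U01) \<partial>U01)"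
    unfolding t_tri_def by (rule U.bker_integral_pair[OF bker_tri_slice[OF x]])
  then show "t_tri W x = (\<integral>y. W x y * p_W W x y \<partial>U01)"
    by (simp add: p_W_def mult.assoc)
  have "t_tri W x = (\<integral>z. (\<integral>y. W x y * W y z * W z x \<partial>U01) \<partial>U01)"
    unfolding e by (rule U.bker_Fubini[OF bker_tri_slice[OF x]])
  also have "\<dots> = (\<integral>z. W z x * p_W W z x \<partial>U01)"
    by (simp add: p_W_def mult.commute)
  finally show "t_tri W x = (\<integral>y. W y x * p_W W y x \<partial>U01)" .
qed

lemma integral_tri_kernel_row: "x \<in> space U01 \<Longrightarrow> (\<integral>y. tri_kernel W x y \<partial>U01) = t_tri W x"
proof -
  assume x: "x \<in> space U01"
  have i: "integrable U01 (\<lambda>y. W x y * p_W W x y)" "integrable U01 (\<lambda>y. W y x * p_W W y x)"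
    by (intro U.bfun_integrable U.bfun_mult U.bker_slice1[OF bker_W[OF W] x] U.bker_slice1[OF bker_p_W[OF W] x]
        U.bker_slice2[OF bker_W[OF W] x] U.bker_slice2[OF bker_p_W[OF W] x])+
  show ?thesis unfolding tri_kernel_def using i t_tri_eq[OF x] by simp
qed

lemma t_C3_eq: "t_C3 W = (\<integral>x. t_tri W x \<partial>U01)"
proof -
  interpret P2: pair_prob_space U01 U01 ..
  interpret P: pair_prob_space U01 "U01 \<Otimes>\<^sub>M U01" ..
  have m: "(\<lambda>p. W (fst p) (fst (snd p)) * W (fst (snd p)) (snd (snd p)) * W (snd (snd p)) (fst p)) \<in> borel_measurable U01_3"
    by (intro borel_measurable_times tournamenton_measurable[OF W]
      measurable_fst measurable_compose[OF measurable_snd measurable_fst] measurable_compose[OF measurable_snd measurable_snd])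
  have "integrable U01_3 (\<lambda>p. W (fst p) (fst (snd p)) * W (fst (snd p)) (snd (snd p)) * W (snd (snd p)) (fst p))"
  proof (rule P.integrable_const_bound[where B = 1])
    show "AE p in U01_3. norm (W (fst p) (fst (snd p)) * W (fst (snd p)) (snd (snd p)) * W (snd (snd p)) (fst p)) \<le> 1"
    proof (rule AE_I2)
      fix p assume "p \<in> space U01_3"
      then have s: "fst p \<in> space U01" "fst (snd p) \<in> space U01" "snd (snd p) \<in> space U01" by (auto simp: space_pair_measure)
      have 1: "\<bar>x * y\<bar> \<le> 1" if "\<bar>x\<bar> \<le> 1" "\<bar>y\<bar> \<le> 1" for x y :: real using that by (simp add: abs_mult mult_le_one)
      have w: "\<bar>W x y\<bar> \<le> 1" if "x \<in> space U01" "y \<in> space U01" for x y using W_bounds[OF W that] by simp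
      show "norm (W (fst p) (fst (snd p)) * W (fst (snd p)) (snd (snd p)) * W (snd (snd p)) (fst p)) \<le> 1"
        unfolding real_norm_def by (intro 1 w s)
    qed
  qed (rule m)
  from P.integral_fst'[OF this] show ?thesis by (simp add: t_C3_def t_tri_def case_prod_unfold)
qed

lemma tri_regular_AE: assumes "tri_regular W" shows "AE x in U01. t_tri W x = t_C3 W"
proof -
  obtain c where c: "AE x in U01. t_tri W x = c" using assms by (auto simp: tri_regular_def)
  have "U.bfun (\<lambda>x. \<integral>y. tri_kernel W x y \<partial>U01)" by (rule U.bker_integral1[OF bker_tri_kernel[OF W]])
  then have "U.bfun (t_tri W)" by (rule U.bfun_cong) (simp add: integral_tri_kernel_row)
  then have "t_C3 W = (\<integral>x. c \<partial>U01)" unfolding t_C3_eq by (intro integral_cong_AE c U.bfun_measurable) simp_all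
  then show ?thesis using c U.prob_space by simp
qed

text \<open>Schur's test with the constant function: the kernel is non-negative and its rows have the
  integral \<open>t_C3 W\<close>, so the operator has norm at most \<open>t_C3 W\<close> on \<open>L\<^sup>1\<close>.\<close>

lemma abs_eigenvalue_le_t_C3:
  assumes reg: "tri_regular W" and f: "U.eigenfun (tri_kernel W) c f" "U.inner2 f f \<noteq> 0"
  shows "\<bar>c\<bar> \<le> t_C3 W"
proof -
  let ?K = "tri_kernel W"
  have b: "U.bfun f" using f(1) by (simp add: U.eigenfun_def)
  have KI: "U.bker (\<lambda>x y. ?K x y * \<bar>f y\<bar>)" by (intro U.bker_mult bker_tri_kernel[OF W] U.bker_snd U.bfun_abs b)
  define I where "I = (\<integral>x. \<bar>f x\<bar> \<partial>U01)"
  have If: "integrable U01 (\<lambda>x. \<bar>f x\<bar>)" by (rule U.bfun_integrable[OF U.bfun_abs[OF b]])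
  have "I \<noteq> 0"
  proof
    assume "I = 0"
    then have "AE x in U01. \<bar>f x\<bar> = 0" unfolding I_def using integral_nonneg_eq_0_iff_AE[OF If] by simp
    then have "U.inner2 f f = 0" using U.inner2_AE_zero[of f f] by simp
    with f(2) show False by simp
  qed
  moreover have "0 \<le> I" unfolding I_def by simp
  ultimately have I: "0 < I" by simp
  have "\<bar>c\<bar> * I = (\<integral>x. \<bar>c * f x\<bar> \<partial>U01)" unfolding I_def by (simp add: abs_mult)
  also have "\<dots> \<le> (\<integral>x. (\<integral>y. ?K x y * \<bar>f y\<bar> \<partial>U01) \<partial>U01)"
  proof (rule integral_mono)
    show "integrable U01 (\<lambda>x. \<bar>c * f x\<bar>)" by (intro U.bfun_integrable U.bfun_abs U.bfun_cmult b)
    show "integrable U01 (\<lambda>x. \<integral>y. ?K x y * \<bar>f y\<bar> \<partial>U01)" by (rule U.bfun_integrable[OF U.bker_integral1[OF KI]])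
    fix x assume x: "x \<in> space U01"
    have "\<bar>c * f x\<bar> = \<bar>\<integral>y. ?K x y * f y \<partial>U01\<bar>" using f(1) x by (simp add: U.eigenfun_def U.kop_def)
    also have "\<dots> \<le> (\<integral>y. \<bar>?K x y * f y\<bar> \<partial>U01)" by (rule integral_abs_bound)
    also have "\<dots> = (\<integral>y. ?K x y * \<bar>f y\<bar> \<partial>U01)"
      using tri_kernel_nonneg[OF x] by (intro Bochner_Integration.integral_cong refl) (simp add: abs_mult)
    finally show "\<bar>c * f x\<bar> \<le> (\<integral>y. ?K x y * \<bar>f y\<bar> \<partial>U01)" .
  qed
  also have "\<dots> = (\<integral>y. (\<integral>x. ?K x y * \<bar>f y\<bar> \<partial>U01) \<partial>U01)" by (rule U.bker_Fubini[OF KI])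
  also have "\<dots> = (\<integral>y. t_C3 W * \<bar>f y\<bar> \<partial>U01)"
  proof (rule integral_cong_AE)
    show "(\<lambda>y. \<integral>x. ?K x y * \<bar>f y\<bar> \<partial>U01) \<in> borel_measurable U01" by (rule U.bfun_measurable[OF U.bker_integral2[OF KI]])
    show "(\<lambda>y. t_C3 W * \<bar>f y\<bar>) \<in> borel_measurable U01" by (intro U.bfun_measurable U.bfun_cmult U.bfun_abs b)
    show "AE y in U01. (\<integral>x. ?K x y * \<bar>f y\<bar> \<partial>U01) = t_C3 W * \<bar>f y\<bar>"
      using tri_regular_AE[OF reg] AE_space
    proof eventually_elim
      case (elim y)
      have "(\<integral>x. ?K x y \<partial>U01) = (\<integral>x. ?K y x \<partial>U01)" by (simp add: tri_kernel_def add.commute)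
      then show ?case using elim integral_tri_kernel_row[of y] by simp
    qed
  qed
  also have "\<dots> = t_C3 W * I" unfolding I_def by simp
  finally show ?thesis using I by simp
qed

text \<open>Regularity says that the constants are eigenfunctions for \<open>t_C3
  W\<close>.\<close>

lemma Spec_t_C3_pos:
  assumes reg: "tri_regular W" and c: "t_C3 W \<noteq> 0"
  shows "1 \<le> Spec (tri_kernel W) (t_C3 W)"
proof -
  have mem: "(\<lambda>_. 1) \<in> eigenfunctions (tri_kernel W) (t_C3 W)"
    unfolding eigenfunctions_def
  proof (intro CollectI conjI)
    show "AE x in U01. (\<integral>y. tri_kernel W x y * 1 \<partial>U01) = t_C3 W * 1"
      using tri_regular_AE[OF reg] AE_space by eventually_elim (simp add: integral_tri_kernel_row)
  qed simp_all
  have "L2_independent 1 (\<lambda>_ _. 1)"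
    unfolding L2_independent_def
  proof (intro allI impI)
    fix a :: "nat \<Rightarrow> real" and i :: nat assume "AE x in U01. (\<Sum>i<1. a i * 1) = 0" and i: "i < 1"
    then have "AE x in U01. a 0 = 0" by simp
    then show "a i = 0" using i U.AE_const by simp
  qed
  then have "enat 1 \<le> L2_dim (eigenfunctions (tri_kernel W) (t_C3 W))"
    unfolding L2_dim_def by (intro Sup_upper CollectI exI[of _ 1] exI[of _ "\<lambda>_ _. 1"] conjI) (use mem in auto)
  then show ?thesis using c by (simp add: Spec_def one_enat_def)
qed

lemma elements_Spec_abs_le:
  assumes reg: "tri_regular W" and i: "i \<in> elements (Spec (tri_kernel W))"
  shows "\<bar>fst i\<bar> \<le> t_C3 W"
proof -
  let ?K = "tri_kernel W"
  obtain c j where cj: "i = (c, j)" "enat j < Spec ?K c" using i by (auto simp: elements_def)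
  have c: "c \<noteq> 0" using cj(2) by (auto simp: Spec_def)
  have j: "j < U.eigendim ?K c" using cj(2) unfolding Spec_eq_eigendim[OF bker_tri_kernel[OF W] ksym_tri_kernel[OF W] c] by simp
  obtain \<phi> where \<phi>: "U.eigen_onfam ?K c (U.eigendim ?K c) \<phi>"
    using U.eigendim(1)[OF bker_tri_kernel[OF W] ksym_tri_kernel[OF W] c] by blast
  have "U.eigenfun ?K c (\<phi> j)" "U.inner2 (\<phi> j) (\<phi> j) = 1"
    using \<phi> j by (auto simp: U.eigen_onfam_def U.orthonormal_on_def)
  then show ?thesis using abs_eigenvalue_le_t_C3[OF reg, of c "\<phi> j"] cj(1) by simp
qed

lemma elements_Spec_minus_tri:
  assumes reg: "tri_regular W" and c: "t_C3 W \<noteq> 0"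
  obtains j where "(t_C3 W, j) \<notin> elements (Spec_minus_tri W)"
    "elements (Spec (tri_kernel W)) = insert (t_C3 W, j) (elements (Spec_minus_tri W))"
proof -
  let ?K = "tri_kernel W" and ?c = "t_C3 W"
  define d where "d = U.eigendim ?K ?c"
  have d: "Spec ?K ?c = enat d" unfolding d_def by (rule Spec_eq_eigendim[OF bker_tri_kernel[OF W] ksym_tri_kernel[OF W] c])
  have d1: "1 \<le> d" using Spec_t_C3_pos[OF reg c] unfolding d by (simp add: one_enat_def)
  have m: "Spec_minus_tri W = (Spec ?K)(?c := enat (d - 1))"
    unfolding Spec_minus_tri_def d by (simp add: one_enat_def)
  have "elements (Spec ?K) = insert (?c, d - 1) (elements (Spec_minus_tri W))"
    unfolding m elements_def using d d1 by (auto split: if_splits)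
  moreover have "(?c, d - 1) \<notin> elements (Spec_minus_tri W)" unfolding m elements_def by simp
  ultimately show ?thesis using that by blast
qed

end

section \<open>Removing the largest eigenvalue\<close>

text \<open>A test function supported beyond \<open>c\<close> has limit 0, which bounds the largest point from above; one
  supported beyond \<open>c - e\<close> has a positive limit, so some point lies there.\<close>

lemma largest_point_converges:
  fixes x :: "nat \<Rightarrow> nat \<Rightarrow> real" and lam :: "'i \<Rightarrow> real"
  assumes x1: "\<And>n s. s \<in> {1..n} \<Longrightarrow> \<bar>x n s\<bar> \<le> 1" and mono: "\<And>n s. s \<in> {1..n} \<Longrightarrow> x n s \<le> x n 1"
    and c: "0 < c" "c \<le> 1" and l: "\<And>i. i \<in> I \<Longrightarrow> \<bar>lam i\<bar> \<le> c" and top_ix: "top_ix \<in> I" "lam top_ix = c" and v: "0 \<le> v"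
    and test: "\<And>h. continuous_on {-1..1} h \<Longrightarrow> (\<lambda>i. (lam i)\<^sup>2 * h (lam i)) summable_on I \<and>
      (\<lambda>n. \<Sum>s=1..n. (x n s)\<^sup>2 * h (x n s)) \<longlonglongrightarrow> infsum (\<lambda>i. (lam i)\<^sup>2 * h (lam i)) I + v * h 0"
  shows "(\<lambda>n. x n 1) \<longlonglongrightarrow> c"
proof (rule LIMSEQ_I)
  fix e :: real assume e: "e > 0"
  let ?h = "\<lambda>y. max 0 (y - (c + e / 2))" and ?g = "\<lambda>y. max 0 (y - (c - e))"
  have hc: "continuous_on {-1..1} ?h" "continuous_on {-1..1} ?g" by (intro continuous_intros)+
  have "infsum (\<lambda>i. (lam i)\<^sup>2 * ?h (lam i)) I = 0"
  proof (rule infsum_0)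
    fix i assume "i \<in> I"
    then have "lam i - (c + e / 2) \<le> 0" using l[of i] e by linarith
    then show "(lam i)\<^sup>2 * ?h (lam i) = 0" by simp
  qed
  moreover have "?h 0 = 0" using c e by simp
  ultimately have "(\<lambda>n. \<Sum>s=1..n. (x n s)\<^sup>2 * ?h (x n s)) \<longlonglongrightarrow> 0" using test[OF hc(1)] by simp
  then have "eventually (\<lambda>n. (\<Sum>s=1..n. (x n s)\<^sup>2 * ?h (x n s)) < c\<^sup>2 * (e / 2)) sequentially"
    by (rule order_tendstoD) (use c e in simp)
  moreover have "eventually (\<lambda>n. 0 < (\<Sum>s=1..n. (x n s)\<^sup>2 * ?g (x n s))) sequentially"
  proof (rule order_tendstoD)
    show "(\<lambda>n. \<Sum>s=1..n. (x n s)\<^sup>2 * ?g (x n s)) \<longlonglongrightarrow> infsum (\<lambda>i. (lam i)\<^sup>2 * ?g (lam i)) I + v * ?g 0"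
      using test[OF hc(2)] by blast
    have "(\<Sum>i\<in>{top_ix}. (lam i)\<^sup>2 * ?g (lam i)) \<le> infsum (\<lambda>i. (lam i)\<^sup>2 * ?g (lam i)) I"
      using test[OF hc(2)] top_ix(1) by (intro finite_sum_le_infsum) auto
    moreover have "0 < (\<Sum>i\<in>{top_ix}. (lam i)\<^sup>2 * ?g (lam i))" using top_ix(2) c e by simp
    moreover have "0 \<le> v * ?g 0" using v by simp
    ultimately show "0 < infsum (\<lambda>i. (lam i)\<^sup>2 * ?g (lam i)) I + v * ?g 0" by linarith
  qed
  ultimately have "eventually (\<lambda>n. norm (x n 1 - c) < e) sequentially"
    using eventually_ge_at_top[of 1]
  proof eventually_elim
    case (elim n)
    have "x n 1 < c + e"
    proof (rule ccontr)
      assume "\<not> x n 1 < c + e"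
      then have a: "c \<le> x n 1" "e / 2 \<le> ?h (x n 1)" using e by auto
      have "c\<^sup>2 * (e / 2) \<le> (x n 1)\<^sup>2 * ?h (x n 1)" by (intro mult_mono power_mono a) (use c e in auto)
      also have "\<dots> \<le> (\<Sum>s=1..n. (x n s)\<^sup>2 * ?h (x n s))" using elim(3) by (intro member_le_sum) auto
      finally show False using elim(1) by simp
    qed
    moreover have "c - e < x n 1"
    proof (rule ccontr)
      assume a: "\<not> c - e < x n 1"
      have "(\<Sum>s=1..n. (x n s)\<^sup>2 * ?g (x n s)) = 0"
      proof (rule sum.neutral, rule ballI)
        fix s assume "s \<in> {1..n}"
        then have "x n s - (c - e) \<le> 0" using mono[of s n] a by linarith
        then show "(x n s)\<^sup>2 * ?g (x n s) = 0" by simp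
      qed
      then show False using elim(2) by simp
    qed
    ultimately show ?case by (simp add: abs_less_iff)
  qed
  then show "\<exists>no. \<forall>n\<ge>no. norm (x n 1 - c) < e" by (simp add: eventually_sequentially)
qed

text \<open>The largest point converges to \<open>c\<close>, so its contribution to the sum
  converges to the term of one index with \<open>lam\<close> equal to \<open>c\<close>, and the
  two can be removed on both sides.\<close>

lemma test_functions_without_largest:
  fixes x :: "nat \<Rightarrow> nat \<Rightarrow> real" and lam :: "'i \<Rightarrow> real"
  assumes x1: "\<And>n s. s \<in> {1..n} \<Longrightarrow> \<bar>x n s\<bar> \<le> 1" and mono: "\<And>n s. s \<in> {1..n} \<Longrightarrow> x n s \<le> x n 1"
    and c: "0 < c" "c \<le> 1" and l: "\<And>i. i \<in> insert top_ix I \<Longrightarrow> \<bar>lam i\<bar> \<le> c" and top_ix: "top_ix \<notin> I" "lam top_ix = c" and v: "0 \<le> v"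
    and M: "\<And>k. ((\<lambda>i. lam i ^ (k + 2)) has_sum M k) (insert top_ix I)"
    and conv: "\<And>k. (\<lambda>n. \<Sum>s=1..n. x n s ^ (k + 2)) \<longlonglongrightarrow> M k + (if k = 0 then v else 0)"
    and h: "continuous_on {-1..1} h"
  shows "(\<lambda>i. (lam i)\<^sup>2 * h (lam i)) summable_on I"
    and "(\<lambda>n. \<Sum>s=2..n. (x n s)\<^sup>2 * h (x n s)) \<longlonglongrightarrow> infsum (\<lambda>i. (lam i)\<^sup>2 * h (lam i)) I + v * h 0"
proof -
  have l1: "\<bar>lam i\<bar> \<le> 1" if "i \<in> insert top_ix I" for i using l[OF that] c by linarith
  have test: "(\<lambda>i. (lam i)\<^sup>2 * h (lam i)) summable_on (insert top_ix I) \<and>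
      (\<lambda>n. \<Sum>s=1..n. (x n s)\<^sup>2 * h (x n s)) \<longlonglongrightarrow> infsum (\<lambda>i. (lam i)\<^sup>2 * h (lam i)) (insert top_ix I) + v * h 0"
    if h: "continuous_on {-1..1} h" for h
    using test_function_convergence_real[of "\<lambda>n. {1..n}" x "insert top_ix I" lam v M h, OF x1 l1 v M conv h] by blast
  show s: "(\<lambda>i. (lam i)\<^sup>2 * h (lam i)) summable_on I"
    by (rule summable_on_subset_banach[OF conjunct1[OF test[OF h]]]) auto
  have xl: "(\<lambda>n. x n 1) \<longlonglongrightarrow> c"
    by (rule largest_point_converges[OF x1 mono c l _ top_ix(2) v test]) auto
  have "(\<lambda>n. h (x n 1)) \<longlonglongrightarrow> h c"
  proof (rule continuous_on_tendsto_compose[OF h xl])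
    show "c \<in> {-1..1}" using c by simp
    show "eventually (\<lambda>n. x n 1 \<in> {-1..1}) sequentially"
      using eventually_ge_at_top[of 1]
    proof eventually_elim
      case (elim n)
      then show ?case using x1[of 1 n] by (simp add: abs_le_iff)
    qed
  qed
  then have "(\<lambda>n. (\<Sum>s=1..n. (x n s)\<^sup>2 * h (x n s)) - (x n 1)\<^sup>2 * h (x n 1))
      \<longlonglongrightarrow> infsum (\<lambda>i. (lam i)\<^sup>2 * h (lam i)) (insert top_ix I) + v * h 0 - c\<^sup>2 * h c"
    by (intro tendsto_diff tendsto_mult tendsto_power xl conjunct2[OF test[OF h]])
  moreover have "infsum (\<lambda>i. (lam i)\<^sup>2 * h (lam i)) (insert top_ix I) = c\<^sup>2 * h c + infsum (\<lambda>i. (lam i)\<^sup>2 * h (lam i)) I"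
    using infsum_insert[OF s top_ix(1)] top_ix(2) by simp
  ultimately have t: "(\<lambda>n. (\<Sum>s=1..n. (x n s)\<^sup>2 * h (x n s)) - (x n 1)\<^sup>2 * h (x n 1))
      \<longlonglongrightarrow> infsum (\<lambda>i. (lam i)\<^sup>2 * h (lam i)) I + v * h 0" by (simp add: algebra_simps)
  have "eventually (\<lambda>n. (\<Sum>s=1..n. (x n s)\<^sup>2 * h (x n s)) - (x n 1)\<^sup>2 * h (x n 1) = (\<Sum>s=2..n. (x n s)\<^sup>2 * h (x n s))) sequentially"
    using eventually_ge_at_top[of 1]
  proof eventually_elim
    case (elim n)
    then have "{1..n} = insert 1 {2..n}" by auto
    then show ?case by simp
  qed
  then show "(\<lambda>n. \<Sum>s=2..n. (x n s)\<^sup>2 * h (x n s)) \<longlonglongrightarrow> infsum (\<lambda>i. (lam i)\<^sup>2 * h (lam i)) I + v * h 0"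
    using t by (rule Lim_transform_eventually[rotated])
qed

text \<open>The test functions are the real and imaginary part of \<open>t\<^sup>2 * log_cf_quot
  (t * y)\<close>; the point mass at 0 contributes the real number \<open>- v *
  t\<^sup>2\<close>.\<close>

lemma log_cf_sums_converge:
  fixes x :: "nat \<Rightarrow> nat \<Rightarrow> real" and lam :: "'i \<Rightarrow> real"
  assumes test: "\<And>h. continuous_on {-1..1} h \<Longrightarrow> (\<lambda>i. (lam i)\<^sup>2 * h (lam i)) summable_on I \<and>
      (\<lambda>n. \<Sum>s\<in>A n. (x n s)\<^sup>2 * h (x n s)) \<longlonglongrightarrow> infsum (\<lambda>i. (lam i)\<^sup>2 * h (lam i)) I + v * h 0"
  shows "\<exists>L. ((\<lambda>i. log_cf (t * lam i)) has_sum L) I \<and>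
      (\<lambda>n. \<Sum>s\<in>A n. log_cf (t * x n s)) \<longlonglongrightarrow> L - of_real (v * t\<^sup>2)"
proof -
  have cont: "continuous_on {-1..1} (\<lambda>y. log_cf_quot (t * y))"
    by (rule continuous_on_compose2[of UNIV log_cf_quot])
      (auto intro!: continuous_intros continuous_at_imp_continuous_on isCont_log_cf_quot)
  let ?r = "\<lambda>y. t\<^sup>2 * Re (log_cf_quot (t * y))" and ?m = "\<lambda>y. t\<^sup>2 * Im (log_cf_quot (t * y))"
  have c: "continuous_on {-1..1} ?r" "continuous_on {-1..1} ?m" by (intro continuous_intros cont)+
  have R: "Re (log_cf (t * y)) = y\<^sup>2 * ?r y" and I: "Im (log_cf (t * y)) = y\<^sup>2 * ?m y" for y
    unfolding log_cf_eq_quot[of "t * y"] by (simp_all add: power_mult_distrib)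
  define a where "a = infsum (\<lambda>i. (lam i)\<^sup>2 * ?r (lam i)) I"
  define b where "b = infsum (\<lambda>i. (lam i)\<^sup>2 * ?m (lam i)) I"
  have ha: "((\<lambda>i. Re (log_cf (t * lam i))) has_sum a) I" unfolding R a_def using test[OF c(1)] by (intro has_sum_infsum) blast
  have hb: "((\<lambda>i. Im (log_cf (t * lam i))) has_sum b) I" unfolding I b_def using test[OF c(2)] by (intro has_sum_infsum) blast
  have h: "((\<lambda>i. log_cf (t * lam i)) has_sum Complex a b) I"
  proof -
    have "((\<lambda>i. of_real (Re (log_cf (t * lam i))) + \<i> * of_real (Im (log_cf (t * lam i)))) has_sum (of_real a + \<i> * of_real b)) I"
      by (intro has_sum_add has_sum_cmult_right has_sum_of_real ha hb)
    then show ?thesis by (simp only: complex_eq[symmetric] Complex_eq[symmetric] complex_surj)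
  qed
  have q0: "log_cf_quot 0 = -1" by (simp add: log_cf_quot_def)
  have "(\<lambda>n. \<Sum>s\<in>A n. (x n s)\<^sup>2 * ?r (x n s)) \<longlonglongrightarrow> a - v * t\<^sup>2"
    using conjunct2[OF test[OF c(1)]] by (simp add: a_def q0)
  then have 1: "(\<lambda>n. Re (\<Sum>s\<in>A n. log_cf (t * x n s))) \<longlonglongrightarrow> Re (Complex a b - of_real (v * t\<^sup>2))" by (simp add: R)
  have "(\<lambda>n. \<Sum>s\<in>A n. (x n s)\<^sup>2 * ?m (x n s)) \<longlonglongrightarrow> b"
    using conjunct2[OF test[OF c(2)]] by (simp add: b_def q0)
  then have 2: "(\<lambda>n. Im (\<Sum>s\<in>A n. log_cf (t * x n s))) \<longlonglongrightarrow> Im (Complex a b - of_real (v * t\<^sup>2))" by (simp add: I)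
  from 1 2 have "(\<lambda>n. \<Sum>s\<in>A n. log_cf (t * x n s)) \<longlonglongrightarrow> Complex a b - of_real (v * t\<^sup>2)" by (simp only: tendsto_complex_iff)
  with h show ?thesis by blast
qed

section \<open>The limit theorem\<close>

text \<open>The sum of the squares of the eigenvalues is a density of a pattern bounded by
  1.\<close>

lemma abs_eigenvalue_le_1:
  assumes n: "n \<ge> 1" and a: "\<And>p q. 0 \<le> a p q \<and> a p q \<le> 1" and s: "s \<in> {1..n}"
  shows "\<bar>eigenvalue_desc (tri_hat_mat n a) s\<bar> \<le> 1"
proof -
  let ?e = "eigenvalue_desc (tri_hat_mat n a)"
  have "(?e s)\<^sup>2 \<le> (\<Sum>s=1..n. (?e s)\<^sup>2)" by (intro member_le_sum s) auto
  also have "\<dots> = avg n (2 * 1 + 2) (tri_cycle 1) a" unfolding avg_tri_cycle[OF n a] Suc_1 ..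
  also have "2 * 1 + 2 = (4::nat)" by simp
  also have "avg n 4 (tri_cycle 1) a \<le> 1"
  proof -
    interpret PM: prob_space "PiM {..<4::nat} (\<lambda>_::nat. unif n)" by (rule prob_space.prob_space_PiM_const[OF prob_space_unif[OF n]])
    have "\<bar>avg n 4 (tri_cycle 1) a - (\<integral>x. 0 \<partial>PiM {..<4::nat} (\<lambda>_. unif n))\<bar> \<le> (\<integral>x. 1 \<partial>PiM {..<4::nat} (\<lambda>_. unif n))"
      unfolding avg_def
    proof (rule integral_diff_le[OF n])
      fix x :: "nat \<Rightarrow> nat"
      show "\<bar>tri_cycle 1 (\<lambda>i j. a (x i) (x j)) - 0\<bar> \<le> 1" using tri_cycle_bound[of 1 "\<lambda>i j. a (x i) (x j)"] a by simp
    qed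
    then show ?thesis by (simp add: PM.prob_space del: One_nat_def)
  qed
  finally show ?thesis by (simp add: abs_square_le_1)
qed

theorem theorem3p2:
  fixes W :: "real \<Rightarrow> real \<Rightarrow> real"
    and M :: "'a measure" and N :: "'b measure"
    and T :: "nat \<Rightarrow> 'a \<Rightarrow> nat \<Rightarrow> nat \<Rightarrow> real"
    and J :: "nat \<Rightarrow> nat \<Rightarrow> 'a \<Rightarrow> real"
    and Z :: "'b \<Rightarrow> real" and Z' :: "real \<times> nat \<Rightarrow> 'b \<Rightarrow> real"
  assumes "tournamenton W" and "tri_regular W" and "0 \<le> zeta_W W" and "zeta_W W < 1"
    and "prob_space M"
    and "\<And>n. n \<ge> 1 \<Longrightarrow> is_random_tournament M (T n) n W"
    and "\<And>n. n \<ge> 1 \<Longrightarrow> iid_std_normal M (J n) {1..n}"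
    and "\<And>n. n \<ge> 1 \<Longrightarrow>
           independent_of M (count_space UNIV) (T n)
             (PiM {1..n} (\<lambda>_. borel)) (\<lambda>\<omega>. \<lambda>s\<in>{1..n}. J n s \<omega>)"
    and "prob_space N"
    and "iid_std_normal N (case_option Z Z') (insert None (Some ` elements (Spec_minus_tri W)))"
  shows "\<exists>S. L2_has_sum N (\<lambda>i \<omega>. fst i * ((Z' i \<omega>)\<^sup>2 - 1)) (elements (Spec_minus_tri W)) S \<and>
           (AE \<omega> in M. weak_conv_m
              (\<lambda>n. cond_distr_given M (\<lambda>\<omega>'. X_hat n (T n \<omega>') (\<lambda>s. J n s \<omega>')) (T n) \<omega>)
              (distr N borel (\<lambda>\<omega>'. tau_W W * Z \<omega>' + S \<omega>')))"
proof -
  note W = assms(1) and reg = assms(2) and M = assms(5) and T = assms(6) and J = assms(7) and ind = assms(8) and N = assms(9) and Z = assms(10)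
  interpret M: prob_space M by (rule M)
  interpret N: prob_space N by (rule N)
  let ?K = "tri_kernel W" and ?c = "t_C3 W" and ?v = "(tau_W W)\<^sup>2 / 2"
  let ?I = "elements (Spec_minus_tri W)"
  let ?e = "\<lambda>n \<omega>. eigenvalue_desc (tri_hat_mat n (T n \<omega>))"
  have c: "0 < ?c" "?c \<le> 1" using assms(3,4) by (auto simp: zeta_W_def)
  obtain j where j: "(?c, j) \<notin> ?I" "elements (Spec ?K) = insert (?c, j) ?I"
    using elements_Spec_minus_tri[OF W reg] c by (metis less_irrefl)
  have mom: "((\<lambda>i. fst i ^ (k + 2)) has_sum U.kinner ?K (U.kpow ?K k)) (insert (?c, j) ?I)" for k
    unfolding j(2)[symmetric] by (rule trace_formula_Spec[OF bker_tri_kernel[OF W] ksym_tri_kernel[OF W]])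
  have le: "\<bar>fst i\<bar> \<le> ?c" if "i \<in> insert (?c, j) ?I" for i
    using elements_Spec_abs_le[OF W reg] that unfolding j(2) by blast
  have "(\<lambda>i. (fst i)\<^sup>2) summable_on insert (?c, j) ?I"
    using mom[of 0] by (simp only: add_0 summable_on_def) blast
  then have "(\<lambda>i. (fst i)\<^sup>2) summable_on ?I" by (rule summable_on_subset_banach) auto
  then obtain S where S: "L2_has_sum N (\<lambda>i \<omega>. fst i * ((Z' i \<omega>)\<^sup>2 - 1)) ?I S"
    using N.ex_chaos_sum[OF iid_std_normal_case_option[OF N Z]] by blast
  have Zm: "Z \<in> borel_measurable N" using N.iid_std_normal_measurable[OF Z, of None] by simp
  let ?L = "distr N borel (\<lambda>\<omega>'. tau_W W * Z \<omega>' + S \<omega>')"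
  have rdL: "real_distribution ?L"
    using Zm S unfolding L2_has_sum_def by (intro N.real_distribution_distr borel_measurable_add borel_measurable_times borel_measurable_const) auto
  have R: "AE \<omega> in M. n \<ge> 1 \<longrightarrow> T n \<omega> \<in> range (adjacency n)" for n
    using AE_tournament_range[OF W T, of n] by (cases "n \<ge> 1") auto
  have P: "AE \<omega> in M. n \<ge> 1 \<longrightarrow> measure M {\<omega>' \<in> space M. T n \<omega>' = T n \<omega>} \<noteq> 0" for n
  proof (cases "n \<ge> 1")
    case True
    have "T n \<in> M \<rightarrow>\<^sub>M count_space UNIV" using T[OF True] by (simp add: is_random_tournament_def)
    from M.AE_atom_positive[OF this finite_range_adjacency AE_tournament_range[OF W T[OF True]]] show ?thesis by eventually_elim blast
  qed simp
  have "AE \<omega> in M. \<forall>n. n \<ge> 1 \<longrightarrow> T n \<omega> \<in> range (adjacency n)" using R by (intro AE_all_countable[THEN iffD2] allI)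
  moreover have "AE \<omega> in M. \<forall>n. n \<ge> 1 \<longrightarrow> measure M {\<omega>' \<in> space M. T n \<omega>' = T n \<omega>} \<noteq> 0" using P by (intro AE_all_countable[THEN iffD2] allI)
  moreover have "AE \<omega> in M. \<forall>k. (\<lambda>n. \<Sum>s=1..n. ?e n \<omega> s ^ (k + 2)) \<longlonglongrightarrow> U.kinner ?K (U.kpow ?K k) + (if k = 0 then ?v else 0)"
    by (rule power_sums_converge[OF W M T])
  ultimately have "AE \<omega> in M. weak_conv_m
              (\<lambda>n. cond_distr_given M (\<lambda>\<omega>'. X_hat n (T n \<omega>') (\<lambda>s. J n s \<omega>')) (T n) \<omega>) ?L"
  proof eventually_elim
    case (elim \<omega>)
    let ?D = "\<lambda>n. cond_distr_given M (\<lambda>\<omega>'. X_hat n (T n \<omega>') (\<lambda>s. J n s \<omega>')) (T n) \<omega>"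
    have e1: "\<bar>?e n \<omega> s\<bar> \<le> 1" if "s \<in> {1..n}" for n s
    proof -
      have n: "n \<ge> 1" using that by simp
      obtain b where "T n \<omega> = adjacency n b" using elim(1) n by blast
      then show ?thesis using abs_eigenvalue_le_1[OF n adjacency_bounds that] by simp
    qed
    have mono: "?e n \<omega> s \<le> ?e n \<omega> 1" if "s \<in> {1..n}" for n s
      using that by (intro eigenvalue_desc_tri_hat_antimono) auto
    have test: "(\<lambda>i. (fst i)\<^sup>2 * h (fst i)) summable_on ?I \<and>
      (\<lambda>n. \<Sum>s=2..n. (?e n \<omega> s)\<^sup>2 * h (?e n \<omega> s)) \<longlonglongrightarrow> infsum (\<lambda>i. (fst i)\<^sup>2 * h (fst i)) ?I + ?v * h 0"
      if h: "continuous_on {-1..1} h" for h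
    proof -
      have v: "0 \<le> ?v" by simp
      have conv: "(\<lambda>n. \<Sum>s=1..n. ?e n \<omega> s ^ (k + 2)) \<longlonglongrightarrow> U.kinner ?K (U.kpow ?K k) + (if k = 0 then ?v else 0)" for k
        using elim(3) by blast
      note t = test_functions_without_largest[where x = "\<lambda>n. ?e n \<omega>" and lam = fst and top_ix = "(?c, j)", OF e1 mono c le j(1) fst_conv v mom conv h]
      show ?thesis by (intro conjI t)
    qed
    \<comment> \<open>the laws are described for positive indices only, so the sequence is shifted by one\<close>
    have char: "(\<lambda>n. char (?D (Suc n)) t) \<longlonglongrightarrow> char ?L t" for t
    proof -
      obtain L where L: "((\<lambda>i. log_cf (t * fst i)) has_sum L) ?I"
        "(\<lambda>n. \<Sum>s=2..n. log_cf (t * ?e n \<omega> s)) \<longlonglongrightarrow> L - of_real (?v * t\<^sup>2)"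
        using log_cf_sums_converge[where lam = fst and I = ?I and A = "\<lambda>n. {2..n}" and x = "\<lambda>n. ?e n \<omega>" and v = ?v and t = t, OF test] by blast
      have "(\<lambda>n. exp (\<Sum>s=2..Suc n. log_cf (t * ?e (Suc n) \<omega> s))) \<longlonglongrightarrow> exp (L - of_real (?v * t\<^sup>2))"
        by (intro tendsto_exp LIMSEQ_Suc[OF L(2)])
      moreover have "char (?D (Suc n)) t = exp (\<Sum>s=2..Suc n. log_cf (t * ?e (Suc n) \<omega> s))" for n
        using elim(2) by (intro char_cond[OF M J ind]) auto
      moreover have "char ?L t = exp (L - of_real (?v * t\<^sup>2))"
        using char_gaussian_chaos[OF N Z S L(1), of "tau_W W"] by simp
      ultimately show ?thesis by (simp only:)
    qed
    have "weak_conv_m (\<lambda>n. ?D (Suc n)) ?L"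
    proof (rule levy_continuity[OF _ rdL char])
      show "real_distribution (?D (Suc n))" for n
        using elim(2) by (intro real_distribution_cond[OF M J ind]) auto
    qed
    then show ?case unfolding weak_conv_m_def weak_conv_def by (blast intro: LIMSEQ_imp_Suc)
  qed
  with S show ?thesis by blast
qed

end
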